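(* Let $s\in(0,1)$, $N>2s$, $r\ge1$, and let $\Omega\subset\mathbb{R}^N$ be a smooth bounded domain. Then $\mathcal{W}^{2s,r}(\Omega)$ is a Banach space and $\mathcal{T}_s(\Omega)$ is dense in $\mathcal{W}^{2s,r}(\Omega)$. Moreover, there is a continuous embedding $\mathcal{W}^{2s,r}(\Omega)\subset L^\gamma(\Omega)$ for $$\begin{cases}1\le\gamma<\frac{N}{N-2s}, & \text{if } r=1;\\ 1\le\gamma\le\frac{Nr}{N-2sr}, & \text{if } 1<r<\frac{N}{2s};\\ 1\le\gamma<\infty, & \text{if } 2sr=N;\\ \gamma=\infty, & \text{if } 2sr>N.\end{cases}$$ Furthermore, these embeddings are compact provided $$1\le\gamma<\frac{Nr}{N-2sr}\ \text{ if } N>2sr;\qquad\text{or}\qquad 1\le\gamma<\infty\ \text{ if } N\le2sr.$$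
   Context: Let $X_0^s(\Omega)$ be the space of $u\in L^2(\mathbb{R}^N)$ with $u=0$ a.e. in $\mathbb{R}^N\setminus\Omega$ and $\int_{\mathbb{R}^{2N}}\frac{|u(x)-u(y)|^2}{|x-y|^{N+2s}}dxdy<\infty$. The operator $(-\Delta)^s$ maps $X_0^s(\Omega)$ to its dual by $\langle(-\Delta)^su,v\rangle=\int_{\mathbb{R}^{2N}}\frac{(u(x)-u(y))(v(x)-v(y))}{|x-y|^{N+2s}}dxdy$; for a function $f$ on $\Omega$, $(-\Delta)^su=f$ means $\langle(-\Delta)^su,w\rangle=\int_\Omega fw\,dx$ for all $w\in X_0^s(\Omega)$. Let $\mathcal{T}_s(\Omega)=\{\varphi\in X_0^s(\Omega):(-\Delta)^s\varphi\in C_c^\infty(\Omega)\}$. For $r\ge1$, $\mathcal{W}^{2s,r}(\Omega)$ is the set of $u\in L^1(\Omega)$ for which there exists $f\in L^r(\Omega)$ with $\int_\Omega u(-\Delta)^s\varphi\,dx=\int_\Omega f\varphi\,dx$ for all $\varphi\in\mathcal{T}_s(\Omega)$; one writes $(-\Delta)^su:=f$, and the norm is $\|u\|_{\mathcal{W}^{2s,r}(\Omega)}=\|(-\Delta)^su\|_{L^r(\Omega)}$. *)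

theory Defs
  imports "HOL-Analysis.Analysis" "HOL-Probability.Essential_Supremum"
begin

section \<open>Smooth functions and smooth bounded domains\<close>

primrec Ck :: "nat \<Rightarrow> ('a::euclidean_space \<Rightarrow> real) \<Rightarrow> bool" where
  "Ck 0 f \<longleftrightarrow> continuous_on UNIV f"
| "Ck (Suc k) f \<longleftrightarrow>
     (\<forall>x. f differentiable (at x)) \<and> (\<forall>v. Ck k (\<lambda>x. frechet_derivative f (at x) v))"

definition smooth_fun :: "('a::euclidean_space \<Rightarrow> real) \<Rightarrow> bool" where
  "smooth_fun f \<longleftrightarrow> (\<forall>k. Ck k f)"

text \<open>A test function on \<open>\<Omega>\<close> is identified with its extension by zero to the whole space.\<close>

definition test_fun :: "'a::euclidean_space set \<Rightarrow> ('a \<Rightarrow> real) set" where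
  "test_fun \<Omega> = {f. smooth_fun f \<and> compact (closure {x. f x \<noteq> 0}) \<and> closure {x. f x \<noteq> 0} \<subseteq> \<Omega>}"

text \<open>Near each boundary point \<open>\<Omega>\<close> is the region above the graph of a smooth function in some
  direction \<open>e\<close>. The graph function is evaluated only on the hyperplane orthogonal to \<open>e\<close>; a
  smooth function on that hyperplane is represented by any smooth extension to the whole space.\<close>

definition smooth_boundary :: "'a::euclidean_space set \<Rightarrow> bool" where
  "smooth_boundary \<Omega> \<longleftrightarrow>
     (\<forall>p\<in>frontier \<Omega>. \<exists>\<rho>>0. \<exists>e g. norm e = 1 \<and> smooth_fun g \<and>
        \<Omega> \<inter> ball p \<rho> = {x \<in> ball p \<rho>. g (x - (x \<bullet> e) *\<^sub>R e) < x \<bullet> e})"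

definition smooth_bounded_domain :: "'a::euclidean_space set \<Rightarrow> bool" where
  "smooth_bounded_domain \<Omega> \<longleftrightarrow>
     open \<Omega> \<and> connected \<Omega> \<and> \<Omega> \<noteq> {} \<and> bounded \<Omega> \<and> smooth_boundary \<Omega>"

section \<open>Lebesgue spaces\<close>

text \<open>Function spaces are represented by sets of functions rather than of almost-everywhere
  equivalence classes. In \<open>Lspace M p\<close> the exponent ranges over \<open>[1, \<infinity>]\<close>.\<close>

definition Lspace :: "'a measure \<Rightarrow> ereal \<Rightarrow> ('a \<Rightarrow> real) set" where
  "Lspace M p = {f \<in> borel_measurable M.
     if p = \<infinity> then esssup M (\<lambda>x. ereal \<bar>f x\<bar>) < \<infinity>
     else integrable M (\<lambda>x. \<bar>f x\<bar> powr real_of_ereal p)}"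

definition Lnorm :: "'a measure \<Rightarrow> ereal \<Rightarrow> ('a \<Rightarrow> real) \<Rightarrow> real" where
  "Lnorm M p f =
     (if p = \<infinity> then real_of_ereal (esssup M (\<lambda>x. ereal \<bar>f x\<bar>))
      else (\<integral>x. \<bar>f x\<bar> powr real_of_ereal p \<partial>M) powr (1 / real_of_ereal p))"

section \<open>Banach spaces of functions, density and embeddings\<close>

text \<open>The first five conjuncts make \<open>W\<close> a vector space of measurable functions that, together
  with \<open>nrm\<close>, is compatible with almost-everywhere equality. The next four say that \<open>nrm\<close> induces
  a norm on the quotient by that equality, and the last one is completeness.\<close>

definition banach_space_ae ::
    "'a measure \<Rightarrow> ('a \<Rightarrow> real) set \<Rightarrow> (('a \<Rightarrow> real) \<Rightarrow> real) \<Rightarrow> bool" where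
  "banach_space_ae M W nrm \<longleftrightarrow>
     W \<subseteq> borel_measurable M \<and>
     (\<lambda>x. 0) \<in> W \<and>
     (\<forall>u\<in>W. \<forall>v\<in>W. (\<lambda>x. u x + v x) \<in> W) \<and>
     (\<forall>c. \<forall>u\<in>W. (\<lambda>x. c * u x) \<in> W) \<and>
     (\<forall>u\<in>W. \<forall>v\<in>borel_measurable M. (AE x in M. u x = v x) \<longrightarrow> v \<in> W \<and> nrm v = nrm u) \<and>
     (\<forall>u\<in>W. 0 \<le> nrm u) \<and>
     (\<forall>u\<in>W. nrm u = 0 \<longleftrightarrow> (AE x in M. u x = 0)) \<and>
     (\<forall>c. \<forall>u\<in>W. nrm (\<lambda>x. c * u x) = \<bar>c\<bar> * nrm u) \<and>
     (\<forall>u\<in>W. \<forall>v\<in>W. nrm (\<lambda>x. u x + v x) \<le> nrm u + nrm v) \<and>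
     (\<forall>\<sigma>::nat \<Rightarrow> 'a \<Rightarrow> real. (\<forall>n. \<sigma> n \<in> W) \<and>
        (\<forall>\<epsilon>>0. \<exists>K. \<forall>m\<ge>K. \<forall>n\<ge>K. nrm (\<lambda>x. \<sigma> m x - \<sigma> n x) < \<epsilon>) \<longrightarrow>
        (\<exists>u\<in>W. (\<lambda>n. nrm (\<lambda>x. \<sigma> n x - u x)) \<longlonglongrightarrow> 0))"

definition dense_in_space ::
    "('a \<Rightarrow> real) set \<Rightarrow> ('a \<Rightarrow> real) set \<Rightarrow> (('a \<Rightarrow> real) \<Rightarrow> real) \<Rightarrow> bool" where
  "dense_in_space T W nrm \<longleftrightarrow>
     T \<subseteq> W \<and> (\<forall>u\<in>W. \<forall>\<epsilon>>0. \<exists>\<phi>\<in>T. nrm (\<lambda>x. u x - \<phi> x) < \<epsilon>)"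

definition continuous_embedding ::
    "('a \<Rightarrow> real) set \<Rightarrow> (('a \<Rightarrow> real) \<Rightarrow> real) \<Rightarrow>
     ('a \<Rightarrow> real) set \<Rightarrow> (('a \<Rightarrow> real) \<Rightarrow> real) \<Rightarrow> bool" where
  "continuous_embedding X normX Y normY \<longleftrightarrow>
     X \<subseteq> Y \<and> (\<exists>C. \<forall>u\<in>X. normY u \<le> C * normX u)"

definition compact_embedding ::
    "('a \<Rightarrow> real) set \<Rightarrow> (('a \<Rightarrow> real) \<Rightarrow> real) \<Rightarrow>
     ('a \<Rightarrow> real) set \<Rightarrow> (('a \<Rightarrow> real) \<Rightarrow> real) \<Rightarrow> bool" where
  "compact_embedding X normX Y normY \<longleftrightarrow>
     continuous_embedding X normX Y normY \<and>
     (\<forall>\<sigma>::nat \<Rightarrow> 'a \<Rightarrow> real. (\<forall>n. \<sigma> n \<in> X) \<and> (\<exists>B. \<forall>n. normX (\<sigma> n) \<le> B) \<longrightarrow>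
        (\<exists>k v. strict_mono (k :: nat \<Rightarrow> nat) \<and> v \<in> Y \<and>
           (\<lambda>n. normY (\<lambda>x. \<sigma> (k n) x - v x)) \<longlonglongrightarrow> 0))"

section \<open>The fractional Laplacian\<close>

text \<open>On the null set \<open>x = y\<close> the two integrands below have the value \<open>0 / 0 = 0\<close>.\<close>

definition X0 :: "real \<Rightarrow> 'a::euclidean_space set \<Rightarrow> ('a \<Rightarrow> real) set" where
  "X0 s \<Omega> = {u \<in> Lspace lebesgue 2.
     (AE x in lebesgue. x \<notin> \<Omega> \<longrightarrow> u x = 0) \<and>
     integrable (lebesgue :: ('a \<times> 'a) measure)
       (\<lambda>(x, y). (u x - u y)\<^sup>2 / norm (x - y) powr (real DIM('a) + 2 * s))}"

definition gagliardo_form ::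
    "real \<Rightarrow> ('a::euclidean_space \<Rightarrow> real) \<Rightarrow> ('a \<Rightarrow> real) \<Rightarrow> real" where
  "gagliardo_form s u v =
     (\<integral>(x, y). (u x - u y) * (v x - v y) / norm (x - y) powr (real DIM('a) + 2 * s)
        \<partial>(lebesgue :: ('a \<times> 'a) measure))"

text \<open>\<open>fractional_laplacian s \<Omega> u f\<close> says that \<open>u\<close> belongs to \<open>X0 s \<Omega>\<close> and \<open>(-\<Delta>)\<^sup>s u = f\<close> in \<open>\<Omega>\<close>.\<close>

definition fractional_laplacian ::
    "real \<Rightarrow> 'a::euclidean_space set \<Rightarrow> ('a \<Rightarrow> real) \<Rightarrow> ('a \<Rightarrow> real) \<Rightarrow> bool" where
  "fractional_laplacian s \<Omega> u f \<longleftrightarrow>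
     u \<in> X0 s \<Omega> \<and> (\<forall>w\<in>X0 s \<Omega>. gagliardo_form s u w = (\<integral>x. f x * w x \<partial>lebesgue_on \<Omega>))"

definition Tspace :: "real \<Rightarrow> 'a::euclidean_space set \<Rightarrow> ('a \<Rightarrow> real) set" where
  "Tspace s \<Omega> = {\<phi> \<in> X0 s \<Omega>. \<exists>\<psi>\<in>test_fun \<Omega>. fractional_laplacian s \<Omega> \<phi> \<psi>}"

text \<open>\<open>very_weak_laplacian s \<Omega> u f\<close> expresses
  \<open>\<integral>\<^sub>\<Omega> u (-\<Delta>)\<^sup>s \<phi> = \<integral>\<^sub>\<Omega> f \<phi>\<close> for all \<open>\<phi> \<in> Tspace s \<Omega>\<close>. The test function \<open>\<psi>\<close> is
  \<open>(-\<Delta>)\<^sup>s \<phi>\<close>, which \<open>\<phi>\<close> determines uniquely.\<close>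

definition very_weak_laplacian ::
    "real \<Rightarrow> 'a::euclidean_space set \<Rightarrow> ('a \<Rightarrow> real) \<Rightarrow> ('a \<Rightarrow> real) \<Rightarrow> bool" where
  "very_weak_laplacian s \<Omega> u f \<longleftrightarrow>
     (\<forall>\<phi>\<in>Tspace s \<Omega>. \<forall>\<psi>\<in>test_fun \<Omega>. fractional_laplacian s \<Omega> \<phi> \<psi> \<longrightarrow>
        (\<integral>x. u x * \<psi> x \<partial>lebesgue_on \<Omega>) = (\<integral>x. f x * \<phi> x \<partial>lebesgue_on \<Omega>))"

definition Wspace :: "real \<Rightarrow> real \<Rightarrow> 'a::euclidean_space set \<Rightarrow> ('a \<Rightarrow> real) set" where
  "Wspace s r \<Omega> = {u \<in> Lspace (lebesgue_on \<Omega>) 1.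
     \<exists>f\<in>Lspace (lebesgue_on \<Omega>) (ereal r). very_weak_laplacian s \<Omega> u f}"

text \<open>The function \<open>f\<close> is unique up to almost-everywhere equality, which does not affect its norm.\<close>

definition Wlaplacian ::
    "real \<Rightarrow> real \<Rightarrow> 'a::euclidean_space set \<Rightarrow> ('a \<Rightarrow> real) \<Rightarrow> ('a \<Rightarrow> real)" where
  "Wlaplacian s r \<Omega> u =
     (SOME f. f \<in> Lspace (lebesgue_on \<Omega>) (ereal r) \<and> very_weak_laplacian s \<Omega> u f)"

definition Wnorm :: "real \<Rightarrow> real \<Rightarrow> 'a::euclidean_space set \<Rightarrow> ('a \<Rightarrow> real) \<Rightarrow> real" where
  "Wnorm s r \<Omega> u = Lnorm (lebesgue_on \<Omega>) (ereal r) (Wlaplacian s r \<Omega> u)"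

end

theory Submission
  imports Defs "HOL-Complex_Analysis.Great_Picard"
begin

text \<open>The theorem concerns the Green operator, which maps data \<open>g\<close> to the solution \<open>\<phi>\<close> of
  \<open>(-\<Delta>)\<^sup>s \<phi> = g\<close> in \<open>\<Omega>\<close>, \<open>\<phi> = 0\<close> outside. For bounded data a solution in the energy space exists by the
  Riesz representation theorem (\<open>weak_solution_exists\<close>; the Poincare inequality makes the Gagliardo form
  complete). Boundedness of the Green operator from \<open>L\<^sup>r\<close> to \<open>L\<^sup>\<gamma>\<close> is the predicate \<open>green_bound r \<gamma>\<close>, and it
  is only asked of bounded data.

  The bounds rest on two estimates, both obtained from the fractional Sobolev inequality. Stampacchia's
  truncation method gives \<open>\<parallel>\<phi>\<parallel>\<^sub>\<infinity> \<le> C \<parallel>g\<parallel>\<^sub>m\<close> for \<open>m > N / (2 s)\<close> (\<open>Stampacchia\<close>), and testing the equation with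
  powers of \<open>\<phi>\<close> gives the critical pairs of exponents with \<open>\<gamma>\<close> at least the Sobolev exponent
  \<open>q = 2N / (N - 2 s)\<close> (\<open>green_bound_large\<close>). The Green operator is symmetric, so duality (\<open>green_bound_dual\<close>) yields the
  remaining critical pairs, and the dual of Stampacchia's bound is the case \<open>r = 1\<close> with
  \<open>\<gamma> < N / (N - 2 s)\<close>.

  Very weak solutions are handled by approximation. The datum of \<open>u\<close> is unique (\<open>datum_unique\<close>) because every
  test function \<open>\<eta>\<close> has bounded \<open>(-\<Delta>)\<^sup>s \<eta>\<close> (\<open>test_fun_weak_sol\<close>) and is therefore a uniform limit of elements
  of \<open>Tspace s \<Omega>\<close>. If \<open>u\<close> has datum \<open>f\<close> and test functions \<open>\<psi>\<^sub>n\<close> converge to \<open>f\<close> in \<open>L\<^sup>r\<close>, then the solutions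
  with data \<open>\<psi>\<^sub>n\<close> converge to \<open>u\<close> (\<open>very_weak_approximation\<close>). This is density of \<open>Tspace s \<Omega>\<close>, and with
  Fatou's lemma it carries the Green bounds over to \<open>Wspace s r \<Omega>\<close>. Completeness follows from completeness
  of \<open>L\<^sup>r\<close> for the data and of \<open>L\<^sup>1\<close> for the functions.

  For the compact embeddings, solutions with data bounded in \<open>L\<^sup>1\<close> are precompact in \<open>L\<^sup>1\<close>
  (\<open>L1_precompact\<close>): the energies of their truncations are bounded, and the oscillation of a function around its
  averages over small balls is controlled by its energy. Interpolation with a Green bound for an exponent
  \<open>\<delta> > \<gamma>\<close> improves convergence in \<open>L\<^sup>1\<close> to convergence in \<open>L\<^sup>\<gamma>\<close>.\<close>

section \<open>Lebesgue spaces\<close>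

lemma Lspace_ereal: "f \<in> Lspace M (ereal p) \<longleftrightarrow>
    f \<in> borel_measurable M \<and> integrable M (\<lambda>x. \<bar>f x\<bar> powr p)"
  by (simp add: Lspace_def)

lemma Lnorm_ereal: "Lnorm M (ereal p) f = (\<integral>x. \<bar>f x\<bar> powr p \<partial>M) powr (1 / p)"
  by (simp add: Lnorm_def)

lemma Lspace_one: "f \<in> Lspace M 1 \<longleftrightarrow> integrable M f"
proof -
  have "f \<in> Lspace M (ereal 1) \<longleftrightarrow> integrable M f"
    unfolding Lspace_ereal by (auto simp: integrable_abs_iff)
  then show ?thesis by (simp add: one_ereal_def)
qed

lemma Lnorm_one: "Lnorm M 1 f = (\<integral>x. \<bar>f x\<bar> \<partial>M)"
proof -
  have "Lnorm M (ereal 1) f = (\<integral>x. \<bar>f x\<bar> \<partial>M)"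
    unfolding Lnorm_ereal by simp
  then show ?thesis by (simp add: one_ereal_def)
qed

lemma Lnorm_nonneg: "0 \<le> Lnorm M (ereal p) f"
  by (simp add: Lnorm_ereal)

lemma Lnorm_powr: "p > 0 \<Longrightarrow> Lnorm M (ereal p) f powr p = (\<integral>x. \<bar>f x\<bar> powr p \<partial>M)"
  by (simp add: Lnorm_ereal powr_powr)

lemma Lnorm_leI:
  assumes "p > 0" "0 \<le> c" "(\<integral>x. \<bar>f x\<bar> powr p \<partial>M) \<le> c powr p"
  shows "Lnorm M (ereal p) f \<le> c"
proof -
  have "Lnorm M (ereal p) f \<le> (c powr p) powr (1 / p)"
    unfolding Lnorm_ereal using assms by (intro powr_mono2) auto
  then show ?thesis using assms by (simp add: powr_powr)
qed

lemma Lspace_cong_AE: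
  assumes "f \<in> Lspace M p" "g \<in> borel_measurable M" "AE x in M. f x = g x"
  shows "g \<in> Lspace M p"
proof -
  have f: "f \<in> borel_measurable M" using assms(1) by (simp add: Lspace_def)
  show ?thesis
  proof (cases "p = \<infinity>")
    case True
    have "esssup M (\<lambda>x. ereal \<bar>f x\<bar>) = esssup M (\<lambda>x. ereal \<bar>g x\<bar>)"
      using assms f by (intro esssup_AE_cong) auto
    then show ?thesis using assms True by (simp add: Lspace_def)
  next
    case False
    have "integrable M (\<lambda>x. \<bar>f x\<bar> powr real_of_ereal p) \<longleftrightarrow> integrable M (\<lambda>x. \<bar>g x\<bar> powr real_of_ereal p)"
      using assms f by (intro integrable_cong_AE) auto
    then show ?thesis using assms False by (simp add: Lspace_def)
  qed
qed

lemma Lnorm_cong_AE: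
  assumes "f \<in> borel_measurable M" "g \<in> borel_measurable M" "AE x in M. f x = g x"
  shows "Lnorm M p f = Lnorm M p g"
proof -
  have "esssup M (\<lambda>x. ereal \<bar>f x\<bar>) = esssup M (\<lambda>x. ereal \<bar>g x\<bar>)"
    using assms by (intro esssup_AE_cong) auto
  moreover have "(\<integral>x. \<bar>f x\<bar> powr real_of_ereal p \<partial>M) = (\<integral>x. \<bar>g x\<bar> powr real_of_ereal p \<partial>M)"
    using assms by (intro integral_cong_AE) auto
  ultimately show ?thesis by (simp add: Lnorm_def)
qed

lemma Lspace_cmult:
  assumes "f \<in> Lspace M (ereal p)"
  shows "(\<lambda>x. c * f x) \<in> Lspace M (ereal p)"
  using assms by (auto simp: Lspace_ereal abs_mult powr_mult)

lemma Lnorm_cmult: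
  assumes "p > 0"
  shows "Lnorm M (ereal p) (\<lambda>x. c * f x) = \<bar>c\<bar> * Lnorm M (ereal p) f"
  using assms by (simp add: Lnorm_ereal abs_mult powr_mult powr_powr)

lemma Lnorm_minus_commute: "Lnorm M p (\<lambda>x. f x - g x) = Lnorm M p (\<lambda>x. g x - f x)"
  by (simp add: Lnorm_def abs_minus_commute)

lemma Lnorm_eq_0_iff:
  assumes "f \<in> Lspace M (ereal p)" "p > 0"
  shows "Lnorm M (ereal p) f = 0 \<longleftrightarrow> (AE x in M. f x = 0)"
proof -
  have "Lnorm M (ereal p) f = 0 \<longleftrightarrow> (\<integral>x. \<bar>f x\<bar> powr p \<partial>M) = 0"
    using assms by (simp add: Lnorm_ereal)
  also have "\<dots> \<longleftrightarrow> (AE x in M. \<bar>f x\<bar> powr p = 0)"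
    using assms by (intro integral_nonneg_eq_0_iff_AE) (auto simp: Lspace_ereal)
  finally show ?thesis by simp
qed

text \<open>Convexity of \<open>x\<^sup>p\<close> on the closed half-line; at \<open>0\<close> it follows from \<open>t\<^sup>p \<le> t\<close> for weights
  \<open>t \<le> 1\<close>.\<close>

lemma powr_convex_combination:
  fixes a b t u p :: real
  assumes "1 \<le> p" "0 \<le> a" "0 \<le> b" "0 \<le> t" "0 \<le> u" "t + u = 1"
  shows "(t * a + u * b) powr p \<le> t * a powr p + u * b powr p"
proof -
  have one: "v powr p \<le> v" if "0 \<le> v" "v \<le> 1" for v :: real
    using that assms(1) powr_mono'[of 1 p v] by (cases "v = 0") auto
  consider "a = 0" | "b = 0" | "a > 0" "b > 0" using assms by linarith
  then show ?thesis
  proof cases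
    case 1
    have "u powr p * b powr p \<le> u * b powr p"
      using one[of u] assms by (intro mult_right_mono) auto
    then show ?thesis using 1 assms by (simp add: powr_mult)
  next
    case 2
    have "t powr p * a powr p \<le> t * a powr p"
      using one[of t] assms by (intro mult_right_mono) auto
    then show ?thesis using 2 assms by (simp add: powr_mult)
  next
    case 3
    have c: "convex_on {0<..} (\<lambda>x::real. x powr p)"
      using assms(1) by (rule powr_convex)
    have "((1-u) *\<^sub>R a + u *\<^sub>R b) powr p \<le> (1-u) * a powr p + u * b powr p"
      using c 3 assms by (intro convex_onD) auto
    moreover have "t = 1 - u" using assms by simp
    ultimately show ?thesis by simp
  qed
qed

text \<open>For any \<open>a > \<parallel>f\<parallel>\<close> and \<open>b > \<parallel>g\<parallel>\<close> the function \<open>(f + g) / (a + b)\<close> is a convex combination of \<open>f / a\<close> and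
  \<open>g / b\<close> with weights \<open>a / (a + b)\<close> and \<open>b / (a + b)\<close>, so convexity of \<open>x\<^sup>p\<close> applies. Numbers above the norms also cover functions
  of norm \<open>0\<close>.\<close>

lemma Minkowski:
  assumes f: "f \<in> Lspace M (ereal p)" and g: "g \<in> Lspace M (ereal p)" and p: "1 \<le> p"
  shows Lspace_add: "(\<lambda>x. f x + g x) \<in> Lspace M (ereal p)"
    and Lnorm_triangle: "Lnorm M (ereal p) (\<lambda>x. f x + g x) \<le> Lnorm M (ereal p) f + Lnorm M (ereal p) g"
proof -
  note [measurable] = f[unfolded Lspace_ereal, THEN conjunct1] g[unfolded Lspace_ereal, THEN conjunct1]
  have fi: "integrable M (\<lambda>x. \<bar>f x\<bar> powr p)" and gi: "integrable M (\<lambda>x. \<bar>g x\<bar> powr p)"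
    using f g by (auto simp: Lspace_ereal)
  have bound: "\<bar>f x + g x\<bar> powr p \<le>
      (a + b) powr p * (a / (a + b) * (\<bar>f x\<bar> powr p / a powr p) + b / (a + b) * (\<bar>g x\<bar> powr p / b powr p))"
    if "a > 0" "b > 0" for a b x
  proof -
    have eq: "(a + b) * (a / (a + b) * (\<bar>f x\<bar> / a) + b / (a + b) * (\<bar>g x\<bar> / b)) = \<bar>f x\<bar> + \<bar>g x\<bar>"
      using that by (simp add: distrib_left)
    have "\<bar>f x + g x\<bar> powr p \<le> (\<bar>f x\<bar> + \<bar>g x\<bar>) powr p"
      using p by (intro powr_mono2) auto
    also have "\<dots> = (a + b) powr p * (a / (a + b) * (\<bar>f x\<bar> / a) + b / (a + b) * (\<bar>g x\<bar> / b)) powr p"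
      using that by (subst eq[symmetric], subst powr_mult) auto
    also have "\<dots> \<le> (a + b) powr p *
        (a / (a + b) * (\<bar>f x\<bar> / a) powr p + b / (a + b) * (\<bar>g x\<bar> / b) powr p)"
      using that p by (intro mult_left_mono powr_convex_combination) (auto simp: add_divide_distrib[symmetric])
    finally show ?thesis using that by (simp add: powr_divide)
  qed
  have int: "integrable M (\<lambda>x. \<bar>f x + g x\<bar> powr p)"
  proof (rule Bochner_Integration.integrable_bound)
    show "integrable M (\<lambda>x. (1 + 1) powr p *
        (1 / (1 + 1) * (\<bar>f x\<bar> powr p / 1 powr p) + 1 / (1 + 1) * (\<bar>g x\<bar> powr p / 1 powr p)))"
      using fi gi by (intro integrable_mult_right Bochner_Integration.integrable_add integrable_divide)
    show "AE x in M. norm (\<bar>f x + g x\<bar> powr p) \<le> norm ((1 + 1) powr p *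
        (1 / (1 + 1) * (\<bar>f x\<bar> powr p / 1 powr p) + 1 / (1 + 1) * (\<bar>g x\<bar> powr p / 1 powr p)))"
      using bound[OF zero_less_one zero_less_one]
      by (intro AE_I2) (smt (verit) real_norm_def powr_ge_zero)
  qed measurable
  then show "(\<lambda>x. f x + g x) \<in> Lspace M (ereal p)" by (simp add: Lspace_ereal)
  show "Lnorm M (ereal p) (\<lambda>x. f x + g x) \<le> Lnorm M (ereal p) f + Lnorm M (ereal p) g"
  proof (rule field_le_epsilon)
    fix e :: real assume "e > 0"
    \<comment> \<open>Halves of \<open>e\<close> keep both normalising constants positive.\<close>
    define a b where "a = Lnorm M (ereal p) f + e / 2" and "b = Lnorm M (ereal p) g + e / 2"
    have pos: "a > 0" "b > 0"
      using \<open>e > 0\<close> Lnorm_nonneg[of M p f] Lnorm_nonneg[of M p g] by (auto simp: a_def b_def)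
    have le: "(\<integral>x. \<bar>f x\<bar> powr p \<partial>M) \<le> a powr p" "(\<integral>x. \<bar>g x\<bar> powr p \<partial>M) \<le> b powr p"
      using p \<open>e > 0\<close> Lnorm_nonneg[of M p f] Lnorm_nonneg[of M p g]
      by (auto simp: Lnorm_powr[symmetric] a_def b_def intro!: powr_mono2)
    have "(\<integral>x. \<bar>f x + g x\<bar> powr p \<partial>M) \<le> (\<integral>x. (a + b) powr p *
        (a / (a + b) * (\<bar>f x\<bar> powr p / a powr p) + b / (a + b) * (\<bar>g x\<bar> powr p / b powr p)) \<partial>M)"
      using fi gi int bound[OF pos] by (intro integral_mono) auto
    also have "\<dots> = (a + b) powr p * (a / (a + b) * ((\<integral>x. \<bar>f x\<bar> powr p \<partial>M) / a powr p)
        + b / (a + b) * ((\<integral>x. \<bar>g x\<bar> powr p \<partial>M) / b powr p))"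
      using fi gi by simp
    also have "\<dots> \<le> (a + b) powr p * (a / (a + b) * 1 + b / (a + b) * 1)"
      using pos le by (intro mult_left_mono add_mono) (auto simp: divide_le_eq_1)
    also have "\<dots> = (a + b) powr p" using pos by (simp add: add_divide_distrib[symmetric])
    finally have "Lnorm M (ereal p) (\<lambda>x. f x + g x) \<le> a + b"
      using p pos by (intro Lnorm_leI) auto
    then show "Lnorm M (ereal p) (\<lambda>x. f x + g x) \<le> Lnorm M (ereal p) f + Lnorm M (ereal p) g + e"
      by (simp add: a_def b_def)
  qed
qed

lemma Lspace_diff:
  assumes "f \<in> Lspace M (ereal p)" "g \<in> Lspace M (ereal p)" "1 \<le> p"
  shows "(\<lambda>x. f x - g x) \<in> Lspace M (ereal p)"
  using Lspace_add[OF assms(1) Lspace_cmult[OF assms(2), of "-1"] assms(3)] by simp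

lemma Lnorm_triangle_diff:
  assumes "f \<in> Lspace M (ereal p)" "g \<in> Lspace M (ereal p)" "1 \<le> p"
  shows "Lnorm M (ereal p) f \<le> Lnorm M (ereal p) g + Lnorm M (ereal p) (\<lambda>x. f x - g x)"
  using Lnorm_triangle[OF assms(2) Lspace_diff[OF assms] assms(3)] by simp

text \<open>Young's inequality for \<open>f / a\<close> and \<open>g / b\<close> with any \<open>a > \<parallel>f\<parallel>\<close> and \<open>b > \<parallel>g\<parallel>\<close>, followed by letting \<open>a\<close> and \<open>b\<close> tend to
  the norms.\<close>

lemma Hoelder:
  assumes f: "f \<in> Lspace M (ereal p)" and g: "g \<in> Lspace M (ereal q)"
    and pq: "1 < p" "1 < q" "1 / p + 1 / q = 1"
  shows "integrable M (\<lambda>x. f x * g x)"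
    and "\<bar>\<integral>x. f x * g x \<partial>M\<bar> \<le> Lnorm M (ereal p) f * Lnorm M (ereal q) g"
proof -
  note [measurable] = f[unfolded Lspace_ereal, THEN conjunct1] g[unfolded Lspace_ereal, THEN conjunct1]
  have fi: "integrable M (\<lambda>x. \<bar>f x\<bar> powr p)" and gi: "integrable M (\<lambda>x. \<bar>g x\<bar> powr q)"
    using f g by (auto simp: Lspace_ereal)
  have bound: "\<bar>f x * g x\<bar> \<le> a * b * (\<bar>f x\<bar> powr p / a powr p / p + \<bar>g x\<bar> powr q / b powr q / q)"
    if "a > 0" "b > 0" for a b x
  proof -
    have "\<bar>f x * g x\<bar> = a * b * ((\<bar>f x\<bar> / a) * (\<bar>g x\<bar> / b))"
      using that by (simp add: abs_mult)
    also have "\<dots> \<le> a * b * ((\<bar>f x\<bar> / a) powr p / p + (\<bar>g x\<bar> / b) powr q / q)"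
      using that pq by (intro mult_left_mono Youngs_inequality) auto
    finally show ?thesis using that by (simp add: powr_divide)
  qed
  show int: "integrable M (\<lambda>x. f x * g x)"
  proof (rule Bochner_Integration.integrable_bound)
    show "integrable M (\<lambda>x. 1 * 1 * (\<bar>f x\<bar> powr p / 1 powr p / p + \<bar>g x\<bar> powr q / 1 powr q / q))"
      using fi gi by (intro integrable_mult_right Bochner_Integration.integrable_add integrable_divide)
    show "AE x in M. norm (f x * g x) \<le> norm (1 * 1 *
        (\<bar>f x\<bar> powr p / 1 powr p / p + \<bar>g x\<bar> powr q / 1 powr q / q))"
      using bound[OF zero_less_one zero_less_one] by (intro AE_I2) (smt (verit) real_norm_def)
  qed measurable
  have le: "\<bar>\<integral>x. f x * g x \<partial>M\<bar> \<le> a * b"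
    if ab: "a > Lnorm M (ereal p) f" "b > Lnorm M (ereal q) g" for a b
  proof -
    have pos: "a > 0" "b > 0" using ab Lnorm_nonneg[of M p f] Lnorm_nonneg[of M q g] by auto
    have le: "(\<integral>x. \<bar>f x\<bar> powr p \<partial>M) \<le> a powr p" "(\<integral>x. \<bar>g x\<bar> powr q \<partial>M) \<le> b powr q"
      using pq ab Lnorm_nonneg[of M p f] Lnorm_nonneg[of M q g]
      by (auto simp: Lnorm_powr[symmetric] intro!: powr_mono2)
    have "\<bar>\<integral>x. f x * g x \<partial>M\<bar> \<le> (\<integral>x. \<bar>f x * g x\<bar> \<partial>M)"
      by (rule integral_abs_bound)
    also have "\<dots> \<le> (\<integral>x. a * b * (\<bar>f x\<bar> powr p / a powr p / p + \<bar>g x\<bar> powr q / b powr q / q) \<partial>M)"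
      using fi gi int bound[OF pos] by (intro integral_mono) auto
    also have "\<dots> = a * b * ((\<integral>x. \<bar>f x\<bar> powr p \<partial>M) / a powr p / p + (\<integral>x. \<bar>g x\<bar> powr q \<partial>M) / b powr q / q)"
      using fi gi by simp
    also have "\<dots> \<le> a * b * (1 / p + 1 / q)"
      using pos le pq by (intro mult_left_mono add_mono divide_right_mono) (auto simp: divide_le_eq_1)
    finally show ?thesis using pq by simp
  qed
  have "(\<lambda>n. (Lnorm M (ereal p) f + inverse (real (Suc n))) * (Lnorm M (ereal q) g + inverse (real (Suc n))))
      \<longlonglongrightarrow> (Lnorm M (ereal p) f + 0) * (Lnorm M (ereal q) g + 0)"
    by (intro tendsto_intros LIMSEQ_inverse_real_of_nat)
  then have "\<bar>\<integral>x. f x * g x \<partial>M\<bar> \<le> (Lnorm M (ereal p) f + 0) * (Lnorm M (ereal q) g + 0)"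
    by (rule LIMSEQ_le_const) (intro exI[of _ 0] allI impI le; simp)
  then show "\<bar>\<integral>x. f x * g x \<partial>M\<bar> \<le> Lnorm M (ereal p) f * Lnorm M (ereal q) g" by simp
qed

lemma integral_mult_bound_AE:
  fixes f g :: "'a \<Rightarrow> real"
  assumes f: "integrable M f" and [measurable]: "g \<in> borel_measurable M"
    and C: "AE x in M. \<bar>g x\<bar> \<le> C"
  shows "integrable M (\<lambda>x. f x * g x)"
    and "\<bar>\<integral>x. f x * g x \<partial>M\<bar> \<le> C * (\<integral>x. \<bar>f x\<bar> \<partial>M)"
proof -
  have [measurable]: "f \<in> borel_measurable M" using f by simp
  have b: "AE x in M. \<bar>f x * g x\<bar> \<le> C * \<bar>f x\<bar>"
    using C by eventually_elim (metis abs_mult abs_ge_zero mult.commute mult_right_mono)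
  show i: "integrable M (\<lambda>x. f x * g x)"
  proof (rule Bochner_Integration.integrable_bound)
    show "integrable M (\<lambda>x. C * \<bar>f x\<bar>)" using f by simp
    show "AE x in M. norm (f x * g x) \<le> norm (C * \<bar>f x\<bar>)"
      using b by (rule AE_mp) (auto intro!: AE_I2)
  qed measurable
  have "\<bar>\<integral>x. f x * g x \<partial>M\<bar> \<le> (\<integral>x. \<bar>f x * g x\<bar> \<partial>M)" by (rule integral_abs_bound)
  also have "\<dots> \<le> (\<integral>x. C * \<bar>f x\<bar> \<partial>M)" using b i f by (intro integral_mono_AE) auto
  finally show "\<bar>\<integral>x. f x * g x \<partial>M\<bar> \<le> C * (\<integral>x. \<bar>f x\<bar> \<partial>M)" by simp
qed

text \<open>Fatou's lemma for Bochner integrals. The bounds \<open>c n\<close> may vary with \<open>n\<close>, as the norms of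
  approximating data do.\<close>

lemma integral_Fatou:
  fixes f :: "nat \<Rightarrow> 'a \<Rightarrow> real"
  assumes int: "\<And>n. integrable M (f n)" and nn: "\<And>n x. 0 \<le> f n x"
    and g: "g \<in> borel_measurable M"
    and lim: "AE x in M. (\<lambda>n. f n x) \<longlonglongrightarrow> g x"
    and le: "\<And>n. (\<integral>x. f n x \<partial>M) \<le> c n" and c: "c \<longlonglongrightarrow> C"
  shows "integrable M g" and "(\<integral>x. g x \<partial>M) \<le> C"
proof -
  have g0: "AE x in M. 0 \<le> g x"
    using lim by eventually_elim (auto intro: LIMSEQ_le_const nn)
  have C0: "0 \<le> C"
    using c by (rule LIMSEQ_le_const) (auto intro!: exI[of _ 0] order_trans[OF Bochner_Integration.integral_nonneg le] nn)
  have "(\<integral>\<^sup>+x. ennreal (g x) \<partial>M) = (\<integral>\<^sup>+x. liminf (\<lambda>n. ennreal (f n x)) \<partial>M)"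
  proof (rule nn_integral_cong_AE)
    show "AE x in M. ennreal (g x) = liminf (\<lambda>n. ennreal (f n x))"
      using lim by eventually_elim (rule lim_imp_Liminf[symmetric], auto intro: tendsto_ennrealI)
  qed
  also have "\<dots> \<le> liminf (\<lambda>n. \<integral>\<^sup>+x. ennreal (f n x) \<partial>M)"
    using int by (intro nn_integral_liminf) (auto dest: borel_measurable_integrable)
  also have "\<dots> \<le> liminf (\<lambda>n. ennreal (c n))"
    using int nn le by (intro Liminf_mono always_eventually allI)
      (auto simp: nn_integral_eq_integral intro!: ennreal_leI)
  also have "\<dots> = ennreal C"
    using c by (intro lim_imp_Liminf) (auto intro: tendsto_ennrealI)
  finally have *: "(\<integral>\<^sup>+x. ennreal (g x) \<partial>M) \<le> ennreal C" .
  show i: "integrable M g"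
    using * g g0 by (intro integrableI_nonneg) (auto simp: less_top[symmetric] top_unique)
  have "ennreal (\<integral>x. g x \<partial>M) \<le> ennreal C"
    using * i g0 by (simp add: nn_integral_eq_integral)
  then show "(\<integral>x. g x \<partial>M) \<le> C" using C0 by simp
qed

lemma Lspace_Fatou:
  assumes f: "\<And>n. f n \<in> Lspace M (ereal p)" and g: "g \<in> borel_measurable M" and p: "1 \<le> p"
    and lim: "AE x in M. (\<lambda>n. f n x) \<longlonglongrightarrow> g x"
    and le: "\<And>n. Lnorm M (ereal p) (f n) \<le> c n" and c: "c \<longlonglongrightarrow> C"
  shows "g \<in> Lspace M (ereal p)" and "Lnorm M (ereal p) g \<le> C"
proof -
  have c0: "0 \<le> c n" for n using le[of n] Lnorm_nonneg[of M p "f n"] by linarith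
  have C0: "0 \<le> C" using c by (rule LIMSEQ_le_const) (use c0 in auto)
  have lim': "AE x in M. (\<lambda>n. \<bar>f n x\<bar> powr p) \<longlonglongrightarrow> \<bar>g x\<bar> powr p"
    using lim by eventually_elim (use p in \<open>auto intro!: tendsto_powr' tendsto_intros\<close>)
  have le': "(\<integral>x. \<bar>f n x\<bar> powr p \<partial>M) \<le> c n powr p" for n
    using le[of n] Lnorm_nonneg[of M p "f n"] p by (simp add: Lnorm_powr[symmetric] powr_mono2)
  have cl: "(\<lambda>n. c n powr p) \<longlonglongrightarrow> C powr p"
    using c p c0 by (intro tendsto_powr') auto
  have int: "integrable M (\<lambda>x. \<bar>f n x\<bar> powr p)" for n using f by (simp add: Lspace_ereal)
  have gm: "(\<lambda>x. \<bar>g x\<bar> powr p) \<in> borel_measurable M" using g by simp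
  note F = integral_Fatou[OF int _ gm lim' le' cl]
  show "g \<in> Lspace M (ereal p)" using F(1) g by (simp add: Lspace_ereal)
  show "Lnorm M (ereal p) g \<le> C" using F(2) p C0 by (intro Lnorm_leI) auto
qed

lemma (in finite_measure) Lspace_bounded:
  assumes [measurable]: "f \<in> borel_measurable M" and "AE x in M. \<bar>f x\<bar> \<le> C" and "p > 0"
  shows "f \<in> Lspace M (ereal p)"
proof -
  have "AE x in M. \<bar>f x\<bar> powr p \<le> C powr p"
    using assms(2) by eventually_elim (use assms(3) in \<open>auto intro: powr_mono2\<close>)
  then have "integrable M (\<lambda>x. \<bar>f x\<bar> powr p)"
    by (intro integrable_const_bound) auto
  then show ?thesis by (simp add: Lspace_ereal)
qed

text \<open>On a finite measure space the \<open>L\<^sup>p\<close> norms increase with \<open>p\<close> up to a constant: after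
  normalising \<open>\<parallel>f\<parallel>\<^sub>q = 1\<close>, integrate \<open>\<bar>f\<bar>\<^sup>p \<le> 1 + \<bar>f\<bar>\<^sup>q\<close>.\<close>

lemma (in finite_measure) Lspace_mono:
  assumes f: "f \<in> Lspace M (ereal q)" and pq: "1 \<le> p" "p \<le> q"
  shows "f \<in> Lspace M (ereal p)"
    and "Lnorm M (ereal p) f \<le> (measure M (space M) + 1) powr (1 / p) * Lnorm M (ereal q) f"
proof -
  note [measurable] = f[unfolded Lspace_ereal, THEN conjunct1]
  have fi: "integrable M (\<lambda>x. \<bar>f x\<bar> powr q)" using f by (simp add: Lspace_ereal)
  have le: "t powr p \<le> 1 + t powr q" if "t \<ge> 0" for t :: real
  proof (cases "t \<le> 1")
    case True
    then have "t powr p \<le> 1" using that pq by (intro powr_le1) auto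
    then show ?thesis by (simp add: add_increasing2)
  next
    case False
    then have "t powr p \<le> t powr q" using pq by (intro powr_mono) auto
    then show ?thesis by simp
  qed
  have i: "integrable M (\<lambda>x. \<bar>f x\<bar> powr p)"
  proof (rule Bochner_Integration.integrable_bound)
    show "integrable M (\<lambda>x. 1 + \<bar>f x\<bar> powr q)" using fi by simp
    show "AE x in M. norm (\<bar>f x\<bar> powr p) \<le> norm (1 + \<bar>f x\<bar> powr q)"
    proof (rule AE_I2)
      fix x show "norm (\<bar>f x\<bar> powr p) \<le> norm (1 + \<bar>f x\<bar> powr q)"
        using le[of "\<bar>f x\<bar>"] by simp
    qed
  qed measurable
  then show "f \<in> Lspace M (ereal p)" by (simp add: Lspace_ereal)
  show "Lnorm M (ereal p) f \<le> (measure M (space M) + 1) powr (1 / p) * Lnorm M (ereal q) f"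
  proof (cases "Lnorm M (ereal q) f = 0")
    case True
    then have "AE x in M. f x = 0" using Lnorm_eq_0_iff[OF f] pq by simp
    then have "Lnorm M (ereal p) f = 0"
      using Lnorm_eq_0_iff[of f M p] i pq by (simp add: Lspace_ereal)
    then show ?thesis by (simp add: True)
  next
    case False
    define a where "a = Lnorm M (ereal q) f"
    have a: "a > 0" using False Lnorm_nonneg[of M q f] by (simp add: a_def)
    have aq: "(\<integral>x. \<bar>f x\<bar> powr q \<partial>M) = a powr q" using pq by (simp add: a_def Lnorm_powr)
    have b: "\<bar>f x\<bar> powr p \<le> a powr p * (1 + \<bar>f x\<bar> powr q / a powr q)" for x
      using le[of "\<bar>f x\<bar> / a"] a by (simp add: powr_divide field_simps)
    have "(\<integral>x. \<bar>f x\<bar> powr p \<partial>M) \<le> (\<integral>x. a powr p * (1 + \<bar>f x\<bar> powr q / a powr q) \<partial>M)"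
      using b i fi by (intro integral_mono) auto
    also have "\<dots> = a powr p * (measure M (space M) + 1)"
      using fi a by (simp add: aq)
    finally have "(\<integral>x. \<bar>f x\<bar> powr p \<partial>M) \<le> ((measure M (space M) + 1) powr (1 / p) * a) powr p"
      using a pq by (simp add: powr_mult powr_powr mult.commute add_nonneg_nonneg)
    then show ?thesis unfolding a_def[symmetric] using a pq by (intro Lnorm_leI) auto
  qed
qed

text \<open>Completeness of \<open>L\<^sup>p\<close> on a finite measure space, in the form that also yields a subsequence
  converging almost everywhere. Cauchy sequences in \<open>L\<^sup>p\<close> are Cauchy in \<open>L\<^sup>1\<close>, and the norm
  convergence is Fatou's lemma along that subsequence.\<close>

lemma (in finite_measure) Lspace_complete:
  assumes f: "\<And>n. f n \<in> Lspace M (ereal p)" and p: "1 \<le> p"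
    and cauchy: "\<And>e. e > 0 \<Longrightarrow> \<exists>K. \<forall>m\<ge>K. \<forall>n\<ge>K. Lnorm M (ereal p) (\<lambda>x. f m x - f n x) < e"
  obtains g k where "g \<in> Lspace M (ereal p)" "strict_mono (k :: nat \<Rightarrow> nat)"
    "AE x in M. (\<lambda>n. f (k n) x) \<longlonglongrightarrow> g x"
    "(\<lambda>n. Lnorm M (ereal p) (\<lambda>x. f n x - g x)) \<longlonglongrightarrow> 0"
proof -
  have f1: "f n \<in> Lspace M 1" for n
    using Lspace_mono(1)[OF f, of 1] p by (simp add: one_ereal_def)
  then have int: "integrable M (f n)" for n by (simp add: Lspace_one)
  note [measurable] = borel_measurable_integrable[OF int]
  define C where "C = (measure M (space M) + 1) powr (1 / 1)"
  have C: "C > 0" using measure_nonneg[of M "space M"] by (simp add: C_def add_nonneg_pos)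
  have "\<exists>K. \<forall>m\<ge>K. \<forall>n\<ge>K. (LINT x|M. norm (f m x - f n x)) < e" if "e > 0" for e
  proof -
    obtain K where K: "Lnorm M (ereal p) (\<lambda>x. f m x - f n x) < e / C" if "m \<ge> K" "n \<ge> K" for m n
      using cauchy[of "e / C"] \<open>e > 0\<close> C by auto
    have "(LINT x|M. norm (f m x - f n x)) < e" if "m \<ge> K" "n \<ge> K" for m n
    proof -
      have "Lnorm M (ereal 1) (\<lambda>x. f m x - f n x) \<le> C * Lnorm M (ereal p) (\<lambda>x. f m x - f n x)"
        unfolding C_def using Lspace_mono(2)[OF Lspace_diff[OF f f p], of 1 m n] p by simp
      also have "\<dots> < C * (e / C)" using K[OF that] C by (intro mult_strict_left_mono) auto
      finally show ?thesis using C by (simp add: one_ereal_def[symmetric] Lnorm_one)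
    qed
    then show ?thesis by blast
  qed
  from cauchy_L1_AE_cauchy_subseq[OF int this]
  obtain k :: "nat \<Rightarrow> nat" where k: "strict_mono k" "AE x in M. Cauchy (\<lambda>i. f (k i) x)" by blast
  define g where "g x = lim (\<lambda>i. f (k i) x)" for x
  have [measurable]: "g \<in> borel_measurable M" unfolding g_def by measurable
  have lim: "AE x in M. (\<lambda>i. f (k i) x) \<longlonglongrightarrow> g x"
    using k(2) by eventually_elim (simp add: g_def Cauchy_convergent_iff convergent_LIMSEQ_iff)
  have close: "(\<lambda>x. f n x - g x) \<in> Lspace M (ereal p) \<and> Lnorm M (ereal p) (\<lambda>x. f n x - g x) \<le> e"
    if e: "e > 0" and K: "\<And>m n. m \<ge> K \<Longrightarrow> n \<ge> K \<Longrightarrow> Lnorm M (ereal p) (\<lambda>x. f m x - f n x) < e" and n: "n \<ge> K"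
    for e K n
  proof -
    define h where "h i x = f n x - f (k (i + K)) x" for i x
    have ki: "k (i + K) \<ge> K" for i using seq_suble[OF k(1), of "i + K"] by linarith
    have h: "h i \<in> Lspace M (ereal p)" for i unfolding h_def by (rule Lspace_diff[OF f f p])
    have hl: "AE x in M. (\<lambda>i. h i x) \<longlonglongrightarrow> f n x - g x"
      using lim unfolding h_def
      by eventually_elim (intro tendsto_diff tendsto_const, rule LIMSEQ_ignore_initial_segment)
    have le: "Lnorm M (ereal p) (h i) \<le> e" for i
      using K[OF n ki, of i] by (simp add: h_def[abs_def])
    show ?thesis using Lspace_Fatou[OF h _ p hl le tendsto_const] by simp
  qed
  have g: "g \<in> Lspace M (ereal p)"
  proof -
    obtain K where "\<And>m n. m \<ge> K \<Longrightarrow> n \<ge> K \<Longrightarrow> Lnorm M (ereal p) (\<lambda>x. f m x - f n x) < 1"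
      using cauchy[of 1] by auto
    then have "(\<lambda>x. f K x - g x) \<in> Lspace M (ereal p)" using close[of 1 K K] by simp
    from Lspace_diff[OF f this p, of K] show ?thesis by simp
  qed
  have "(\<lambda>n. Lnorm M (ereal p) (\<lambda>x. f n x - g x)) \<longlonglongrightarrow> 0"
  proof (rule LIMSEQ_I)
    fix e :: real assume e: "e > 0"
    then obtain K where K: "\<And>m n. m \<ge> K \<Longrightarrow> n \<ge> K \<Longrightarrow> Lnorm M (ereal p) (\<lambda>x. f m x - f n x) < e / 2"
      using cauchy[of "e / 2"] by auto
    have "norm (Lnorm M (ereal p) (\<lambda>x. f n x - g x) - 0) < e" if "n \<ge> K" for n
      using close[OF _ K that] e Lnorm_nonneg[of M p "\<lambda>x. f n x - g x"] by simp
    then show "\<exists>no. \<forall>n\<ge>no. norm (Lnorm M (ereal p) (\<lambda>x. f n x - g x) - 0) < e" by blast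
  qed
  with g k(1) lim that show ?thesis by blast
qed

text \<open>The first summand dominates for \<open>\<bar>t\<bar> \<le> R\<close> and the second one for \<open>\<bar>t\<bar> > R\<close>. For \<open>a < b\<close> the coefficient
  of the higher power is small when \<open>R\<close> is large.\<close>

lemma powr_interpolation:
  fixes t R a b :: real
  assumes "0 < R" "1 \<le> a" "a \<le> b"
  shows "\<bar>t\<bar> powr a \<le> R powr (a - 1) * \<bar>t\<bar> + R powr (a - b) * \<bar>t\<bar> powr b"
proof (cases "\<bar>t\<bar> \<le> R")
  case True
  have "\<bar>t\<bar> powr a = \<bar>t\<bar> powr (a - 1) * \<bar>t\<bar>"
    by (cases "t = 0") (use assms in \<open>auto simp: powr_diff\<close>)
  also have "\<dots> \<le> R powr (a - 1) * \<bar>t\<bar>"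
    using True assms by (intro mult_right_mono powr_mono2) auto
  finally show ?thesis by (simp add: add_increasing2)
next
  case False
  then have "\<bar>t\<bar> powr a = \<bar>t\<bar> powr (a - b) * \<bar>t\<bar> powr b" using assms by (simp flip: powr_add)
  also have "\<dots> \<le> R powr (a - b) * \<bar>t\<bar> powr b"
    using False assms by (intro mult_right_mono powr_mono2') auto
  finally show ?thesis using assms by (simp add: add_increasing)
qed

section \<open>Smooth functions\<close>

lemma Ck_SucI:
  assumes "\<And>x. (f has_derivative F x) (at x)" and "\<And>v. Ck k (\<lambda>x. F x v)"
  shows "Ck (Suc k) f"
proof -
  have "frechet_derivative f (at x) = F x" for x
    using frechet_derivative_at[OF assms(1)] by simp
  then show ?thesis using assms by (auto simp: differentiable_def)
qed

lemma Ck_SucD: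
  assumes "Ck (Suc k) f"
  shows "(f has_derivative frechet_derivative f (at x)) (at x)"
    and "Ck k (\<lambda>x. frechet_derivative f (at x) v)"
  using assms by (auto simp: frechet_derivative_works)

lemma Ck_decrease: "Ck (Suc k) f \<Longrightarrow> Ck k f"
proof (induction k arbitrary: f)
  case 0
  then have "isCont f x" for x
    using Ck_SucD(1)[OF 0, of x] has_derivative_continuous by blast
  then show ?case by (simp add: continuous_on_eq_continuous_at)
next
  case (Suc k)
  show ?case
    by (rule Ck_SucI[OF Ck_SucD(1)[OF Suc.prems]]) (rule Suc.IH[OF Ck_SucD(2)[OF Suc.prems]])
qed

lemma Ck_const: "Ck k (\<lambda>x. c)"
proof (induction k arbitrary: c)
  case (Suc k)
  show ?case by (rule Ck_SucI[where F = "\<lambda>x v. 0"]) (auto intro: Suc)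
qed simp

lemma Ck_add: "Ck k f \<Longrightarrow> Ck k g \<Longrightarrow> Ck k (\<lambda>x. f x + g x)"
proof (induction k arbitrary: f g)
  case (Suc k)
  show ?case
    by (rule Ck_SucI[OF has_derivative_add[OF Ck_SucD(1)[OF Suc.prems(1)] Ck_SucD(1)[OF Suc.prems(2)]]])
      (rule Suc.IH[OF Ck_SucD(2)[OF Suc.prems(1)] Ck_SucD(2)[OF Suc.prems(2)]])
qed (auto intro!: continuous_intros)

lemma Ck_mult: "Ck k f \<Longrightarrow> Ck k g \<Longrightarrow> Ck k (\<lambda>x. f x * g x)"
proof (induction k arbitrary: f g)
  case (Suc k)
  have f: "Ck k f" and g: "Ck k g" using Suc.prems by (auto intro: Ck_decrease)
  show ?case
    by (rule Ck_SucI[OF has_derivative_mult[OF Ck_SucD(1)[OF Suc.prems(1)] Ck_SucD(1)[OF Suc.prems(2)]]])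
      (intro Ck_add Suc.IH f g Ck_SucD(2)[OF Suc.prems(1)] Ck_SucD(2)[OF Suc.prems(2)])
qed (auto intro!: continuous_intros)

text \<open>The outer function comes with the sequence \<open>h\<close> of its successive derivatives, because the chain rule
  replaces \<open>h j\<close> by \<open>h (Suc j)\<close> in the induction.\<close>

lemma Ck_compose:
  fixes h :: "nat \<Rightarrow> real \<Rightarrow> real"
  assumes h: "\<And>j t. (h j has_real_derivative h (Suc j) t) (at t)"
  shows "Ck k q \<Longrightarrow> Ck k (\<lambda>x. h j (q x))"
proof (induction k arbitrary: j)
  case 0
  have "continuous_on UNIV (h j)"
    using h by (auto simp: continuous_on_eq_continuous_at intro: DERIV_isCont)
  from continuous_on_compose2[OF this, of UNIV q] 0 show ?case by simp
next
  case (Suc k)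
  have *: "((\<lambda>x. h j (q x)) has_derivative (\<lambda>v. h (Suc j) (q x) * frechet_derivative q (at x) v)) (at x)" for x
    by (rule has_derivative_compose[OF Ck_SucD(1)[OF Suc.prems, of x]
        has_field_derivative_imp_has_derivative[OF h[of j "q x"]]])
  show ?case
    by (rule Ck_SucI[OF *]) (intro Ck_mult Suc.IH Ck_SucD(2)[OF Suc.prems] Ck_decrease[OF Suc.prems])
qed

lemma Ck_inner_left: "Ck k (\<lambda>x. (x - c) \<bullet> v)"
proof (cases k)
  case (Suc j)
  show ?thesis unfolding Suc
    by (rule Ck_SucI[where F = "\<lambda>x w. w \<bullet> v"]) (auto intro!: derivative_eq_intros Ck_const)
qed (auto intro!: continuous_intros)

lemma Ck_dist_square: "Ck k (\<lambda>x. (x - c) \<bullet> (x - c))"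
proof (cases k)
  case (Suc j)
  show ?thesis unfolding Suc
  proof (rule Ck_SucI[where F = "\<lambda>x w. 2 * ((x - c) \<bullet> w)"])
    show "((\<lambda>x. (x - c) \<bullet> (x - c)) has_derivative (\<lambda>w. 2 * ((x - c) \<bullet> w))) (at x)" for x
      by (auto intro!: derivative_eq_intros simp: inner_commute)
  qed (intro Ck_mult Ck_const Ck_inner_left)
qed (auto intro!: continuous_intros)

lemma smooth_fun_add: "smooth_fun f \<Longrightarrow> smooth_fun g \<Longrightarrow> smooth_fun (\<lambda>x. f x + g x)"
  by (simp add: smooth_fun_def Ck_add)

lemma smooth_fun_cmult: "smooth_fun f \<Longrightarrow> smooth_fun (\<lambda>x. c * f x)"
  by (simp add: smooth_fun_def Ck_mult Ck_const)

lemma smooth_fun_sum: "(\<And>i. i \<in> I \<Longrightarrow> smooth_fun (f i)) \<Longrightarrow> smooth_fun (\<lambda>x. \<Sum>i\<in>I. f i x)"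
proof (induction I rule: infinite_finite_induct)
  case (insert i I)
  then show ?case using smooth_fun_add[of "f i" "\<lambda>x. \<Sum>i\<in>I. f i x"] by simp
qed (simp_all add: smooth_fun_def Ck_const)

lemma smooth_fun_compose:
  assumes "\<And>j t. (h j has_real_derivative h (Suc j) t) (at t)" and "smooth_fun q"
  shows "smooth_fun (\<lambda>x. h j (q x))"
  using assms by (simp add: smooth_fun_def Ck_compose)

lemma smooth_fun_continuous: "smooth_fun f \<Longrightarrow> continuous_on UNIV f"
  unfolding smooth_fun_def by (metis Ck.simps(1))

text \<open>The functions \<open>P(1/t) exp(-1/t)\<close>, extended by zero to \<open>t \<le> 0\<close>, are closed under
  differentiation when \<open>P\<close> ranges over polynomials.\<close>

definition expinv :: "real poly \<Rightarrow> real \<Rightarrow> real" where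
  "expinv P t = (if t \<le> 0 then 0 else poly P (1 / t) * exp (- (1 / t)))"

lemma poly_times_exp_tendsto_0: "((\<lambda>y. poly P y * exp (- y)) \<longlongrightarrow> (0::real)) at_top"
proof -
  have "((\<lambda>y. \<Sum>i\<le>degree P. coeff P i * (y ^ i / exp y)) \<longlongrightarrow> (\<Sum>i\<le>degree P. coeff P i * 0)) at_top"
    by (intro tendsto_intros tendsto_power_div_exp_0)
  moreover have "poly P y * exp (- y) = (\<Sum>i\<le>degree P. coeff P i * (y ^ i / exp y))" for y
    by (simp add: poly_altdef sum_distrib_left sum_distrib_right exp_minus divide_inverse mult.assoc)
  ultimately show ?thesis by simp
qed

text \<open>For \<open>t > 0\<close> the polynomial \<open>x\<^sup>2 (P - P')\<close> is the chain rule for \<open>x = 1 / t\<close>. At \<open>t = 0\<close> the difference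
  quotient is again of the form polynomial times exponential and tends to \<open>0\<close>.\<close>

lemma expinv_derivative:
  "(expinv P has_real_derivative expinv ([:0, 0, 1:] * (P - pderiv P)) t) (at t)"
proof -
  consider "t < 0" | "t = 0" | "t > 0" by linarith
  then show ?thesis
  proof cases
    case 1
    have "((\<lambda>t. 0) has_real_derivative 0) (at t)" by simp
    then have "(expinv P has_real_derivative 0) (at t)"
      by (rule has_field_derivative_transform_within_open[of _ _ _ "{..<0}"])
        (use 1 in \<open>auto simp: expinv_def\<close>)
    then show ?thesis using 1 by (simp add: expinv_def)
  next
    case 2
    have "((\<lambda>h. expinv P h / h) \<longlongrightarrow> 0) (at 0)"
    proof (rule filterlim_split_at)
      have "eventually (\<lambda>h. 0 = expinv P h / h) (at_left 0)"
        by (auto simp: expinv_def eventually_at_filter)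
      then show "((\<lambda>h. expinv P h / h) \<longlongrightarrow> 0) (at_left 0)"
        by (rule Lim_transform_eventually[OF tendsto_const])
    next
      have "((\<lambda>h. poly ([:0, 1:] * P) (inverse h) * exp (- inverse h)) \<longlongrightarrow> 0) (at_right 0)"
        by (rule filterlim_compose[OF poly_times_exp_tendsto_0 filterlim_inverse_at_top_right])
      moreover have "eventually (\<lambda>h. poly ([:0, 1:] * P) (inverse h) * exp (- inverse h) = expinv P h / h) (at_right 0)"
        by (auto simp: expinv_def eventually_at_filter field_simps)
      ultimately show "((\<lambda>h. expinv P h / h) \<longlongrightarrow> 0) (at_right 0)"
        by (rule Lim_transform_eventually)
    qed
    then show ?thesis using 2 by (simp add: has_field_derivative_iff expinv_def)
  next
    case 3
    have "((\<lambda>t. poly P (1 / t) * exp (- (1 / t))) has_real_derivative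
        poly ([:0, 0, 1:] * (P - pderiv P)) (1 / t) * exp (- (1 / t))) (at t)"
      using 3 by (auto intro!: derivative_eq_intros poly_DERIV[THEN DERIV_chain2] simp: field_simps power2_eq_square)
    then have "(expinv P has_real_derivative
        poly ([:0, 0, 1:] * (P - pderiv P)) (1 / t) * exp (- (1 / t))) (at t)"
      by (rule has_field_derivative_transform_within_open[of _ _ _ "{0<..}"])
        (use 3 in \<open>auto simp: expinv_def\<close>)
    then show ?thesis using 3 by (simp add: expinv_def)
  qed
qed

lemma smooth_fun_expinv:
  assumes "smooth_fun q"
  shows "smooth_fun (\<lambda>x. expinv 1 (q x))"
proof -
  define h where "h j = expinv (((\<lambda>P. [:0, 0, 1:] * (P - pderiv P)) ^^ j) 1)" for j
  have "smooth_fun (\<lambda>x. h 0 (q x))"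
    by (rule smooth_fun_compose[OF _ assms]) (use expinv_derivative in \<open>simp add: h_def\<close>)
  then show ?thesis by (simp add: h_def)
qed

lemma smooth_fun_one_minus_exp:
  assumes "smooth_fun q"
  shows "smooth_fun (\<lambda>x. 1 - exp (- q x))"
proof -
  define h where "h j t = (if j = 0 then 1 - exp (- t) else (-1) ^ (j + 1) * exp (- t))" for j :: nat and t :: real
  have "smooth_fun (\<lambda>x. h 0 (q x))"
  proof (rule smooth_fun_compose[OF _ assms])
    show "(h j has_real_derivative h (Suc j) t) (at t)" for j t
      by (cases j) (auto simp: h_def[abs_def] intro!: derivative_eq_intros)
  qed
  then show ?thesis by (simp add: h_def)
qed

definition bump :: "'a::euclidean_space \<Rightarrow> real \<Rightarrow> 'a \<Rightarrow> real" where
  "bump c \<rho> x = expinv 1 (\<rho>\<^sup>2 - (x - c) \<bullet> (x - c))"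

lemma smooth_fun_bump: "smooth_fun (bump c \<rho>)"
proof -
  have "smooth_fun (\<lambda>x. \<rho>\<^sup>2 + (-1) * ((x - c) \<bullet> (x - c)))"
    using Ck_add[OF Ck_const Ck_mult[OF Ck_const Ck_dist_square]] unfolding smooth_fun_def by blast
  from smooth_fun_expinv[OF this] show ?thesis by (simp add: bump_def[abs_def])
qed

lemma bump_nonneg: "0 \<le> bump c \<rho> x"
  by (simp add: bump_def expinv_def)

lemma bump_pos_iff:
  assumes "\<rho> > 0"
  shows "bump c \<rho> x > 0 \<longleftrightarrow> x \<in> ball c \<rho>"
proof -
  have "(x - c) \<bullet> (x - c) < \<rho>\<^sup>2 \<longleftrightarrow> norm (x - c) < \<rho>"
    using assms by (simp add: norm_lt_square)
  then show ?thesis by (auto simp: bump_def expinv_def dist_norm norm_minus_commute)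
qed

section \<open>Test functions\<close>

lemma test_fun_continuous: "f \<in> test_fun \<Omega> \<Longrightarrow> continuous_on UNIV f"
  by (simp add: test_fun_def smooth_fun_continuous)

lemma test_fun_borel: "f \<in> test_fun \<Omega> \<Longrightarrow> f \<in> borel_measurable borel"
  by (intro borel_measurable_continuous_onI test_fun_continuous)

lemma test_fun_zero: "f \<in> test_fun \<Omega> \<Longrightarrow> x \<notin> \<Omega> \<Longrightarrow> f x = 0"
  using closure_subset[of "{x. f x \<noteq> 0}"] by (auto simp: test_fun_def)

lemma continuous_compact_support_bounded:
  fixes f :: "'a::euclidean_space \<Rightarrow> real"
  assumes "continuous_on UNIV f" "compact K" "{x. f x \<noteq> 0} \<subseteq> K"
  obtains C where "C \<ge> 0" "\<And>x. \<bar>f x\<bar> \<le> C"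
proof -
  have "compact (f ` K)" using assms by (meson compact_continuous_image continuous_on_subset subset_UNIV)
  then obtain B where B: "B > 0" "\<And>x. x \<in> K \<Longrightarrow> \<bar>f x\<bar> \<le> B"
    using compact_imp_bounded bounded_pos by (metis image_eqI real_norm_def)
  have "\<bar>f x\<bar> \<le> B" for x
    using B assms(3) by (cases "f x = 0") auto
  with B that show thesis by (meson less_imp_le)
qed

lemma test_fun_bounded:
  assumes "f \<in> test_fun \<Omega>"
  obtains C where "C \<ge> 0" "\<And>x. \<bar>f x\<bar> \<le> C"
proof -
  have "compact (closure {x. f x \<noteq> 0})" using assms by (simp add: test_fun_def)
  from continuous_compact_support_bounded[OF test_fun_continuous[OF assms] this closure_subset] that
  show thesis by metis
qed

lemma test_fun_linear:
  assumes "f \<in> test_fun \<Omega>" "g \<in> test_fun \<Omega>"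
  shows "(\<lambda>x. a * f x + b * g x) \<in> test_fun \<Omega>"
proof -
  let ?S = "closure {x. f x \<noteq> 0} \<union> closure {x. g x \<noteq> 0}"
  have S: "compact ?S" "?S \<subseteq> \<Omega>" using assms by (auto simp: test_fun_def)
  have sub: "closure {x. a * f x + b * g x \<noteq> 0} \<subseteq> ?S"
  proof (rule closure_minimal)
    have "{x. a * f x + b * g x \<noteq> 0} \<subseteq> {x. f x \<noteq> 0} \<union> {x. g x \<noteq> 0}" by auto
    also have "\<dots> \<subseteq> ?S" by (intro Un_mono closure_subset)
    finally show "{x. a * f x + b * g x \<noteq> 0} \<subseteq> ?S" .
  qed (rule compact_imp_closed[OF S(1)])
  have "compact (closure {x. a * f x + b * g x \<noteq> 0})"
    using compact_Int_closed[OF S(1) closed_closure] sub by (metis Int_absorb1)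
  moreover have "smooth_fun (\<lambda>x. a * f x + b * g x)"
    using assms by (intro smooth_fun_add smooth_fun_cmult) (auto simp: test_fun_def)
  ultimately show ?thesis using sub S(2) by (auto simp: test_fun_def)
qed

lemma test_fun_zero_fun: "(\<lambda>x. 0) \<in> test_fun \<Omega>"
  by (simp add: test_fun_def smooth_fun_def Ck_const)

text \<open>Urysohn functions: a finite sum \<open>b\<close> of bumps is bounded below on \<open>K\<close>, so
  \<open>1 - exp (- n b)\<close> is close to \<open>1\<close> on \<open>K\<close> for large \<open>n\<close>, and it has the support of \<open>b\<close>.\<close>

lemma test_fun_Urysohn:
  fixes K U :: "'a::euclidean_space set"
  assumes K: "compact K" "K \<subseteq> U" and U: "open U" "U \<subseteq> \<Omega>" and e: "e > 0"
  obtains \<eta> where "\<eta> \<in> test_fun \<Omega>" "\<And>x. 0 \<le> \<eta> x" "\<And>x. \<eta> x \<le> 1"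
    "\<And>x. x \<notin> U \<Longrightarrow> \<eta> x = 0" "\<And>x. x \<in> K \<Longrightarrow> 1 - e \<le> \<eta> x"
proof (cases "K = {}")
  case True
  with that[of "\<lambda>x. 0"] test_fun_zero_fun show ?thesis by auto
next
  case False
  have "\<exists>\<rho>>0. cball x \<rho> \<subseteq> U" if "x \<in> K" for x
    using K U that open_contains_cball by blast
  then obtain \<rho> where \<rho>: "\<And>x. x \<in> K \<Longrightarrow> \<rho> x > 0 \<and> cball x (\<rho> x) \<subseteq> U" by metis
  have "K \<subseteq> (\<Union>x\<in>K. ball x (\<rho> x))" using \<rho> by force
  then obtain T where T: "T \<subseteq> K" "finite T" "K \<subseteq> (\<Union>x\<in>T. ball x (\<rho> x))"
    using compactE_image[OF K(1), of K "\<lambda>x. ball x (\<rho> x)"] by auto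
  define b where "b x = (\<Sum>c\<in>T. bump c (\<rho> c) x)" for x
  have sb: "smooth_fun b" unfolding b_def[abs_def] by (intro smooth_fun_sum smooth_fun_bump)
  have b0: "0 \<le> b x" for x unfolding b_def by (intro sum_nonneg bump_nonneg)
  have bK: "b x > 0" if x: "x \<in> K" for x
  proof -
    obtain c where "c \<in> T" "x \<in> ball c (\<rho> c)" using T x by blast
    then show ?thesis unfolding b_def
      using T \<rho> by (intro sum_pos2[of T c]) (auto simp: bump_pos_iff bump_nonneg)
  qed
  have bsupp: "{x. b x \<noteq> 0} \<subseteq> (\<Union>c\<in>T. cball c (\<rho> c))"
  proof
    fix x assume "x \<in> {x. b x \<noteq> 0}"
    then obtain c where c: "c \<in> T" "bump c (\<rho> c) x \<noteq> 0"
      unfolding b_def by (metis (mono_tags, lifting) mem_Collect_eq sum.neutral)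
    then have "bump c (\<rho> c) x > 0" using bump_nonneg[of c "\<rho> c" x] by linarith
    moreover have "\<rho> c > 0" using \<rho> T c by blast
    ultimately have "x \<in> ball c (\<rho> c)" by (simp add: bump_pos_iff)
    with c show "x \<in> (\<Union>c\<in>T. cball c (\<rho> c))" by force
  qed
  have comp: "compact (\<Union>c\<in>T. cball c (\<rho> c))" using T by (intro compact_UN) auto
  have sub: "(\<Union>c\<in>T. cball c (\<rho> c)) \<subseteq> U" using T \<rho> by blast
  obtain x0 where x0: "x0 \<in> K" "\<And>x. x \<in> K \<Longrightarrow> b x0 \<le> b x"
    using continuous_attains_inf[OF K(1) False, of b] smooth_fun_continuous[OF sb]
    by (meson continuous_on_subset subset_UNIV)
  define n where "n = - ln e / b x0"
  define m where "m = max n 0"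
  define \<eta> where "\<eta> x = 1 - exp (- (m * b x))" for x
  have m: "m \<ge> 0" by (simp add: m_def)
  have "\<eta> \<in> test_fun \<Omega>"
  proof -
    have "smooth_fun \<eta>" unfolding \<eta>_def[abs_def] by (intro smooth_fun_one_minus_exp smooth_fun_cmult sb)
    moreover have cl: "closure {x. \<eta> x \<noteq> 0} \<subseteq> (\<Union>c\<in>T. cball c (\<rho> c))"
    proof (rule closure_minimal)
      show "{x. \<eta> x \<noteq> 0} \<subseteq> (\<Union>c\<in>T. cball c (\<rho> c))"
        using bsupp by (auto simp: \<eta>_def)
    qed (use comp compact_imp_closed in blast)
    moreover have "compact (closure {x. \<eta> x \<noteq> 0})"
      using compact_Int_closed[OF comp closed_closure, of "{x. \<eta> x \<noteq> 0}"] cl by (simp add: Int_absorb1)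
    ultimately show ?thesis using sub U by (auto simp: test_fun_def)
  qed
  moreover have "0 \<le> \<eta> x" "\<eta> x \<le> 1" for x using m b0[of x] by (auto simp: \<eta>_def)
  moreover have "\<eta> x = 0" if "x \<notin> U" for x
    using that bsupp sub by (auto simp: \<eta>_def)
  moreover have "1 - e \<le> \<eta> x" if "x \<in> K" for x
  proof -
    have "- ln e = n * b x0" using bK[OF x0(1)] by (simp add: n_def)
    also have "\<dots> \<le> m * b x0" using b0[of x0] by (intro mult_right_mono) (auto simp: m_def)
    also have "\<dots> \<le> m * b x" using m x0(2)[OF that] by (intro mult_left_mono)
    finally have "- (m * b x) \<le> ln e" by simp
    then have "exp (- (m * b x)) \<le> e" using e by (metis exp_le_cancel_iff exp_ln)
    then show ?thesis by (simp add: \<eta>_def)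
  qed
  ultimately show ?thesis using that by blast
qed

subsection \<open>Approximation by test functions\<close>

lemma lebesgue_on_borel:
  "f \<in> borel_measurable borel \<Longrightarrow> f \<in> borel_measurable (lebesgue_on \<Omega>)"
  by (intro measurable_restrict_space1 measurable_completion) simp

lemma test_fun_measurable: "f \<in> test_fun \<Omega> \<Longrightarrow> f \<in> borel_measurable (lebesgue_on \<Omega>)"
  by (intro lebesgue_on_borel test_fun_borel)

lemma finite_measure_lebesgue_on_open:
  assumes "open \<Omega>" "bounded \<Omega>"
  shows "finite_measure (lebesgue_on \<Omega>)"
  using assms by (intro finite_measure_lebesgue_on lmeasurable_open)

text \<open>Regularity of Lebesgue measure encloses \<open>E\<close> between a compact set and an open set, and a Urysohn
  function for them is close to the indicator in \<open>L\<^sup>1\<close>; a subsequence converges almost everywhere.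
  Bounded almost-everywhere convergence serves all exponents \<open>p\<close> at once.\<close>

lemma indicator_test_fun_approx:
  fixes \<Omega> :: "'a::euclidean_space set"
  assumes \<Omega>: "open \<Omega>" "bounded \<Omega>" and E: "E \<in> sets (lebesgue_on \<Omega>)"
  obtains \<eta> where "\<And>n::nat. \<eta> n \<in> test_fun \<Omega>" "\<And>n x. \<bar>\<eta> n x\<bar> \<le> 1"
    "AE x in lebesgue_on \<Omega>. (\<lambda>n. \<eta> n x) \<longlonglongrightarrow> indicat_real E x"
proof -
  let ?M = "lebesgue_on \<Omega>"
  interpret finite_measure ?M using \<Omega> by (rule finite_measure_lebesgue_on_open)
  have \<Omega>L: "\<Omega> \<in> sets lebesgue" using \<Omega> by simp
  have EL: "E \<in> sets lebesgue" "E \<subseteq> \<Omega>"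
    using E \<Omega>L by (auto simp: sets_restrict_space_iff)
  have ex: "\<exists>\<eta>. \<eta> \<in> test_fun \<Omega> \<and> (\<forall>x. \<bar>\<eta> x\<bar> \<le> 1) \<and>
      (\<integral>x. \<bar>\<eta> x - indicat_real E x\<bar> \<partial>?M) \<le> e * (3 + measure ?M (space ?M))" if e: "e > 0" for e :: real
  proof -
    obtain U where U: "open U" "E \<subseteq> U" "U - E \<in> lmeasurable" "emeasure lebesgue (U - E) < ennreal e"
      using sets_lebesgue_outer_open[OF EL(1) e] by blast
    obtain K where K: "closed K" "K \<subseteq> E" "E - K \<in> lmeasurable" "emeasure lebesgue (E - K) < ennreal e"
      using sets_lebesgue_inner_closed[OF EL(1) e] by blast
    have "bounded K" using K(2) EL(2) \<Omega>(2) by (meson bounded_subset order_trans)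
    then have cK: "compact K" using K(1) by (simp add: compact_eq_bounded_closed)
    have KU: "K \<subseteq> U \<inter> \<Omega>" "open (U \<inter> \<Omega>)" "U \<inter> \<Omega> \<subseteq> \<Omega>"
      using K(2) U(1,2) EL(2) \<Omega>(1) by auto
    obtain \<eta> where \<eta>: "\<eta> \<in> test_fun \<Omega>" "\<And>x. 0 \<le> \<eta> x" "\<And>x. \<eta> x \<le> 1"
        "\<And>x. x \<notin> U \<inter> \<Omega> \<Longrightarrow> \<eta> x = 0" "\<And>x. x \<in> K \<Longrightarrow> 1 - e \<le> \<eta> x"
      by (rule test_fun_Urysohn[OF cK KU e]) blast
    note [measurable] = test_fun_measurable[OF \<eta>(1)] E
    have meas: "measure lebesgue (U - E) \<le> e" "measure lebesgue (E - K) \<le> e"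
      using U(4) K(4) e by (simp_all add: measure_def enn2real_leI less_imp_le)
    have sets: "(U - E) \<inter> \<Omega> \<in> sets ?M" "E - K \<in> sets ?M"
      using U(3) K(2,3) EL \<Omega>L by (auto simp: sets_restrict_space_iff fmeasurable_def)
    have m1: "measure ?M ((U - E) \<inter> \<Omega>) \<le> e"
    proof -
      have "measure ?M ((U - E) \<inter> \<Omega>) = measure lebesgue ((U - E) \<inter> \<Omega>)"
        using \<Omega>L by (subst measure_restrict_space) auto
      also have "\<dots> \<le> measure lebesgue (U - E)"
        using U(3) \<Omega>L by (intro measure_mono_fmeasurable) (auto simp: fmeasurable_def)
      finally show ?thesis using meas by simp
    qed
    have m2: "measure ?M (E - K) \<le> e"
      using \<Omega>L EL meas by (subst measure_restrict_space) auto
    have ii: "integrable ?M (indicat_real ((U - E) \<inter> \<Omega>))" "integrable ?M (indicat_real (E - K))"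
      using sets by (auto intro!: integrable_real_indicator simp: less_top[symmetric])
    have "\<bar>\<eta> x - indicat_real E x\<bar> \<le> indicat_real ((U - E) \<inter> \<Omega>) x + indicat_real (E - K) x + e" for x
      using \<eta>(2)[of x] \<eta>(3)[of x] \<eta>(4)[of x] \<eta>(5)[of x] U(2) K(2) EL(2) e
      by (auto simp: indicator_def)
    then have "(\<integral>x. \<bar>\<eta> x - indicat_real E x\<bar> \<partial>?M) \<le>
        (\<integral>x. indicat_real ((U - E) \<inter> \<Omega>) x + indicat_real (E - K) x + e \<partial>?M)"
      using ii e by (intro integral_mono' Bochner_Integration.integrable_add) (auto intro!: add_nonneg_nonneg)
    also have "\<dots> = measure ?M ((U - E) \<inter> \<Omega>) + measure ?M (E - K) + e * measure ?M (space ?M)"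
      using sets[THEN sets.sets_into_space] ii by (simp add: Int_absorb2 mult.commute)
    also have "\<dots> \<le> e * (3 + measure ?M (space ?M))"
      using m1 m2 e by (simp add: algebra_simps)
    finally show ?thesis using \<eta> by (intro exI[of _ \<eta>]) (auto simp: abs_le_iff intro: order_trans)
  qed
  have "\<forall>n. \<exists>\<eta>. \<eta> \<in> test_fun \<Omega> \<and> (\<forall>x. \<bar>\<eta> x\<bar> \<le> 1) \<and>
      (\<integral>x. \<bar>\<eta> x - indicat_real E x\<bar> \<partial>?M) \<le> inverse (real (Suc n)) * (3 + measure ?M (space ?M))"
    by (intro allI ex) simp
  then obtain \<eta> where \<eta>: "\<And>n. \<eta> n \<in> test_fun \<Omega>" "\<And>n x. \<bar>\<eta> n x\<bar> \<le> 1"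
      "\<And>n. (\<integral>x. \<bar>\<eta> n x - indicat_real E x\<bar> \<partial>?M) \<le> inverse (real (Suc n)) * (3 + measure ?M (space ?M))"
    by metis
  note [measurable] = test_fun_measurable[OF \<eta>(1)] E
  have "(\<lambda>n. (\<integral>x. norm (\<eta> n x - indicat_real E x) \<partial>?M)) \<longlonglongrightarrow> 0"
  proof (rule tendsto_sandwich[OF always_eventually always_eventually tendsto_const])
    show "(\<lambda>n. inverse (real (Suc n)) * (3 + measure ?M (space ?M))) \<longlonglongrightarrow> 0"
      by (intro tendsto_mult_left_zero LIMSEQ_inverse_real_of_nat)
  qed (use \<eta>(3) in auto)
  moreover have "integrable ?M (\<lambda>x. \<eta> n x - indicat_real E x)" for n
    by (rule integrable_const_bound[where B = 2])
      (use \<eta>(2) in \<open>auto intro!: AE_I2 order_trans[OF abs_triangle_ineq4] simp: indicator_def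
        intro: order_trans[OF \<eta>(2)]\<close>)
  ultimately obtain k :: "nat \<Rightarrow> nat" where "AE x in ?M. (\<lambda>n. \<eta> (k n) x - indicat_real E x) \<longlonglongrightarrow> 0"
    using tendsto_L1_AE_subseq[of ?M "\<lambda>n x. \<eta> n x - indicat_real E x"] by blast
  then have "AE x in ?M. (\<lambda>n. \<eta> (k n) x) \<longlonglongrightarrow> indicat_real E x"
    by eventually_elim (simp add: LIM_zero_iff)
  then show ?thesis using \<eta> by (intro that[of "\<lambda>n. \<eta> (k n)"])
qed

lemma simple_function_test_fun_approx:
  fixes \<Omega> :: "'a::euclidean_space set" and c :: "'i \<Rightarrow> real"
  assumes \<Omega>: "open \<Omega>" "bounded \<Omega>" and "finite I" and "\<And>i. i \<in> I \<Longrightarrow> A i \<in> sets (lebesgue_on \<Omega>)"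
  shows "\<exists>\<eta> B. (\<forall>n::nat. \<eta> n \<in> test_fun \<Omega>) \<and> (\<forall>n x. \<bar>\<eta> n x\<bar> \<le> B) \<and>
    (AE x in lebesgue_on \<Omega>. (\<lambda>n. \<eta> n x) \<longlonglongrightarrow> (\<Sum>i\<in>I. c i * indicat_real (A i) x))"
  using assms(3,4)
proof (induction I rule: finite_induct)
  case empty
  then show ?case
    by (intro exI[of _ "\<lambda>n x. 0"] exI[of _ 0]) (auto simp: test_fun_zero_fun)
next
  case (insert i I)
  from insert.IH[OF insert.prems[OF insertI2]]
  obtain \<eta> B where \<eta>: "\<And>n::nat. \<eta> n \<in> test_fun \<Omega>" "\<And>n x. \<bar>\<eta> n x\<bar> \<le> B"
      "AE x in lebesgue_on \<Omega>. (\<lambda>n. \<eta> n x) \<longlonglongrightarrow> (\<Sum>i\<in>I. c i * indicat_real (A i) x)"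
    by blast
  obtain \<theta> where \<theta>: "\<And>n::nat. \<theta> n \<in> test_fun \<Omega>" "\<And>n x. \<bar>\<theta> n x\<bar> \<le> 1"
      "AE x in lebesgue_on \<Omega>. (\<lambda>n. \<theta> n x) \<longlonglongrightarrow> indicat_real (A i) x"
    using indicator_test_fun_approx[OF \<Omega>, of "A i"] insert.prems by blast
  have "\<bar>c i * \<theta> n x + 1 * \<eta> n x\<bar> \<le> \<bar>c i\<bar> + B" for n x
    using \<eta>(2)[of n x] \<theta>(2)[of n x] mult_left_mono[OF \<theta>(2)[of n x], of "\<bar>c i\<bar>"]
      abs_triangle_ineq[of "c i * \<theta> n x" "\<eta> n x"] by (simp add: abs_mult)
  moreover have "AE x in lebesgue_on \<Omega>. (\<lambda>n. c i * \<theta> n x + 1 * \<eta> n x) \<longlonglongrightarrow>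
      (\<Sum>i\<in>insert i I. c i * indicat_real (A i) x)"
    using \<eta>(3) \<theta>(3)
  proof eventually_elim
    case (elim x)
    then show ?case
      using tendsto_add[OF tendsto_mult_left[OF elim(2), of "c i"] elim(1)]
      unfolding sum.insert[OF insert.hyps] by simp
  qed
  ultimately show ?case
    by (intro exI[of _ "\<lambda>n x. c i * \<theta> n x + 1 * \<eta> n x"] exI[of _ "\<bar>c i\<bar> + B"] conjI allI
        test_fun_linear[OF \<theta>(1) \<eta>(1)])
qed

lemma LIMSEQ_ex_less:
  fixes e :: real
  assumes "X \<longlonglongrightarrow> 0" "e > 0"
  shows "\<exists>n. X n < e"
  using order_tendstoD(2)[OF assms] by (auto simp: eventually_sequentially)

lemma Lnorm_tendsto_0_dominated:
  assumes f: "\<And>n. f n \<in> borel_measurable M" and b: "\<And>n. AE x in M. \<bar>f n x\<bar> \<le> w x"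
    and w: "integrable M (\<lambda>x. w x powr p)" and lim: "AE x in M. (\<lambda>n. f n x) \<longlonglongrightarrow> 0" and p: "1 \<le> p"
  shows "(\<lambda>n. Lnorm M (ereal p) (f n)) \<longlonglongrightarrow> 0"
proof -
  have "(\<lambda>n. \<integral>x. \<bar>f n x\<bar> powr p \<partial>M) \<longlonglongrightarrow> (\<integral>x. 0 \<partial>M)"
  proof (rule integral_dominated_convergence[OF _ _ w])
    show "AE x in M. (\<lambda>n. \<bar>f n x\<bar> powr p) \<longlonglongrightarrow> 0"
      using lim
    proof eventually_elim
      case (elim x)
      have "(\<lambda>n. \<bar>f n x\<bar> powr p) \<longlonglongrightarrow> \<bar>0\<bar> powr p"
        using elim p by (intro tendsto_powr' tendsto_rabs) auto
      then show ?case using p by simp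
    qed
    show "AE x in M. norm (\<bar>f n x\<bar> powr p) \<le> w x powr p" for n
      using b[of n] by eventually_elim (use p in \<open>auto intro!: powr_mono2\<close>)
  qed (use f in measurable)
  then have "(\<lambda>n. (\<integral>x. \<bar>f n x\<bar> powr p \<partial>M) powr (1 / p)) \<longlonglongrightarrow> 0 powr (1 / p)"
    using p by (intro tendsto_powr') (auto intro: always_eventually)
  then show ?thesis by (simp add: Lnorm_ereal)
qed

text \<open>A simple function close to \<open>f\<close> is approximated by test functions boundedly and almost everywhere, and
  hence in \<open>L\<^sup>p\<close> by dominated convergence.\<close>

lemma test_fun_dense:
  fixes \<Omega> :: "'a::euclidean_space set"
  assumes \<Omega>: "open \<Omega>" "bounded \<Omega>" and f: "f \<in> Lspace (lebesgue_on \<Omega>) (ereal p)" and p: "1 \<le> p" and e: "e > 0"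
  obtains \<psi> where "\<psi> \<in> test_fun \<Omega>" "Lnorm (lebesgue_on \<Omega>) (ereal p) (\<lambda>x. f x - \<psi> x) < e"
proof -
  let ?M = "lebesgue_on \<Omega>"
  interpret finite_measure ?M using \<Omega> by (rule finite_measure_lebesgue_on_open)
  have fm[measurable]: "f \<in> borel_measurable ?M" and fi: "integrable ?M (\<lambda>x. \<bar>f x\<bar> powr p)"
    using f by (auto simp: Lspace_ereal)
  obtain S where S: "\<And>i. simple_function ?M (S i)" "\<And>x. x \<in> space ?M \<Longrightarrow> (\<lambda>i. S i x) \<longlonglongrightarrow> f x"
      "\<And>i x. x \<in> space ?M \<Longrightarrow> dist (S i x) 0 \<le> 2 * dist (f x) 0"
    using borel_measurable_implies_sequence_metric[OF fm, of 0] by blast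
  have Sm: "S i \<in> borel_measurable ?M" for i using S(1) by (rule borel_measurable_simple_function)
  have "(\<lambda>i. Lnorm ?M (ereal p) (\<lambda>x. f x - S i x)) \<longlonglongrightarrow> 0"
  proof (rule Lnorm_tendsto_0_dominated[where w = "\<lambda>x. 3 * \<bar>f x\<bar>", OF _ _ _ _ p])
    show "AE x in ?M. \<bar>f x - S i x\<bar> \<le> 3 * \<bar>f x\<bar>" for i
      using S(3)[of _ i] abs_triangle_ineq4 by (intro AE_I2) (smt (verit) dist_norm diff_0_right real_norm_def)
    show "integrable ?M (\<lambda>x. (3 * \<bar>f x\<bar>) powr p)" using fi by (simp add: powr_mult)
    show "AE x in ?M. (\<lambda>i. f x - S i x) \<longlonglongrightarrow> 0"
      using S(2) by (intro AE_I2 tendsto_eq_intros) auto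
  qed (use Sm in measurable)
  then obtain i where i: "Lnorm ?M (ereal p) (\<lambda>x. f x - S i x) < e / 2"
    using LIMSEQ_ex_less[of _ "e / 2"] e by auto
  define A where "A y = S i -` {y} \<inter> space ?M" for y
  have fin: "finite (S i ` space ?M)" using S(1)[of i] by (simp add: simple_function_def)
  have A: "A y \<in> sets ?M" for y
    unfolding A_def by (rule measurable_sets[OF Sm]) simp
  have rep: "S i x = (\<Sum>y\<in>S i ` space ?M. y * indicat_real (A y) x)" if "x \<in> space ?M" for x
  proof -
    have "(\<Sum>y\<in>S i ` space ?M. y * indicat_real (A y) x) = (\<Sum>y\<in>S i ` space ?M. if y = S i x then y else 0)"
      using that by (intro sum.cong) (auto simp: A_def indicator_def)
    also have "\<dots> = S i x" using fin that by (simp add: sum.delta)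
    finally show ?thesis by simp
  qed
  obtain \<eta> B where \<eta>: "\<And>n::nat. \<eta> n \<in> test_fun \<Omega>" "\<And>n x. \<bar>\<eta> n x\<bar> \<le> B"
      "AE x in ?M. (\<lambda>n. \<eta> n x) \<longlonglongrightarrow> (\<Sum>y\<in>S i ` space ?M. y * indicat_real (A y) x)"
    using simple_function_test_fun_approx[OF \<Omega> fin, of A "\<lambda>y. y"] A by blast
  note [measurable] = test_fun_measurable[OF \<eta>(1)] Sm
  obtain D where D: "\<And>x. x \<in> space ?M \<Longrightarrow> \<bar>S i x\<bar> \<le> D"
    using fin by (metis (no_types, opaque_lifting) finite_imp_bounded bounded_real image_eqI)
  have "(\<lambda>n. Lnorm ?M (ereal p) (\<lambda>x. S i x - \<eta> n x)) \<longlonglongrightarrow> 0"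
  proof (rule Lnorm_tendsto_0_dominated[where w = "\<lambda>x. D + B", OF _ _ _ _ p])
    show "AE x in ?M. \<bar>S i x - \<eta> n x\<bar> \<le> D + B" for n
    proof (rule AE_I2)
      fix x assume "x \<in> space ?M"
      from D[OF this] \<eta>(2)[of n x] show "\<bar>S i x - \<eta> n x\<bar> \<le> D + B" by linarith
    qed
    show "AE x in ?M. (\<lambda>n. S i x - \<eta> n x) \<longlonglongrightarrow> 0"
      using \<eta>(3) AE_space
    proof eventually_elim
      case (elim x)
      have "(\<lambda>n. S i x - \<eta> n x) \<longlonglongrightarrow> S i x - S i x"
        using elim rep[OF elim(2)] by (intro tendsto_intros) simp
      then show ?case by simp
    qed
  qed measurable
  then obtain n where n: "Lnorm ?M (ereal p) (\<lambda>x. S i x - \<eta> n x) < e / 2"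
    using LIMSEQ_ex_less[of _ "e / 2"] e by auto
  have SL: "S i \<in> Lspace ?M (ereal p)"
    using D p by (intro Lspace_bounded[where C = D]) auto
  have \<eta>L: "\<eta> n \<in> Lspace ?M (ereal p)"
    using \<eta>(2) p by (intro Lspace_bounded[where C = B]) auto
  have "Lnorm ?M (ereal p) (\<lambda>x. f x - \<eta> n x) \<le>
      Lnorm ?M (ereal p) (\<lambda>x. f x - S i x) + Lnorm ?M (ereal p) (\<lambda>x. S i x - \<eta> n x)"
    using Lnorm_triangle[OF Lspace_diff[OF f SL p] Lspace_diff[OF SL \<eta>L p] p] by simp
  also have "\<dots> < e" using i n by simp
  finally show ?thesis using \<eta>(1) that by blast
qed

lemma test_fun_dense_sequence:
  fixes \<Omega> :: "'a::euclidean_space set"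
  assumes \<Omega>: "open \<Omega>" "bounded \<Omega>" and f: "f \<in> Lspace (lebesgue_on \<Omega>) (ereal p)" and p: "1 \<le> p"
  obtains \<psi> where "\<And>n::nat. \<psi> n \<in> test_fun \<Omega>"
    "(\<lambda>n. Lnorm (lebesgue_on \<Omega>) (ereal p) (\<lambda>x. f x - \<psi> n x)) \<longlonglongrightarrow> 0"
proof -
  have "\<forall>n. \<exists>\<psi>. \<psi> \<in> test_fun \<Omega> \<and> Lnorm (lebesgue_on \<Omega>) (ereal p) (\<lambda>x. f x - \<psi> x) < inverse (real (Suc n))"
    using test_fun_dense[OF \<Omega> f p] by (metis inverse_positive_iff_positive of_nat_0_less_iff zero_less_Suc)
  then obtain \<psi> where \<psi>: "\<And>n. \<psi> n \<in> test_fun \<Omega>"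
      "\<And>n. Lnorm (lebesgue_on \<Omega>) (ereal p) (\<lambda>x. f x - \<psi> n x) < inverse (real (Suc n))"
    by metis
  have "(\<lambda>n. Lnorm (lebesgue_on \<Omega>) (ereal p) (\<lambda>x. f x - \<psi> n x)) \<longlonglongrightarrow> 0"
    by (rule tendsto_sandwich[OF always_eventually always_eventually tendsto_const LIMSEQ_inverse_real_of_nat])
      (use \<psi>(2) in \<open>auto simp: Lnorm_nonneg less_imp_le\<close>)
  with \<psi>(1) that show ?thesis by blast
qed

text \<open>Test functions approximate indicators boundedly and almost everywhere, so the integrals of \<open>f\<close> over all
  measurable sets vanish; the sets \<open>{f > 0}\<close> and \<open>{f < 0}\<close> then have measure \<open>0\<close>.\<close>

lemma fundamental_lemma_calculus_of_variations:
  fixes \<Omega> :: "'a::euclidean_space set"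
  assumes \<Omega>: "open \<Omega>" "bounded \<Omega>" and f: "integrable (lebesgue_on \<Omega>) f"
    and zero: "\<And>\<eta>. \<eta> \<in> test_fun \<Omega> \<Longrightarrow> (\<integral>x. f x * \<eta> x \<partial>lebesgue_on \<Omega>) = 0"
  shows "AE x in lebesgue_on \<Omega>. f x = 0"
proof -
  let ?M = "lebesgue_on \<Omega>"
  have fm[measurable]: "f \<in> borel_measurable ?M" using f by simp
  have set0: "(\<integral>x. f x * indicat_real E x \<partial>?M) = 0" if E[measurable]: "E \<in> sets ?M" for E
  proof -
    obtain \<eta> where \<eta>: "\<And>n::nat. \<eta> n \<in> test_fun \<Omega>" "\<And>n x. \<bar>\<eta> n x\<bar> \<le> 1"
        "AE x in ?M. (\<lambda>n. \<eta> n x) \<longlonglongrightarrow> indicat_real E x"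
      using indicator_test_fun_approx[OF \<Omega> E] by blast
    note [measurable] = test_fun_measurable[OF \<eta>(1)]
    have "(\<lambda>n. \<integral>x. f x * \<eta> n x \<partial>?M) \<longlonglongrightarrow> (\<integral>x. f x * indicat_real E x \<partial>?M)"
    proof (rule integral_dominated_convergence[where w = "\<lambda>x. \<bar>f x\<bar>"])
      show "AE x in ?M. (\<lambda>n. f x * \<eta> n x) \<longlonglongrightarrow> f x * indicat_real E x"
        using \<eta>(3) by eventually_elim (intro tendsto_intros)
      show "AE x in ?M. norm (f x * \<eta> n x) \<le> \<bar>f x\<bar>" for n
        using \<eta>(2) by (intro AE_I2) (simp add: abs_mult mult_left_le)
    qed (use f in auto)
    then have "(\<lambda>n. 0 :: real) \<longlonglongrightarrow> (\<integral>x. f x * indicat_real E x \<partial>?M)"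
      using zero[OF \<eta>(1)] by simp
    then show ?thesis by (simp add: LIMSEQ_const_iff)
  qed
  have pos: "AE x in ?M. g x * indicat_real {x\<in>space ?M. 0 < g x} x = 0"
    if g: "integrable ?M g" and "\<And>E. E \<in> sets ?M \<Longrightarrow> (\<integral>x. g x * indicat_real E x \<partial>?M) = 0" for g
  proof -
    have [measurable]: "g \<in> borel_measurable ?M" using g by simp
    have P: "{x\<in>space ?M. 0 < g x} \<in> sets ?M" by measurable
    then have "(\<integral>x. g x * indicat_real {x\<in>space ?M. 0 < g x} x \<partial>?M) = 0" by (rule that(2))
    moreover have "integrable ?M (\<lambda>x. g x * indicat_real {x\<in>space ?M. 0 < g x} x)"
      using P g by (rule integrable_real_mult_indicator)
    ultimately show ?thesis
      by (subst (asm) integral_nonneg_eq_0_iff_AE) (auto simp: indicator_def)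
  qed
  have "AE x in ?M. f x * indicat_real {x\<in>space ?M. 0 < f x} x = 0"
    by (rule pos[OF f set0])
  moreover have "AE x in ?M. - f x * indicat_real {x\<in>space ?M. 0 < - f x} x = 0"
    by (rule pos) (use f set0 in auto)
  ultimately show ?thesis using AE_space
    by eventually_elim (auto simp: indicator_def split: if_splits)
qed

section \<open>Quadratic minimisation\<close>

text \<open>The elements of \<open>V\<close> are functions, not equivalence classes, so \<open>B\<close> vanishes on functions that are zero
  almost everywhere and completeness refers to a seminorm.\<close>

locale complete_form =
  fixes V :: "('b \<Rightarrow> real) set" and B :: "('b \<Rightarrow> real) \<Rightarrow> ('b \<Rightarrow> real) \<Rightarrow> real"
  assumes V_lin: "\<And>u v a b. u \<in> V \<Longrightarrow> v \<in> V \<Longrightarrow> (\<lambda>x. a * u x + b * v x) \<in> V"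
    and V_ne: "V \<noteq> {}"
    and B_lin: "\<And>u v w a b. u \<in> V \<Longrightarrow> v \<in> V \<Longrightarrow> w \<in> V \<Longrightarrow> B (\<lambda>x. a * u x + b * v x) w = a * B u w + b * B v w"
    and B_sym: "\<And>u v. B u v = B v u"
    and B_nonneg: "\<And>u. u \<in> V \<Longrightarrow> 0 \<le> B u u"
    and B_complete: "\<And>u. (\<And>n::nat. u n \<in> V) \<Longrightarrow>
      (\<And>e. e > 0 \<Longrightarrow> \<exists>K. \<forall>m\<ge>K. \<forall>n\<ge>K. B (\<lambda>x. u m x - u n x) (\<lambda>x. u m x - u n x) < e) \<Longrightarrow>
      \<exists>v\<in>V. (\<lambda>n. B (\<lambda>x. u n x - v x) (\<lambda>x. u n x - v x)) \<longlonglongrightarrow> 0"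
begin

lemma V_diff: "u \<in> V \<Longrightarrow> v \<in> V \<Longrightarrow> (\<lambda>x. u x - v x) \<in> V"
  using V_lin[of u v 1 "-1"] by simp

lemma B_diff: "u \<in> V \<Longrightarrow> v \<in> V \<Longrightarrow> w \<in> V \<Longrightarrow> B (\<lambda>x. u x - v x) w = B u w - B v w"
  using B_lin[of u v w 1 "-1"] by simp

lemma B_lin_square:
  assumes "u \<in> V" "v \<in> V"
  shows "B (\<lambda>x. a * u x + b * v x) (\<lambda>x. a * u x + b * v x) = a\<^sup>2 * B u u + 2 * a * b * B u v + b\<^sup>2 * B v v"
proof -
  let ?w = "\<lambda>x. a * u x + b * v x"
  have "B ?w ?w = a * B u ?w + b * B v ?w" by (rule B_lin[OF assms V_lin[OF assms]])
  also have "B u ?w = a * B u u + b * B u v"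
    unfolding B_sym[of u ?w] B_sym[of u v] by (rule B_lin[OF assms assms(1)])
  also have "B v ?w = a * B u v + b * B v v"
    unfolding B_sym[of v ?w] by (rule B_lin[OF assms assms(2)])
  finally show ?thesis unfolding power2_eq_square by algebra
qed

lemma B_Cauchy_Schwarz:
  assumes "u \<in> V" "v \<in> V"
  shows "(B u v)\<^sup>2 \<le> B u u * B v v"
proof -
  have nn: "0 \<le> a\<^sup>2 * B u u + 2 * a * b * B u v + b\<^sup>2 * B v v" for a b
    using B_nonneg[OF V_lin[OF assms, of a b]] B_lin_square[OF assms, of a b] by simp
  show ?thesis
  proof (cases "B v v = 0")
    case True
    have "B u v = 0"
    proof (rule ccontr)
      assume ne: "B u v \<noteq> 0"
      have "0 \<le> B u u + 2 * (- (B u u + 1) / (2 * B u v)) * B u v"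
        using nn[of 1 "- (B u u + 1) / (2 * B u v)"] True by simp
      then show False using ne by (simp add: field_simps)
    qed
    then show ?thesis using True by simp
  next
    case False
    then have pos: "B v v > 0" using B_nonneg[OF assms(2)] by simp
    have "0 \<le> (B v v)\<^sup>2 * B u u + 2 * B v v * (- B u v) * B u v + (- B u v)\<^sup>2 * B v v"
      by (rule nn)
    also have "\<dots> = B v v * (B u u * B v v - (B u v)\<^sup>2)" by (simp add: power2_eq_square algebra_simps)
    finally have *: "0 \<le> B v v * (B u u * B v v - (B u v)\<^sup>2)" .
    show ?thesis
    proof (rule ccontr)
      assume "\<not> ?thesis"
      then have "B v v * (B u u * B v v - (B u v)\<^sup>2) < 0" using pos by (intro mult_pos_neg) auto
      with * show False by simp
    qed
  qed
qed

text \<open>The Riesz representation theorem. A minimising sequence of \<open>B w w - 2 L w\<close> is Cauchy by the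
  parallelogram law, and comparing its members with small multiples of \<open>w\<close> added gives the
  Euler--Lagrange equation in the limit.\<close>

lemma Riesz_representation:
  assumes L_lin: "\<And>u v a b. u \<in> V \<Longrightarrow> v \<in> V \<Longrightarrow> L (\<lambda>x. a * u x + b * v x) = a * L u + b * L v"
    and L_bound: "\<And>u. u \<in> V \<Longrightarrow> (L u)\<^sup>2 \<le> C * B u u" and C: "0 \<le> C"
  shows "\<exists>u\<in>V. \<forall>w\<in>V. B u w = L w"
proof -
  define J where "J w = B w w - 2 * L w" for w
  have Jlow: "- C \<le> J w" if "w \<in> V" for w
  proof -
    have "0 \<le> (B w w - C)\<^sup>2" by simp
    then have "4 * (C * B w w) \<le> (B w w + C)\<^sup>2" by (simp add: power2_eq_square algebra_simps)
    then have "(2 * L w)\<^sup>2 \<le> (B w w + C)\<^sup>2" using L_bound[OF that] by (simp add: power_mult_distrib)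
    then have "2 * L w \<le> B w w + C"
      using B_nonneg[OF that] C by (meson add_nonneg_nonneg power2_le_imp_le)
    then show ?thesis by (simp add: J_def)
  qed
  define d where "d = Inf (J ` V)"
  have bdd: "bdd_below (J ` V)" using Jlow by (intro bdd_belowI2)
  have d: "d \<le> J w" if "w \<in> V" for w using bdd that by (auto simp: d_def intro: cInf_lower)
  have "\<exists>u\<in>V. J u < d + inverse (real (Suc n))" for n
    using cInf_lessD[of "J ` V" "d + inverse (real (Suc n))"] V_ne by (auto simp: d_def)
  then obtain u where uV: "\<And>n. u n \<in> V" and uJ: "\<And>n. J (u n) < d + inverse (real (Suc n))"
    by metis
  have para: "B (\<lambda>x. u m x - u n x) (\<lambda>x. u m x - u n x) \<le> 2 * inverse (real (Suc m)) + 2 * inverse (real (Suc n))"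
    for m n
  proof -
    define h where "h x = 1/2 * u m x + 1/2 * u n x" for x
    have h: "h \<in> V" unfolding h_def[abs_def] by (rule V_lin[OF uV uV])
    have "B (\<lambda>x. u m x - u n x) (\<lambda>x. u m x - u n x) = B (u m) (u m) - 2 * B (u m) (u n) + B (u n) (u n)"
      using B_lin_square[OF uV uV, of 1 m "-1" n] by simp
    moreover have "B h h = 1/4 * B (u m) (u m) + 1/2 * B (u m) (u n) + 1/4 * B (u n) (u n)"
      unfolding h_def[abs_def] B_lin_square[OF uV uV] by (simp add: power2_eq_square)
    moreover have "L h = 1/2 * L (u m) + 1/2 * L (u n)"
      unfolding h_def[abs_def] by (rule L_lin[OF uV uV])
    ultimately show ?thesis
      using uJ[of m] uJ[of n] d[OF h] unfolding J_def by linarith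
  qed
  have "\<exists>v\<in>V. (\<lambda>n. B (\<lambda>x. u n x - v x) (\<lambda>x. u n x - v x)) \<longlonglongrightarrow> 0"
  proof (rule B_complete[OF uV])
    fix e :: real assume "e > 0"
    then obtain K where K: "inverse (real (Suc K)) < e / 4" using reals_Archimedean[of "e / 4"] by auto
    have "B (\<lambda>x. u m x - u n x) (\<lambda>x. u m x - u n x) < e" if "m \<ge> K" "n \<ge> K" for m n
    proof -
      have "inverse (real (Suc m)) \<le> inverse (real (Suc K))" "inverse (real (Suc n)) \<le> inverse (real (Suc K))"
        using that by (auto intro: le_imp_inverse_le)
      with para[of m n] K show ?thesis by linarith
    qed
    then show "\<exists>K. \<forall>m\<ge>K. \<forall>n\<ge>K. B (\<lambda>x. u m x - u n x) (\<lambda>x. u m x - u n x) < e" by blast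
  qed
  then obtain v where vV: "v \<in> V" and lim: "(\<lambda>n. B (\<lambda>x. u n x - v x) (\<lambda>x. u n x - v x)) \<longlonglongrightarrow> 0"
    by blast
  have "B v w = L w" if w: "w \<in> V" for w
  proof -
    have "(\<lambda>n. sqrt (B (\<lambda>x. u n x - v x) (\<lambda>x. u n x - v x) * B w w)) \<longlonglongrightarrow> sqrt (0 * B w w)"
      using lim by (intro tendsto_intros)
    then have sq: "(\<lambda>n. sqrt (B (\<lambda>x. u n x - v x) (\<lambda>x. u n x - v x) * B w w)) \<longlonglongrightarrow> 0"
      by simp
    have le: "norm (B (u n) w - B v w) \<le> sqrt (B (\<lambda>x. u n x - v x) (\<lambda>x. u n x - v x) * B w w)" for n
      using B_Cauchy_Schwarz[OF V_diff[OF uV vV] w, of n]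
      unfolding B_diff[OF uV vV w] by (intro real_le_rsqrt) simp
    have "(\<lambda>n. B (u n) w - B v w) \<longlonglongrightarrow> 0"
      by (rule Lim_null_comparison[OF always_eventually[OF allI[OF le]] sq])
    then have Bn: "(\<lambda>n. B (u n) w) \<longlonglongrightarrow> B v w" by (simp add: LIM_zero_iff)
    define D where "D = B v w - L w"
    have "0 \<le> 2 * t * D + t\<^sup>2 * B w w" for t
    proof -
      have "(\<lambda>n. inverse (real (Suc n)) + 2 * t * (B (u n) w - L w) + t\<^sup>2 * B w w)
          \<longlonglongrightarrow> 0 + 2 * t * (B v w - L w) + t\<^sup>2 * B w w"
        by (intro tendsto_intros LIMSEQ_inverse_real_of_nat Bn)
      moreover have "0 \<le> inverse (real (Suc n)) + 2 * t * (B (u n) w - L w) + t\<^sup>2 * B w w" for n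
        using d[OF V_lin[OF uV w, of 1 n t]] uJ[of n] B_lin_square[OF uV w, of 1 n t] L_lin[OF uV w, of 1 n t]
        unfolding J_def by (simp add: algebra_simps)
      ultimately show ?thesis unfolding D_def by (auto dest: LIMSEQ_le_const)
    qed
    note quad = this
    \<comment> \<open>The quadratic polynomial in \<open>t\<close> is negative at \<open>t = - D e\<close> unless \<open>D = 0\<close>.\<close>
    define e where "e = 1 / (B w w + 1)"
    have e: "e > 0" "e * B w w = 1 - e"
      using B_nonneg[OF w] by (auto simp: e_def field_simps)
    have "2 * (- (D * e)) * D + (- (D * e))\<^sup>2 * B w w = D\<^sup>2 * (e * (e * B w w) - 2 * e)"
      unfolding power2_eq_square by algebra
    also have "\<dots> = - (D\<^sup>2 * (e + e\<^sup>2))" unfolding e(2) power2_eq_square by algebra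
    finally have "D\<^sup>2 * (e + e\<^sup>2) \<le> 0" using quad[of "- (D * e)"] by simp
    moreover have "e + e\<^sup>2 > 0" using e(1) by (simp add: add_pos_pos)
    ultimately have "D = 0" by (simp add: mult_le_0_iff)
    then show ?thesis by (simp add: D_def)
  qed
  with vV show ?thesis by blast
qed

end

section \<open>The energy space\<close>

text \<open>The integrand of the Gagliardo form. The energy integrates it over the product of Lebesgue-Borel measures,
  where Tonelli's and Fubini's theorems apply directly.\<close>

definition gagl :: "real \<Rightarrow> ('a::euclidean_space \<Rightarrow> real) \<Rightarrow> ('a \<Rightarrow> real) \<Rightarrow> 'a \<times> 'a \<Rightarrow> real" where
  "gagl s u v p = (u (fst p) - u (snd p)) * (v (fst p) - v (snd p)) /
     norm (fst p - snd p) powr (real DIM('a) + 2 * s)"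

definition energy :: "real \<Rightarrow> ('a::euclidean_space \<Rightarrow> real) \<Rightarrow> ('a \<Rightarrow> real) \<Rightarrow> real" where
  "energy s u v = (\<integral>p. gagl s u v p \<partial>(lborel \<Otimes>\<^sub>M lborel))"

lemma gagl_measurable [measurable]:
  assumes [measurable]: "u \<in> borel_measurable borel" "v \<in> borel_measurable borel"
  shows "gagl s u v \<in> borel_measurable (lborel \<Otimes>\<^sub>M lborel)"
  unfolding gagl_def[abs_def] by measurable

lemma gagl_nonneg: "0 \<le> gagl s u u p"
  by (simp add: gagl_def)

lemma gagl_sym: "gagl s u v = gagl s v u"
  by (auto simp: gagl_def mult.commute)

lemma gagl_lin: "gagl s (\<lambda>x. a * u x + b * v x) w p = a * gagl s u w p + b * gagl s v w p"
  by (simp add: gagl_def divide_inverse algebra_simps)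

lemma gagl_abs_le: "\<bar>gagl s u v p\<bar> \<le> gagl s u u p + gagl s v v p"
proof -
  have *: "\<bar>a * b\<bar> \<le> a * a + b * b" for a b :: real
  proof -
    have "2 * \<bar>a * b\<bar> \<le> a * a + b * b"
      using sum_squares_bound[of "\<bar>a\<bar>" "\<bar>b\<bar>"] by (simp add: abs_mult power2_eq_square mult.assoc)
    then show ?thesis using abs_ge_zero[of "a * b"] by linarith
  qed
  show ?thesis
    unfolding gagl_def by (simp add: abs_divide add_divide_distrib[symmetric] divide_right_mono *)
qed

lemma AE_pair_lborel:
  assumes "AE x in lborel. P (x :: 'a::euclidean_space)"
  shows "AE p in lborel \<Otimes>\<^sub>M lborel. P (fst p) \<and> P (snd p)"
proof -
  obtain N where N: "{x. \<not> P x} \<subseteq> N" "N \<in> null_sets lborel"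
    using assms by (auto elim!: AE_E2 simp: eventually_ae_filter)
  have "N \<times> UNIV \<union> UNIV \<times> N \<in> null_sets (lborel \<Otimes>\<^sub>M lborel)"
    using N(2) by (intro null_sets.Un lborel.times_in_null_sets1 lborel.times_in_null_sets2) auto
  then show ?thesis by (rule AE_I') (use N(1) in auto)
qed

locale bounded_open_set =
  fixes s N :: real and \<Omega> :: "'a::euclidean_space set"
  assumes N_eq: "N = real DIM('a)" and s_pos: "0 < s" and s_less: "s < 1" and dim: "2 * s < N"
    and open_\<Omega>: "open \<Omega>" and bounded_\<Omega>: "bounded \<Omega>"
begin

abbreviation M :: "'a measure" where "M \<equiv> lebesgue_on \<Omega>"

sublocale M: finite_measure M
  using open_\<Omega> bounded_\<Omega> by (rule finite_measure_lebesgue_on_open)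

lemma \<Omega>_lebesgue: "\<Omega> \<in> sets lebesgue"
  using open_\<Omega> by simp

lemma \<Omega>_borel [measurable]: "\<Omega> \<in> sets borel"
  using open_\<Omega> by simp

text \<open>Every element of \<open>X0 s \<Omega>\<close> has a Borel representative that vanishes everywhere outside
  \<open>\<Omega>\<close>. These representatives avoid null sets in Fubini arguments.\<close>

definition V :: "('a \<Rightarrow> real) set" where
  "V = {u \<in> borel_measurable borel. (\<forall>x. x \<notin> \<Omega> \<longrightarrow> u x = 0) \<and>
     integrable lborel (\<lambda>x. (u x)\<^sup>2) \<and> integrable (lborel \<Otimes>\<^sub>M lborel) (gagl s u u)}"

lemma V_borel [measurable_dest]: "u \<in> V \<Longrightarrow> u \<in> borel_measurable borel"
  by (simp add: V_def)

lemma V_zero: "u \<in> V \<Longrightarrow> x \<notin> \<Omega> \<Longrightarrow> u x = 0"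
  by (simp add: V_def)

lemma V_measurable: "u \<in> V \<Longrightarrow> u \<in> borel_measurable M"
  by (intro lebesgue_on_borel V_borel)

lemma integrable_gagl:
  assumes "u \<in> V" "v \<in> V"
  shows "integrable (lborel \<Otimes>\<^sub>M lborel) (gagl s u v)"
proof (rule Bochner_Integration.integrable_bound)
  show "integrable (lborel \<Otimes>\<^sub>M lborel) (\<lambda>p. gagl s u u p + gagl s v v p)"
    using assms by (auto simp: V_def)
  show "gagl s u v \<in> borel_measurable (lborel \<Otimes>\<^sub>M lborel)"
    using assms by (intro gagl_measurable V_borel)
  show "AE p in lborel \<Otimes>\<^sub>M lborel. norm (gagl s u v p) \<le> norm (gagl s u u p + gagl s v v p)"
    by (intro AE_I2) (metis abs_ge_self gagl_abs_le order_trans real_norm_def)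
qed

lemma V_lin:
  assumes "u \<in> V" "v \<in> V"
  shows "(\<lambda>x. a * u x + b * v x) \<in> V"
proof -
  let ?w = "\<lambda>x. a * u x + b * v x"
  note [measurable] = assms[THEN V_borel]
  have ui: "integrable lborel (\<lambda>x. (u x)\<^sup>2)" and vi: "integrable lborel (\<lambda>x. (v x)\<^sup>2)"
    using assms by (auto simp: V_def)
  have "integrable lborel (\<lambda>x. (?w x)\<^sup>2)"
  proof (rule Bochner_Integration.integrable_bound)
    show "integrable lborel (\<lambda>x. 2 * a\<^sup>2 * (u x)\<^sup>2 + 2 * b\<^sup>2 * (v x)\<^sup>2)" using ui vi by simp
    have "(c + d)\<^sup>2 \<le> 2 * c\<^sup>2 + 2 * d\<^sup>2" for c d :: real
      using sum_squares_bound[of c d] by (simp add: power2_eq_square algebra_simps)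
    from this[of "a * u _" "b * v _"]
    show "AE x in lborel. norm ((?w x)\<^sup>2) \<le> norm (2 * a\<^sup>2 * (u x)\<^sup>2 + 2 * b\<^sup>2 * (v x)\<^sup>2)"
      by (intro AE_I2) (simp add: power_mult_distrib mult.assoc)
  qed measurable
  moreover have "gagl s ?w ?w p = a\<^sup>2 * gagl s u u p + 2 * a * b * gagl s u v p + b\<^sup>2 * gagl s v v p" for p
    unfolding gagl_lin gagl_sym[of s u ?w] gagl_sym[of s v ?w] gagl_sym[of s v u]
    by (simp add: power2_eq_square algebra_simps)
  then have "integrable (lborel \<Otimes>\<^sub>M lborel) (gagl s ?w ?w)"
    using integrable_gagl assms by (subst Bochner_Integration.integrable_cong[OF refl]) auto
  ultimately show ?thesis using assms by (auto simp: V_def)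
qed

lemma V_diff: "u \<in> V \<Longrightarrow> v \<in> V \<Longrightarrow> (\<lambda>x. u x - v x) \<in> V"
  using V_lin[of u v 1 "-1"] by simp

lemma V_zero_fun: "(\<lambda>x. 0) \<in> V"
  by (simp add: V_def gagl_def[abs_def])

lemma energy_lin:
  assumes "u \<in> V" "v \<in> V" "w \<in> V"
  shows "energy s (\<lambda>x. a * u x + b * v x) w = a * energy s u w + b * energy s v w"
  unfolding energy_def gagl_lin using assms by (simp add: integrable_gagl)

lemma energy_sym: "energy s u v = energy s v u"
  by (simp add: energy_def gagl_sym)

lemma energy_nonneg: "0 \<le> energy s u u"
  by (simp add: energy_def gagl_nonneg)

lemma nn_integral_gagl: "u \<in> V \<Longrightarrow> (\<integral>\<^sup>+p. ennreal (gagl s u u p) \<partial>(lborel \<Otimes>\<^sub>M lborel)) = ennreal (energy s u u)"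
  unfolding energy_def by (intro nn_integral_eq_integral integrable_gagl) (auto simp: gagl_nonneg)

lemma V_cong_AE:
  assumes u: "u \<in> V" and v: "v \<in> borel_measurable borel" "\<And>x. x \<notin> \<Omega> \<Longrightarrow> v x = 0" and eq: "AE x in lborel. u x = v x"
  shows "v \<in> V" and "w \<in> V \<Longrightarrow> energy s v w = energy s u w"
proof -
  note [measurable] = V_borel[OF u] v(1)
  note AE_pair_lborel[OF eq]
  then have eqv: "AE p in lborel \<Otimes>\<^sub>M lborel. gagl s v v p = gagl s u u p"
    by eventually_elim (simp add: gagl_def)
  have "integrable (lborel \<Otimes>\<^sub>M lborel) (gagl s v v)"
    using eqv integrable_gagl[OF u u] by (subst integrable_cong_AE[where g = "gagl s u u"]) measurable
  moreover have "integrable lborel (\<lambda>x. (v x)\<^sup>2)"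
  proof -
    have "AE x in lborel. (v x)\<^sup>2 = (u x)\<^sup>2" using eq by eventually_elim simp
    then show ?thesis using u
      by (subst integrable_cong_AE[where g = "\<lambda>x. (u x)\<^sup>2"]) (auto simp: V_def)
  qed
  ultimately show "v \<in> V" using v by (simp add: V_def)
  assume w: "w \<in> V"
  note [measurable] = V_borel[OF w]
  have "AE p in lborel \<Otimes>\<^sub>M lborel. gagl s v w p = gagl s u w p"
    using AE_pair_lborel[OF eq] by eventually_elim (simp add: gagl_def)
  then show "energy s v w = energy s u w"
    unfolding energy_def by (intro integral_cong_AE) measurable
qed

text \<open>The energy sees only the increments of \<open>u\<close>, which a Lipschitz function enlarges at most by its
  constant. This supplies all the nonlinear test functions below: level cuts, truncations and, for
  bounded \<open>u\<close>, powers.\<close>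

lemma V_contraction:
  assumes u: "u \<in> V" and h: "h \<in> borel_measurable borel" "h 0 = 0" and L: "0 \<le> L"
    and lip: "\<And>x y. \<bar>h (u x) - h (u y)\<bar> \<le> L * \<bar>u x - u y\<bar>"
  shows "(\<lambda>x. h (u x)) \<in> V"
proof -
  note [measurable] = V_borel[OF u] h(1)
  have sq: "(h (u x) - h (u y))\<^sup>2 \<le> L\<^sup>2 * (u x - u y)\<^sup>2" for x y
    using power_mono[OF lip[of x y], of 2] by (simp add: power_mult_distrib)
  have "integrable (lborel \<Otimes>\<^sub>M lborel) (gagl s (\<lambda>x. h (u x)) (\<lambda>x. h (u x)))"
  proof (rule Bochner_Integration.integrable_bound)
    show "integrable (lborel \<Otimes>\<^sub>M lborel) (\<lambda>p. L\<^sup>2 * gagl s u u p)" using integrable_gagl[OF u u] by simp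
    show "AE p in lborel \<Otimes>\<^sub>M lborel. norm (gagl s (\<lambda>x. h (u x)) (\<lambda>x. h (u x)) p) \<le> norm (L\<^sup>2 * gagl s u u p)"
      using sq by (intro AE_I2) (simp add: gagl_def power2_eq_square[symmetric] divide_right_mono)
  qed measurable
  moreover have "integrable lborel (\<lambda>x. (h (u x))\<^sup>2)"
  proof (rule Bochner_Integration.integrable_bound)
    show "integrable lborel (\<lambda>x. L\<^sup>2 * (u x)\<^sup>2)" using u by (simp add: V_def)
    obtain y where y: "y \<notin> \<Omega>"
      using bounded_\<Omega> not_bounded_UNIV by (metis UNIV_eq_I)
    have "(h (u x))\<^sup>2 \<le> L\<^sup>2 * (u x)\<^sup>2" for x
      using sq[of x y] V_zero[OF u y] h(2) by simp
    then show "AE x in lborel. norm ((h (u x))\<^sup>2) \<le> norm (L\<^sup>2 * (u x)\<^sup>2)" by simp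
  qed measurable
  ultimately show ?thesis using V_zero[OF u] h(2) by (simp add: V_def)
qed

lemma M_lborel:
  fixes f :: "'a \<Rightarrow> real"
  assumes f: "f \<in> borel_measurable borel" and z: "\<And>x. x \<notin> \<Omega> \<Longrightarrow> f x = 0"
  shows "integrable M f \<longleftrightarrow> integrable lborel f" and "(\<integral>x. f x \<partial>M) = (\<integral>x. f x \<partial>lborel)"
proof -
  have eq: "(\<lambda>x. indicator \<Omega> x *\<^sub>R f x) = f" by (rule ext) (use z in \<open>auto simp: indicator_def\<close>)
  have fm: "f \<in> borel_measurable lborel" using f by simp
  show "integrable M f \<longleftrightarrow> integrable lborel f"
    by (subst integrable_restrict_space) (use \<Omega>_lebesgue in simp, simp only: eq integrable_completion[OF fm])
  show "(\<integral>x. f x \<partial>M) = (\<integral>x. f x \<partial>lborel)"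
    by (subst integral_restrict_space) (use \<Omega>_lebesgue in simp, simp only: eq integral_completion[OF fm])
qed

lemma AE_M_lborel:
  assumes "\<And>x. x \<notin> \<Omega> \<Longrightarrow> P x"
  shows "(AE x in M. P x) \<longleftrightarrow> (AE x in lborel. P x)"
proof -
  have "(AE x in M. P x) \<longleftrightarrow> (AE x in lebesgue. x \<in> \<Omega> \<longrightarrow> P x)"
    using \<Omega>_lebesgue by (intro AE_restrict_space_iff) simp
  also have "\<dots> \<longleftrightarrow> (AE x in lebesgue. P x)"
    using assms by (intro AE_cong) auto
  finally show ?thesis by (simp add: AE_completion_iff)
qed

lemma V_L2:
  assumes "u \<in> V"
  shows "u \<in> Lspace M (ereal 2)" and "(Lnorm M (ereal 2) u)\<^sup>2 = (\<integral>x. (u x)\<^sup>2 \<partial>lborel)"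
proof -
  note [measurable] = V_borel[OF assms]
  have eq: "\<bar>t\<bar> powr 2 = t\<^sup>2" for t :: real by simp
  have "integrable M (\<lambda>x. (u x)\<^sup>2)" and i: "(\<integral>x. (u x)\<^sup>2 \<partial>M) = (\<integral>x. (u x)\<^sup>2 \<partial>lborel)"
    using assms M_lborel[of "\<lambda>x. (u x)\<^sup>2"] by (auto simp: V_def)
  then show "u \<in> Lspace M (ereal 2)"
    using V_measurable[OF assms] by (simp add: Lspace_ereal eq)
  have "(Lnorm M (ereal 2) u) powr 2 = (\<integral>x. (u x)\<^sup>2 \<partial>lborel)"
    by (subst Lnorm_powr) (simp_all add: eq i)
  then show "(Lnorm M (ereal 2) u)\<^sup>2 = (\<integral>x. (u x)\<^sup>2 \<partial>lborel)"
    using Lnorm_nonneg[of M 2 u] by simp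
qed

text \<open>The Poincare inequality holds because every point of \<open>\<Omega>\<close> is at bounded distance from a
  unit ball outside \<open>\<Omega>\<close>, on which functions of \<open>V\<close> vanish.\<close>

lemma Poincare:
  obtains C where "C > 0" "\<And>u. u \<in> V \<Longrightarrow> (\<integral>x. (u x)\<^sup>2 \<partial>lborel) \<le> C * energy s u u"
proof -
  obtain R where R: "R > 0" "\<And>x. x \<in> \<Omega> \<Longrightarrow> norm x \<le> R"
    using bounded_\<Omega> by (auto simp: bounded_pos)
  obtain e :: 'a where e: "norm e = 1" using vector_choose_size[of 1] by auto
  define z where "z = (R + 1) *\<^sub>R e"
  have nz: "norm z = R + 1" using e R by (simp add: z_def)
  define D where "D = 2 * R + 2"
  define \<kappa> where "\<kappa> = D powr (real DIM('a) + 2 * s)"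
  have D: "D > 0" and \<kappa>: "\<kappa> > 0" using R by (auto simp: D_def \<kappa>_def)
  have out: "y \<notin> \<Omega>" if "y \<in> ball z 1" for y
  proof
    assume "y \<in> \<Omega>"
    then have "norm y \<le> R" by (rule R)
    moreover have "norm z \<le> norm y + dist z y" by (metis dist_norm norm_triangle_sub)
    ultimately show False using that nz by simp
  qed
  have dist: "norm (x - y) \<le> D" if "x \<in> \<Omega>" "y \<in> ball z 1" for x y
  proof -
    have "norm y \<le> norm z + dist z y" by (metis dist_commute dist_norm norm_triangle_sub)
    then show ?thesis using R(2)[OF that(1)] that(2) nz norm_triangle_ineq4[of x y] by (simp add: D_def)
  qed
  define b where "b = unit_ball_vol (real DIM('a))"
  have b: "b > 0" by (simp add: b_def)
  have bm: "emeasure lborel (ball z 1) = ennreal b" by (simp add: emeasure_ball b_def)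
  have "(\<integral>x. (u x)\<^sup>2 \<partial>lborel) \<le> \<kappa> / b * energy s u u" if u: "u \<in> V" for u
  proof -
    note [measurable] = V_borel[OF u]
    have ui: "integrable lborel (\<lambda>x. (u x)\<^sup>2)" using u by (simp add: V_def)
    have pt: "(u x)\<^sup>2 / \<kappa> * indicat_real (ball z 1) y \<le> gagl s u u (x, y)" for x y
    proof (cases "x \<in> \<Omega> \<and> y \<in> ball z 1")
      case True
      then have uy: "u y = 0" using out V_zero[OF u] by blast
      have ne: "x \<noteq> y" using True out by blast
      have "norm (x - y) powr (real DIM('a) + 2 * s) \<le> \<kappa>"
        unfolding \<kappa>_def using True dist s_pos by (intro powr_mono2) auto
      then show ?thesis using True uy ne
        using \<kappa> by (auto simp: gagl_def power2_eq_square intro!: divide_left_mono mult_pos_pos)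
    next
      case False
      then show ?thesis
        using V_zero[OF u] gagl_nonneg[of s u "(x, y)"] by (auto simp: indicator_def)
    qed
    have "ennreal ((\<integral>x. (u x)\<^sup>2 \<partial>lborel) * (b / \<kappa>)) = (\<integral>\<^sup>+x. ennreal ((u x)\<^sup>2) \<partial>lborel) * ennreal (b / \<kappa>)"
      using ui b \<kappa> by (subst ennreal_mult) (auto simp: nn_integral_eq_integral)
    also have "\<dots> = (\<integral>\<^sup>+x. (\<integral>\<^sup>+y. ennreal ((u x)\<^sup>2 / \<kappa> * indicat_real (ball z 1) y) \<partial>lborel) \<partial>lborel)"
    proof -
      have "(\<integral>\<^sup>+y. ennreal ((u x)\<^sup>2 / \<kappa> * indicat_real (ball z 1) y) \<partial>lborel) = ennreal ((u x)\<^sup>2) * ennreal (b / \<kappa>)" for x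
      proof -
        have "(\<integral>\<^sup>+y. ennreal ((u x)\<^sup>2 / \<kappa> * indicat_real (ball z 1) y) \<partial>lborel) =
            (\<integral>\<^sup>+y. ennreal ((u x)\<^sup>2 / \<kappa>) * indicator (ball z 1) y \<partial>lborel)"
          by (intro nn_integral_cong) (auto simp: indicator_def)
        also have "\<dots> = ennreal ((u x)\<^sup>2 / \<kappa>) * ennreal b"
          by (subst nn_integral_cmult_indicator) (auto simp: bm)
        also have "\<dots> = ennreal ((u x)\<^sup>2) * ennreal (b / \<kappa>)"
          using b \<kappa> by (simp add: ennreal_mult'[symmetric])
        finally show ?thesis .
      qed
      then show ?thesis by (simp add: nn_integral_multc)
    qed
    also have "\<dots> \<le> (\<integral>\<^sup>+x. (\<integral>\<^sup>+y. ennreal (gagl s u u (x, y)) \<partial>lborel) \<partial>lborel)"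
      by (intro nn_integral_mono ennreal_leI pt)
    also have "\<dots> = (\<integral>\<^sup>+p. ennreal (gagl s u u p) \<partial>(lborel \<Otimes>\<^sub>M lborel))"
      by (rule lborel.nn_integral_fst) measurable
    also have "\<dots> = ennreal (energy s u u)" by (rule nn_integral_gagl[OF u])
    finally have "(\<integral>x. (u x)\<^sup>2 \<partial>lborel) * (b / \<kappa>) \<le> energy s u u" by (simp add: energy_nonneg)
    then show ?thesis using b \<kappa> by (simp add: field_simps)
  qed
  moreover have "\<kappa> / b > 0" using b \<kappa> by simp
  ultimately show ?thesis using that by blast
qed

text \<open>The Borel function is obtained from the extension of \<open>g\<close> by zero, and it is reset to zero
  outside \<open>\<Omega>\<close> because Lebesgue and Borel versions may differ on a null set there.\<close>

lemma borel_representative: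
  fixes g :: "'a \<Rightarrow> real"
  assumes "g \<in> borel_measurable M"
  obtains u where "u \<in> borel_measurable borel" "\<And>x. x \<notin> \<Omega> \<Longrightarrow> u x = 0" "AE x in M. u x = g x"
proof -
  have "(\<lambda>x. if x \<in> \<Omega> then g x else 0) \<in> borel_measurable lebesgue"
    using assms \<Omega>_lebesgue by (rule borel_measurable_if_I)
  then obtain g' where g': "g' \<in> borel_measurable lborel" "AE x in lborel. (if x \<in> \<Omega> then g x else 0) = g' x"
    using completion_ex_borel_measurable_real by blast
  define u where "u x = (if x \<in> \<Omega> then g' x else 0)" for x
  have "AE x in lborel. x \<in> \<Omega> \<longrightarrow> u x = g x"
    using g'(2) by eventually_elim (auto simp: u_def split: if_splits)
  then have "AE x in M. x \<in> \<Omega> \<longrightarrow> u x = g x" by (subst AE_M_lborel) auto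
  then have "AE x in M. u x = g x" using AE_space by eventually_elim simp
  moreover have "u \<in> borel_measurable borel" unfolding u_def[abs_def] using g'(1) by measurable
  ultimately show ?thesis using that[of u] by (simp add: u_def)
qed

text \<open>By the Poincare inequality a Cauchy sequence for the energy converges in \<open>L\<^sup>2\<close>, and along a subsequence
  almost everywhere. Fatou's lemma for the Gagliardo integrands bounds the energy distance to the limit.\<close>

lemma V_complete:
  assumes uV: "\<And>n::nat. u n \<in> V"
    and cauchy: "\<And>e. e > 0 \<Longrightarrow> \<exists>K. \<forall>m\<ge>K. \<forall>n\<ge>K. energy s (\<lambda>x. u m x - u n x) (\<lambda>x. u m x - u n x) < e"
  shows "\<exists>v\<in>V. (\<lambda>n. energy s (\<lambda>x. u n x - v x) (\<lambda>x. u n x - v x)) \<longlonglongrightarrow> 0"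
proof -
  obtain C where C: "C > 0" "\<And>u. u \<in> V \<Longrightarrow> (\<integral>x. (u x)\<^sup>2 \<partial>lborel) \<le> C * energy s u u"
    using Poincare by blast
  have L2: "u n \<in> Lspace M (ereal 2)" for n by (rule V_L2(1)[OF uV])
  have "\<exists>K. \<forall>m\<ge>K. \<forall>n\<ge>K. Lnorm M (ereal 2) (\<lambda>x. u m x - u n x) < e" if e: "e > 0" for e
  proof -
    obtain K where K: "\<And>m n. m \<ge> K \<Longrightarrow> n \<ge> K \<Longrightarrow> energy s (\<lambda>x. u m x - u n x) (\<lambda>x. u m x - u n x) < e\<^sup>2 / C"
      using cauchy[of "e\<^sup>2 / C"] e C by auto
    have "Lnorm M (ereal 2) (\<lambda>x. u m x - u n x) < e" if mn: "m \<ge> K" "n \<ge> K" for m n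
    proof -
      have "(Lnorm M (ereal 2) (\<lambda>x. u m x - u n x))\<^sup>2 \<le> C * energy s (\<lambda>x. u m x - u n x) (\<lambda>x. u m x - u n x)"
        using C(2)[OF V_diff[OF uV uV]] V_L2(2)[OF V_diff[OF uV uV]] by simp
      also have "\<dots> < e\<^sup>2" using K[OF mn] C(1) by (simp add: field_simps)
      finally show ?thesis using e by (simp add: power2_less_imp_less)
    qed
    then show ?thesis by blast
  qed
  then obtain g k where g: "g \<in> Lspace M (ereal 2)" "strict_mono (k :: nat \<Rightarrow> nat)" "AE x in M. (\<lambda>n. u (k n) x) \<longlonglongrightarrow> g x"
      "(\<lambda>n. Lnorm M (ereal 2) (\<lambda>x. u n x - g x)) \<longlonglongrightarrow> 0"
    using M.Lspace_complete[where f = u, OF L2 one_le_numeral] by blast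
  have gm: "g \<in> borel_measurable M" using g(1) by (simp add: Lspace_ereal)
  from borel_representative[OF gm] obtain v where v: "v \<in> borel_measurable borel" "\<And>x. x \<notin> \<Omega> \<Longrightarrow> v x = 0" "AE x in M. v x = g x"
    by blast
  note [measurable] = v(1) V_borel[OF uV]
  have lim: "AE x in lborel. (\<lambda>n. u (k n) x) \<longlonglongrightarrow> v x"
  proof -
    have "AE x in M. (\<lambda>n. u (k n) x) \<longlonglongrightarrow> v x" using g(3) v(3) by eventually_elim simp
    then show ?thesis by (subst (asm) AE_M_lborel) (auto simp: V_zero[OF uV] v(2))
  qed
  have v2: "integrable lborel (\<lambda>x. (v x)\<^sup>2)"
  proof -
    have "v \<in> Lspace M (ereal 2)"
    proof (rule Lspace_cong_AE[OF g(1)])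
      show "AE x in M. g x = v x" using v(3) by eventually_elim simp
    qed (rule lebesgue_on_borel[OF v(1)])
    then have "integrable M (\<lambda>x. (v x)\<^sup>2)" by (simp add: Lspace_ereal)
    then show ?thesis using M_lborel(1)[of "\<lambda>x. (v x)\<^sup>2"] v(2) by simp
  qed
  have close: "(\<lambda>x. u n x - v x) \<in> V \<and> energy s (\<lambda>x. u n x - v x) (\<lambda>x. u n x - v x) \<le> e"
    if K: "\<And>m. m \<ge> K \<Longrightarrow> energy s (\<lambda>x. u n x - u m x) (\<lambda>x. u n x - u m x) \<le> e" for e n K
  proof -
    let ?P = "lborel \<Otimes>\<^sub>M (lborel :: 'a measure)"
    define h where "h j x = u n x - u (k (j + K)) x" for j x
    have hV: "h j \<in> V" for j unfolding h_def[abs_def] by (rule V_diff[OF uV uV])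
    note [measurable] = V_borel[OF hV]
    let ?w = "\<lambda>x. u n x - v x"
    have "k (j + K) \<ge> K" for j using seq_suble[OF g(2), of "j + K"] by linarith
    then have le: "(\<integral>p. gagl s (h j) (h j) p \<partial>?P) \<le> e" for j
      using K[of "k (j + K)"] by (simp add: energy_def h_def[abs_def])
    have "AE p in ?P. (\<lambda>j. gagl s (h j) (h j) p) \<longlonglongrightarrow> gagl s ?w ?w p"
      using AE_pair_lborel[OF lim]
    proof eventually_elim
      case (elim p)
      have "(\<lambda>j. u (k (j + K)) (fst p)) \<longlonglongrightarrow> v (fst p)" "(\<lambda>j. u (k (j + K)) (snd p)) \<longlonglongrightarrow> v (snd p)"
        using elim by (auto intro: LIMSEQ_ignore_initial_segment[of "\<lambda>n. u (k n) _"])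
      then show ?case
        unfolding gagl_def h_def divide_inverse by (intro tendsto_intros)
    qed
    note F = integral_Fatou[OF integrable_gagl[OF hV hV] gagl_nonneg _ this le tendsto_const]
    have int: "integrable ?P (gagl s ?w ?w)" and en: "energy s ?w ?w \<le> e"
      using F by (auto simp: energy_def)
    have "integrable lborel (\<lambda>x. (u n x - v x)\<^sup>2)"
    proof (rule Bochner_Integration.integrable_bound)
      show "integrable lborel (\<lambda>x. 2 * (u n x)\<^sup>2 + 2 * (v x)\<^sup>2)" using v2 uV[of n] by (simp add: V_def)
      have "(c - d)\<^sup>2 \<le> 2 * c\<^sup>2 + 2 * d\<^sup>2" for c d :: real
        using sum_squares_bound[of c "- d"] by (simp add: power2_eq_square algebra_simps)
      then show "AE x in lborel. norm ((u n x - v x)\<^sup>2) \<le> norm (2 * (u n x)\<^sup>2 + 2 * (v x)\<^sup>2)"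
        by (intro AE_I2) simp
    qed measurable
    then have "?w \<in> V" using int V_zero[OF uV] v(2) by (simp add: V_def)
    with en show ?thesis by simp
  qed
  have vV: "v \<in> V"
  proof -
    obtain K where "\<And>m n. m \<ge> K \<Longrightarrow> n \<ge> K \<Longrightarrow> energy s (\<lambda>x. u m x - u n x) (\<lambda>x. u m x - u n x) < 1"
      using cauchy[of 1] by auto
    then have "(\<lambda>x. u K x - v x) \<in> V" using close[of K K 1] by (simp add: less_imp_le)
    from V_diff[OF uV this, of K] show ?thesis by simp
  qed
  have "(\<lambda>n. energy s (\<lambda>x. u n x - v x) (\<lambda>x. u n x - v x)) \<longlonglongrightarrow> 0"
  proof (rule LIMSEQ_I)
    fix e :: real assume e: "e > 0"
    then obtain K where K: "\<And>m n. m \<ge> K \<Longrightarrow> n \<ge> K \<Longrightarrow> energy s (\<lambda>x. u m x - u n x) (\<lambda>x. u m x - u n x) < e / 2"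
      using cauchy[of "e / 2"] by auto
    have "norm (energy s (\<lambda>x. u n x - v x) (\<lambda>x. u n x - v x) - 0) < e" if n: "n \<ge> K" for n
    proof -
      have "energy s (\<lambda>x. u n x - v x) (\<lambda>x. u n x - v x) \<le> e / 2"
        using close[of K n "e / 2"] K[OF n] by (simp add: less_imp_le)
      then show ?thesis using e energy_nonneg[of "\<lambda>x. u n x - v x"] by simp
    qed
    then show "\<exists>no. \<forall>n\<ge>no. norm (energy s (\<lambda>x. u n x - v x) (\<lambda>x. u n x - v x) - 0) < e" by blast
  qed
  with vV show ?thesis by blast
qed

sublocale form: complete_form V "energy s"
proof
  show "V \<noteq> {}" using V_zero_fun by blast
next
  fix u :: "nat \<Rightarrow> 'a \<Rightarrow> real"
  assume "\<And>n. u n \<in> V"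
    and "\<And>e. e > 0 \<Longrightarrow> \<exists>K. \<forall>m\<ge>K. \<forall>n\<ge>K. energy s (\<lambda>x. u m x - u n x) (\<lambda>x. u m x - u n x) < e"
  then show "\<exists>v\<in>V. (\<lambda>n. energy s (\<lambda>x. u n x - v x) (\<lambda>x. u n x - v x)) \<longlonglongrightarrow> 0"
    by (rule V_complete)
qed (rule V_lin energy_lin energy_sym energy_nonneg; assumption)+

lemma weak_solution_exists:
  assumes [measurable]: "g \<in> borel_measurable M" and "AE x in M. \<bar>g x\<bar> \<le> K"
  shows "\<exists>u\<in>V. \<forall>w\<in>V. energy s u w = (\<integral>x. g x * w x \<partial>M)"
proof -
  obtain C where C: "C > 0" "\<And>u. u \<in> V \<Longrightarrow> (\<integral>x. (u x)\<^sup>2 \<partial>lborel) \<le> C * energy s u u"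
    using Poincare by blast
  have g2: "g \<in> Lspace M (ereal 2)" using assms by (intro M.Lspace_bounded) auto
  have int: "integrable M (\<lambda>x. g x * w x)" if "w \<in> V" for w
    using Hoelder(1)[OF g2 V_L2(1)[OF that]] by simp
  show ?thesis
  proof (rule form.Riesz_representation)
    show "(\<integral>x. g x * (a * u x + b * v x) \<partial>M) = a * (\<integral>x. g x * u x \<partial>M) + b * (\<integral>x. g x * v x \<partial>M)"
      if "u \<in> V" "v \<in> V" for u v a b
      using int[OF that(1)] int[OF that(2)] by (simp add: distrib_left mult.left_commute[of "g _"])
    show "(\<integral>x. g x * w x \<partial>M)\<^sup>2 \<le> ((Lnorm M (ereal 2) g)\<^sup>2 * C) * energy s w w" if w: "w \<in> V" for w
    proof -
      have "\<bar>\<integral>x. g x * w x \<partial>M\<bar> \<le> Lnorm M (ereal 2) g * Lnorm M (ereal 2) w"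
        using Hoelder(2)[OF g2 V_L2(1)[OF w]] by simp
      from power_mono[OF this, of 2]
      have "(\<integral>x. g x * w x \<partial>M)\<^sup>2 \<le> (Lnorm M (ereal 2) g)\<^sup>2 * (Lnorm M (ereal 2) w)\<^sup>2"
        by (simp add: power_mult_distrib)
      also have "\<dots> \<le> (Lnorm M (ereal 2) g)\<^sup>2 * (C * energy s w w)"
        using C(2)[OF w] V_L2(2)[OF w] by (intro mult_left_mono) auto
      finally show ?thesis by (simp add: mult.assoc)
    qed
  qed (use C in auto)
qed

end

section \<open>Inequalities for powers and level sets\<close>

lemma powr_diff_le:
  fixes x y e :: real
  assumes "0 \<le> y" "y \<le> x" "1 \<le> e"
  shows "x powr e - y powr e \<le> e * x powr (e - 1) * (x - y)"
proof -
  consider "y = x" | "y = 0" "x > 0" | "0 < y" "y < x" using assms by linarith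
  then show ?thesis
  proof cases
    case 2
    have "x powr e = x powr (e - 1) * x" using 2 by (simp add: powr_diff)
    also have "\<dots> \<le> e * (x powr (e - 1) * x)"
      using assms 2 mult_right_mono[of 1 e "x powr (e - 1) * x"] by simp
    finally show ?thesis using 2 assms by (simp add: mult.assoc)
  next
    case 3
    obtain z where z: "y < z" "z < x" "x powr e - y powr e = (x - y) * (e * z powr (e - 1))"
    proof (rule MVT2[OF 3(2), of "\<lambda>t. t powr e" "\<lambda>t. e * t powr (e - 1)", THEN exE])
      show "((\<lambda>t. t powr e) has_real_derivative e * t powr (e - 1)) (at t)" if "y \<le> t" "t \<le> x" for t
        using that 3 by (intro has_real_derivative_powr) auto
    qed auto
    have "z powr (e - 1) \<le> x powr (e - 1)" using z 3 assms by (intro powr_mono2) auto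
    from mult_left_mono[OF mult_left_mono[OF this, of e], of "x - y"]
    have "(x - y) * (e * z powr (e - 1)) \<le> (x - y) * (e * x powr (e - 1))"
      using 3 assms by simp
    then show ?thesis unfolding z(3) by (simp only: mult_ac)
  qed simp
qed

lemma powr_Lipschitz:
  fixes x y e B :: real
  assumes "0 \<le> x" "0 \<le> y" "x \<le> B" "y \<le> B" "1 \<le> e"
  shows "\<bar>x powr e - y powr e\<bar> \<le> e * B powr (e - 1) * \<bar>x - y\<bar>"
proof -
  have *: "\<bar>x powr e - y powr e\<bar> \<le> e * B powr (e - 1) * \<bar>x - y\<bar>" if "0 \<le> y" "y \<le> x" "x \<le> B" for x y
  proof -
    have "0 \<le> x powr e - y powr e" using that assms(5) by (simp add: powr_mono2)
    then have "\<bar>x powr e - y powr e\<bar> \<le> e * x powr (e - 1) * (x - y)"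
      using powr_diff_le[OF that(1,2) assms(5)] by simp
    also have "\<dots> \<le> e * B powr (e - 1) * (x - y)"
      using that assms(5) by (intro mult_right_mono mult_left_mono powr_mono2) auto
    finally show ?thesis using that by simp
  qed
  show ?thesis using *[of y x] *[of x y] assms by (cases "y \<le> x") (auto simp: abs_minus_commute)
qed

text \<open>The signed power, usually written \<open>t \<bar>t\<bar>\<^bsup>e-1\<^esup>\<close>.\<close>

definition spow :: "real \<Rightarrow> real \<Rightarrow> real" where
  "spow e t = sgn t * \<bar>t\<bar> powr e"

lemma spow_zero [simp]: "spow e 0 = 0"
  by (simp add: spow_def)

lemma abs_spow: "\<bar>spow e t\<bar> = \<bar>t\<bar> powr e"
  by (simp add: spow_def abs_mult abs_sgn_eq)

lemma mult_spow: "t * spow e t = \<bar>t\<bar> powr (e + 1)"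
proof -
  have "t * spow e t = \<bar>t\<bar> * \<bar>t\<bar> powr e"
    unfolding spow_def mult.assoc[symmetric] by (simp only: abs_sgn[symmetric])
  then show ?thesis by (cases "t = 0") (simp_all add: powr_add mult.commute)
qed

lemma spow_borel [measurable]: "spow e \<in> borel_measurable borel"
  unfolding spow_def[abs_def] by measurable

lemma spow_Lipschitz:
  assumes "\<bar>a\<bar> \<le> B" "\<bar>b\<bar> \<le> B" "1 \<le> e"
  shows "\<bar>spow e a - spow e b\<bar> \<le> e * B powr (e - 1) * \<bar>a - b\<bar>"
proof -
  have z: "t powr e \<le> e * B powr (e - 1) * t" if "0 \<le> t" "t \<le> B" for t
    using powr_Lipschitz[of t 0 B e] that assms by simp
  consider "a \<ge> 0" "b \<ge> 0" | "a \<le> 0" "b \<le> 0" | "a > 0" "b < 0" | "a < 0" "b > 0" by linarith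
  then show ?thesis
  proof cases
    case 1
    then have "spow e a = a powr e" "spow e b = b powr e" by (auto simp: spow_def sgn_if)
    then show ?thesis using powr_Lipschitz[of a b B e] assms 1 by simp
  next
    case 2
    then have "spow e a = - ((- a) powr e)" "spow e b = - ((- b) powr e)" by (auto simp: spow_def sgn_if)
    then show ?thesis using powr_Lipschitz[of "- a" "- b" B e] assms 2 by (simp add: abs_minus_commute)
  next
    case 3
    then have "spow e a = a powr e" "spow e b = - ((- b) powr e)" by (auto simp: spow_def sgn_if)
    then show ?thesis using z[of a] z[of "- b"] assms 3 by (simp add: distrib_left right_diff_distrib)
  next
    case 4
    then have "spow e a = - ((- a) powr e)" "spow e b = b powr e" by (auto simp: spow_def sgn_if)
    then have "\<bar>spow e a - spow e b\<bar> = (- a) powr e + b powr e" by (smt (verit) powr_ge_zero)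
    also have "\<dots> \<le> e * B powr (e - 1) * (- a) + e * B powr (e - 1) * b"
      using z[of "- a"] z[of b] assms 4 by (intro add_mono) auto
    also have "\<dots> = e * B powr (e - 1) * \<bar>a - b\<bar>" using 4 by (simp add: right_diff_distrib)
    finally show ?thesis .
  qed
qed

text \<open>The pointwise Stroock--Varopoulos inequality. For \<open>0 \<le> Q \<le> P\<close> both sides are compared with
  \<open>P\<^bsup>p-2\<^esup> (P - Q)\<^sup>2\<close>; signs only increase the right-hand side.\<close>

lemma Stroock_Varopoulos:
  fixes a b p :: real
  assumes p: "2 \<le> p"
  shows "(\<bar>a\<bar> powr (p / 2) - \<bar>b\<bar> powr (p / 2))\<^sup>2 \<le> p\<^sup>2 / 4 * ((a - b) * (spow (p - 1) a - spow (p - 1) b))"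
proof -
  have le: "(P powr (p / 2) - Q powr (p / 2))\<^sup>2 \<le> p\<^sup>2 / 4 * ((P - Q) * (P powr (p - 1) - Q powr (p - 1)))"
    if "0 \<le> Q" "Q \<le> P" for P Q
  proof (cases "P = 0")
    case False
    then have P: "P > 0" using that by simp
    have nn: "0 \<le> P powr (p / 2) - Q powr (p / 2)" using that p by (simp add: powr_mono2)
    have "P powr (p / 2) - Q powr (p / 2) \<le> p / 2 * P powr (p / 2 - 1) * (P - Q)"
      using powr_diff_le[OF that, of "p / 2"] p by simp
    from power_mono[OF this nn, of 2]
    have "(P powr (p / 2) - Q powr (p / 2))\<^sup>2 \<le> p\<^sup>2 / 4 * (P powr (p / 2 - 1))\<^sup>2 * (P - Q)\<^sup>2"
      by (simp add: power_mult_distrib power_divide)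
    also have "(P powr (p / 2 - 1))\<^sup>2 = P powr (p - 2)"
      by (simp add: power2_eq_square flip: powr_add)
    also have "p\<^sup>2 / 4 * P powr (p - 2) * (P - Q)\<^sup>2 = p\<^sup>2 / 4 * ((P - Q) * (P * P powr (p - 2) - Q * P powr (p - 2)))"
    proof -
      have "c * Y * (P - Q)\<^sup>2 = c * ((P - Q) * (P * Y - Q * Y))" for c Y :: real
        by algebra
      then show ?thesis .
    qed
    also have "\<dots> \<le> p\<^sup>2 / 4 * ((P - Q) * (P powr (p - 1) - Q powr (p - 1)))"
    proof (intro mult_left_mono diff_mono)
      have "P powr (p - 1) = P powr (1 + (p - 2))" by simp
      then show "P * P powr (p - 2) \<le> P powr (p - 1)" using P by (simp only: powr_add) simp
      show "Q powr (p - 1) \<le> Q * P powr (p - 2)"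
      proof (cases "Q = 0")
        case False
        have "Q powr (p - 1) = Q powr (1 + (p - 2))" by simp
        also have "\<dots> = Q * Q powr (p - 2)" unfolding powr_add using that by simp
        also have "\<dots> \<le> Q * P powr (p - 2)" using that p by (intro mult_left_mono powr_mono2) auto
        finally show ?thesis .
      qed simp
    qed (use that in auto)
    finally show ?thesis .
  qed (use that in simp)
  have "(\<bar>a\<bar> powr (p / 2) - \<bar>b\<bar> powr (p / 2))\<^sup>2 \<le>
      p\<^sup>2 / 4 * ((\<bar>a\<bar> - \<bar>b\<bar>) * (\<bar>a\<bar> powr (p - 1) - \<bar>b\<bar> powr (p - 1)))"
  proof (cases "\<bar>b\<bar> \<le> \<bar>a\<bar>")
    case True
    then show ?thesis using le by simp
  next
    case False
    then have "(\<bar>b\<bar> powr (p / 2) - \<bar>a\<bar> powr (p / 2))\<^sup>2 \<le>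
        p\<^sup>2 / 4 * ((\<bar>b\<bar> - \<bar>a\<bar>) * (\<bar>b\<bar> powr (p - 1) - \<bar>a\<bar> powr (p - 1)))"
      using le by simp
    moreover have "(d - c)\<^sup>2 = (c - d)\<^sup>2" "(d - c) * (d' - c') = (c - d) * (c' - d')" for c d c' d' :: real
      by (algebra, algebra)
    ultimately show ?thesis by metis
  qed
  also have "\<dots> \<le> p\<^sup>2 / 4 * ((a - b) * (spow (p - 1) a - spow (p - 1) b))"
  proof (rule mult_left_mono)
    have sq: "t * spow (p - 1) t = \<bar>t\<bar> * \<bar>t\<bar> powr (p - 1)" for t
      unfolding spow_def mult.assoc[symmetric] by (simp only: abs_sgn[symmetric])
    have "c * spow (p - 1) d \<le> \<bar>c\<bar> * \<bar>d\<bar> powr (p - 1)" for c d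
      using abs_ge_self[of "c * spow (p - 1) d"] by (simp add: abs_mult abs_spow)
    from this[of a b] this[of b a] sq[of a] sq[of b]
    show "(\<bar>a\<bar> - \<bar>b\<bar>) * (\<bar>a\<bar> powr (p - 1) - \<bar>b\<bar> powr (p - 1)) \<le> (a - b) * (spow (p - 1) a - spow (p - 1) b)"
      by (simp add: algebra_simps)
  qed simp
  finally show ?thesis .
qed

text \<open>De Giorgi's iteration: along \<open>k\<^sub>j = d (1 - 2\<^sup>-\<^sup>j)\<close> the superlinear decay \<open>\<beta> > 1\<close> beats the growth
  of \<open>1 / (k\<^sub>j\<^sub>+\<^sub>1 - k\<^sub>j)\<close> and \<open>\<Phi>\<close> decreases geometrically; \<open>d\<close> is chosen so that the induction
  closes with equality.\<close>

lemma De_Giorgi_iteration: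
  fixes \<Phi> :: "real \<Rightarrow> real"
  assumes a: "a > 0" and \<beta>: "\<beta> > 1" and K: "K > 0" and m0: "m0 > 0"
    and nn: "\<And>k. 0 \<le> \<Phi> k" and le: "\<And>k. \<Phi> k \<le> m0" and anti: "\<And>k h. k \<le> h \<Longrightarrow> \<Phi> h \<le> \<Phi> k"
    and decay: "\<And>k h. 0 \<le> k \<Longrightarrow> k < h \<Longrightarrow> \<Phi> h \<le> (K / (h - k)) powr a * \<Phi> k powr \<beta>"
  shows "\<Phi> (K * (2 * (m0 powr (\<beta> - 1) / 2 powr (- a / (\<beta> - 1))) powr (1 / a))) = 0"
proof -
  define l where "l = 2 powr (- a / (\<beta> - 1))"
  define D where "D = 2 * (m0 powr (\<beta> - 1) / l) powr (1 / a)"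
  define d where "d = K * D"
  define k where "k j = d * (1 - (1 / 2) ^ j)" for j :: nat
  have l: "l > 0" "l < 1"
  proof -
    have "- a / (\<beta> - 1) < 0" using a \<beta> by (simp add: divide_neg_pos)
    then show "l > 0" "l < 1" unfolding l_def using powr_less_mono[of "- a / (\<beta> - 1)" 0 2] by auto
  qed
  have D: "D > 0" using m0 l by (simp add: D_def)
  have d: "d > 0" using K D by (simp add: d_def)
  have Da: "D powr a = 2 powr a * (m0 powr (\<beta> - 1) / l)"
    using a m0 l by (simp add: D_def powr_mult powr_powr)
  have lb: "l powr (\<beta> - 1) = 2 powr (- a)"
    using \<beta> by (simp add: l_def powr_powr)
  have bound: "\<Phi> (k j) \<le> m0 * l ^ j" for j
  proof (induction j)
    case 0 show ?case using le[of "k 0"] by simp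
  next
    case (Suc j)
    have "(1 / 2 :: real) ^ j \<le> 1" by (intro power_le_one) auto
    then have kj: "0 \<le> k j" using d by (simp add: k_def)
    have diff: "k (Suc j) - k j = d / 2 ^ Suc j"
      by (simp add: k_def power_one_over field_simps)
    have dp: "d / 2 ^ Suc j > 0" using d by simp
    have "\<Phi> (k (Suc j)) \<le> (K / (d / 2 ^ Suc j)) powr a * \<Phi> (k j) powr \<beta>"
      using decay[of "k j" "k (Suc j)"] kj diff dp by simp
    also have "\<dots> \<le> (K / (d / 2 ^ Suc j)) powr a * (m0 * l ^ j) powr \<beta>"
      using Suc nn \<beta> by (intro mult_left_mono powr_mono2) auto
    also have "K / (d / 2 ^ Suc j) = 2 ^ Suc j / D" using K D by (simp add: d_def)
    also have "(2 ^ Suc j / D) powr a = (2 powr a) * (2 powr a) ^ j / (D powr a)"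
      using D by (simp add: powr_divide powr_mult powr_power powr_powr mult.commute flip: powr_realpow)
    also have "(m0 * l ^ j) powr \<beta> = m0 * l ^ j * (m0 powr (\<beta> - 1) * (l powr (\<beta> - 1)) ^ j)"
    proof -
      have pos: "m0 * l ^ j > 0" using m0 l by simp
      have "(m0 * l ^ j) powr \<beta> = (m0 * l ^ j) powr (1 + (\<beta> - 1))" by simp
      also have "\<dots> = m0 * l ^ j * (m0 * l ^ j) powr (\<beta> - 1)" using pos by (simp only: powr_add) simp
      also have "(m0 * l ^ j) powr (\<beta> - 1) = m0 powr (\<beta> - 1) * (l powr (\<beta> - 1)) ^ j"
        using m0 l by (simp add: powr_mult powr_power powr_powr mult.commute flip: powr_realpow)
      finally show ?thesis .
    qed
    also have "(2 powr a) * (2 powr a) ^ j / (D powr a) * (m0 * l ^ j * (m0 powr (\<beta> - 1) * (l powr (\<beta> - 1)) ^ j)) =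
        m0 * l ^ j * l * ((2 powr a) ^ j * (2 powr (- a)) ^ j)"
      unfolding Da lb using m0 l by (simp add: field_simps)
    also have "(2 powr a) ^ j * (2 powr (- a)) ^ j = (1 :: real)"
      by (simp add: powr_minus flip: power_mult_distrib)
    finally show ?case by (simp add: mult_ac)
  qed
  have "\<Phi> d \<le> m0 * l ^ j" for j
  proof -
    have "k j \<le> d" using d by (simp add: k_def mult_left_le)
    then show ?thesis using anti bound[of j] order_trans by blast
  qed
  moreover have "(\<lambda>j. m0 * l ^ j) \<longlonglongrightarrow> m0 * 0"
    using l by (intro tendsto_intros LIMSEQ_realpow_zero) auto
  ultimately have "\<Phi> d \<le> 0" by (auto dest!: LIMSEQ_le_const)
  then show ?thesis using nn[of d] by (simp add: d_def D_def l_def)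
qed

section \<open>The fractional Sobolev inequality\<close>

context bounded_open_set
begin

definition q :: real where "q = 2 * N / (N - 2 * s)"

lemma N_pos: "N > 0"
  by (simp add: N_eq)

lemma q_gt: "q > 2"
  using dim s_pos by (simp add: q_def field_simps)

lemma two_div_q: "2 / q = 1 - 2 * s / N"
  using dim s_pos N_pos by (simp add: q_def field_simps)

lemma q_alpha: "q * (2 * s / N) = q - 2"
  using dim s_pos N_pos by (simp add: q_def field_simps)

lemma bounded_Lspace:
  assumes "w \<in> borel_measurable M" "\<And>x. \<bar>w x\<bar> \<le> B" "p > 0"
  shows "w \<in> Lspace M (ereal p)"
  using assms by (intro M.Lspace_bounded[where C = B]) auto

lemma Lnorm_q_powr_2: "(Lnorm M (ereal q) w)\<^sup>2 = (\<integral>x. \<bar>w x\<bar> powr q \<partial>M) powr (1 - 2 * s / N)"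
proof -
  have "(Lnorm M (ereal q) w)\<^sup>2 = (Lnorm M (ereal q) w) powr 2"
    using Lnorm_nonneg[of M q w] by simp
  also have "\<dots> = (\<integral>x. \<bar>w x\<bar> powr q \<partial>M) powr (2 / q)"
    unfolding Lnorm_ereal powr_powr by simp
  finally show ?thesis by (simp only: two_div_q)
qed

text \<open>In the ball around \<open>x\<close> whose measure is twice the Chebyshev bound \<open>(2 / t)\<^sup>q A\<close> for
  \<open>{\<bar>w\<bar> \<ge> t / 2}\<close>, where \<open>t = \<bar>w x\<bar>\<close> and \<open>A = \<parallel>w\<parallel>\<^sub>q\<^sup>q\<close>, at least half of the points satisfy
  \<open>\<bar>w y\<bar> < t / 2\<close>. Hence \<open>t\<^sup>q\<close> is bounded by \<open>A\<^bsup>2s/N\<^esup>\<close> times the energy density at \<open>x\<close>, and integration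
  in \<open>x\<close> gives the inequality.\<close>

lemma fractional_Sobolev:
  obtains S where "S > 0"
    "\<And>w B. w \<in> V \<Longrightarrow> (\<And>x. \<bar>w x\<bar> \<le> B) \<Longrightarrow> (Lnorm M (ereal q) w)\<^sup>2 \<le> S * energy s w w"
proof -
  define \<alpha> where "\<alpha> = 2 * s / N"
  have \<alpha>: "0 < \<alpha>" "\<alpha> < 1" "q * \<alpha> = q - 2" "1 + \<alpha> = (N + 2 * s) / N"
    using s_pos dim N_pos q_alpha by (auto simp: \<alpha>_def field_simps)
  define \<omega> where "\<omega> = unit_ball_vol N"
  have \<omega>: "\<omega> > 0" using N_pos by (simp add: \<omega>_def)
  define c where "c = 2 powr q * (2 / \<omega>) powr (1 + \<alpha>)"
  have c: "c > 0" using \<omega> by (simp add: c_def)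
  have "(Lnorm M (ereal q) w)\<^sup>2 \<le> c * energy s w w" if w: "w \<in> V" and B: "\<And>x. \<bar>w x\<bar> \<le> B" for w B
  proof -
    note [measurable] = V_borel[OF w]
    define A where "A = (\<integral>x. \<bar>w x\<bar> powr q \<partial>lborel)"
    have int: "integrable lborel (\<lambda>x. \<bar>w x\<bar> powr q)" and AM: "(\<integral>x. \<bar>w x\<bar> powr q \<partial>M) = A"
    proof -
      have "integrable M (\<lambda>x. \<bar>w x\<bar> powr q)"
        using bounded_Lspace[OF V_measurable[OF w] B, of q] q_gt by (simp add: Lspace_ereal)
      then show "integrable lborel (\<lambda>x. \<bar>w x\<bar> powr q)" "(\<integral>x. \<bar>w x\<bar> powr q \<partial>M) = A"
        using M_lborel[of "\<lambda>x. \<bar>w x\<bar> powr q"] V_zero[OF w] by (auto simp: A_def)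
    qed
    have A0: "A \<ge> 0" by (simp add: A_def)
    show ?thesis
    proof (cases "A = 0")
      case True
      then show ?thesis using c energy_nonneg[of w] by (simp add: Lnorm_q_powr_2 AM)
    next
      case False
      then have A: "A > 0" using A0 by simp
      have pt: "ennreal (\<bar>w x\<bar> powr q) \<le> ennreal (c * A powr \<alpha>) * (\<integral>\<^sup>+y. ennreal (gagl s w w (x, y)) \<partial>lborel)" for x
      proof (cases "w x = 0")
        case False
        define t where "t = \<bar>w x\<bar>"
        have t: "t > 0" using False by (simp add: t_def)
        \<comment> \<open>The Chebyshev bound for the measure of the set \<open>H\<close> below; the ball of radius \<open>\<rho>\<close> has measure \<open>2 X\<close>.\<close>
        define X where "X = A * (2 / t) powr q"
        have X: "X > 0" using A t by (simp add: X_def)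
        define \<rho> where "\<rho> = (2 * X / \<omega>) powr (1 / N)"
        have \<rho>: "\<rho> > 0" using X \<omega> by (simp add: \<rho>_def)
        have "\<rho> ^ DIM('a) = \<rho> powr N" using \<rho> by (simp add: powr_realpow N_eq)
        also have "\<dots> = 2 * X / \<omega>" using X \<omega> N_pos by (simp add: \<rho>_def powr_powr)
        finally have \<rho>N: "\<rho> ^ DIM('a) = 2 * X / \<omega>" .
        have mb: "measure lborel (ball x \<rho>) = 2 * X"
          using content_ball[of \<rho> x] \<rho> \<omega> unfolding \<rho>N \<omega>_def N_eq by simp
        define H where "H = {y \<in> space lborel. \<bar>w y\<bar> powr q \<ge> (t / 2) powr q}"
        have Hm: "H \<in> sets lborel" unfolding H_def by measurable
        have mH: "measure lborel H \<le> X"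
        proof -
          have "measure lborel H \<le> A / (t / 2) powr q"
            unfolding H_def A_def
            by (rule integral_Markov_inequality_measure[where A = "{}"]) (use int t in auto)
          also have "\<dots> = X" using t by (simp add: X_def powr_divide)
          finally show ?thesis .
        qed
        have eH: "emeasure lborel H < \<infinity>"
        proof -
          have "emeasure lborel H \<le> ennreal ((1 / (t / 2) powr q) * A)"
            unfolding H_def A_def by (rule integral_Markov_inequality) (use int t in auto)
          then show ?thesis by (rule le_less_trans) simp
        qed
        define G where "G = ball x \<rho> - ball x \<rho> \<inter> H"
        have Gm: "G \<in> sets lborel" using Hm by (simp add: G_def)
        have mG: "X \<le> measure lborel G"
        proof -
          have "measure lborel G = measure lborel (ball x \<rho>) - measure lborel (ball x \<rho> \<inter> H)"
            unfolding G_def using Hm emeasure_lborel_ball_finite[of x \<rho>] by (intro measure_Diff) auto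
          moreover have "measure lborel (ball x \<rho> \<inter> H) \<le> measure lborel H"
            using Hm eH by (intro measure_mono_fmeasurable) (auto simp: fmeasurable_def)
          ultimately show ?thesis using mb mH by simp
        qed
        have Gfin: "emeasure lborel G < \<infinity>"
        proof -
          have "emeasure lborel G \<le> emeasure lborel (ball x \<rho>)" by (intro emeasure_mono) (auto simp: G_def)
          then show ?thesis using emeasure_lborel_ball_finite le_less_trans by blast
        qed
        define \<kappa> where "\<kappa> = (t / 2)\<^sup>2 / \<rho> powr (N + 2 * s)"
        have \<kappa>: "\<kappa> > 0" using t \<rho> by (simp add: \<kappa>_def)
        have low: "\<kappa> * indicat_real G y \<le> gagl s w w (x, y)" for y
        proof (cases "y \<in> G")
          case True
          then have wlt: "\<bar>w y\<bar> powr q < (t / 2) powr q" and yb: "norm (x - y) < \<rho>"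
            by (auto simp: G_def H_def dist_norm)
          have wy: "\<bar>w y\<bar> < t / 2"
          proof (rule ccontr)
            assume "\<not> \<bar>w y\<bar> < t / 2"
            then have "(t / 2) powr q \<le> \<bar>w y\<bar> powr q" using q_gt t by (intro powr_mono2) auto
            with wlt show False by simp
          qed
          have ne: "x \<noteq> y" using wy t by (auto simp: t_def)
          have "t / 2 \<le> \<bar>w x - w y\<bar>"
            using wy abs_triangle_ineq2[of "w x" "w y"] unfolding t_def by linarith
          from power_mono[OF this, of 2] have "(t / 2)\<^sup>2 \<le> (w x - w y)\<^sup>2" using t by simp
          moreover have "norm (x - y) powr (N + 2 * s) \<le> \<rho> powr (N + 2 * s)"
            using yb s_pos N_pos by (intro powr_mono2) auto
          ultimately have "(t / 2)\<^sup>2 / \<rho> powr (N + 2 * s) \<le> (w x - w y)\<^sup>2 / norm (x - y) powr (N + 2 * s)"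
            using ne by (intro frac_le) auto
          then show ?thesis using True by (simp add: \<kappa>_def gagl_def power2_eq_square N_eq)
        qed (simp add: gagl_nonneg)
        \<comment> \<open>The powers of \<open>t\<close> match because \<open>q \<alpha> = q - 2\<close>: this identity characterises the exponent \<open>q\<close>.\<close>
        have val: "c * A powr \<alpha> * (\<kappa> * X) = t powr q"
        proof -
          have e1: "\<rho> powr (N + 2 * s) = (2 * X / \<omega>) powr (1 + \<alpha>)"
            using N_pos by (simp add: \<rho>_def powr_powr \<alpha>(4))
          have e2: "(2 * X / \<omega>) powr (1 + \<alpha>) = (2 / \<omega>) powr (1 + \<alpha>) * (X * X powr \<alpha>)"
          proof -
            have "(2 * X / \<omega>) powr (1 + \<alpha>) = (2 / \<omega> * X) powr (1 + \<alpha>)" by simp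
            also have "\<dots> = (2 / \<omega>) powr (1 + \<alpha>) * X powr (1 + \<alpha>)" by (rule powr_mult)
            also have "X powr (1 + \<alpha>) = X * X powr \<alpha>" using X by (simp add: powr_add)
            finally show ?thesis .
          qed
          have e3: "X powr \<alpha> = A powr \<alpha> * (2 / t) powr (q - 2)"
            using A t by (simp add: X_def powr_mult powr_powr \<alpha>(3))
          have e4: "(2 / t) powr (q - 2) = (2 / t) powr q / (2 / t)\<^sup>2"
            using t by (simp add: powr_diff)
          have e5: "(2 / t) powr q = 2 powr q / t powr q" using t by (simp add: powr_divide)
          have pos: "(2 / \<omega>) powr (1 + \<alpha>) > 0" "A powr \<alpha> > 0" "t powr q > 0" "2 powr q > (0::real)"
            using \<omega> A t by auto
          show ?thesis
            unfolding \<kappa>_def c_def e1 e2 e3 e4 e5 using pos X t by (simp add: field_simps power2_eq_square)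
        qed
        have "ennreal (t powr q) = ennreal (c * A powr \<alpha>) * (ennreal \<kappa> * ennreal X)"
          using c \<kappa> X by (simp add: val[symmetric] ennreal_mult)
        also have "\<dots> \<le> ennreal (c * A powr \<alpha>) * (ennreal \<kappa> * emeasure lborel G)"
          using mG Gfin by (intro mult_left_mono) (auto simp: emeasure_eq_ennreal_measure)
        also have "ennreal \<kappa> * emeasure lborel G = (\<integral>\<^sup>+y. ennreal \<kappa> * indicator G y \<partial>lborel)"
          using Gm by (simp add: nn_integral_cmult_indicator)
        also have "\<dots> = (\<integral>\<^sup>+y. ennreal (\<kappa> * indicat_real G y) \<partial>lborel)"
          by (intro nn_integral_cong) (auto simp: indicator_def)
        also have "\<dots> \<le> (\<integral>\<^sup>+y. ennreal (gagl s w w (x, y)) \<partial>lborel)"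
          by (intro nn_integral_mono ennreal_leI low)
        finally show ?thesis by (simp add: t_def mult_left_mono)
      qed simp
      have "ennreal A = (\<integral>\<^sup>+x. ennreal (\<bar>w x\<bar> powr q) \<partial>lborel)"
        unfolding A_def using int by (simp add: nn_integral_eq_integral)
      also have "\<dots> \<le> (\<integral>\<^sup>+x. ennreal (c * A powr \<alpha>) * (\<integral>\<^sup>+y. ennreal (gagl s w w (x, y)) \<partial>lborel) \<partial>lborel)"
        by (intro nn_integral_mono pt)
      also have "\<dots> = ennreal (c * A powr \<alpha>) * (\<integral>\<^sup>+x. (\<integral>\<^sup>+y. ennreal (gagl s w w (x, y)) \<partial>lborel) \<partial>lborel)"
        by (rule nn_integral_cmult) measurable
      also have "(\<integral>\<^sup>+x. (\<integral>\<^sup>+y. ennreal (gagl s w w (x, y)) \<partial>lborel) \<partial>lborel) = ennreal (energy s w w)"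
        by (subst lborel.nn_integral_fst) (measurable, rule nn_integral_gagl[OF w])
      also have "ennreal (c * A powr \<alpha>) * ennreal (energy s w w) = ennreal (c * A powr \<alpha> * energy s w w)"
        using c energy_nonneg[of w] by (subst ennreal_mult) auto
      finally have "A \<le> c * A powr \<alpha> * energy s w w" using c energy_nonneg[of w] by (simp add: ennreal_le_iff)
      then have "A / A powr \<alpha> \<le> c * energy s w w" using A by (simp add: field_simps)
      moreover have "A powr (1 - \<alpha>) = A / A powr \<alpha>" using A by (simp add: powr_diff)
      ultimately show ?thesis by (simp add: Lnorm_q_powr_2 AM \<alpha>_def)
    qed
  qed
  with c that show thesis by blast
qed

end

section \<open>Bounds for the Green operator\<close>

context bounded_open_set
begin

definition bdd_data :: "('a \<Rightarrow> real) set" where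
  "bdd_data = {g \<in> borel_measurable M. \<exists>K. \<forall>x. \<bar>g x\<bar> \<le> K}"

definition weak_sol :: "('a \<Rightarrow> real) \<Rightarrow> ('a \<Rightarrow> real) \<Rightarrow> bool" where
  "weak_sol g \<phi> \<longleftrightarrow> \<phi> \<in> V \<and> (\<forall>w\<in>V. energy s \<phi> w = (\<integral>x. g x * w x \<partial>M))"

text \<open>Requiring a bound for \<open>\<phi>\<close> at every point makes powers of \<open>\<phi>\<close> available as test functions and as data. Every
  weak solution with bounded data has such a version.\<close>

definition sol :: "('a \<Rightarrow> real) \<Rightarrow> ('a \<Rightarrow> real) \<Rightarrow> bool" where
  "sol g \<phi> \<longleftrightarrow> g \<in> bdd_data \<and> weak_sol g \<phi> \<and> (\<exists>B. \<forall>x. \<bar>\<phi> x\<bar> \<le> B)"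

lemma weak_sol_V: "weak_sol g \<phi> \<Longrightarrow> \<phi> \<in> V"
  unfolding weak_sol_def by (elim conjE)

lemma weak_sol_eq: "weak_sol g \<phi> \<Longrightarrow> w \<in> V \<Longrightarrow> energy s \<phi> w = (\<integral>x. g x * w x \<partial>M)"
  unfolding weak_sol_def by (elim conjE bspec)

lemma weak_solI:
  "\<phi> \<in> V \<Longrightarrow> (\<And>w. w \<in> V \<Longrightarrow> energy s \<phi> w = (\<integral>x. g x * w x \<partial>M)) \<Longrightarrow> weak_sol g \<phi>"
  unfolding weak_sol_def by (intro conjI ballI)

lemma bdd_data_bounded: "g \<in> bdd_data \<Longrightarrow> \<exists>K. \<forall>x. \<bar>g x\<bar> \<le> K"
  unfolding bdd_data_def mem_Collect_eq by (elim conjE)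

lemma sol_bounded: "sol g \<phi> \<Longrightarrow> \<exists>B. \<forall>x. \<bar>\<phi> x\<bar> \<le> B"
  unfolding sol_def by (elim conjE)

lemma sol_data: "sol g \<phi> \<Longrightarrow> g \<in> bdd_data"
  unfolding sol_def by (elim conjE)

lemma sol_weak_sol: "sol g \<phi> \<Longrightarrow> weak_sol g \<phi>"
  unfolding sol_def by (elim conjE)

lemma bdd_dataI: "g \<in> borel_measurable M \<Longrightarrow> (\<And>x. \<bar>g x\<bar> \<le> K) \<Longrightarrow> g \<in> bdd_data"
  unfolding bdd_data_def mem_Collect_eq by (intro conjI exI allI)

lemma solI: "g \<in> bdd_data \<Longrightarrow> weak_sol g \<phi> \<Longrightarrow> (\<And>x. \<bar>\<phi> x\<bar> \<le> B) \<Longrightarrow> sol g \<phi>"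
  unfolding sol_def by (intro conjI exI allI)

lemma bdd_data_measurable: "g \<in> bdd_data \<Longrightarrow> g \<in> borel_measurable M"
  unfolding bdd_data_def mem_Collect_eq by (elim conjE)

lemma bdd_data_Lspace:
  assumes "g \<in> bdd_data" "0 < p"
  shows "g \<in> Lspace M (ereal p)"
proof -
  obtain K where "\<And>x. \<bar>g x\<bar> \<le> K" using bdd_data_bounded[OF assms(1)] by blast
  from bounded_Lspace[OF bdd_data_measurable[OF assms(1)] this assms(2)] show ?thesis .
qed

lemma bdd_data_integrable: "g \<in> bdd_data \<Longrightarrow> integrable M g"
  using bdd_data_Lspace[of g 1] Lspace_one[of g M] by (simp only: one_ereal_def zero_less_one)

lemma integrable_data_V:
  assumes "g \<in> bdd_data" "w \<in> V"
  shows "integrable M (\<lambda>x. g x * w x)"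
  by (rule Hoelder(1)[OF bdd_data_Lspace[OF assms(1), of 2] V_L2(1)[OF assms(2)]]) simp_all

lemma V_bounded_data: "\<phi> \<in> V \<Longrightarrow> (\<And>x. \<bar>\<phi> x\<bar> \<le> B) \<Longrightarrow> \<phi> \<in> bdd_data"
  by (rule bdd_dataI[OF V_measurable])

lemma bdd_data_lin:
  assumes "g \<in> bdd_data" "h \<in> bdd_data"
  shows "(\<lambda>x. a * g x + b * h x) \<in> bdd_data"
proof -
  obtain K L where K: "\<And>x. \<bar>g x\<bar> \<le> K" and L: "\<And>x. \<bar>h x\<bar> \<le> L"
    using bdd_data_bounded[OF assms(1)] bdd_data_bounded[OF assms(2)] by blast
  have "\<bar>a * g x + b * h x\<bar> \<le> \<bar>a\<bar> * K + \<bar>b\<bar> * L" for x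
  proof -
    have "\<bar>a * g x + b * h x\<bar> \<le> \<bar>a\<bar> * \<bar>g x\<bar> + \<bar>b\<bar> * \<bar>h x\<bar>"
      by (metis abs_mult abs_triangle_ineq)
    also have "\<dots> \<le> \<bar>a\<bar> * K + \<bar>b\<bar> * L" by (intro add_mono mult_left_mono K L) auto
    finally show ?thesis .
  qed
  note bound = this
  note [measurable] = bdd_data_measurable[OF assms(1)] bdd_data_measurable[OF assms(2)]
  have "(\<lambda>x. a * g x + b * h x) \<in> borel_measurable M" by measurable
  then show ?thesis by (rule bdd_dataI[OF _ bound])
qed

lemma weak_sol_lin:
  assumes "g \<in> bdd_data" "h \<in> bdd_data" "weak_sol g \<phi>" "weak_sol h \<zeta>"
  shows "weak_sol (\<lambda>x. a * g x + b * h x) (\<lambda>x. a * \<phi> x + b * \<zeta> x)"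
proof -
  note V = weak_sol_V[OF assms(3)] weak_sol_V[OF assms(4)]
  have "energy s (\<lambda>x. a * \<phi> x + b * \<zeta> x) w = (\<integral>x. (a * g x + b * h x) * w x \<partial>M)" if w: "w \<in> V" for w
  proof -
    have "energy s (\<lambda>x. a * \<phi> x + b * \<zeta> x) w = a * (\<integral>x. g x * w x \<partial>M) + b * (\<integral>x. h x * w x \<partial>M)"
      by (simp only: energy_lin[OF V w] weak_sol_eq[OF assms(3) w] weak_sol_eq[OF assms(4) w])
    also have "\<dots> = (\<integral>x. a * (g x * w x) + b * (h x * w x) \<partial>M)"
      using integrable_data_V[OF assms(1) w] integrable_data_V[OF assms(2) w] by simp
    finally show ?thesis by (simp add: distrib_right mult.assoc)
  qed
  then show ?thesis by (rule weak_solI[OF V_lin[OF V]])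
qed

lemma sol_diff:
  assumes "sol g \<phi>" "sol h \<zeta>"
  shows "sol (\<lambda>x. g x - h x) (\<lambda>x. \<phi> x - \<zeta> x)"
proof -
  obtain A B where "\<And>x. \<bar>\<phi> x\<bar> \<le> A" "\<And>x. \<bar>\<zeta> x\<bar> \<le> B" using sol_bounded[OF assms(1)] sol_bounded[OF assms(2)] by blast
  then have bound: "\<bar>\<phi> x - \<zeta> x\<bar> \<le> A + B" for x
    by (rule order_trans[OF abs_triangle_ineq4 add_mono])
  have "(\<lambda>x. g x - h x) \<in> bdd_data"
    using bdd_data_lin[OF sol_data[OF assms(1)] sol_data[OF assms(2)], of 1 "-1"] by simp
  moreover have "weak_sol (\<lambda>x. g x - h x) (\<lambda>x. \<phi> x - \<zeta> x)"
    using weak_sol_lin[OF sol_data[OF assms(1)] sol_data[OF assms(2)] sol_weak_sol[OF assms(1)] sol_weak_sol[OF assms(2)], of 1 "-1"]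
    by simp
  ultimately show ?thesis by (rule solI[OF _ _ bound])
qed

lemma weak_sol_symmetric:
  assumes "weak_sol g \<phi>" "weak_sol h \<zeta>"
  shows "(\<integral>x. g x * \<zeta> x \<partial>M) = (\<integral>x. h x * \<phi> x \<partial>M)"
  using weak_sol_eq[OF assms(1) weak_sol_V[OF assms(2)]] weak_sol_eq[OF assms(2) weak_sol_V[OF assms(1)]]
    energy_sym[of \<phi> \<zeta>] by simp

text \<open>This is applied to a solution \<open>u\<close> and nonlinear functions \<open>v\<close> and \<open>w\<close> of \<open>u\<close>: \<open>energy s u v\<close> is then the
  pairing of the data with \<open>v\<close>, and it controls the energy of \<open>w\<close>.\<close>

lemma energy_le:
  assumes V: "u \<in> V" "v \<in> V" "w \<in> V"
    and le: "\<And>x y. (w x - w y)\<^sup>2 \<le> C * ((u x - u y) * (v x - v y))"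
  shows "energy s w w \<le> C * energy s u v"
proof -
  have "energy s w w \<le> (\<integral>p. C * gagl s u v p \<partial>(lborel \<Otimes>\<^sub>M lborel))"
    unfolding energy_def
  proof (rule integral_mono[OF integrable_gagl[OF V(3,3)]])
    show "integrable (lborel \<Otimes>\<^sub>M lborel) (\<lambda>p. C * gagl s u v p)" using integrable_gagl[OF V(1,2)] by simp
    show "gagl s w w p \<le> C * gagl s u v p" for p
      using le[of "fst p" "snd p"] unfolding gagl_def
      by (simp add: power2_eq_square divide_right_mono)
  qed
  then show ?thesis using integrable_gagl[OF V(1,2)] by (simp add: energy_def)
qed

text \<open>Stampacchia's \<open>L\<^sup>\<infinity>\<close> bound. Testing with \<open>(\<phi> - k)\<^sup>+\<close> cut at height \<open>h - k\<close>, rather than with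
  \<open>(\<phi> - k)\<^sup>+\<close> itself, keeps the test function bounded by \<open>h - k\<close> on \<open>{\<phi> > k}\<close>, so that Hoelder's
  inequality for two factors suffices. The condition \<open>m > N / (2 s)\<close> is superlinearity of the
  resulting decay of level sets.\<close>

lemma Stampacchia_upper:
  assumes m: "m > N / (2 * s)"
  obtains C where "C \<ge> 0"
    "\<And>g \<phi>. g \<in> bdd_data \<Longrightarrow> weak_sol g \<phi> \<Longrightarrow> AE x in M. \<phi> x \<le> C * Lnorm M (ereal m) g"
proof -
  obtain S where S: "S > 0"
      "\<And>w B. w \<in> V \<Longrightarrow> (\<And>x. \<bar>w x\<bar> \<le> B) \<Longrightarrow> (Lnorm M (ereal q) w)\<^sup>2 \<le> S * energy s w w"
    using fractional_Sobolev by blast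
  have m1: "m > 1" using m dim s_pos by (smt (verit) less_divide_eq_1_pos zero_less_mult_iff)
  define m' where "m' = m / (m - 1)"
  have m': "m' > 1" "1 / m + 1 / m' = 1" using m1 by (auto simp: m'_def field_simps)
  define a where "a = q / 2"
  define \<beta> where "\<beta> = a / m'"
  have a: "a > 0" using q_gt by (simp add: a_def)
  have "1 / m < 2 * s / N" using m N_pos s_pos m1 by (simp add: field_simps)
  then have "1 / m' > 2 / q" using m'(2) by (simp add: two_div_q)
  then have \<beta>: "\<beta> > 1" using q_gt m'(1) by (simp add: \<beta>_def a_def field_simps)
  define m0 where "m0 = measure M (space M) + 1"
  have m0: "m0 > 0" by (simp add: m0_def add_nonneg_pos)
  define D where "D = 2 * (m0 powr (\<beta> - 1) / 2 powr (- a / (\<beta> - 1))) powr (1 / a)"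
  have D: "D \<ge> 0" by (simp add: D_def)
  have "AE x in M. \<phi> x \<le> (S * D) * Lnorm M (ereal m) g" if g: "g \<in> bdd_data" and sol: "weak_sol g \<phi>" for g \<phi>
  proof -
    note \<phi> = weak_sol_V[OF sol] and weak = weak_sol_eq[OF sol]
    note [measurable] = V_measurable[OF \<phi>]
    define G where "G = Lnorm M (ereal m) g"
    have G: "G \<ge> 0" by (simp add: G_def Lnorm_nonneg)
    define \<Phi> where "\<Phi> k = measure M {x \<in> space M. k < \<phi> x}" for k
    have sets: "{x \<in> space M. k < \<phi> x} \<in> sets M" for k by measurable
    have \<Phi>0: "0 \<le> \<Phi> k" and \<Phi>m: "\<Phi> k \<le> m0" for k
      using M.bounded_measure[of "{x \<in> space M. k < \<phi> x}"] by (auto simp: \<Phi>_def m0_def)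
    have anti: "\<Phi> h \<le> \<Phi> k" if "k \<le> h" for k h
      unfolding \<Phi>_def using that sets by (intro M.finite_measure_mono) auto
    have decay: "\<Phi> h \<le> (K / (h - k)) powr a * \<Phi> k powr \<beta>" if kh: "0 \<le> k" "k < h" and K: "K > 0" "S * G \<le> K" for k h K
    proof -
      define \<tau> where "\<tau> t = min (max (t - k) 0) (h - k)" for t :: real
      define w where "w x = \<tau> (\<phi> x)" for x
      have \<tau>m: "\<tau> \<in> borel_measurable borel" unfolding \<tau>_def[abs_def] by measurable
      have wV: "w \<in> V"
        unfolding w_def[abs_def]
      proof (rule V_contraction[OF \<phi> \<tau>m, of 1])
        show "\<bar>\<tau> (\<phi> x) - \<tau> (\<phi> y)\<bar> \<le> 1 * \<bar>\<phi> x - \<phi> y\<bar>" for x y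
          unfolding \<tau>_def using kh by (auto simp: min_def max_def)
      qed (use kh in \<open>auto simp: \<tau>_def\<close>)
      have wb: "0 \<le> w x" "w x \<le> h - k" for x using kh by (auto simp: w_def \<tau>_def)
      note [measurable] = V_measurable[OF wV]
      have e1: "energy s w w \<le> 1 * energy s \<phi> w"
      proof (rule energy_le[OF \<phi> wV wV])
        fix x y
        have "(w x - w y) * (w x - w y) \<le> (\<phi> x - \<phi> y) * (w x - w y)"
        proof (cases "\<phi> x \<ge> \<phi> y")
          case True
          then have "w x - w y \<le> \<phi> x - \<phi> y" "0 \<le> w x - w y"
            by (auto simp: w_def \<tau>_def)
          then show ?thesis by (intro mult_right_mono)
        next
          case False
          then have "\<phi> x - \<phi> y \<le> w x - w y" "w x - w y \<le> 0"
            by (auto simp: w_def \<tau>_def)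
          then show ?thesis by (intro mult_right_mono_neg)
        qed
        then show "(w x - w y)\<^sup>2 \<le> 1 * ((\<phi> x - \<phi> y) * (w x - w y))" by (simp add: power2_eq_square)
      qed
      have wL: "w \<in> Lspace M (ereal p)" if "p > 0" for p
        using bounded_Lspace[OF V_measurable[OF wV], of "h - k" p] wb that by auto
      have e2: "energy s \<phi> w \<le> G * Lnorm M (ereal m') w"
        using Hoelder(2)[OF bdd_data_Lspace[OF g] wL m1 m'(1) m'(2)] m1 m'(1) weak[OF wV]
        unfolding G_def by simp
      have e3: "Lnorm M (ereal m') w \<le> (h - k) * \<Phi> k powr (1 / m')"
      proof (rule Lnorm_leI)
        have "(\<integral>x. \<bar>w x\<bar> powr m' \<partial>M) \<le> (\<integral>x. (h - k) powr m' * indicat_real {x \<in> space M. k < \<phi> x} x \<partial>M)"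
        proof (rule integral_mono)
          show "integrable M (\<lambda>x. \<bar>w x\<bar> powr m')" using wL[of m'] m' by (simp add: Lspace_ereal)
          show "integrable M (\<lambda>x. (h - k) powr m' * indicat_real {x \<in> space M. k < \<phi> x} x)"
            using sets[of k] by (intro integrable_mult_right integrable_real_indicator) (auto simp: less_top[symmetric])
          fix x assume x: "x \<in> space M"
          show "\<bar>w x\<bar> powr m' \<le> (h - k) powr m' * indicat_real {x \<in> space M. k < \<phi> x} x"
          proof (cases "k < \<phi> x")
            case True
            then show ?thesis using x wb[of x] m' by (simp add: powr_mono2)
          next
            case False
            then have "w x = 0" using kh by (simp add: w_def \<tau>_def)
            then show ?thesis by simp
          qed
        qed
        also have "\<dots> = (h - k) powr m' * \<Phi> k"
          using sets[of k] by (simp add: \<Phi>_def Int_absorb2)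
        also have "\<dots> = ((h - k) * \<Phi> k powr (1 / m')) powr m'"
          using m' kh \<Phi>0[of k] by (simp add: powr_mult powr_powr)
        finally show "(\<integral>x. \<bar>w x\<bar> powr m' \<partial>M) \<le> ((h - k) * \<Phi> k powr (1 / m')) powr m'" .
      qed (use m' kh in auto)
      have e4: "(h - k) * \<Phi> h powr (1 / q) \<le> Lnorm M (ereal q) w"
      proof -
        have "(h - k) powr q * \<Phi> h = (\<integral>x. (h - k) powr q * indicat_real {x \<in> space M. h < \<phi> x} x \<partial>M)"
          using sets[of h] by (simp add: \<Phi>_def Int_absorb2)
        also have "\<dots> \<le> (\<integral>x. \<bar>w x\<bar> powr q \<partial>M)"
        proof (rule integral_mono)
          show "integrable M (\<lambda>x. \<bar>w x\<bar> powr q)" using wL[of q] q_gt by (simp add: Lspace_ereal)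
          show "integrable M (\<lambda>x. (h - k) powr q * indicat_real {x \<in> space M. h < \<phi> x} x)"
            using sets[of h] by (intro integrable_mult_right integrable_real_indicator) (auto simp: less_top[symmetric])
          fix x
          show "(h - k) powr q * indicat_real {x \<in> space M. h < \<phi> x} x \<le> \<bar>w x\<bar> powr q"
          proof (cases "h < \<phi> x")
            case True
            then have "w x = h - k" using kh by (simp add: w_def \<tau>_def)
            then show ?thesis using kh by (simp add: indicator_def)
          qed simp
        qed
        finally have "((h - k) powr q * \<Phi> h) powr (1 / q) \<le> Lnorm M (ereal q) w"
          unfolding Lnorm_ereal using q_gt \<Phi>0[of h] by (intro powr_mono2) auto
        then show ?thesis using q_gt kh \<Phi>0[of h] by (simp add: powr_mult powr_powr)
      qed
      have "(h - k)\<^sup>2 * (\<Phi> h powr (1 / q))\<^sup>2 = ((h - k) * \<Phi> h powr (1 / q))\<^sup>2"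
        by (simp add: power_mult_distrib)
      also have "\<dots> \<le> (Lnorm M (ereal q) w)\<^sup>2"
        using e4 kh by (intro power_mono) auto
      also have "\<dots> \<le> S * energy s w w" using S(2)[OF wV, of "h - k"] wb by auto
      also have "\<dots> \<le> S * (G * ((h - k) * \<Phi> k powr (1 / m')))"
        using e1 e2 mult_left_mono[OF e3 G] S(1) by (intro mult_left_mono) auto
      also have "\<dots> \<le> K * ((h - k) * \<Phi> k powr (1 / m'))"
        using K kh unfolding mult.assoc[symmetric] by (intro mult_right_mono) auto
      finally have "(h - k) * ((h - k) * (\<Phi> h powr (1 / q))\<^sup>2) \<le> (h - k) * (K * \<Phi> k powr (1 / m'))"
        by (simp only: power2_eq_square[of "h - k"] mult.assoc mult.left_commute[of K])
      then have "(h - k) * (\<Phi> h powr (1 / q))\<^sup>2 \<le> K * \<Phi> k powr (1 / m')"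
        using kh by (subst (asm) mult_le_cancel_left_pos) auto
      then have "(\<Phi> h powr (1 / q))\<^sup>2 \<le> K / (h - k) * \<Phi> k powr (1 / m')"
        using kh by (simp add: pos_le_divide_eq mult.commute)
      then have le: "((\<Phi> h powr (1 / q))\<^sup>2) powr a \<le> (K / (h - k) * \<Phi> k powr (1 / m')) powr a"
        using a by (intro powr_mono2) auto
      have "((\<Phi> h powr (1 / q))\<^sup>2) powr a = ((\<Phi> h powr (1 / q)) powr 2) powr a" by simp
      also have "\<dots> = \<Phi> h powr (1 / q * 2 * a)" by (simp only: powr_powr)
      also have "1 / q * 2 * a = 1" using q_gt by (simp add: a_def)
      finally have "\<Phi> h = ((\<Phi> h powr (1 / q))\<^sup>2) powr a" using \<Phi>0[of h] by simp
      also note le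
      also have "(K / (h - k) * \<Phi> k powr (1 / m')) powr a = (K / (h - k)) powr a * \<Phi> k powr \<beta>"
      proof -
        have "(K / (h - k) * \<Phi> k powr (1 / m')) powr a = (K / (h - k)) powr a * \<Phi> k powr (1 / m' * a)"
          by (simp only: powr_mult powr_powr)
        then show ?thesis by (simp add: \<beta>_def)
      qed
      finally show ?thesis .
    qed
    have step: "AE x in M. \<phi> x \<le> S * (G + inverse (real (Suc n))) * D" for n
    proof -
      \<comment> \<open>The iteration needs \<open>K > 0\<close>, while \<open>G\<close> may be \<open>0\<close>.\<close>
      define K where "K = S * (G + inverse (real (Suc n)))"
      have K: "K > 0" "S * G \<le> K" using S(1) G by (auto simp: K_def add_nonneg_pos)
      have "\<Phi> (K * D) = 0"
        unfolding D_def by (rule De_Giorgi_iteration[OF a \<beta> K(1) m0 \<Phi>0 \<Phi>m anti decay[OF _ _ K]])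
      then have "emeasure M {x \<in> space M. K * D < \<phi> x} = 0"
        by (simp add: \<Phi>_def M.emeasure_eq_measure)
      then have "AE x in M. \<not> K * D < \<phi> x"
        by (subst AE_iff_measurable[OF sets[of "K * D"]]) auto
      then show ?thesis by (simp add: K_def not_less)
    qed
    then have "AE x in M. \<forall>n. \<phi> x \<le> S * (G + inverse (real (Suc n))) * D"
      by (simp add: AE_all_countable)
    then show ?thesis
    proof eventually_elim
      case (elim x)
      have "(\<lambda>n. S * (G + inverse (real (Suc n))) * D) \<longlonglongrightarrow> S * (G + 0) * D"
        by (intro tendsto_intros LIMSEQ_inverse_real_of_nat)
      then have "\<phi> x \<le> S * (G + 0) * D" by (rule LIMSEQ_le_const) (use elim in auto)
      then show ?case by (simp add: G_def mult_ac)
    qed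
  qed
  moreover have "S * D \<ge> 0" using S D by simp
  ultimately show ?thesis using that by blast
qed

lemma Stampacchia:
  assumes m: "m > N / (2 * s)"
  obtains C where "C \<ge> 0"
    "\<And>g \<phi>. g \<in> bdd_data \<Longrightarrow> weak_sol g \<phi> \<Longrightarrow> AE x in M. \<bar>\<phi> x\<bar> \<le> C * Lnorm M (ereal m) g"
proof -
  obtain C where C: "C \<ge> 0"
      "\<And>g \<phi>. g \<in> bdd_data \<Longrightarrow> weak_sol g \<phi> \<Longrightarrow> AE x in M. \<phi> x \<le> C * Lnorm M (ereal m) g"
    using Stampacchia_upper[OF m] by blast
  have "AE x in M. \<bar>\<phi> x\<bar> \<le> C * Lnorm M (ereal m) g" if g: "g \<in> bdd_data" and sol: "weak_sol g \<phi>" for g \<phi>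
  proof -
    have "weak_sol (\<lambda>x. (-1) * g x + 0 * g x) (\<lambda>x. (-1) * \<phi> x + 0 * \<phi> x)"
      by (rule weak_sol_lin[OF g g sol sol])
    from C(2)[OF bdd_data_lin[OF g g] this]
    have "AE x in M. - \<phi> x \<le> C * Lnorm M (ereal m) g"
      by (simp add: Lnorm_def)
    with C(2)[OF g sol] show ?thesis by eventually_elim simp
  qed
  with C(1) that show ?thesis by blast
qed

lemma weak_sol_bounded_version:
  assumes g: "g \<in> bdd_data" and sol: "weak_sol g \<phi>"
  obtains \<zeta> where "sol g \<zeta>" "AE x in M. \<phi> x = \<zeta> x"
proof -
  have "N / (2 * s) + 1 > N / (2 * s)" by simp
  from Stampacchia[OF this] obtain C' where "C' \<ge> 0"
      "\<And>g \<phi>. g \<in> bdd_data \<Longrightarrow> weak_sol g \<phi> \<Longrightarrow> AE x in M. \<bar>\<phi> x\<bar> \<le> C' * Lnorm M (ereal (N / (2 * s) + 1)) g"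
    by blast
  from this(2)[OF g sol] obtain C where "AE x in M. \<bar>\<phi> x\<bar> \<le> C" ..
  note \<phi> = weak_sol_V[OF sol]
  note [measurable] = V_borel[OF \<phi>]
  \<comment> \<open>The modification must vanish where \<open>\<phi>\<close> does, also when the almost-everywhere bound \<open>C\<close> is negative.\<close>
  define \<zeta> where "\<zeta> x = (if \<bar>\<phi> x\<bar> \<le> \<bar>C\<bar> then \<phi> x else 0)" for x
  have eq: "AE x in M. \<phi> x = \<zeta> x"
    using \<open>AE x in M. \<bar>\<phi> x\<bar> \<le> C\<close> by eventually_elim (auto simp: \<zeta>_def)
  then have eq': "AE x in lborel. \<phi> x = \<zeta> x"
    by (subst (asm) AE_M_lborel) (auto simp: \<zeta>_def V_zero[OF \<phi>])
  have \<zeta>b: "\<zeta> \<in> borel_measurable borel" unfolding \<zeta>_def[abs_def] by measurable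
  have \<zeta>z: "\<zeta> x = 0" if "x \<notin> \<Omega>" for x using V_zero[OF \<phi> that] by (simp add: \<zeta>_def)
  have "weak_sol g \<zeta>"
  proof (rule weak_solI)
    show "\<zeta> \<in> V" by (rule V_cong_AE(1)[OF \<phi> \<zeta>b \<zeta>z eq'])
    show "energy s \<zeta> w = (\<integral>x. g x * w x \<partial>M)" if "w \<in> V" for w
      using V_cong_AE(2)[OF \<phi> \<zeta>b \<zeta>z eq' that] weak_sol_eq[OF sol that] by simp
  qed
  moreover have "\<bar>\<zeta> x\<bar> \<le> \<bar>C\<bar>" for x by (simp add: \<zeta>_def)
  ultimately have "sol g \<zeta>" by (rule solI[OF g])
  with eq that show ?thesis by blast
qed

lemma sol_exists:
  assumes g: "g \<in> bdd_data"
  obtains \<phi> where "sol g \<phi>"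
proof -
  obtain K where K: "\<And>x. \<bar>g x\<bar> \<le> K" using bdd_data_bounded[OF g] by blast
  have "AE x in M. \<bar>g x\<bar> \<le> K" by (intro AE_I2 K)
  from weak_solution_exists[OF bdd_data_measurable[OF g] this]
  obtain u where "weak_sol g u" by (blast intro: weak_solI)
  from weak_sol_bounded_version[OF g this] that show ?thesis by blast
qed

lemma sol_V: "sol g \<phi> \<Longrightarrow> \<phi> \<in> V"
  by (rule weak_sol_V[OF sol_weak_sol])

lemma sol_bdd_data: "sol g \<phi> \<Longrightarrow> \<phi> \<in> bdd_data"
  using V_bounded_data[OF sol_V] sol_bounded by blast

text \<open>Boundedness of the Green operator from \<open>L\<^sup>r\<close> to \<open>L\<^sup>\<gamma>\<close>, asked only of bounded data, whose solutions are bounded.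
  Very weak solutions with data in \<open>L\<^sup>r\<close> inherit such bounds by approximation.\<close>

definition green_bound :: "real \<Rightarrow> real \<Rightarrow> bool" where
  "green_bound r \<gamma> \<longleftrightarrow> (\<exists>C\<ge>0. \<forall>g \<phi>. sol g \<phi> \<longrightarrow> Lnorm M (ereal \<gamma>) \<phi> \<le> C * Lnorm M (ereal r) g)"

lemma green_bound_mono:
  assumes gb: "green_bound r \<gamma>" and r: "1 \<le> r" "r \<le> r'" and \<gamma>: "1 \<le> \<gamma>'" "\<gamma>' \<le> \<gamma>"
  shows "green_bound r' \<gamma>'"
proof -
  obtain C where C: "C \<ge> 0" "\<And>g \<phi>. sol g \<phi> \<Longrightarrow> Lnorm M (ereal \<gamma>) \<phi> \<le> C * Lnorm M (ereal r) g"
    using gb by (auto simp: green_bound_def)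
  define A where "A = (measure M (space M) + 1) powr (1 / \<gamma>')"
  define B where "B = (measure M (space M) + 1) powr (1 / r)"
  have AB: "A \<ge> 0" "B \<ge> 0" by (auto simp: A_def B_def)
  have "Lnorm M (ereal \<gamma>') \<phi> \<le> (A * (C * B)) * Lnorm M (ereal r') g" if sol: "sol g \<phi>" for g \<phi>
  proof -
    have g: "g \<in> bdd_data" by (rule sol_data[OF sol])
    have "Lnorm M (ereal \<gamma>') \<phi> \<le> A * Lnorm M (ereal \<gamma>) \<phi>"
      unfolding A_def by (rule M.Lspace_mono(2)[OF bdd_data_Lspace[OF sol_bdd_data[OF sol]]]) (use \<gamma> in auto)
    also have "\<dots> \<le> A * (C * Lnorm M (ereal r) g)"
      by (intro mult_left_mono C(2)[OF sol] AB)
    also have "\<dots> \<le> A * (C * (B * Lnorm M (ereal r') g))"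
      unfolding B_def
      by (intro mult_left_mono M.Lspace_mono(2)[OF bdd_data_Lspace[OF g]] C(1) AB(1)) (use r in auto)
    finally show ?thesis by (simp add: mult.assoc)
  qed
  moreover have "A * (C * B) \<ge> 0" using AB C by simp
  ultimately show ?thesis unfolding green_bound_def by blast
qed

lemma powr_cancel_le:
  fixes A C x y z :: real
  assumes "0 \<le> A" "0 \<le> C" "A powr x \<le> C * A powr y" "x = y + z"
  shows "A powr z \<le> C"
proof (cases "A = 0")
  case False
  then have A: "A > 0" using assms by simp
  then have "A powr y * A powr z \<le> A powr y * C"
    using assms(3) by (simp add: assms(4) powr_add mult.commute)
  then show ?thesis using A by simp
qed (use assms(2) in simp)

text \<open>Testing with \<open>\<phi> \<bar>\<phi>\<bar>\<^bsup>p-2\<^esup>\<close> controls the energy of \<open>\<bar>\<phi>\<bar>\<^bsup>p/2\<^esup>\<close>, to which the Sobolev inequality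
  applies. With \<open>p = 2 \<gamma> / q\<close> both sides become powers of \<open>\<integral> \<bar>\<phi>\<bar>\<^sup>\<gamma>\<close>. The restriction \<open>\<gamma> \<ge> q\<close> makes
  \<open>p \<ge> 2\<close>, so that the test function is a Lipschitz function of the bounded function \<open>\<phi>\<close>.\<close>

lemma green_bound_large:
  assumes \<gamma>: "\<gamma> \<ge> q" and r: "1 / r = 2 * s / N + 1 / \<gamma>"
  shows "green_bound r \<gamma>"
proof -
  obtain S where S: "S > 0"
      "\<And>w B. w \<in> V \<Longrightarrow> (\<And>x. \<bar>w x\<bar> \<le> B) \<Longrightarrow> (Lnorm M (ereal q) w)\<^sup>2 \<le> S * energy s w w"
    using fractional_Sobolev by blast
  have \<gamma>0: "\<gamma> > 0" using \<gamma> q_gt by simp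
  have "1 / \<gamma> \<le> 1 / q" using \<gamma> q_gt by (intro divide_left_mono) auto
  moreover have "2 / q = 1 / q + 1 / q" "1 / q > 0" "2 * s / N > 0" "1 / \<gamma> > 0"
    using s_pos N_pos q_gt \<gamma>0 by auto
  ultimately have "1 / r < 1" "0 < 1 / r"
    using r two_div_q by linarith+
  then have r1: "r > 1" by (simp add: divide_less_eq_1 zero_less_divide_iff)
  define p where "p = 2 * \<gamma> / q"
  have p: "p \<ge> 2" using \<gamma> q_gt by (simp add: p_def field_simps)
  define r' where "r' = r / (r - 1)"
  have r': "r' > 1" "1 / r + 1 / r' = 1" using r1 by (auto simp: r'_def field_simps)
  have r'q: "1 / r' = 2 / q - 1 / \<gamma>" using r r'(2) two_div_q by simp
  have pr': "(p - 1) * r' = \<gamma>"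
  proof -
    have "(p - 1) / \<gamma> = 1 / r'" using \<gamma>0 q_gt unfolding r'q p_def by (simp add: field_simps)
    then show ?thesis using \<gamma>0 r'(1) by (simp add: field_simps)
  qed
  define C where "C = S * (p\<^sup>2 / 4)"
  have C: "C \<ge> 0" using S by (simp add: C_def)
  have "Lnorm M (ereal \<gamma>) \<phi> \<le> C * Lnorm M (ereal r) g" if sol: "sol g \<phi>" for g \<phi>
  proof -
    have g: "g \<in> bdd_data" and \<phi>: "\<phi> \<in> V" using sol_data[OF sol] sol_V[OF sol] .
    obtain B where B: "\<And>x. \<bar>\<phi> x\<bar> \<le> B" using sol_bounded[OF sol] by blast
    have B0: "B \<ge> 0" using B[of undefined] by linarith
    define F where "F x = \<bar>\<phi> x\<bar> powr (p / 2)" for x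
    define w where "w x = spow (p - 1) (\<phi> x)" for x
    define A where "A = (\<integral>x. \<bar>\<phi> x\<bar> powr \<gamma> \<partial>M)"
    have A: "A \<ge> 0" by (simp add: A_def)
    have wV: "w \<in> V"
      unfolding w_def[abs_def]
      by (rule V_contraction[OF \<phi> spow_borel spow_zero _ spow_Lipschitz[OF B B]]) (use p in auto)
    have FV: "F \<in> V"
      unfolding F_def[abs_def]
    proof (rule V_contraction[OF \<phi>, where h = "\<lambda>t. \<bar>t\<bar> powr (p / 2)" and L = "p / 2 * B powr (p / 2 - 1)"])
      show "\<bar>\<bar>\<phi> x\<bar> powr (p / 2) - \<bar>\<phi> y\<bar> powr (p / 2)\<bar> \<le> p / 2 * B powr (p / 2 - 1) * \<bar>\<phi> x - \<phi> y\<bar>" for x y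
      proof -
        have "\<bar>\<bar>\<phi> x\<bar> powr (p / 2) - \<bar>\<phi> y\<bar> powr (p / 2)\<bar> \<le> p / 2 * B powr (p / 2 - 1) * \<bar>\<bar>\<phi> x\<bar> - \<bar>\<phi> y\<bar>\<bar>"
          using B[of x] B[of y] p by (intro powr_Lipschitz) auto
        also have "\<dots> \<le> p / 2 * B powr (p / 2 - 1) * \<bar>\<phi> x - \<phi> y\<bar>"
          using p by (intro mult_left_mono abs_triangle_ineq3) auto
        finally show ?thesis .
      qed
    qed (use p in auto)
    have Fb: "\<bar>F x\<bar> \<le> B powr (p / 2)" for x
      unfolding F_def abs_of_nonneg[OF powr_ge_zero] using B[of x] p by (intro powr_mono2) auto
    have wb: "\<bar>w x\<bar> \<le> B powr (p - 1)" for x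
      unfolding w_def abs_spow using B[of x] p by (intro powr_mono2) auto
    have "A powr (2 / q) = (Lnorm M (ereal q) F)\<^sup>2"
    proof -
      have "\<bar>F x\<bar> powr q = \<bar>\<phi> x\<bar> powr \<gamma>" for x
        using q_gt by (simp add: F_def powr_powr p_def)
      then show ?thesis by (simp only: Lnorm_q_powr_2 A_def two_div_q)
    qed
    also have "\<dots> \<le> S * energy s F F" by (rule S(2)[OF FV Fb])
    also have "\<dots> \<le> S * (p\<^sup>2 / 4 * energy s \<phi> w)"
      using S(1) Stroock_Varopoulos[OF p] unfolding F_def w_def
      by (intro mult_left_mono energy_le[OF \<phi> wV[unfolded w_def[abs_def]] FV[unfolded F_def[abs_def]]]) auto
    also have "energy s \<phi> w = (\<integral>x. g x * w x \<partial>M)"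
      by (rule weak_sol_eq[OF sol_weak_sol[OF sol] wV])
    also have "S * (p\<^sup>2 / 4 * (\<integral>x. g x * w x \<partial>M)) \<le> S * (p\<^sup>2 / 4 * (Lnorm M (ereal r) g * A powr (1 / r')))"
    proof -
      have "Lnorm M (ereal r') w = A powr (1 / r')"
        by (simp add: Lnorm_ereal w_def abs_spow powr_powr pr' A_def)
      moreover have "\<bar>\<integral>x. g x * w x \<partial>M\<bar> \<le> Lnorm M (ereal r) g * Lnorm M (ereal r') w"
        using r1 r' by (intro Hoelder(2) bdd_data_Lspace g V_bounded_data[OF wV wb]) auto
      ultimately show ?thesis using S(1) by (intro mult_left_mono) auto
    qed
    finally have "A powr (2 / q) \<le> (C * Lnorm M (ereal r) g) * A powr (1 / r')"
      by (simp add: C_def mult_ac)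
    note le = this
    have "A powr (1 / \<gamma>) \<le> C * Lnorm M (ereal r) g"
      by (rule powr_cancel_le[OF A _ le]) (use C Lnorm_nonneg[of M r g] r'q in auto)
    then show ?thesis by (simp add: Lnorm_ereal A_def)
  qed
  with C show ?thesis unfolding green_bound_def by blast
qed

text \<open>The Green operator is symmetric, so its boundedness can be dualised by testing against
  \<open>\<phi> \<bar>\<phi>\<bar>\<^bsup>\<gamma>-2\<^esup>\<close>, which is again bounded data.\<close>

lemma green_bound_dual_aux:
  assumes \<gamma>: "1 < \<gamma>" "1 / \<gamma> + 1 / \<gamma>' = 1" and C: "C \<ge> 0"
    and bound: "\<And>h \<zeta>. sol h \<zeta> \<Longrightarrow> (\<integral>x. g x * \<zeta> x \<partial>M) \<le> C * Lnorm M (ereal \<gamma>') h"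
    and sol: "sol g \<phi>"
  shows "Lnorm M (ereal \<gamma>) \<phi> \<le> C"
proof -
  obtain B where B: "\<And>x. \<bar>\<phi> x\<bar> \<le> B" using sol_bounded[OF sol] by blast
  define h where "h x = spow (\<gamma> - 1) (\<phi> x)" for x
  define A where "A = (\<integral>x. \<bar>\<phi> x\<bar> powr \<gamma> \<partial>M)"
  have A: "A \<ge> 0" by (simp add: A_def)
  have "h \<in> bdd_data"
  proof -
    note [measurable] = V_borel[OF sol_V[OF sol]]
    have "h \<in> borel_measurable borel" unfolding h_def[abs_def] by measurable
    then have "h \<in> borel_measurable M" by (rule lebesgue_on_borel)
    moreover have "\<bar>h x\<bar> \<le> B powr (\<gamma> - 1)" for x
      unfolding h_def abs_spow using B[of x] \<gamma> by (intro powr_mono2) auto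
    ultimately show ?thesis by (rule bdd_dataI)
  qed
  then obtain \<zeta> where \<zeta>: "sol h \<zeta>" using sol_exists by blast
  have g': "(\<gamma> - 1) * \<gamma>' = \<gamma>"
  proof -
    have "\<gamma>' \<noteq> 0" using \<gamma> by auto
    then show ?thesis using \<gamma> by (simp add: field_simps)
  qed
  have "A powr 1 = A" using A by simp
  also have "A = (\<integral>x. h x * \<phi> x \<partial>M)"
  proof -
    have "h x * \<phi> x = \<bar>\<phi> x\<bar> powr \<gamma>" for x
      using mult_spow[of "\<phi> x" "\<gamma> - 1"] by (simp add: h_def mult.commute)
    then show ?thesis by (simp add: A_def)
  qed
  also have "\<dots> = (\<integral>x. g x * \<zeta> x \<partial>M)"
    by (rule weak_sol_symmetric[OF sol_weak_sol[OF \<zeta>] sol_weak_sol[OF sol]])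
  also have "\<dots> \<le> C * Lnorm M (ereal \<gamma>') h" by (rule bound[OF \<zeta>])
  also have "Lnorm M (ereal \<gamma>') h = A powr (1 / \<gamma>')"
    by (simp add: Lnorm_ereal h_def abs_spow powr_powr g' A_def)
  finally have "A powr (1 / \<gamma>) \<le> C"
    by (rule powr_cancel_le[OF A C]) (use \<gamma> in simp)
  then show ?thesis by (simp add: Lnorm_ereal A_def)
qed

lemma green_bound_dual:
  assumes r: "1 < r" "1 / r + 1 / r' = 1" and \<gamma>: "1 < \<gamma>" "1 / \<gamma> + 1 / \<gamma>' = 1" and gb: "green_bound \<gamma>' r'"
  shows "green_bound r \<gamma>"
proof -
  obtain C where C: "C \<ge> 0" "\<And>h \<zeta>. sol h \<zeta> \<Longrightarrow> Lnorm M (ereal r') \<zeta> \<le> C * Lnorm M (ereal \<gamma>') h"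
    using gb by (auto simp: green_bound_def)
  have r': "r' > 1"
  proof -
    have "1 / r < 1" "0 < 1 / r" using r by auto
    then have "0 < 1 / r'" "1 / r' < 1" using r(2) by linarith+
    then show ?thesis by (simp add: divide_less_eq_1 zero_less_divide_iff)
  qed
  have "Lnorm M (ereal \<gamma>) \<phi> \<le> C * Lnorm M (ereal r) g" if sol: "sol g \<phi>" for g \<phi>
  proof (rule green_bound_dual_aux[OF \<gamma> _ _ sol])
    show "0 \<le> C * Lnorm M (ereal r) g" using C(1) Lnorm_nonneg[of M r g] by simp
    fix h \<zeta> assume \<zeta>: "sol h \<zeta>"
    have g: "g \<in> bdd_data" by (rule sol_data[OF sol])
    have "(\<integral>x. g x * \<zeta> x \<partial>M) \<le> Lnorm M (ereal r) g * Lnorm M (ereal r') \<zeta>"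
      using Hoelder(2)[OF bdd_data_Lspace[OF g] bdd_data_Lspace[OF sol_bdd_data[OF \<zeta>]] r(1) r' r(2)] r r'
      by simp
    also have "\<dots> \<le> Lnorm M (ereal r) g * (C * Lnorm M (ereal \<gamma>') h)"
      by (intro mult_left_mono C(2)[OF \<zeta>] Lnorm_nonneg)
    finally show "(\<integral>x. g x * \<zeta> x \<partial>M) \<le> C * Lnorm M (ereal r) g * Lnorm M (ereal \<gamma>') h"
      by (simp add: mult_ac)
  qed
  with C(1) show ?thesis unfolding green_bound_def by blast
qed

text \<open>The dual of Stampacchia's bound: the exponent \<open>\<gamma>'\<close> conjugate to \<open>\<gamma>\<close> exceeds \<open>N / (2 s)\<close> exactly when
  \<open>\<gamma> < N / (N - 2 s)\<close>.\<close>

lemma green_bound_one: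
  assumes \<gamma>: "1 \<le> \<gamma>" "\<gamma> < N / (N - 2 * s)"
  shows "green_bound 1 \<gamma>"
proof -
  define \<gamma>1 where "\<gamma>1 = (\<gamma> + N / (N - 2 * s)) / 2"
  have \<gamma>1: "1 < \<gamma>1" "\<gamma> \<le> \<gamma>1" "\<gamma>1 < N / (N - 2 * s)"
  proof -
    have "1 < (a + b) / 2 \<and> a \<le> (a + b) / 2 \<and> (a + b) / 2 < b" if "1 \<le> a" "a < b" for a b :: real
      using that by auto
    from this[OF \<gamma>] show "1 < \<gamma>1" "\<gamma> \<le> \<gamma>1" "\<gamma>1 < N / (N - 2 * s)" by (simp_all only: \<gamma>1_def)
  qed
  define \<gamma>' where "\<gamma>' = \<gamma>1 / (\<gamma>1 - 1)"
  have g': "1 / \<gamma>1 + 1 / \<gamma>' = 1" "\<gamma>' > 0" using \<gamma>1 by (auto simp: \<gamma>'_def field_simps)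
  have "1 / \<gamma>1 > (N - 2 * s) / N" using \<gamma>1 dim N_pos by (simp add: field_simps)
  then have "1 / \<gamma>' < 2 * s / N" using g' N_pos by (simp add: diff_divide_distrib)
  then have "\<gamma>' > N / (2 * s)" using g'(2) s_pos N_pos by (simp add: field_simps)
  from Stampacchia[OF this] obtain C where C: "C \<ge> 0"
      "\<And>h \<zeta>. h \<in> bdd_data \<Longrightarrow> weak_sol h \<zeta> \<Longrightarrow> AE x in M. \<bar>\<zeta> x\<bar> \<le> C * Lnorm M (ereal \<gamma>') h"
    by blast
  have "Lnorm M (ereal \<gamma>1) \<phi> \<le> C * Lnorm M (ereal 1) g" if sol: "sol g \<phi>" for g \<phi>
  proof (rule green_bound_dual_aux[OF \<gamma>1(1) g'(1) _ _ sol])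
    show "0 \<le> C * Lnorm M (ereal 1) g" using C(1) Lnorm_nonneg[of M 1 g] by simp
    fix h \<zeta> assume \<zeta>: "sol h \<zeta>"
    have g: "g \<in> bdd_data" by (rule sol_data[OF sol])
    have "\<bar>\<integral>x. g x * \<zeta> x \<partial>M\<bar> \<le> (C * Lnorm M (ereal \<gamma>') h) * (\<integral>x. \<bar>g x\<bar> \<partial>M)"
      by (intro integral_mult_bound_AE bdd_data_integrable[OF g] V_measurable[OF sol_V[OF \<zeta>]] C(2)
          sol_data[OF \<zeta>] sol_weak_sol[OF \<zeta>])
    then show "(\<integral>x. g x * \<zeta> x \<partial>M) \<le> C * Lnorm M (ereal 1) g * Lnorm M (ereal \<gamma>') h"
      unfolding one_ereal_def[symmetric] Lnorm_one by (simp add: mult_ac)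
  qed
  with C(1) have "green_bound 1 \<gamma>1" unfolding green_bound_def by blast
  then show ?thesis by (rule green_bound_mono[OF _ _ order_refl \<gamma>(1) \<gamma>1(2)]) simp
qed

text \<open>Let \<open>\<delta>\<close> be the critical exponent belonging to \<open>r\<close>. If \<open>\<delta> < q\<close>, then the conjugate \<open>r'\<close> of \<open>r\<close> satisfies \<open>r' > q\<close>, and
  \<open>r'\<close> is the critical exponent belonging to the conjugate of \<open>\<delta>\<close>; so one of the two sides of the duality is
  always in the range of the power test functions.\<close>

lemma green_bound_critical:
  assumes r: "1 < r" "r < N / (2 * s)" and \<gamma>: "1 \<le> \<gamma>" "\<gamma> \<le> N * r / (N - 2 * s * r)"
  shows "green_bound r \<gamma>"
proof -
  define \<delta> where "\<delta> = N * r / (N - 2 * s * r)"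
  have pos: "N - 2 * s * r > 0" using r s_pos by (simp add: field_simps)
  have i\<delta>: "1 / \<delta> = 1 / r - 2 * s / N"
    using pos r N_pos by (simp add: \<delta>_def field_simps)
  have \<delta>0: "\<delta> > 0" using pos r N_pos by (simp add: \<delta>_def)
  have ir: "1 / r < 1" using r by simp
  have "2 * s / N > 0" using s_pos N_pos by simp
  then have "1 / \<delta> < 1" using i\<delta> ir by linarith
  then have \<delta>1: "\<delta> > 1" using \<delta>0 by (simp add: divide_less_eq_1)
  have "green_bound r \<delta>"
  proof (cases "\<delta> \<ge> q")
    case True
    then show ?thesis using i\<delta> by (intro green_bound_large) auto
  next
    case False
    define r' where "r' = r / (r - 1)"
    define \<delta>' where "\<delta>' = \<delta> / (\<delta> - 1)"
    have r': "1 / r + 1 / r' = 1" "r' > 0" and d': "1 / \<delta> + 1 / \<delta>' = 1"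
      using r \<delta>1 by (auto simp: r'_def \<delta>'_def field_simps)
    have "1 / q < 1 / \<delta>" using False \<delta>0 q_gt by (intro divide_strict_left_mono) auto
    then have "1 / r' < 1 / q" using r' i\<delta> two_div_q by simp
    then have "r' \<ge> q" using r'(2) q_gt by (simp add: field_simps)
    moreover have "1 / \<delta>' = 2 * s / N + 1 / r'" using r' d' i\<delta> by simp
    ultimately have "green_bound \<delta>' r'" by (rule green_bound_large)
    then show ?thesis by (rule green_bound_dual[OF r(1) r'(1) \<delta>1 d'])
  qed
  then show ?thesis
    by (rule green_bound_mono[OF _ _ order_refl \<gamma>(1) \<gamma>(2)[folded \<delta>_def]]) (use r in simp)
qed

text \<open>A critical pair \<open>1 / \<rho> = 2 s / N + 1 / \<delta>\<close> has \<open>\<rho> < N / (2 s) \<le> r\<close>, however large \<open>\<delta>\<close> is.\<close>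

lemma green_bound_supercritical:
  assumes r: "r \<ge> N / (2 * s)" and \<gamma>: "1 \<le> \<gamma>"
  shows "green_bound r \<gamma>"
proof -
  define \<delta> where "\<delta> = max \<gamma> q"
  define \<rho> where "\<rho> = 1 / (2 * s / N + 1 / \<delta>)"
  have \<delta>: "\<delta> \<ge> q" "\<gamma> \<le> \<delta>" "\<delta> > 0" using q_gt by (auto simp: \<delta>_def)
  have sN: "2 * s / N > 0" using s_pos N_pos by simp
  have "1 / \<delta> \<le> 1 / q" using \<delta> q_gt by (intro divide_left_mono) auto
  moreover have "2 / q = 1 / q + 1 / q" by simp
  moreover have "1 / q > 0" using q_gt by simp
  ultimately have lt: "2 * s / N + 1 / \<delta> \<le> 1" using two_div_q by linarith
  have gt: "2 * s / N + 1 / \<delta> \<ge> 2 * s / N" using \<delta> by simp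
  have "green_bound \<rho> \<delta>"
    using \<delta> by (intro green_bound_large) (auto simp: \<rho>_def)
  moreover have "1 \<le> \<rho>"
  proof -
    have "2 * s / N + 1 / \<delta> > 0" using sN \<delta>(3) by (simp add: add_pos_pos)
    then show ?thesis using lt unfolding \<rho>_def by (subst le_divide_eq_1_pos)
  qed
  moreover have "\<rho> \<le> r"
  proof -
    have "\<rho> \<le> 1 / (2 * s / N)" unfolding \<rho>_def using gt sN \<delta>(3) by (intro divide_left_mono mult_pos_pos add_pos_pos) auto
    then show ?thesis using r by simp
  qed
  ultimately show ?thesis by (rule green_bound_mono[OF _ _ _ \<gamma> \<delta>(2)])
qed

end

section \<open>The fractional Laplacian of a test function\<close>

lemma derivative_bound:
  fixes f :: "'a::euclidean_space \<Rightarrow> real"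
  assumes der: "\<And>x. (f has_derivative F x) (at x)" and bnd: "\<And>x b. b \<in> Basis \<Longrightarrow> \<bar>F x b\<bar> \<le> m b"
  shows "\<bar>f x - f y\<bar> \<le> (\<Sum>b\<in>Basis. m b) * norm (x - y)"
proof -
  have on: "onorm (F z) \<le> (\<Sum>b\<in>Basis. m b)" for z
  proof (rule onorm_le)
    fix v
    have lin: "linear (F z)" using der[of z] has_derivative_linear by blast
    have "F z v = F z (\<Sum>b\<in>Basis. (v \<bullet> b) *\<^sub>R b)" by (simp only: euclidean_representation)
    also have "\<dots> = (\<Sum>b\<in>Basis. (v \<bullet> b) * F z b)" using lin by (simp add: linear_sum linear_scale)
    finally have "norm (F z v) \<le> (\<Sum>b\<in>Basis. \<bar>v \<bullet> b\<bar> * \<bar>F z b\<bar>)"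
      using sum_abs[of "\<lambda>b. (v \<bullet> b) * F z b" Basis] by (simp add: abs_mult)
    also have "\<dots> \<le> (\<Sum>b\<in>Basis. norm v * m b)"
      by (intro sum_mono mult_mono bnd Basis_le_norm) auto
    finally show "norm (F z v) \<le> (\<Sum>b\<in>Basis. m b) * norm v"
      by (simp add: sum_distrib_left mult.commute)
  qed
  have "norm (f x - f y) \<le> (\<Sum>b\<in>Basis. m b) * norm (x - y)"
    by (rule differentiable_bound[OF convex_UNIV has_derivative_at_withinI[OF der] on]) auto
  then show ?thesis by simp
qed

lemma Ck_support_derivative:
  fixes f :: "'a::euclidean_space \<Rightarrow> real"
  shows "{x. frechet_derivative f (at x) v \<noteq> 0} \<subseteq> closure {x. f x \<noteq> 0}"
proof
  fix x assume "x \<in> {x. frechet_derivative f (at x) v \<noteq> 0}"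
  then have ne: "frechet_derivative f (at x) v \<noteq> 0" by simp
  show "x \<in> closure {x. f x \<noteq> 0}"
  proof (rule ccontr)
    assume x: "x \<notin> closure {x. f x \<noteq> 0}"
    have "((\<lambda>x. 0) has_derivative (\<lambda>v. 0)) (at x)" by simp
    then have "(f has_derivative (\<lambda>v. 0)) (at x)"
    proof (rule has_derivative_transform_within_open)
      show "open (- closure {x. f x \<noteq> 0})" by (rule open_Compl[OF closed_closure])
      show "0 = f y" if "y \<in> - closure {x. f x \<noteq> 0}" for y
        using that closure_subset[of "{x. f x \<noteq> 0}"] by auto
    qed (use x in simp)
    from fun_cong[OF frechet_derivative_at[OF this], of v] have "frechet_derivative f (at x) v = 0" by simp
    with ne show False by simp
  qed
qed

lemma Ck_compact_support_Lipschitz: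
  fixes f :: "'a::euclidean_space \<Rightarrow> real"
  assumes f: "Ck (Suc 0) f" and K: "compact K" "{x. f x \<noteq> 0} \<subseteq> K"
  obtains L where "L \<ge> 0" "\<And>x y. \<bar>f x - f y\<bar> \<le> L * norm (x - y)"
proof -
  have "\<exists>m\<ge>0. \<forall>x. \<bar>frechet_derivative f (at x) b\<bar> \<le> m" for b
  proof -
    have "continuous_on UNIV (\<lambda>x. frechet_derivative f (at x) b)" using Ck_SucD(2)[OF f] by simp
    moreover have "{x. frechet_derivative f (at x) b \<noteq> 0} \<subseteq> K"
      using Ck_support_derivative closure_minimal[OF K(2) compact_imp_closed[OF K(1)]] by blast
    ultimately show ?thesis using continuous_compact_support_bounded[OF _ K(1)] by metis
  qed
  then obtain m where m: "\<And>b. m b \<ge> 0" "\<And>b x. \<bar>frechet_derivative f (at x) b\<bar> \<le> m b" by metis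
  show thesis
    by (rule that[of "\<Sum>b\<in>Basis. m b"]) (auto intro: sum_nonneg m derivative_bound[OF Ck_SucD(1)[OF f]])
qed

lemma test_fun_Lipschitz:
  assumes "f \<in> test_fun \<Omega>"
  obtains L where "L \<ge> 0" "\<And>x y. \<bar>f x - f y\<bar> \<le> L * norm (x - y)"
proof -
  have "Ck (Suc 0) f" "compact (closure {x. f x \<noteq> 0})"
    using assms unfolding test_fun_def smooth_fun_def by blast+
  from Ck_compact_support_Lipschitz[OF this closure_subset] that show thesis by metis
qed

text \<open>The second difference is a first difference of \<open>y \<mapsto> f (y + h) - f y\<close>, whose derivative is of size
  \<open>\<parallel>h\<parallel>\<close> because the partial derivatives of \<open>f\<close> are Lipschitz.\<close>

lemma test_fun_second_difference:
  assumes "f \<in> test_fun \<Omega>"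
  obtains C where "C \<ge> 0" "\<And>x h. \<bar>2 * f x - f (x + h) - f (x - h)\<bar> \<le> C * (norm h)\<^sup>2"
proof -
  have f2: "Ck (Suc (Suc 0)) f" and K: "compact (closure {x. f x \<noteq> 0})"
    using assms unfolding test_fun_def smooth_fun_def by blast+
  have "\<exists>L\<ge>0. \<forall>x y. \<bar>frechet_derivative f (at x) b - frechet_derivative f (at y) b\<bar> \<le> L * norm (x - y)" for b
    using Ck_compact_support_Lipschitz[OF Ck_SucD(2)[OF f2] K Ck_support_derivative] by metis
  then obtain L where L: "\<And>b. L b \<ge> 0"
      "\<And>b x y. \<bar>frechet_derivative f (at x) b - frechet_derivative f (at y) b\<bar> \<le> L b * norm (x - y)"
    by metis
  have "\<bar>2 * f x - f (x + h) - f (x - h)\<bar> \<le> (\<Sum>b\<in>Basis. L b) * (norm h)\<^sup>2" for x h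
  proof -
    define P where "P y = f (y + h) - f y" for y
    have der: "(P has_derivative (\<lambda>v. frechet_derivative f (at (y + h)) v - frechet_derivative f (at y) v)) (at y)" for y
    proof -
      have "((\<lambda>y. y + h) has_derivative (\<lambda>v. v)) (at y)" by (auto intro!: derivative_eq_intros)
      from has_derivative_compose[OF this Ck_SucD(1)[OF f2, of "y + h"]]
      have "((\<lambda>y. f (y + h)) has_derivative frechet_derivative f (at (y + h))) (at y)" by simp
      from has_derivative_diff[OF this Ck_SucD(1)[OF f2, of y]] show ?thesis by (simp add: P_def[abs_def])
    qed
    have "\<bar>P x - P (x - h)\<bar> \<le> (\<Sum>b\<in>Basis. L b * norm h) * norm (x - (x - h))"
    proof (rule derivative_bound[OF der])
      show "\<bar>frechet_derivative f (at (y + h)) b - frechet_derivative f (at y) b\<bar> \<le> L b * norm h" for y b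
        using L(2)[of "y + h" b y] by simp
    qed
    then have "\<bar>P x - P (x - h)\<bar> \<le> (\<Sum>b\<in>Basis. L b) * (norm h)\<^sup>2"
      by (simp add: sum_distrib_right power2_eq_square mult.assoc)
    moreover have "\<bar>2 * f x - f (x + h) - f (x - h)\<bar> = \<bar>P x - P (x - h)\<bar>"
      by (simp add: P_def abs_minus_commute)
    ultimately show ?thesis by simp
  qed
  then show thesis by (rule that[of "\<Sum>b\<in>Basis. L b", rotated]) (intro sum_nonneg L)
qed

lemma dyadic_scale:
  fixes r :: real
  assumes "r \<ge> 1"
  obtains k :: nat where "2 ^ k \<le> r" "r < 2 * 2 ^ k"
proof -
  obtain n :: nat where "r < 2 ^ n" using real_arch_pow[of 2 r] by auto
  moreover have "\<not> r < 2 ^ 0" using assms by simp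
  ultimately obtain k where "\<forall>i\<le>k. \<not> r < 2 ^ i" "r < 2 ^ Suc k"
    using ex_least_nat_less[of "\<lambda>n. r < 2 ^ n" n] by auto
  then show thesis using that[of k] by (auto simp: not_less)
qed

lemma term_le_suminf: "f k \<le> (\<Sum>j. f j)" for f :: "nat \<Rightarrow> ennreal"
  using sum_le_suminf[of f "{k}"] by simp

text \<open>The part of the Levy measure of the fractional Laplacian seen by functions with bounded
  second differences is finite: on the dyadic shells its mass is geometric, with ratio \<open>2\<^bsup>-2s\<^esup>\<close> towards
  infinity and \<open>2\<^bsup>-(2-2s)\<^esup>\<close> towards the origin.\<close>

lemma integrable_truncated_kernel:
  fixes s :: real
  assumes s: "0 < s" "s < 1"
  shows "integrable lborel (\<lambda>h::'a::euclidean_space. min 1 ((norm h)\<^sup>2) / norm h powr (real DIM('a) + 2 * s))"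
proof -
  let ?N = "real DIM('a)"
  let ?f = "\<lambda>h::'a. min 1 ((norm h)\<^sup>2) / norm h powr (?N + 2 * s)"
  define \<omega> where "\<omega> = unit_ball_vol ?N"
  have \<omega>: "\<omega> \<ge> 0" by (simp add: \<omega>_def)
  define a where "a k = ((2::real) ^ k) powr (- (?N + 2 * s))" for k :: nat
  define b where "b k = ((2::real) ^ k) powr (?N + 2 * s - 2) * 2 powr (?N + 2 * s)" for k :: nat
  define A where "A k = ball (0::'a) (2 * 2 ^ k)" for k :: nat
  define B where "B k = ball (0::'a) (2 / 2 ^ k)" for k :: nat
  have up: "ennreal (?f h) \<le> (\<Sum>k. ennreal (a k) * indicator (A k) h) + (\<Sum>k. ennreal (b k) * indicator (B k) h)" for h
  proof (cases "norm h \<ge> 1")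
    case True
    then obtain k where k: "2 ^ k \<le> norm h" "norm h < 2 * 2 ^ k" by (rule dyadic_scale)
    have "?f h \<le> 1 / norm h powr (?N + 2 * s)" by (intro divide_right_mono) auto
    also have "\<dots> \<le> 1 / (2 ^ k) powr (?N + 2 * s)"
      using k True s by (intro divide_left_mono powr_mono2 mult_pos_pos) auto
    also have "\<dots> = a k" by (simp only: a_def powr_minus_divide)
    finally have "ennreal (?f h) \<le> ennreal (a k) * indicator (A k) h" using k by (simp add: A_def ennreal_leI)
    also have "\<dots> \<le> (\<Sum>j. ennreal (a j) * indicator (A j) h)" by (rule term_le_suminf)
    finally show ?thesis by (simp add: add_increasing2)
  next
    case False
    show ?thesis
    proof (cases "h = 0")
      case nz: False
      then have n0: "norm h > 0" by simp
      have "1 / norm h \<ge> 1" using False n0 by simp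
      then obtain k where k: "2 ^ k \<le> 1 / norm h" "1 / norm h < 2 * 2 ^ k" by (rule dyadic_scale)
      have k1: "norm h \<le> 1 / 2 ^ k" and k2: "1 / (2 * 2 ^ k) \<le> norm h"
        using k n0 by (auto simp: field_simps)
      have "?f h \<le> (norm h)\<^sup>2 / norm h powr (?N + 2 * s)" by (intro divide_right_mono) auto
      also have "\<dots> \<le> (1 / 2 ^ k)\<^sup>2 / (1 / (2 * 2 ^ k)) powr (?N + 2 * s)"
        using k1 k2 s by (intro frac_le power_mono powr_mono2) auto
      also have "\<dots> = b k"
      proof -
        have e1: "(1 / (2 * 2 ^ k)) powr (?N + 2 * s) = 1 / (2 powr (?N + 2 * s) * (2 ^ k) powr (?N + 2 * s))"
          by (simp add: powr_divide powr_mult)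
        have e2: "((2::real) ^ k) powr (?N + 2 * s - 2) = (2 ^ k) powr (?N + 2 * s) / (2 ^ k)\<^sup>2"
          by (simp add: powr_diff)
        show ?thesis unfolding b_def e1 e2 by (simp add: power_one_over field_simps)
      qed
      finally have "?f h \<le> b k" .
      moreover have "h \<in> B k"
      proof -
        have "1 / (2::real) ^ k < 2 / 2 ^ k" by (simp add: divide_strict_right_mono)
        then show ?thesis using k1 by (simp add: B_def)
      qed
      ultimately have "ennreal (?f h) \<le> ennreal (b k) * indicator (B k) h" by (simp add: ennreal_leI)
      also have "\<dots> \<le> (\<Sum>j. ennreal (b j) * indicator (B j) h)" by (rule term_le_suminf)
      finally show ?thesis by (simp add: add_increasing)
    qed simp
  qed
  have pw: "((2::real) ^ k) powr e = (2 powr e) ^ k" for k e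
    by (simp add: powr_powr powr_power mult.commute flip: powr_realpow)
  have sA: "(\<Sum>k. ennreal (a k) * emeasure lborel (A k)) < top"
  proof -
    have "ennreal (a k) * emeasure lborel (A k) = ennreal (\<omega> * 2 ^ DIM('a) * (2 powr (- (2 * s))) ^ k)" for k
    proof -
      have "a k * ((2::real) ^ k) ^ DIM('a) = (2 powr (- (2 * s))) ^ k"
      proof -
        have "((2::real) ^ k) ^ DIM('a) = (2 ^ k) powr ?N" by (simp add: powr_realpow)
        then have "a k * ((2::real) ^ k) ^ DIM('a) = (2 ^ k) powr (- (2 * s))"
          by (simp add: a_def powr_add[symmetric])
        then show ?thesis by (simp only: pw)
      qed
      note key = this
      have "emeasure lborel (A k) = ennreal (\<omega> * (2 * 2 ^ k) ^ DIM('a))"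
        unfolding A_def \<omega>_def by (rule emeasure_ball) simp
      then have "ennreal (a k) * emeasure lborel (A k) = ennreal (a k * (\<omega> * (2 * 2 ^ k) ^ DIM('a)))"
        by (simp add: ennreal_mult' a_def)
      also have "a k * (\<omega> * (2 * 2 ^ k) ^ DIM('a)) = \<omega> * 2 ^ DIM('a) * (a k * (2 ^ k) ^ DIM('a))"
        by (simp only: power_mult_distrib mult_ac)
      finally show ?thesis unfolding key .
    qed
    moreover have "(\<Sum>k. ennreal (\<omega> * 2 ^ DIM('a) * (2 powr (- (2 * s))) ^ k)) \<noteq> top"
    proof (rule ennreal_suminf_neq_top)
      have "2 powr (- (2 * s)) < (1::real)" using powr_less_mono[of "- (2 * s)" 0 2] s by simp
      then show "summable (\<lambda>k. \<omega> * 2 ^ DIM('a) * (2 powr (- (2 * s))) ^ k)"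
        by (intro summable_mult summable_geometric) simp
    qed (use \<omega> in simp)
    ultimately show ?thesis by (simp add: less_top)
  qed
  have sB: "(\<Sum>k. ennreal (b k) * emeasure lborel (B k)) < top"
  proof -
    have "ennreal (b k) * emeasure lborel (B k) = ennreal (2 powr (?N + 2 * s) * \<omega> * 2 ^ DIM('a) * (2 powr (2 * s - 2)) ^ k)" for k
    proof -
      have "((2::real) ^ k) powr (?N + 2 * s - 2) / (2 ^ k) ^ DIM('a) = (2 powr (2 * s - 2)) ^ k"
      proof -
        have "((2::real) ^ k) powr (?N + 2 * s - 2) = (2 ^ k) powr ?N * (2 ^ k) powr (2 * s - 2)"
          by (simp add: powr_add[symmetric] algebra_simps)
        also have "((2::real) ^ k) powr ?N = (2 ^ k) ^ DIM('a)" by (simp add: powr_realpow)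
        finally show ?thesis by (simp add: pw)
      qed
      note key = this
      have "emeasure lborel (B k) = ennreal (\<omega> * (2 / 2 ^ k) ^ DIM('a))"
        unfolding B_def \<omega>_def by (rule emeasure_ball) simp
      then have "ennreal (b k) * emeasure lborel (B k) = ennreal (b k * (\<omega> * (2 / 2 ^ k) ^ DIM('a)))"
        by (simp add: ennreal_mult' b_def)
      also have "b k * (\<omega> * (2 / 2 ^ k) ^ DIM('a)) =
          2 powr (?N + 2 * s) * \<omega> * 2 ^ DIM('a) * (((2::real) ^ k) powr (?N + 2 * s - 2) / (2 ^ k) ^ DIM('a))"
        unfolding b_def power_divide by (simp only: divide_inverse mult_ac)
      finally show ?thesis unfolding key .
    qed
    moreover have "(\<Sum>k. ennreal (2 powr (?N + 2 * s) * \<omega> * 2 ^ DIM('a) * (2 powr (2 * s - 2)) ^ k)) \<noteq> top"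
    proof (rule ennreal_suminf_neq_top)
      have "2 powr (2 * s - 2) < (1::real)" using powr_less_mono[of "2 * s - 2" 0 2] s by simp
      then show "summable (\<lambda>k. 2 powr (?N + 2 * s) * \<omega> * 2 ^ DIM('a) * (2 powr (2 * s - 2)) ^ k)"
        by (intro summable_mult summable_geometric) simp
    qed (use \<omega> in simp)
    ultimately show ?thesis by (simp add: less_top)
  qed
  have "(\<integral>\<^sup>+h. ennreal (?f h) \<partial>lborel) \<le>
      (\<integral>\<^sup>+h. (\<Sum>k. ennreal (a k) * indicator (A k) h) + (\<Sum>k. ennreal (b k) * indicator (B k) h) \<partial>lborel)"
    by (intro nn_integral_mono up)
  also have "\<dots> = (\<Sum>k. ennreal (a k) * emeasure lborel (A k)) + (\<Sum>k. ennreal (b k) * emeasure lborel (B k))"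
  proof -
    have [measurable]: "A k \<in> sets borel" "B k \<in> sets borel" for k by (auto simp: A_def B_def)
    have i: "(\<integral>\<^sup>+h. (\<Sum>k. ennreal (c k) * indicator (D k) h) \<partial>lborel) = (\<Sum>k. ennreal (c k) * emeasure lborel (D k))"
      if [measurable]: "\<And>k. D k \<in> sets borel" for c :: "nat \<Rightarrow> real" and D :: "nat \<Rightarrow> 'a set"
      by (subst nn_integral_suminf) (measurable, simp add: nn_integral_cmult_indicator that)
    show ?thesis by (subst nn_integral_add) (measurable, simp add: i)
  qed
  also have "\<dots> < top" using sA sB by simp
  finally have "(\<integral>\<^sup>+h. ennreal (norm (?f h)) \<partial>lborel) < \<infinity>" by simp
  then show ?thesis by (intro integrableI_bounded) measurable
qed

lemma nn_integral_translate:
  fixes f :: "'a::euclidean_space \<Rightarrow> ennreal"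
  assumes "f \<in> borel_measurable borel"
  shows "(\<integral>\<^sup>+h. f (x + h) \<partial>lborel) = (\<integral>\<^sup>+y. f y \<partial>lborel)"
proof -
  have "(\<integral>\<^sup>+y. f y \<partial>distr lborel borel ((+) x)) = (\<integral>\<^sup>+h. f (x + h) \<partial>lborel)"
    using assms by (intro nn_integral_distr) auto
  then show ?thesis by (simp add: lborel_distr_plus)
qed

lemma integral_translate:
  fixes f :: "'a::euclidean_space \<Rightarrow> real"
  assumes "f \<in> borel_measurable borel"
  shows "(\<integral>h. f (x + h) \<partial>lborel) = (\<integral>y. f y \<partial>lborel)"
proof -
  have "(\<integral>y. f y \<partial>distr lborel borel ((+) x)) = (\<integral>h. f (x + h) \<partial>lborel)"
    using assms by (intro integral_distr) auto
  then show ?thesis by (simp add: lborel_distr_plus)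
qed

lemma integrable_translate:
  fixes f :: "'a::euclidean_space \<Rightarrow> real"
  assumes "integrable lborel f"
  shows "integrable lborel (\<lambda>h. f (x + h))"
proof -
  have "integrable (distr lborel borel ((+) x)) f" using assms by (simp add: lborel_distr_plus)
  then show ?thesis using assms by (subst (asm) integrable_distr_eq) auto
qed

context bounded_open_set
begin

text \<open>Up to a constant, \<open>kern h\<close> dominates the squared first differences and the second differences by \<open>h\<close> of a
  test function, divided by \<open>\<parallel>h\<parallel>\<^bsup>N+2s\<^esup>\<close>.\<close>

definition kern :: "'a \<Rightarrow> real" where
  "kern h = min 1 ((norm h)\<^sup>2) / norm h powr (N + 2 * s)"

lemma kern_nonneg: "0 \<le> kern h"
  by (simp add: kern_def)

lemma kern_measurable [measurable]: "kern \<in> borel_measurable borel"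
  unfolding kern_def[abs_def] by measurable

lemma integrable_kern: "integrable lborel kern"
  unfolding kern_def[abs_def] unfolding N_eq by (rule integrable_truncated_kernel[OF s_pos s_less])

lemma emeasure_\<Omega>: "emeasure lborel \<Omega> < \<infinity>"
  using emeasure_bounded_finite[OF bounded_\<Omega>] by simp

lemma V_integrable:
  assumes "w \<in> V"
  shows "integrable lborel w" "integrable M w"
proof -
  have "w \<in> Lspace M (ereal 1)" using M.Lspace_mono(1)[OF V_L2(1)[OF assms], of 1] by simp
  then show "integrable M w" by (simp add: Lspace_one one_ereal_def[symmetric])
  then show "integrable lborel w" using M_lborel(1)[OF V_borel[OF assms] V_zero[OF assms]] by simp
qed

text \<open>A Gagliardo integrand of a test function vanishes unless one of the two points is in \<open>\<Omega>\<close>, so the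
  energy is at most \<open>2 C \<bar>\<Omega>\<bar>\<close> times the integral of \<open>kern\<close>.\<close>

lemma test_fun_V:
  assumes \<eta>: "\<eta> \<in> test_fun \<Omega>"
  shows "\<eta> \<in> V"
proof -
  obtain B where B: "B \<ge> 0" "\<And>x. \<bar>\<eta> x\<bar> \<le> B" using test_fun_bounded[OF \<eta>] by blast
  obtain L where L: "L \<ge> 0" "\<And>x y. \<bar>\<eta> x - \<eta> y\<bar> \<le> L * norm (x - y)" using test_fun_Lipschitz[OF \<eta>] by blast
  note [measurable] = test_fun_borel[OF \<eta>]
  define C where "C = max ((2 * B)\<^sup>2) (L\<^sup>2)"
  have C: "C \<ge> 0" by (simp add: C_def le_max_iff_disj)
  have sq: "(\<eta> x - \<eta> y)\<^sup>2 \<le> C * min 1 ((norm (y - x))\<^sup>2)" for x y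
  proof -
    have "\<bar>\<eta> x - \<eta> y\<bar> \<le> 2 * B" using B(2)[of x] B(2)[of y] by linarith
    from power_mono[OF this, of 2] have 1: "(\<eta> x - \<eta> y)\<^sup>2 \<le> (2 * B)\<^sup>2" by simp
    from power_mono[OF L(2)[of x y], of 2] have 2: "(\<eta> x - \<eta> y)\<^sup>2 \<le> L\<^sup>2 * (norm (y - x))\<^sup>2"
      by (simp add: power_mult_distrib norm_minus_commute)
    show ?thesis
    proof (cases "1 \<le> (norm (y - x))\<^sup>2")
      case True
      then show ?thesis using 1 by (simp add: C_def)
    next
      case False
      have "L\<^sup>2 * (norm (y - x))\<^sup>2 \<le> C * (norm (y - x))\<^sup>2" by (intro mult_right_mono) (auto simp: C_def)
      then show ?thesis using 2 False by simp
    qed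
  qed
  have pt: "gagl s \<eta> \<eta> (x, y) \<le> C * (indicat_real \<Omega> x * kern (y - x)) + C * (indicat_real \<Omega> y * kern (x - y))" for x y
  proof (cases "x \<in> \<Omega> \<or> y \<in> \<Omega>")
    case True
    have "gagl s \<eta> \<eta> (x, y) = (\<eta> x - \<eta> y)\<^sup>2 / norm (y - x) powr (N + 2 * s)"
      by (simp add: gagl_def power2_eq_square norm_minus_commute N_eq)
    also have "\<dots> \<le> C * min 1 ((norm (y - x))\<^sup>2) / norm (y - x) powr (N + 2 * s)"
      by (intro divide_right_mono sq) auto
    also have "\<dots> = C * kern (y - x)" by (simp add: kern_def)
    finally have 1: "gagl s \<eta> \<eta> (x, y) \<le> C * kern (y - x)" .
    have sym: "kern (x - y) = kern (y - x)" by (simp add: kern_def norm_minus_commute)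
    have 2: "0 \<le> C * kern (y - x)" using C kern_nonneg by simp
    show ?thesis using True 1 2 by (auto simp: sym indicator_def)
  next
    case False
    then have "gagl s \<eta> \<eta> (x, y) = 0" using test_fun_zero[OF \<eta>] by (simp add: gagl_def)
    then show ?thesis using False by (simp add: indicator_def)
  qed
  let ?P = "lborel \<Otimes>\<^sub>M (lborel :: 'a measure)"
  define I where "I = (\<integral>\<^sup>+h. ennreal (kern h) \<partial>lborel)"
  have I: "I < \<infinity>" unfolding I_def
    using integrable_kern kern_nonneg by (simp add: nn_integral_eq_integral)
  have inner: "(\<integral>\<^sup>+x. (\<integral>\<^sup>+y. ennreal (C * (indicat_real \<Omega> x * kern (y - x))) \<partial>lborel) \<partial>lborel) < \<infinity>"
  proof -
    have "(\<integral>\<^sup>+y. ennreal (C * (indicat_real \<Omega> x * kern (y - x))) \<partial>lborel) = ennreal C * I * indicator \<Omega> x" for x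
    proof -
      have "(\<integral>\<^sup>+y. ennreal (C * (indicat_real \<Omega> x * kern (y - x))) \<partial>lborel) =
          (\<integral>\<^sup>+y. (ennreal C * indicator \<Omega> x) * ennreal (kern (y - x)) \<partial>lborel)"
        using C kern_nonneg by (intro nn_integral_cong) (auto simp: indicator_def ennreal_mult)
      also have "\<dots> = ennreal C * indicator \<Omega> x * (\<integral>\<^sup>+y. ennreal (kern (y - x)) \<partial>lborel)"
        by (rule nn_integral_cmult) measurable
      also have "(\<integral>\<^sup>+y. ennreal (kern (y - x)) \<partial>lborel) = I"
        using nn_integral_translate[of "\<lambda>y. ennreal (kern y)" "- x"] by (simp add: I_def)
      finally show ?thesis by (simp add: mult_ac)
    qed
    then have "(\<integral>\<^sup>+x. (\<integral>\<^sup>+y. ennreal (C * (indicat_real \<Omega> x * kern (y - x))) \<partial>lborel) \<partial>lborel) = ennreal C * I * emeasure lborel \<Omega>"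
      by (simp add: nn_integral_cmult_indicator)
    also have "\<dots> < \<infinity>" using I emeasure_\<Omega> by (simp add: ennreal_mult_less_top)
    finally show ?thesis .
  qed
  have "(\<integral>\<^sup>+p. ennreal (gagl s \<eta> \<eta> p) \<partial>?P) = (\<integral>\<^sup>+x. (\<integral>\<^sup>+y. ennreal (gagl s \<eta> \<eta> (x, y)) \<partial>lborel) \<partial>lborel)"
    by (rule lborel.nn_integral_fst[symmetric]) measurable
  also have "\<dots> \<le> (\<integral>\<^sup>+x. (\<integral>\<^sup>+y. ennreal (C * (indicat_real \<Omega> x * kern (y - x))) + ennreal (C * (indicat_real \<Omega> y * kern (x - y))) \<partial>lborel) \<partial>lborel)"
    using C kern_nonneg by (intro nn_integral_mono order_trans[OF ennreal_leI[OF pt]]) (simp add: ennreal_plus)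
  also have "\<dots> = (\<integral>\<^sup>+x. (\<integral>\<^sup>+y. ennreal (C * (indicat_real \<Omega> x * kern (y - x))) \<partial>lborel) \<partial>lborel) +
      (\<integral>\<^sup>+x. (\<integral>\<^sup>+y. ennreal (C * (indicat_real \<Omega> y * kern (x - y))) \<partial>lborel) \<partial>lborel)"
    by (subst nn_integral_add[symmetric]) (auto simp: nn_integral_add)
  also have "(\<integral>\<^sup>+x. (\<integral>\<^sup>+y. ennreal (C * (indicat_real \<Omega> y * kern (x - y))) \<partial>lborel) \<partial>lborel) =
      (\<integral>\<^sup>+x. (\<integral>\<^sup>+y. ennreal (C * (indicat_real \<Omega> x * kern (y - x))) \<partial>lborel) \<partial>lborel)"
    by (rule lborel_pair.Fubini') measurable
  also have "(\<integral>\<^sup>+x. (\<integral>\<^sup>+y. ennreal (C * (indicat_real \<Omega> x * kern (y - x))) \<partial>lborel) \<partial>lborel) +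
      (\<integral>\<^sup>+x. (\<integral>\<^sup>+y. ennreal (C * (indicat_real \<Omega> x * kern (y - x))) \<partial>lborel) \<partial>lborel) < \<infinity>"
    using inner by simp
  finally have "(\<integral>\<^sup>+p. ennreal (norm (gagl s \<eta> \<eta> p)) \<partial>?P) < \<infinity>" by (simp add: gagl_nonneg)
  then have "integrable ?P (gagl s \<eta> \<eta>)" by (intro integrableI_bounded) measurable
  moreover have "integrable lborel (\<lambda>x. (\<eta> x)\<^sup>2)"
  proof (rule integrableI_bounded_set[where A = \<Omega> and B = "B\<^sup>2"])
    have "(\<eta> x)\<^sup>2 \<le> B\<^sup>2" for x using power_mono[OF B(2)[of x], of 2] by simp
    then show "AE x in lborel. x \<in> \<Omega> \<longrightarrow> norm ((\<eta> x)\<^sup>2) \<le> B\<^sup>2" by simp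
  qed (use emeasure_\<Omega> test_fun_zero[OF \<eta>] in auto)
  ultimately show ?thesis using test_fun_zero[OF \<eta>] by (simp add: V_def)
qed

text \<open>Shearing \<open>(x, y) = (x, x + h)\<close> and integrating in \<open>x\<close> first moves the differences from \<open>w\<close> to \<open>\<eta>\<close>;
  the resulting second difference of \<open>\<eta>\<close> makes the integral in \<open>h\<close> absolutely convergent.\<close>

lemma test_fun_weak_sol:
  assumes \<eta>: "\<eta> \<in> test_fun \<Omega>"
  obtains g where "g \<in> bdd_data" "weak_sol g \<eta>"
proof -
  let ?P = "lborel \<Otimes>\<^sub>M (lborel :: 'a measure)"
  obtain B where B: "B \<ge> 0" "\<And>x. \<bar>\<eta> x\<bar> \<le> B" using test_fun_bounded[OF \<eta>] by blast
  obtain C2 where C2: "C2 \<ge> 0" "\<And>x h. \<bar>2 * \<eta> x - \<eta> (x + h) - \<eta> (x - h)\<bar> \<le> C2 * (norm h)\<^sup>2"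
    using test_fun_second_difference[OF \<eta>] by blast
  note [measurable] = test_fun_borel[OF \<eta>]
  note \<eta>V = test_fun_V[OF \<eta>]
  define C where "C = max (4 * B) C2"
  have C: "C \<ge> 0" using C2 by (simp add: C_def)
  define T where "T x h = (2 * \<eta> x - \<eta> (x + h) - \<eta> (x - h)) / norm h powr (N + 2 * s)" for x h
  have [measurable]: "(\<lambda>p. T (fst p) (snd p)) \<in> borel_measurable (borel \<Otimes>\<^sub>M borel)"
    unfolding T_def by measurable
  have T: "\<bar>T x h\<bar> \<le> C * kern h" for x h
  proof -
    have "\<bar>2 * \<eta> x - \<eta> (x + h) - \<eta> (x - h)\<bar> \<le> C * min 1 ((norm h)\<^sup>2)"
    proof (cases "1 \<le> (norm h)\<^sup>2")
      case True
      have "\<bar>2 * \<eta> x - \<eta> (x + h) - \<eta> (x - h)\<bar> \<le> 4 * B"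
        using B(2)[of x] B(2)[of "x + h"] B(2)[of "x - h"] by linarith
      then show ?thesis using True by (simp add: C_def)
    next
      case False
      have "C2 * (norm h)\<^sup>2 \<le> C * (norm h)\<^sup>2" by (intro mult_right_mono) (auto simp: C_def)
      with C2(2)[of x h] False show ?thesis by simp
    qed
    then have "\<bar>2 * \<eta> x - \<eta> (x + h) - \<eta> (x - h)\<bar> / norm h powr (N + 2 * s) \<le>
        C * min 1 ((norm h)\<^sup>2) / norm h powr (N + 2 * s)"
      by (rule divide_right_mono) simp
    then show ?thesis by (simp add: T_def kern_def abs_divide)
  qed
  have Tm: "T x \<in> borel_measurable borel" for x unfolding T_def[abs_def] by measurable
  have Ti: "integrable lborel (T x)" for x
  proof (rule Bochner_Integration.integrable_bound)
    show "integrable lborel (\<lambda>h. C * kern h)" using integrable_kern by simp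
    show "AE h in lborel. norm (T x h) \<le> norm (C * kern h)"
      using T C kern_nonneg by (intro AE_I2) (simp add: abs_mult)
  qed (use Tm in simp)
  define g where "g x = (\<integral>h. T x h \<partial>lborel)" for x
  have gb: "\<bar>g x\<bar> \<le> C * (\<integral>h. kern h \<partial>lborel)" for x
  proof -
    have "\<bar>g x\<bar> \<le> (\<integral>h. \<bar>T x h\<bar> \<partial>lborel)" unfolding g_def by (rule integral_abs_bound)
    also have "\<dots> \<le> (\<integral>h. C * kern h \<partial>lborel)"
      using Ti T integrable_kern by (intro integral_mono) auto
    finally show ?thesis by simp
  qed
  have gm: "g \<in> borel_measurable borel"
  proof -
    have "(\<lambda>x. \<integral>h. T x h \<partial>lborel) \<in> borel_measurable lborel"
      by (rule lborel.borel_measurable_lebesgue_integral) (simp add: case_prod_beta')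
    then show ?thesis by (simp add: g_def[abs_def])
  qed
  have gd: "g \<in> bdd_data" by (rule bdd_dataI[OF lebesgue_on_borel[OF gm] gb])
  have "energy s \<eta> w = (\<integral>x. g x * w x \<partial>M)" if w: "w \<in> V" for w
  proof -
    note [measurable] = V_borel[OF w]
    note wi = V_integrable(1)[OF w]
    define Q where "Q p = gagl s \<eta> w (fst p, fst p + snd p)" for p
    have Qm[measurable]: "Q \<in> borel_measurable ?P" unfolding Q_def gagl_def by measurable
    have Qe: "Q (x, h) = (\<eta> x - \<eta> (x + h)) * (w x - w (x + h)) / norm h powr (N + 2 * s)" for x h
      by (simp add: Q_def gagl_def N_eq)
    have gi: "integrable ?P (gagl s \<eta> w)" by (rule integrable_gagl[OF \<eta>V w])
    have g1: "(\<lambda>y. gagl s \<eta> w (x, y)) \<in> borel_measurable borel" for x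
      unfolding gagl_def fst_conv snd_conv by measurable
    have Qi: "integrable ?P Q"
    proof (rule integrableI_bounded)
      have "(\<integral>\<^sup>+p. ennreal (norm (Q p)) \<partial>?P) = (\<integral>\<^sup>+x. (\<integral>\<^sup>+h. ennreal (norm (Q (x, h))) \<partial>lborel) \<partial>lborel)"
        by (rule lborel.nn_integral_fst[symmetric]) measurable
      also have "\<dots> = (\<integral>\<^sup>+x. (\<integral>\<^sup>+y. ennreal (norm (gagl s \<eta> w (x, y))) \<partial>lborel) \<partial>lborel)"
      proof (rule nn_integral_cong)
        fix x
        show "(\<integral>\<^sup>+h. ennreal (norm (Q (x, h))) \<partial>lborel) = (\<integral>\<^sup>+y. ennreal (norm (gagl s \<eta> w (x, y))) \<partial>lborel)"
          using nn_integral_translate[of "\<lambda>y. ennreal (norm (gagl s \<eta> w (x, y)))" x] g1[of x]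
          by (simp add: Q_def)
      qed
      also have "\<dots> = (\<integral>\<^sup>+p. ennreal (norm (gagl s \<eta> w p)) \<partial>?P)"
        by (rule lborel.nn_integral_fst) measurable
      also have "\<dots> < \<infinity>" using gi by (simp add: integrable_iff_bounded)
      finally show "(\<integral>\<^sup>+p. ennreal (norm (Q p)) \<partial>?P) < \<infinity>" .
    qed measurable
    have "energy s \<eta> w = (\<integral>x. (\<integral>y. gagl s \<eta> w (x, y) \<partial>lborel) \<partial>lborel)"
      unfolding energy_def by (rule lborel_pair.integral_fst'[OF gi, symmetric])
    also have "\<dots> = (\<integral>x. (\<integral>h. Q (x, h) \<partial>lborel) \<partial>lborel)"
      using integral_translate[OF g1] by (simp add: Q_def)
    also have "\<dots> = (\<integral>h. (\<integral>x. Q (x, h) \<partial>lborel) \<partial>lborel)"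
      by (rule lborel_pair.Fubini_integral[symmetric]) (simp add: Qi)
    also have "\<dots> = (\<integral>h. (\<integral>x. w x * T x h \<partial>lborel) \<partial>lborel)"
    proof (rule Bochner_Integration.integral_cong[OF refl])
      fix h :: 'a
      have i0: "integrable lborel (\<lambda>x. (\<eta> (a + x) - \<eta> (b + x)) * w x)" for a b
      proof (rule Bochner_Integration.integrable_bound)
        show "integrable lborel (\<lambda>x. 2 * B * w x)" using wi by simp
        show "AE x in lborel. norm ((\<eta> (a + x) - \<eta> (b + x)) * w x) \<le> norm (2 * B * w x)"
        proof (rule AE_I2)
          fix x
          have "\<bar>\<eta> (a + x) - \<eta> (b + x)\<bar> \<le> 2 * B" using B(2)[of "a + x"] B(2)[of "b + x"] by linarith
          then have "\<bar>\<eta> (a + x) - \<eta> (b + x)\<bar> * \<bar>w x\<bar> \<le> 2 * B * \<bar>w x\<bar>" by (rule mult_right_mono) simp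
          then show "norm ((\<eta> (a + x) - \<eta> (b + x)) * w x) \<le> norm (2 * B * w x)"
            using B(1) by (simp add: abs_mult)
        qed
      qed measurable
      have i1: "integrable lborel (\<lambda>x. (\<eta> x - \<eta> (x + h)) * w x)"
        using i0[of 0 h] by (simp add: add.commute)
      have i2: "integrable lborel (\<lambda>x. (\<eta> (x - h) - \<eta> x) * w x)"
        using i0[of "- h" 0] by simp
      have i3: "integrable lborel (\<lambda>x. (\<eta> x - \<eta> (x + h)) * w (x + h))"
        and e3: "(\<integral>x. (\<eta> x - \<eta> (x + h)) * w (x + h) \<partial>lborel) = (\<integral>x. (\<eta> (x - h) - \<eta> x) * w x \<partial>lborel)"
        using integrable_translate[OF i2, of h] integral_translate[of "\<lambda>x. (\<eta> (x - h) - \<eta> x) * w x" h]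
        by (simp_all add: add.commute)
      have "(\<integral>x. Q (x, h) \<partial>lborel) =
          (\<integral>x. ((\<eta> x - \<eta> (x + h)) * w x - (\<eta> x - \<eta> (x + h)) * w (x + h)) / norm h powr (N + 2 * s) \<partial>lborel)"
        by (simp add: Qe right_diff_distrib)
      also have "\<dots> = ((\<integral>x. (\<eta> x - \<eta> (x + h)) * w x \<partial>lborel) - (\<integral>x. (\<eta> (x - h) - \<eta> x) * w x \<partial>lborel)) / norm h powr (N + 2 * s)"
        using i1 i3 by (simp add: e3)
      also have "\<dots> = (\<integral>x. ((\<eta> x - \<eta> (x + h)) * w x - (\<eta> (x - h) - \<eta> x) * w x) / norm h powr (N + 2 * s) \<partial>lborel)"
        using i1 i2 by simp
      also have "\<dots> = (\<integral>x. w x * T x h \<partial>lborel)"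
      proof (rule Bochner_Integration.integral_cong[OF refl])
        fix x
        have "(\<eta> x - \<eta> (x + h)) * w x - (\<eta> (x - h) - \<eta> x) * w x = w x * (2 * \<eta> x - \<eta> (x + h) - \<eta> (x - h))"
          by (simp add: algebra_simps)
        then show "((\<eta> x - \<eta> (x + h)) * w x - (\<eta> (x - h) - \<eta> x) * w x) / norm h powr (N + 2 * s) = w x * T x h"
          by (simp add: T_def)
      qed
      finally show "(\<integral>x. Q (x, h) \<partial>lborel) = (\<integral>x. w x * T x h \<partial>lborel)" .
    qed
    also have "\<dots> = (\<integral>x. (\<integral>h. w x * T x h \<partial>lborel) \<partial>lborel)"
    proof (rule lborel_pair.Fubini_integral)
      show "integrable ?P (case_prod (\<lambda>x h. w x * T x h))"
      proof (rule integrableI_bounded)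
        have "(\<integral>\<^sup>+p. ennreal (norm (case_prod (\<lambda>x h. w x * T x h) p)) \<partial>?P) =
            (\<integral>\<^sup>+x. (\<integral>\<^sup>+h. ennreal (norm (w x * T x h)) \<partial>lborel) \<partial>lborel)"
          by (subst lborel.nn_integral_fst[symmetric]) (simp_all add: case_prod_beta')
        also have "\<dots> \<le> (\<integral>\<^sup>+x. (\<integral>\<^sup>+h. ennreal \<bar>w x\<bar> * ennreal (C * kern h) \<partial>lborel) \<partial>lborel)"
          using T C kern_nonneg
          by (intro nn_integral_mono) (simp add: abs_mult ennreal_mult'[symmetric] ennreal_leI mult_left_mono)
        also have "\<dots> = (\<integral>\<^sup>+x. ennreal \<bar>w x\<bar> \<partial>lborel) * (\<integral>\<^sup>+h. ennreal (C * kern h) \<partial>lborel)"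
          by (simp add: nn_integral_cmult nn_integral_multc)
        also have "\<dots> < \<infinity>"
          using wi integrable_kern kern_nonneg C
          by (simp add: nn_integral_eq_integral ennreal_mult_less_top)
        finally show "(\<integral>\<^sup>+p. ennreal (norm (case_prod (\<lambda>x h. w x * T x h) p)) \<partial>?P) < \<infinity>" .
      qed (simp add: case_prod_beta')
    qed
    also have "\<dots> = (\<integral>x. g x * w x \<partial>lborel)" by (simp add: g_def mult.commute)
    also have "\<dots> = (\<integral>x. g x * w x \<partial>M)"
      using gm V_zero[OF w] by (intro M_lborel(2)[symmetric]) auto
    finally show ?thesis .
  qed
  then have "weak_sol g \<eta>" by (rule weak_solI[OF \<eta>V])
  with gd that show thesis by blast
qed

lemma test_fun_sol:
  assumes \<eta>: "\<eta> \<in> test_fun \<Omega>"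
  obtains g where "sol g \<eta>"
proof -
  obtain g where g: "g \<in> bdd_data" "weak_sol g \<eta>" using test_fun_weak_sol[OF \<eta>] by blast
  obtain B where "\<And>x. \<bar>\<eta> x\<bar> \<le> B" using test_fun_bounded[OF \<eta>] by blast
  from solI[OF g this] that show thesis by blast
qed

lemma test_fun_bdd_data: "\<psi> \<in> test_fun \<Omega> \<Longrightarrow> \<psi> \<in> bdd_data"
  using test_fun_bounded test_fun_measurable bdd_dataI by metis

end

section \<open>Compactness\<close>

definition trunc :: "real \<Rightarrow> real \<Rightarrow> real" where
  "trunc k t = max (- k) (min t k)"

lemma trunc_bounded: "0 \<le> k \<Longrightarrow> \<bar>trunc k t\<bar> \<le> k"
  by (auto simp: trunc_def)

lemma trunc_borel [measurable]: "trunc k \<in> borel_measurable borel"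
  unfolding trunc_def[abs_def] by measurable

lemma trunc_tail:
  assumes "0 < k" "1 \<le> \<gamma>"
  shows "\<bar>t - trunc k t\<bar> \<le> k powr (1 - \<gamma>) * \<bar>t\<bar> powr \<gamma>"
proof (cases "\<bar>t\<bar> \<le> k")
  case True
  then show ?thesis by (auto simp: trunc_def)
next
  case False
  have "\<bar>t - trunc k t\<bar> \<le> \<bar>t\<bar>" using assms by (auto simp: trunc_def)
  also have "\<dots> = \<bar>t\<bar> powr (1 - \<gamma>) * \<bar>t\<bar> powr \<gamma>" using False assms by (simp flip: powr_add)
  also have "\<dots> \<le> k powr (1 - \<gamma>) * \<bar>t\<bar> powr \<gamma>"
    using False assms by (intro mult_right_mono powr_mono2') auto
  finally show ?thesis .
qed

context bounded_open_set
begin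

lemma trunc_V:
  assumes "\<phi> \<in> V" "0 \<le> k"
  shows "(\<lambda>x. trunc k (\<phi> x)) \<in> V"
proof (rule V_contraction[OF assms(1) trunc_borel, of _ 1])
  show "\<bar>trunc k (\<phi> x) - trunc k (\<phi> y)\<bar> \<le> 1 * \<bar>\<phi> x - \<phi> y\<bar>" for x y
    using assms(2) by (auto simp: trunc_def min_def max_def)
qed (use assms(2) in \<open>auto simp: trunc_def\<close>)

text \<open>The truncated solution is a test function with values in \<open>[-k, k]\<close>, and its pairing with \<open>g\<close>
  costs only the \<open>L\<^sup>1\<close> norm of \<open>g\<close>. The solution itself has no such energy bound, which is why
  truncations are used for compactness.\<close>

lemma trunc_energy:
  assumes sol: "sol g \<phi>" and k: "0 \<le> k"
  shows "energy s (\<lambda>x. trunc k (\<phi> x)) (\<lambda>x. trunc k (\<phi> x)) \<le> k * (\<integral>x. \<bar>g x\<bar> \<partial>M)"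
proof -
  let ?w = "\<lambda>x. trunc k (\<phi> x)"
  have w: "?w \<in> V" by (rule trunc_V[OF sol_V[OF sol] k])
  have "energy s ?w ?w \<le> 1 * energy s \<phi> ?w"
  proof (rule energy_le[OF sol_V[OF sol] w w])
    fix x y
    have "(trunc k a - trunc k b) * (trunc k a - trunc k b) \<le> (a - b) * (trunc k a - trunc k b)" for a b
    proof (cases "b \<le> a")
      case True
      then have "trunc k a - trunc k b \<le> a - b" "0 \<le> trunc k a - trunc k b"
        using k by (auto simp: trunc_def)
      then show ?thesis by (intro mult_right_mono)
    next
      case False
      then have "a - b \<le> trunc k a - trunc k b" "trunc k a - trunc k b \<le> 0"
        using k by (auto simp: trunc_def)
      then show ?thesis by (intro mult_right_mono_neg)
    qed
    then show "(?w x - ?w y)\<^sup>2 \<le> 1 * ((\<phi> x - \<phi> y) * (?w x - ?w y))" by (simp add: power2_eq_square)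
  qed
  also have "energy s \<phi> ?w = (\<integral>x. g x * ?w x \<partial>M)" by (rule weak_sol_eq[OF sol_weak_sol[OF sol] w])
  also have "1 * \<dots> \<le> k * (\<integral>x. \<bar>g x\<bar> \<partial>M)"
  proof -
    have "AE x in M. \<bar>?w x\<bar> \<le> k" by (intro AE_I2 trunc_bounded k)
    from integral_mult_bound_AE(2)[OF bdd_data_integrable[OF sol_data[OF sol]] V_measurable[OF w] this]
    show ?thesis by simp
  qed
  finally show ?thesis .
qed

definition average :: "('a \<Rightarrow> real) \<Rightarrow> 'a \<Rightarrow> real \<Rightarrow> real" where
  "average u c \<epsilon> = (\<integral>y. indicat_real (ball c \<epsilon>) y * u y \<partial>lborel) / measure lborel (ball c \<epsilon>)"

lemma measure_ball: "\<epsilon> > 0 \<Longrightarrow> measure lborel (ball (c::'a) \<epsilon>) = unit_ball_vol N * \<epsilon> powr N"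
  using content_ball[of \<epsilon> c] by (simp add: N_eq powr_realpow)

lemma integrable_indicator_ball: "integrable lborel (indicat_real (ball (c::'a) \<epsilon>))"
  using emeasure_lborel_ball_finite[of c \<epsilon>] by (intro integrable_real_indicator) auto

lemma integrable_ball_mult:
  assumes "u \<in> V"
  shows "integrable lborel (\<lambda>y. indicat_real (ball c \<epsilon>) y * u y)"
  using integrable_real_mult_indicator[OF _ V_integrable(1)[OF assms], of "ball c \<epsilon>"] by (simp add: mult.commute)

lemma average_bounded:
  assumes u: "u \<in> V" and K: "\<And>x. \<bar>u x\<bar> \<le> K" and \<epsilon>: "\<epsilon> > 0"
  shows "\<bar>average u c \<epsilon>\<bar> \<le> K"
proof -
  have b: "measure lborel (ball c \<epsilon>) > 0" using \<epsilon> N_pos by (simp add: measure_ball)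
  have "\<bar>\<integral>y. indicat_real (ball c \<epsilon>) y * u y \<partial>lborel\<bar> \<le> (\<integral>y. \<bar>indicat_real (ball c \<epsilon>) y * u y\<bar> \<partial>lborel)"
    by (rule integral_abs_bound)
  also have "\<dots> \<le> (\<integral>y. K * indicat_real (ball c \<epsilon>) y \<partial>lborel)"
  proof (rule integral_mono)
    show "integrable lborel (\<lambda>y. \<bar>indicat_real (ball c \<epsilon>) y * u y\<bar>)" using integrable_ball_mult[OF u] by simp
    show "integrable lborel (\<lambda>y. K * indicat_real (ball c \<epsilon>) y)" using integrable_indicator_ball by simp
    show "\<bar>indicat_real (ball c \<epsilon>) y * u y\<bar> \<le> K * indicat_real (ball c \<epsilon>) y" for y
      using K[of y] by (simp add: indicator_def)
  qed
  also have "\<dots> = K * measure lborel (ball c \<epsilon>)" by simp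
  finally show ?thesis using b by (simp add: average_def abs_divide pos_divide_le_eq)
qed

lemma average_diff:
  assumes "u \<in> V" "v \<in> V"
  shows "average (\<lambda>x. u x - v x) c \<epsilon> = average u c \<epsilon> - average v c \<epsilon>"
  using integrable_ball_mult[OF assms(1)] integrable_ball_mult[OF assms(2)]
  by (simp add: average_def right_diff_distrib diff_divide_distrib)

text \<open>The oscillation of \<open>u\<close> around its averages over balls of radius \<open>\<epsilon>\<close> is controlled by the energy,
  because \<open>\<bar>x - y\<bar>\<^bsup>N+2s\<^esup> \<le> (2\<epsilon>)\<^bsup>N+2s\<^esup>\<close> for two points of one such ball. The elementary inequality
  \<open>\<bar>d\<bar> \<le> \<delta> + d\<^sup>2 / (4\<delta>)\<close> replaces the Cauchy--Schwarz inequality.\<close>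

lemma L1_average_estimate:
  obtains C where "C \<ge> 0"
    "\<And>u \<epsilon> \<delta> T. u \<in> V \<Longrightarrow> \<epsilon> > 0 \<Longrightarrow> \<delta> > 0 \<Longrightarrow> finite T \<Longrightarrow> \<Omega> \<subseteq> (\<Union>c\<in>T. ball c \<epsilon>) \<Longrightarrow>
      (\<integral>x. \<bar>u x\<bar> \<partial>M) \<le> measure lborel \<Omega> * ((\<Sum>c\<in>T. \<bar>average u c \<epsilon>\<bar>) + \<delta>) + C * \<epsilon> powr (2 * s) / \<delta> * energy s u u"
proof -
  define \<omega> where "\<omega> = unit_ball_vol N"
  have \<omega>: "\<omega> > 0" using N_pos by (simp add: \<omega>_def)
  define C where "C = 2 powr (N + 2 * s) / (4 * \<omega>)"
  have C: "C \<ge> 0" using \<omega> by (simp add: C_def)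
  have "(\<integral>x. \<bar>u x\<bar> \<partial>M) \<le> measure lborel \<Omega> * ((\<Sum>c\<in>T. \<bar>average u c \<epsilon>\<bar>) + \<delta>) + C * \<epsilon> powr (2 * s) / \<delta> * energy s u u"
    if u: "u \<in> V" and \<epsilon>: "\<epsilon> > 0" and \<delta>: "\<delta> > 0" and T: "finite T" "\<Omega> \<subseteq> (\<Union>c\<in>T. ball c \<epsilon>)" for u \<epsilon> \<delta> T
  proof -
    note [measurable] = V_borel[OF u]
    define b where "b = \<omega> * \<epsilon> powr N"
    have b: "b > 0" using \<omega> \<epsilon> by (simp add: b_def)
    have mb: "measure lborel (ball c \<epsilon>) = b" for c :: 'a using measure_ball[OF \<epsilon>] by (simp add: b_def \<omega>_def)
    define R where "R = (2 * \<epsilon>) powr (N + 2 * s) / (4 * \<delta>)"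
    have R: "R \<ge> 0" using \<delta> by (simp add: R_def)
    have Rb: "R / b = C * \<epsilon> powr (2 * s) / \<delta>"
      using \<epsilon> \<delta> \<omega> by (simp add: R_def b_def C_def powr_mult powr_add field_simps)
    define D where "D x = (\<integral>y. gagl s u u (x, y) \<partial>lborel)" for x
    note gi = integrable_gagl[OF u u]
    have Di: "integrable lborel D" unfolding D_def[abs_def] by (rule lborel_pair.integrable_fst'[OF gi])
    have DE: "(\<integral>x. D x \<partial>lborel) = energy s u u"
      unfolding D_def energy_def by (rule lborel_pair.integral_fst'[OF gi])
    have D0: "0 \<le> D x" for x unfolding D_def by (intro Bochner_Integration.integral_nonneg gagl_nonneg)
    let ?A = "(\<Sum>c\<in>T. \<bar>average u c \<epsilon>\<bar>) + \<delta>"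
    have A0: "0 \<le> ?A" using \<delta> by (intro add_nonneg_nonneg sum_nonneg) auto
    have pt: "AE x in lborel. \<bar>u x\<bar> \<le> ?A * indicat_real \<Omega> x + R / b * D x"
      using lborel_pair.AE_integrable_fst'[OF gi]
    proof eventually_elim
      case (elim x)
      show ?case
      proof (cases "x \<in> \<Omega>")
        case False
        then show ?thesis using V_zero[OF u] D0[of x] R b by simp
      next
        case True
        then obtain c where c: "c \<in> T" "x \<in> ball c \<epsilon>" using T by blast
        let ?i = "indicat_real (ball c \<epsilon>)"
        have osc: "\<bar>?i y * (u x - u y)\<bar> \<le> \<delta> * ?i y + R * gagl s u u (x, y)" for y
        proof (cases "y \<in> ball c \<epsilon> \<and> y \<noteq> x")
          case True
          let ?n = "norm (x - y) powr (N + 2 * s)"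
          have "norm (x - y) \<le> 2 * \<epsilon>"
            using True c dist_triangle[of x y c] by (simp add: dist_norm norm_minus_commute)
          then have n: "?n \<le> (2 * \<epsilon>) powr (N + 2 * s)" "?n > 0"
            using True N_pos s_pos by (auto intro!: powr_mono2)
          let ?d = "u x - u y"
          have "0 \<le> (\<bar>?d\<bar> - 2 * \<delta>)\<^sup>2" by simp
          then have "\<bar>?d\<bar> \<le> \<delta> + ?d\<^sup>2 / (4 * \<delta>)" using \<delta> by (simp add: power2_eq_square field_simps)
          also have "?d\<^sup>2 / (4 * \<delta>) = ?n / (4 * \<delta>) * gagl s u u (x, y)"
            using n(2) by (simp add: gagl_def power2_eq_square N_eq)
          also have "\<dots> \<le> R * gagl s u u (x, y)"
            unfolding R_def using n(1) \<delta> by (intro mult_right_mono divide_right_mono gagl_nonneg) auto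
          finally show ?thesis using True by simp
        next
          case False
          then show ?thesis using \<delta> R gagl_nonneg[of s u "(x, y)"] by (auto simp: indicator_def)
        qed
        have i1: "integrable lborel (\<lambda>y. ?i y * u x)" using integrable_indicator_ball by simp
        note i2 = integrable_ball_mult[OF u, of c \<epsilon>]
        have i3: "integrable lborel (\<lambda>y. ?i y * (u x - u y))"
          using i1 i2 by (simp add: right_diff_distrib)
        have "b * u x = (\<integral>y. ?i y * u x \<partial>lborel)" by (simp add: mb)
        also have "\<dots> = (\<integral>y. ?i y * (u x - u y) \<partial>lborel) + (\<integral>y. ?i y * u y \<partial>lborel)"
          using i1 i2 by (simp add: right_diff_distrib)
        also have "(\<integral>y. ?i y * u y \<partial>lborel) = b * average u c \<epsilon>" using b by (simp add: average_def mb)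
        finally have "\<bar>b * u x\<bar> \<le> \<bar>\<integral>y. ?i y * (u x - u y) \<partial>lborel\<bar> + \<bar>b * average u c \<epsilon>\<bar>"
          by (simp only: abs_triangle_ineq)
        also have "\<bar>\<integral>y. ?i y * (u x - u y) \<partial>lborel\<bar> \<le> (\<integral>y. \<bar>?i y * (u x - u y)\<bar> \<partial>lborel)"
          by (rule integral_abs_bound)
        also have "\<dots> \<le> (\<integral>y. \<delta> * ?i y + R * gagl s u u (x, y) \<partial>lborel)"
          using i3 elim integrable_indicator_ball[of c \<epsilon>] osc by (intro integral_mono) auto
        also have "\<dots> = \<delta> * b + R * D x"
          using elim integrable_indicator_ball[of c \<epsilon>] by (simp add: mb D_def)
        finally have "b * \<bar>u x\<bar> \<le> \<delta> * b + R * D x + b * \<bar>average u c \<epsilon>\<bar>"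
          using b by (simp add: abs_mult)
        also have "\<dots> = b * (\<bar>average u c \<epsilon>\<bar> + \<delta> + R / b * D x)"
          using b by (simp add: distrib_left)
        finally have "\<bar>u x\<bar> \<le> \<bar>average u c \<epsilon>\<bar> + \<delta> + R / b * D x" using b by simp
        moreover have "\<bar>average u c \<epsilon>\<bar> \<le> (\<Sum>c\<in>T. \<bar>average u c \<epsilon>\<bar>)"
          using T(1) c(1) by (intro member_le_sum) auto
        ultimately show ?thesis using True by simp
      qed
    qed
    have \<Omega>i: "integrable lborel (indicat_real \<Omega>)"
      using emeasure_\<Omega> by (intro integrable_real_indicator) auto
    have "(\<integral>x. \<bar>u x\<bar> \<partial>M) = (\<integral>x. \<bar>u x\<bar> \<partial>lborel)"
      using V_zero[OF u] by (intro M_lborel(2)) auto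
    also have "\<dots> \<le> (\<integral>x. ?A * indicat_real \<Omega> x + R / b * D x \<partial>lborel)"
    proof (rule integral_mono_AE[OF _ _ pt])
      show "integrable lborel (\<lambda>x. \<bar>u x\<bar>)" using V_integrable(1)[OF u] by simp
      show "integrable lborel (\<lambda>x. ?A * indicat_real \<Omega> x + R / b * D x)"
        by (intro Bochner_Integration.integrable_add integrable_mult_right \<Omega>i Di)
    qed
    also have "\<dots> = ?A * measure lborel \<Omega> + R / b * energy s u u"
    proof -
      have "(\<integral>x. ?A * indicat_real \<Omega> x + R / b * D x \<partial>lborel) = (\<integral>x. ?A * indicat_real \<Omega> x \<partial>lborel) + (\<integral>x. R / b * D x \<partial>lborel)"
        by (intro Bochner_Integration.integral_add integrable_mult_right \<Omega>i Di)
      also have "(\<integral>x. ?A * indicat_real \<Omega> x \<partial>lborel) = ?A * measure lborel \<Omega>" by simp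
      also have "(\<integral>x. R / b * D x \<partial>lborel) = R / b * energy s u u" unfolding DE[symmetric] by (rule integral_mult_right_zero)
      finally show ?thesis .
    qed
    finally show ?thesis unfolding Rb by (simp only: mult.commute)
  qed
  with C that show thesis by blast
qed

lemma finite_ball_cover:
  assumes "\<epsilon> > 0"
  shows "\<exists>T. finite T \<and> \<Omega> \<subseteq> (\<Union>c\<in>T. ball c \<epsilon>)"
proof -
  have "compact (closure \<Omega>)" using bounded_\<Omega> by simp
  moreover have "closure \<Omega> \<subseteq> (\<Union>c\<in>closure \<Omega>. ball c \<epsilon>)" using assms by auto
  ultimately obtain T where "T \<subseteq> closure \<Omega>" "finite T" "closure \<Omega> \<subseteq> (\<Union>c\<in>T. ball c \<epsilon>)"
    using compactE_image[of "closure \<Omega>" "closure \<Omega>" "\<lambda>c. ball c \<epsilon>"] by auto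
  then show ?thesis using closure_subset[of \<Omega>] by blast
qed

text \<open>A diagonal sequence makes the averages of all truncations over all balls of countably many
  finite covers converge. For fixed truncation height the energies are bounded, so the averages over a
  fine cover determine the truncation up to a small \<open>L\<^sup>1\<close> error; the bound in \<open>L\<^sup>\<gamma>\<close> with \<open>\<gamma> > 1\<close> makes the
  part above the truncation height uniformly small.\<close>

lemma L1_precompact:
  assumes sol: "\<And>n::nat. sol (g n) (\<phi> n)" and g: "\<And>n. (\<integral>x. \<bar>g n x\<bar> \<partial>M) \<le> B"
    and \<gamma>: "1 < \<gamma>" and \<phi>: "\<And>n. (\<integral>x. \<bar>\<phi> n x\<bar> powr \<gamma> \<partial>M) \<le> B'"
  obtains k where "strict_mono (k :: nat \<Rightarrow> nat)"
    "\<And>e. e > 0 \<Longrightarrow> \<exists>K. \<forall>m\<ge>K. \<forall>n\<ge>K. (\<integral>x. \<bar>\<phi> (k m) x - \<phi> (k n) x\<bar> \<partial>M) < e"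
proof -
  obtain C where C: "C \<ge> 0"
    "\<And>u \<epsilon> \<delta> T. u \<in> V \<Longrightarrow> \<epsilon> > 0 \<Longrightarrow> \<delta> > 0 \<Longrightarrow> finite T \<Longrightarrow> \<Omega> \<subseteq> (\<Union>c\<in>T. ball c \<epsilon>) \<Longrightarrow>
      (\<integral>x. \<bar>u x\<bar> \<partial>M) \<le> measure lborel \<Omega> * ((\<Sum>c\<in>T. \<bar>average u c \<epsilon>\<bar>) + \<delta>) + C * \<epsilon> powr (2 * s) / \<delta> * energy s u u"
    using L1_average_estimate by blast
  have B0: "B \<ge> 0" using g[of 0] order_trans[OF Bochner_Integration.integral_nonneg g[of 0]] by simp
  have B'0: "B' \<ge> 0" using order_trans[OF Bochner_Integration.integral_nonneg \<phi>[of 0]] by simp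
  define \<epsilon> where "\<epsilon> j = inverse (real (Suc j))" for j
  have \<epsilon>: "\<epsilon> j > 0" for j by (simp add: \<epsilon>_def)
  define w where "w k n x = trunc (real (Suc k)) (\<phi> n x)" for k n x
  have wV: "w k n \<in> V" for k n unfolding w_def[abs_def] by (rule trunc_V[OF sol_V[OF sol]]) simp
  have wb: "\<bar>w k n x\<bar> \<le> real (Suc k)" for k n x unfolding w_def by (rule trunc_bounded) simp
  have wE: "energy s (w k n) (w k n) \<le> real (Suc k) * B" for k n
  proof -
    have "energy s (w k n) (w k n) \<le> real (Suc k) * (\<integral>x. \<bar>g n x\<bar> \<partial>M)"
      unfolding w_def[abs_def] by (rule trunc_energy[OF sol]) simp
    also have "\<dots> \<le> real (Suc k) * B" by (intro mult_left_mono g) simp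
    finally show ?thesis .
  qed
  have "\<forall>j. \<exists>T. finite T \<and> \<Omega> \<subseteq> (\<Union>c\<in>T. ball c (\<epsilon> j))" using finite_ball_cover[OF \<epsilon>] by blast
  then obtain T where T: "\<And>j. finite (T j)" "\<And>j. \<Omega> \<subseteq> (\<Union>c\<in>T j. ball c (\<epsilon> j))" by metis
  define I where "I = (\<Union>k. \<Union>j. (\<lambda>c. (k :: nat, j :: nat, c)) ` T j)"
  have "countable I" unfolding I_def
    using countable_finite[OF T(1)] by (intro countable_UN countable_image countableI_type)
  \<comment> \<open>Dividing by the truncation height makes the family uniformly bounded, as the diagonal argument requires.\<close>
  define F where "F n = (\<lambda>(k, j, c). average (w k n) c (\<epsilon> j) / real (Suc k))" for n
  have "norm (F n i) \<le> 1" for n i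
  proof -
    obtain k j c where i: "i = (k, j, c)" by (cases i)
    have "\<bar>average (w k n) c (\<epsilon> j)\<bar> \<le> real (Suc k)" by (rule average_bounded[OF wV wb \<epsilon>])
    then have "\<bar>average (w k n) c (\<epsilon> j)\<bar> / real (Suc k) \<le> 1" by (subst divide_le_eq_1_pos) simp_all
    then show ?thesis by (simp add: F_def i abs_divide)
  qed
  then obtain \<kappa> where \<kappa>: "strict_mono (\<kappa> :: nat \<Rightarrow> nat)" "\<And>i. i \<in> I \<Longrightarrow> \<exists>l. (\<lambda>n. F (\<kappa> n) i) \<longlonglongrightarrow> l"
    using function_convergent_subsequence[OF \<open>countable I\<close>, of F 1] by blast
  have conv: "Cauchy (\<lambda>n. average (w k (\<kappa> n)) c (\<epsilon> j))" if "c \<in> T j" for k j c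
  proof -
    have "(k, j, c) \<in> I" using that by (auto simp: I_def)
    then obtain l where "(\<lambda>n. F (\<kappa> n) (k, j, c)) \<longlonglongrightarrow> l" using \<kappa>(2) by blast
    then have "(\<lambda>n. real (Suc k) * F (\<kappa> n) (k, j, c)) \<longlonglongrightarrow> real (Suc k) * l" by (rule tendsto_mult_left)
    then have "(\<lambda>n. average (w k (\<kappa> n)) c (\<epsilon> j)) \<longlonglongrightarrow> real (Suc k) * l" by (simp add: F_def)
    then show ?thesis by (rule LIMSEQ_imp_Cauchy)
  qed
  have tail: "(\<integral>x. \<bar>\<phi> n x - w k n x\<bar> \<partial>M) \<le> real (Suc k) powr (1 - \<gamma>) * B'" for k n
  proof -
    have i: "integrable M (\<lambda>x. \<bar>\<phi> n x\<bar> powr \<gamma>)"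
      using bdd_data_Lspace[OF sol_bdd_data[OF sol], of \<gamma> n] \<gamma> by (simp add: Lspace_ereal)
    have "(\<integral>x. \<bar>\<phi> n x - w k n x\<bar> \<partial>M) \<le> (\<integral>x. real (Suc k) powr (1 - \<gamma>) * \<bar>\<phi> n x\<bar> powr \<gamma> \<partial>M)"
    proof (rule integral_mono)
      show "integrable M (\<lambda>x. \<bar>\<phi> n x - w k n x\<bar>)"
        using V_integrable(2)[OF V_diff[OF sol_V[OF sol] wV]] by simp
      show "\<bar>\<phi> n x - w k n x\<bar> \<le> real (Suc k) powr (1 - \<gamma>) * \<bar>\<phi> n x\<bar> powr \<gamma>" for x
        unfolding w_def using \<gamma> by (intro trunc_tail) auto
    qed (use i in simp)
    also have "\<dots> \<le> real (Suc k) powr (1 - \<gamma>) * B'"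
      using mult_left_mono[OF \<phi>[of n], of "real (Suc k) powr (1 - \<gamma>)"] by simp
    finally show ?thesis .
  qed
  have main: "\<exists>K. \<forall>m\<ge>K. \<forall>n\<ge>K. (\<integral>x. \<bar>\<phi> (\<kappa> m) x - \<phi> (\<kappa> n) x\<bar> \<partial>M) < e" if e: "e > 0" for e
  proof -
    have "((\<lambda>k. real (Suc k) powr (1 - \<gamma>) * B') \<longlongrightarrow> 0 * B') sequentially"
    proof (intro tendsto_mult tendsto_const)
      have "filterlim (\<lambda>k. real (Suc k)) at_top sequentially"
        by (rule filterlim_compose[OF filterlim_real_sequentially filterlim_Suc])
      then show "(\<lambda>k. real (Suc k) powr (1 - \<gamma>)) \<longlonglongrightarrow> 0"
        using \<gamma> by (intro tendsto_neg_powr) auto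
    qed
    then have "(\<lambda>k. real (Suc k) powr (1 - \<gamma>) * B') \<longlonglongrightarrow> 0" by simp
    then obtain k where k: "real (Suc k) powr (1 - \<gamma>) * B' < e / 5"
      using LIMSEQ_ex_less[of _ "e / 5"] e by auto
    define m0 where "m0 = measure lborel \<Omega> + 1"
    have m0: "m0 > 0" "measure lborel \<Omega> \<le> m0" by (auto simp: m0_def add_nonneg_pos)
    define \<delta> where "\<delta> = e / (5 * m0)"
    have \<delta>: "\<delta> > 0" "m0 * \<delta> = e / 5" using e m0 by (auto simp: \<delta>_def)
    define E where "E = 4 * (real (Suc k) * B)"
    have E0: "E \<ge> 0" using B0 by (simp add: E_def)
    have "(\<lambda>j. C * \<epsilon> j powr (2 * s) / \<delta> * E) \<longlonglongrightarrow> C * 0 powr (2 * s) / \<delta> * E"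
      unfolding \<epsilon>_def using s_pos \<delta>(1)
      by (intro tendsto_intros tendsto_powr' LIMSEQ_inverse_real_of_nat) auto
    then have "(\<lambda>j. C * \<epsilon> j powr (2 * s) / \<delta> * E) \<longlonglongrightarrow> 0" using s_pos by simp
    from LIMSEQ_ex_less[OF this, of "e / 5"] e obtain j where j: "C * \<epsilon> j powr (2 * s) / \<delta> * E < e / 5"
      by (metis divide_pos_pos zero_less_numeral)
    \<comment> \<open>The five parts of \<open>e\<close> are the two tails, the averages, the term with \<open>\<delta>\<close> and the energy term.\<close>
    define \<theta> where "\<theta> = e / (5 * m0 * (real (card (T j)) + 1))"
    have \<theta>: "\<theta> > 0" using e m0 by (simp add: \<theta>_def)
    have card: "m0 * (real (card (T j)) * \<theta>) < e / 5"
    proof -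
      have "m0 * (real (card (T j)) * \<theta>) = e / 5 * (real (card (T j)) / (real (card (T j)) + 1))"
        using m0 by (simp add: \<theta>_def)
      also have "\<dots> < e / 5 * 1" using e by (intro mult_strict_left_mono) auto
      finally show ?thesis by simp
    qed
    have "\<forall>c\<in>T j. \<exists>K. \<forall>m\<ge>K. \<forall>n\<ge>K. \<bar>average (w k (\<kappa> m)) c (\<epsilon> j) - average (w k (\<kappa> n)) c (\<epsilon> j)\<bar> < \<theta>"
      using conv[of _ j k] \<theta> unfolding Cauchy_def dist_real_def by blast
    then obtain K where K: "\<And>c m n. c \<in> T j \<Longrightarrow> m \<ge> K c \<Longrightarrow> n \<ge> K c \<Longrightarrow>
        \<bar>average (w k (\<kappa> m)) c (\<epsilon> j) - average (w k (\<kappa> n)) c (\<epsilon> j)\<bar> < \<theta>" by metis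
    define K0 where "K0 = (\<Sum>c\<in>T j. K c)"
    have K0: "K c \<le> K0" if "c \<in> T j" for c unfolding K0_def using that T(1) by (intro member_le_sum) auto
    have "(\<integral>x. \<bar>\<phi> (\<kappa> m) x - \<phi> (\<kappa> n) x\<bar> \<partial>M) < e" if mn: "m \<ge> K0" "n \<ge> K0" for m n
    proof -
      let ?u = "\<lambda>x. w k (\<kappa> m) x - w k (\<kappa> n) x"
      have uV: "?u \<in> V" by (rule V_diff[OF wV wV])
      have "energy s ?u ?u \<le> E"
      proof -
        have "energy s ?u ?u = energy s (w k (\<kappa> m)) (w k (\<kappa> m)) - 2 * energy s (w k (\<kappa> m)) (w k (\<kappa> n)) + energy s (w k (\<kappa> n)) (w k (\<kappa> n))"
          using form.B_lin_square[OF wV wV, of 1 k "\<kappa> m" "-1" k "\<kappa> n"] by simp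
        moreover have "0 \<le> energy s (w k (\<kappa> m)) (w k (\<kappa> m)) + 2 * energy s (w k (\<kappa> m)) (w k (\<kappa> n)) + energy s (w k (\<kappa> n)) (w k (\<kappa> n))"
          using form.B_lin_square[OF wV wV, of 1 k "\<kappa> m" 1 k "\<kappa> n"]
            energy_nonneg[of "\<lambda>x. 1 * w k (\<kappa> m) x + 1 * w k (\<kappa> n) x"] by simp
        ultimately show ?thesis using wE[of k "\<kappa> m"] wE[of k "\<kappa> n"] unfolding E_def by linarith
      qed
      have sum: "(\<Sum>c\<in>T j. \<bar>average ?u c (\<epsilon> j)\<bar>) \<le> real (card (T j)) * \<theta>"
      proof (rule sum_bounded_above)
        fix c assume c: "c \<in> T j"
        have "\<bar>average ?u c (\<epsilon> j)\<bar> = \<bar>average (w k (\<kappa> m)) c (\<epsilon> j) - average (w k (\<kappa> n)) c (\<epsilon> j)\<bar>"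
          by (simp only: average_diff[OF wV wV])
        also have "\<dots> < \<theta>" by (rule K[OF c]) (use K0[OF c] mn in auto)
        finally show "\<bar>average ?u c (\<epsilon> j)\<bar> \<le> \<theta>" by simp
      qed
      have "(\<integral>x. \<bar>?u x\<bar> \<partial>M) \<le> measure lborel \<Omega> * ((\<Sum>c\<in>T j. \<bar>average ?u c (\<epsilon> j)\<bar>) + \<delta>) + C * \<epsilon> j powr (2 * s) / \<delta> * energy s ?u ?u"
        by (rule C(2)[OF uV \<epsilon> \<delta>(1) T])
      also have "\<dots> \<le> m0 * (real (card (T j)) * \<theta> + \<delta>) + C * \<epsilon> j powr (2 * s) / \<delta> * E"
        using m0 sum \<open>energy s ?u ?u \<le> E\<close> C(1) \<delta>(1) \<theta>
        by (intro add_mono mult_mono) (auto intro!: add_nonneg_nonneg sum_nonneg energy_nonneg)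
      also have "\<dots> < 3 * (e / 5)" using card \<delta>(2) j by (simp add: distrib_left)
      finally have u1: "(\<integral>x. \<bar>?u x\<bar> \<partial>M) < 3 * (e / 5)" .
      have i: "integrable M (\<lambda>x. \<bar>\<phi> n' x - w k n' x\<bar>)" for n'
        using V_integrable(2)[OF V_diff[OF sol_V[OF sol] wV]] by simp
      have iu: "integrable M (\<lambda>x. \<bar>?u x\<bar>)" using V_integrable(2)[OF uV] by simp
      have "(\<integral>x. \<bar>\<phi> (\<kappa> m) x - \<phi> (\<kappa> n) x\<bar> \<partial>M) \<le>
          (\<integral>x. \<bar>\<phi> (\<kappa> m) x - w k (\<kappa> m) x\<bar> + \<bar>\<phi> (\<kappa> n) x - w k (\<kappa> n) x\<bar> + \<bar>?u x\<bar> \<partial>M)"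
      proof (rule integral_mono)
        show "integrable M (\<lambda>x. \<bar>\<phi> (\<kappa> m) x - \<phi> (\<kappa> n) x\<bar>)"
          using V_integrable(2)[OF V_diff[OF sol_V[OF sol] sol_V[OF sol]]] by simp
        show "integrable M (\<lambda>x. \<bar>\<phi> (\<kappa> m) x - w k (\<kappa> m) x\<bar> + \<bar>\<phi> (\<kappa> n) x - w k (\<kappa> n) x\<bar> + \<bar>?u x\<bar>)"
          by (intro Bochner_Integration.integrable_add i iu)
        show "\<bar>\<phi> (\<kappa> m) x - \<phi> (\<kappa> n) x\<bar> \<le> \<bar>\<phi> (\<kappa> m) x - w k (\<kappa> m) x\<bar> + \<bar>\<phi> (\<kappa> n) x - w k (\<kappa> n) x\<bar> + \<bar>?u x\<bar>" for x
          by linarith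
      qed
      also have "\<dots> = (\<integral>x. \<bar>\<phi> (\<kappa> m) x - w k (\<kappa> m) x\<bar> \<partial>M) + (\<integral>x. \<bar>\<phi> (\<kappa> n) x - w k (\<kappa> n) x\<bar> \<partial>M) + (\<integral>x. \<bar>?u x\<bar> \<partial>M)"
        by (simp only: Bochner_Integration.integral_add Bochner_Integration.integrable_add i iu)
      also have "\<dots> < e / 5 + e / 5 + 3 * (e / 5)"
        using le_less_trans[OF tail k] u1 by (intro add_strict_mono)
      finally show ?thesis by simp
    qed
    then show ?thesis by blast
  qed
  show thesis by (rule that[OF \<kappa>(1) main])
qed

end

section \<open>Very weak solutions\<close>

context bounded_open_set
begin

lemma X0_lebesgue: "u \<in> X0 s \<Omega> \<Longrightarrow> u \<in> borel_measurable lebesgue"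
  by (simp add: X0_def Lspace_def)

lemma AE_pair_lebesgue:
  assumes "AE x in lborel. P (x :: 'a)"
  shows "AE p in lebesgue. P (fst p) \<and> P (snd p)"
  using AE_pair_lborel[OF assms] unfolding lborel_prod by (rule AE_completion)

text \<open>The form on \<open>X0 s \<Omega>\<close> integrates over the completed measure; Borel representatives reduce it to the
  product measure.\<close>

lemma gagliardo_form_energy:
  assumes V: "u' \<in> V" "w' \<in> V" and eq: "AE x in lborel. u x = u' x" "AE x in lborel. w x = w' x"
  shows "gagliardo_form s u w = energy s u' w'"
proof -
  have gagl_eq: "(\<lambda>(x, y). (u x - u y) * (w x - w y) / norm (x - y) powr (real DIM('a) + 2 * s)) = gagl s u w"
    by (auto simp: gagl_def)
  have "AE x in lborel. u x = u' x \<and> w x = w' x" using eq by eventually_elim simp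
  from AE_pair_lebesgue[OF this] have AE: "AE p in lebesgue. gagl s u' w' p = gagl s u w p"
    by eventually_elim (simp add: gagl_def)
  have m: "gagl s u' w' \<in> borel_measurable lborel"
    using gagl_measurable[OF V_borel[OF V(1)] V_borel[OF V(2)]] unfolding lborel_prod .
  then have m': "gagl s u' w' \<in> borel_measurable lebesgue" by (rule measurable_completion)
  have "gagliardo_form s u w = (\<integral>p. gagl s u w p \<partial>lebesgue)" by (simp only: gagliardo_form_def gagl_eq)
  also have "\<dots> = (\<integral>p. gagl s u' w' p \<partial>lebesgue)"
    using AE by (intro integral_cong_AE borel_measurable_AE[OF m' AE] m') auto
  also have "\<dots> = (\<integral>p. gagl s u' w' p \<partial>lborel)" by (rule integral_completion[OF m])
  finally show ?thesis by (simp only: energy_def lborel_prod)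
qed

lemma V_X0:
  assumes u: "u \<in> V"
  shows "u \<in> X0 s \<Omega>"
proof -
  have "integrable lebesgue (\<lambda>x. (u x)\<^sup>2)"
    using u V_borel[OF u] by (subst integrable_completion) (auto simp: V_def)
  then have "u \<in> Lspace lebesgue (ereal 2)"
    using V_borel[OF u] by (simp add: Lspace_ereal measurable_completion)
  moreover have "integrable (lebesgue :: ('a \<times> 'a) measure) (gagl s u u)"
    using integrable_gagl[OF u u] gagl_measurable[OF V_borel[OF u] V_borel[OF u]] unfolding lborel_prod
    by (subst integrable_completion) auto
  moreover have "(\<lambda>(x, y). (u x - u y)\<^sup>2 / norm (x - y) powr (real DIM('a) + 2 * s)) = gagl s u u"
    by (auto simp: gagl_def power2_eq_square)
  ultimately show ?thesis using V_zero[OF u] by (simp add: X0_def)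
qed

lemma X0_representative:
  assumes u: "u \<in> X0 s \<Omega>"
  obtains u' where "u' \<in> V" "AE x in lborel. u x = u' x"
proof -
  obtain g where g: "g \<in> borel_measurable lborel" "AE x in lborel. u x = g x"
    using completion_ex_borel_measurable_real[OF X0_lebesgue[OF u]] by blast
  define u' where "u' x = (if x \<in> \<Omega> then g x else 0)" for x
  have m: "u' \<in> borel_measurable borel" unfolding u'_def[abs_def] using g(1) by measurable
  have "AE x in lebesgue. x \<notin> \<Omega> \<longrightarrow> u x = 0" using u by (simp add: X0_def)
  then have "AE x in lborel. x \<notin> \<Omega> \<longrightarrow> u x = 0" by (simp only: AE_completion_iff)
  with g(2) have eq: "AE x in lborel. u x = u' x" by eventually_elim (auto simp: u'_def)
  have "(2::ereal) = ereal 2" by simp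
  with u have "integrable lebesgue (\<lambda>x. \<bar>u x\<bar> powr 2)" by (simp add: X0_def Lspace_ereal)
  then have ui: "integrable lebesgue (\<lambda>x. (u x)\<^sup>2)" by simp
  have m2: "(\<lambda>x. (u' x)\<^sup>2) \<in> borel_measurable lborel" using m by simp
  have "integrable lebesgue (\<lambda>x. (u' x)\<^sup>2)"
  proof (rule integrable_cong_AE_imp[OF ui measurable_completion[OF m2]])
    show "AE x in lebesgue. (u x)\<^sup>2 = (u' x)\<^sup>2"
      using AE_completion[OF eq] by eventually_elim simp
  qed
  then have u2: "integrable lborel (\<lambda>x. (u' x)\<^sup>2)" by (subst (asm) integrable_completion[OF m2])
  have gagl_eq: "(\<lambda>(x, y). (u x - u y)\<^sup>2 / norm (x - y) powr (real DIM('a) + 2 * s)) = gagl s u u"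
    by (auto simp: gagl_def power2_eq_square)
  have gi: "integrable (lebesgue :: ('a \<times> 'a) measure) (gagl s u u)"
    using u unfolding X0_def gagl_eq[symmetric] by simp
  have mg: "gagl s u' u' \<in> borel_measurable lborel"
    using gagl_measurable[OF m m] unfolding lborel_prod .
  have "integrable lebesgue (gagl s u' u')"
  proof (rule integrable_cong_AE_imp[OF gi measurable_completion[OF mg]])
    show "AE p in lebesgue. gagl s u u p = gagl s u' u' p"
      using AE_pair_lebesgue[OF eq] by eventually_elim (simp add: gagl_def)
  qed
  then have "integrable (lborel \<Otimes>\<^sub>M lborel) (gagl s u' u')"
    unfolding lborel_prod by (subst (asm) integrable_completion[OF mg])
  with m u2 have "u' \<in> V" by (simp add: V_def u'_def)
  with eq that show thesis by blast
qed

lemma AE_lborel_M: "AE x in lborel. P x \<Longrightarrow> AE x in M. P x"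
proof -
  assume "AE x in lborel. P x"
  then have "AE x in lebesgue. P x" by (rule AE_completion)
  then show ?thesis using \<Omega>_lebesgue by (subst AE_restrict_space_iff) (auto elim: eventually_mono)
qed

lemma X0_measurable: "u \<in> X0 s \<Omega> \<Longrightarrow> u \<in> borel_measurable M"
  by (intro measurable_restrict_space1 X0_lebesgue)

lemma fractional_laplacian_iff:
  assumes \<phi>: "\<phi> \<in> X0 s \<Omega>" "\<phi>' \<in> V" "AE x in lborel. \<phi> x = \<phi>' x" and \<psi>: "\<psi> \<in> borel_measurable M"
  shows "fractional_laplacian s \<Omega> \<phi> \<psi> \<longleftrightarrow> weak_sol \<psi> \<phi>'"
proof
  assume fl: "fractional_laplacian s \<Omega> \<phi> \<psi>"
  show "weak_sol \<psi> \<phi>'"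
  proof (rule weak_solI[OF \<phi>(2)])
    fix w assume w: "w \<in> V"
    have "energy s \<phi>' w = gagliardo_form s \<phi> w"
      by (rule gagliardo_form_energy[OF \<phi>(2) w \<phi>(3), symmetric]) simp
    also have "\<dots> = (\<integral>x. \<psi> x * w x \<partial>M)"
      using fl V_X0[OF w] unfolding fractional_laplacian_def by blast
    finally show "energy s \<phi>' w = (\<integral>x. \<psi> x * w x \<partial>M)" .
  qed
next
  assume ws: "weak_sol \<psi> \<phi>'"
  have "gagliardo_form s \<phi> w = (\<integral>x. \<psi> x * w x \<partial>M)" if w: "w \<in> X0 s \<Omega>" for w
  proof -
    obtain w' where w': "w' \<in> V" "AE x in lborel. w x = w' x" using X0_representative[OF w] by blast
    note [measurable] = \<psi> X0_measurable[OF w] V_measurable[OF w'(1)]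
    have "gagliardo_form s \<phi> w = energy s \<phi>' w'" by (rule gagliardo_form_energy[OF \<phi>(2) w'(1) \<phi>(3) w'(2)])
    also have "\<dots> = (\<integral>x. \<psi> x * w' x \<partial>M)" by (rule weak_sol_eq[OF ws w'(1)])
    also have "\<dots> = (\<integral>x. \<psi> x * w x \<partial>M)"
    proof (rule integral_cong_AE)
      show "AE x in M. \<psi> x * w' x = \<psi> x * w x"
        using AE_lborel_M[OF w'(2)] by eventually_elim simp
    qed measurable
    finally show ?thesis .
  qed
  with \<phi>(1) show "fractional_laplacian s \<Omega> \<phi> \<psi>" unfolding fractional_laplacian_def by blast
qed

lemma sol_fractional_laplacian:
  assumes "sol \<psi> \<phi>"
  shows "fractional_laplacian s \<Omega> \<phi> \<psi>"
  by (subst fractional_laplacian_iff[OF V_X0[OF sol_V[OF assms]] sol_V[OF assms] _ bdd_data_measurable[OF sol_data[OF assms]]])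
    (simp_all add: sol_weak_sol[OF assms])

lemma sol_Tspace:
  assumes "\<psi> \<in> test_fun \<Omega>" "sol \<psi> \<phi>"
  shows "\<phi> \<in> Tspace s \<Omega>"
  using assms sol_fractional_laplacian[OF assms(2)] V_X0[OF sol_V[OF assms(2)]] unfolding Tspace_def by blast

lemma fractional_laplacian_sol:
  assumes "\<psi> \<in> test_fun \<Omega>" "fractional_laplacian s \<Omega> \<phi> \<psi>"
  obtains \<phi>' where "sol \<psi> \<phi>'" "AE x in M. \<phi> x = \<phi>' x"
proof -
  have \<phi>: "\<phi> \<in> X0 s \<Omega>" using assms(2) by (simp add: fractional_laplacian_def)
  obtain \<zeta> where \<zeta>: "\<zeta> \<in> V" "AE x in lborel. \<phi> x = \<zeta> x" using X0_representative[OF \<phi>] by blast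
  have \<psi>: "\<psi> \<in> bdd_data" by (rule test_fun_bdd_data[OF assms(1)])
  have "weak_sol \<psi> \<zeta>"
    using assms(2) fractional_laplacian_iff[OF \<phi> \<zeta> bdd_data_measurable[OF \<psi>]] by blast
  then obtain \<phi>' where "sol \<psi> \<phi>'" "AE x in M. \<zeta> x = \<phi>' x"
    using weak_sol_bounded_version[OF \<psi>] by blast
  moreover from this(2) AE_lborel_M[OF \<zeta>(2)] have "AE x in M. \<phi> x = \<phi>' x" by eventually_elim simp
  ultimately show thesis using that by blast
qed

text \<open>Up to null sets the elements of \<open>Tspace s \<Omega>\<close> are the bounded solutions for test function data, so very
  weak solutions can be tested with pairs related by \<open>sol\<close>.\<close>

lemma very_weak_laplacian_iff:
  assumes f: "f \<in> borel_measurable M"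
  shows "very_weak_laplacian s \<Omega> u f \<longleftrightarrow>
    (\<forall>\<psi>\<in>test_fun \<Omega>. \<forall>\<phi>. sol \<psi> \<phi> \<longrightarrow> (\<integral>x. u x * \<psi> x \<partial>M) = (\<integral>x. f x * \<phi> x \<partial>M))"
proof
  assume "very_weak_laplacian s \<Omega> u f"
  then show "\<forall>\<psi>\<in>test_fun \<Omega>. \<forall>\<phi>. sol \<psi> \<phi> \<longrightarrow> (\<integral>x. u x * \<psi> x \<partial>M) = (\<integral>x. f x * \<phi> x \<partial>M)"
    unfolding very_weak_laplacian_def using sol_Tspace sol_fractional_laplacian by blast
next
  assume R: "\<forall>\<psi>\<in>test_fun \<Omega>. \<forall>\<phi>. sol \<psi> \<phi> \<longrightarrow> (\<integral>x. u x * \<psi> x \<partial>M) = (\<integral>x. f x * \<phi> x \<partial>M)"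
  show "very_weak_laplacian s \<Omega> u f"
    unfolding very_weak_laplacian_def
  proof (intro ballI impI)
    fix \<phi> \<psi> assume T: "\<phi> \<in> Tspace s \<Omega>" and \<psi>: "\<psi> \<in> test_fun \<Omega>" and fl: "fractional_laplacian s \<Omega> \<phi> \<psi>"
    obtain \<phi>' where \<phi>': "sol \<psi> \<phi>'" "AE x in M. \<phi> x = \<phi>' x"
      using fractional_laplacian_sol[OF \<psi> fl] by blast
    have "\<phi> \<in> X0 s \<Omega>" using T by (simp add: Tspace_def)
    note [measurable] = f X0_measurable[OF this] V_measurable[OF sol_V[OF \<phi>'(1)]]
    have "(\<integral>x. u x * \<psi> x \<partial>M) = (\<integral>x. f x * \<phi>' x \<partial>M)" using R \<psi> \<phi>'(1) by blast
    also have "\<dots> = (\<integral>x. f x * \<phi> x \<partial>M)"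
    proof (rule integral_cong_AE)
      show "AE x in M. f x * \<phi>' x = f x * \<phi> x" using \<phi>'(2) by eventually_elim simp
    qed measurable
    finally show "(\<integral>x. u x * \<psi> x \<partial>M) = (\<integral>x. f x * \<phi> x \<partial>M)" .
  qed
qed

lemma sol_very_weak_laplacian:
  assumes "sol g \<phi>"
  shows "very_weak_laplacian s \<Omega> \<phi> g"
proof -
  have "(\<integral>x. \<phi> x * \<psi> x \<partial>M) = (\<integral>x. g x * \<zeta> x \<partial>M)" if "sol \<psi> \<zeta>" for \<psi> \<zeta>
    using weak_sol_symmetric[OF sol_weak_sol[OF assms] sol_weak_sol[OF that]] by (simp add: mult.commute)
  then show ?thesis
    by (subst very_weak_laplacian_iff[OF bdd_data_measurable[OF sol_data[OF assms]]]) blast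
qed

lemma integrable_mult_data:
  assumes "integrable M f" "g \<in> bdd_data"
  shows "integrable M (\<lambda>x. f x * g x)"
proof -
  obtain K where "\<And>x. \<bar>g x\<bar> \<le> K" using bdd_data_bounded[OF assms(2)] by blast
  then have "AE x in M. \<bar>g x\<bar> \<le> K" by (intro AE_I2)
  from integral_mult_bound_AE(1)[OF assms(1) bdd_data_measurable[OF assms(2)] this] show ?thesis .
qed

lemma very_weak_laplacian_lin:
  assumes "integrable M u" "integrable M v" "integrable M f" "integrable M h"
    and "very_weak_laplacian s \<Omega> u f" "very_weak_laplacian s \<Omega> v h"
  shows "very_weak_laplacian s \<Omega> (\<lambda>x. a * u x + b * v x) (\<lambda>x. a * f x + b * h x)"
proof -
  have fm: "f \<in> borel_measurable M" and hm: "h \<in> borel_measurable M" using assms by auto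
  have "(\<integral>x. (a * u x + b * v x) * \<psi> x \<partial>M) = (\<integral>x. (a * f x + b * h x) * \<phi> x \<partial>M)"
    if \<psi>: "\<psi> \<in> test_fun \<Omega>" and \<phi>: "sol \<psi> \<phi>" for \<psi> \<phi>
  proof -
    note i = integrable_mult_data[OF _ sol_data[OF \<phi>]] integrable_mult_data[OF _ sol_bdd_data[OF \<phi>]]
    have 1: "(\<integral>x. u x * \<psi> x \<partial>M) = (\<integral>x. f x * \<phi> x \<partial>M)"
      using assms(5) \<psi> \<phi> unfolding very_weak_laplacian_iff[OF fm] by blast
    have 2: "(\<integral>x. v x * \<psi> x \<partial>M) = (\<integral>x. h x * \<phi> x \<partial>M)"
      using assms(6) \<psi> \<phi> unfolding very_weak_laplacian_iff[OF hm] by blast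
    have "(\<integral>x. (a * u x + b * v x) * \<psi> x \<partial>M) = (\<integral>x. a * (u x * \<psi> x) + b * (v x * \<psi> x) \<partial>M)"
      by (simp only: distrib_right mult.assoc)
    also have "\<dots> = a * (\<integral>x. u x * \<psi> x \<partial>M) + b * (\<integral>x. v x * \<psi> x \<partial>M)"
      using i(1)[OF assms(1)] i(1)[OF assms(2)] by simp
    also have "\<dots> = a * (\<integral>x. f x * \<phi> x \<partial>M) + b * (\<integral>x. h x * \<phi> x \<partial>M)" by (simp only: 1 2)
    also have "\<dots> = (\<integral>x. a * (f x * \<phi> x) + b * (h x * \<phi> x) \<partial>M)"
      using i(2)[OF assms(3)] i(2)[OF assms(4)] by simp
    also have "\<dots> = (\<integral>x. (a * f x + b * h x) * \<phi> x \<partial>M)" by (simp only: distrib_right mult.assoc)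
    finally show ?thesis .
  qed
  moreover have "(\<lambda>x. a * f x + b * h x) \<in> borel_measurable M" using fm hm by measurable
  ultimately show ?thesis by (subst very_weak_laplacian_iff) blast+
qed

lemma LIMSEQ_integral_mult:
  assumes f: "integrable M f" "\<And>n. integrable M (F n)" and lim: "(\<lambda>n. \<integral>x. \<bar>f x - F n x\<bar> \<partial>M) \<longlonglongrightarrow> 0"
    and g: "g \<in> bdd_data"
  shows "(\<lambda>n. \<integral>x. F n x * g x \<partial>M) \<longlonglongrightarrow> (\<integral>x. f x * g x \<partial>M)"
proof -
  obtain K where "\<And>x. \<bar>g x\<bar> \<le> K" using bdd_data_bounded[OF g] by blast
  then have K: "AE x in M. \<bar>g x\<bar> \<le> K" by (intro AE_I2)
  have "norm ((\<integral>x. F n x * g x \<partial>M) - (\<integral>x. f x * g x \<partial>M)) \<le> K * (\<integral>x. \<bar>f x - F n x\<bar> \<partial>M)" for n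
  proof -
    have i: "integrable M (\<lambda>x. F n x - f x)" using f by simp
    have "(\<integral>x. F n x * g x \<partial>M) - (\<integral>x. f x * g x \<partial>M) = (\<integral>x. (F n x - f x) * g x \<partial>M)"
      using integrable_mult_data[OF f(1) g] integrable_mult_data[OF f(2) g]
      by (simp add: left_diff_distrib)
    with integral_mult_bound_AE(2)[OF i bdd_data_measurable[OF g] K] show ?thesis
      by (simp add: abs_minus_commute)
  qed
  moreover have "(\<lambda>n. K * (\<integral>x. \<bar>f x - F n x\<bar> \<partial>M)) \<longlonglongrightarrow> 0" using tendsto_mult_left[OF lim, of K] by simp
  ultimately have "(\<lambda>n. (\<integral>x. F n x * g x \<partial>M) - (\<integral>x. f x * g x \<partial>M)) \<longlonglongrightarrow> 0"
    by (rule Lim_null_comparison[OF always_eventually[OF allI]])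
  then show ?thesis by (simp add: LIM_zero_iff)
qed

lemma Lspace_integrable:
  assumes "f \<in> Lspace M (ereal r)" "1 \<le> r"
  shows "integrable M f"
  using M.Lspace_mono(1)[OF assms(1), of 1] assms(2) by (simp add: Lspace_one one_ereal_def[symmetric])

lemma L1_le_Lnorm:
  assumes "1 \<le> r"
  obtains C where "C \<ge> 0" "\<And>f. f \<in> Lspace M (ereal r) \<Longrightarrow> (\<integral>x. \<bar>f x\<bar> \<partial>M) \<le> C * Lnorm M (ereal r) f"
proof (rule that)
  show "(measure M (space M) + 1) powr (1 / 1) \<ge> 0" by simp
  show "(\<integral>x. \<bar>f x\<bar> \<partial>M) \<le> (measure M (space M) + 1) powr (1 / 1) * Lnorm M (ereal r) f"
    if "f \<in> Lspace M (ereal r)" for f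
    using M.Lspace_mono(2)[OF that order_refl assms] by (simp only: one_ereal_def[symmetric] Lnorm_one)
qed

text \<open>Uniqueness of the datum. A test function \<open>\<eta>\<close> is the solution for bounded data \<open>g\<close>, and
  approximating \<open>g\<close> by test functions in \<open>L\<^sup>m\<close> with \<open>m > N / (2 s)\<close> makes elements of the test space
  \<open>Tspace s \<Omega>\<close> converge uniformly to \<open>\<eta>\<close>.\<close>

lemma datum_zero:
  assumes f: "integrable M f"
    and zero: "\<And>\<psi> \<phi>. \<psi> \<in> test_fun \<Omega> \<Longrightarrow> sol \<psi> \<phi> \<Longrightarrow> (\<integral>x. f x * \<phi> x \<partial>M) = 0"
  shows "AE x in M. f x = 0"
proof (rule fundamental_lemma_calculus_of_variations[OF open_\<Omega> bounded_\<Omega> f])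
  fix \<eta> assume \<eta>: "\<eta> \<in> test_fun \<Omega>"
  obtain g where g: "sol g \<eta>" using test_fun_sol[OF \<eta>] by blast
  \<comment> \<open>Any exponent above \<open>N / (2 s)\<close>.\<close>
  define m where "m = N / (2 * s) + 1"
  have m: "m > N / (2 * s)" "m \<ge> 1" using N_pos s_pos by (auto simp: m_def)
  obtain C where C: "C \<ge> 0"
      "\<And>g \<phi>. g \<in> bdd_data \<Longrightarrow> weak_sol g \<phi> \<Longrightarrow> AE x in M. \<bar>\<phi> x\<bar> \<le> C * Lnorm M (ereal m) g"
    using Stampacchia[OF m(1)] by blast
  have gL: "g \<in> Lspace M (ereal m)" using m(2) by (intro bdd_data_Lspace sol_data[OF g]) simp
  obtain \<psi> where \<psi>: "\<And>n::nat. \<psi> n \<in> test_fun \<Omega>" "(\<lambda>n. Lnorm M (ereal m) (\<lambda>x. g x - \<psi> n x)) \<longlonglongrightarrow> 0"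
    using test_fun_dense_sequence[OF open_\<Omega> bounded_\<Omega> gL m(2)] by blast
  have "\<exists>\<phi>. sol (\<psi> n) \<phi>" for n using sol_exists[OF test_fun_bdd_data[OF \<psi>(1)]] by blast
  then obtain \<phi> where \<phi>: "\<And>n. sol (\<psi> n) (\<phi> n)" by metis
  have "\<bar>\<integral>x. f x * \<eta> x \<partial>M\<bar> \<le> C * Lnorm M (ereal m) (\<lambda>x. g x - \<psi> n x) * (\<integral>x. \<bar>f x\<bar> \<partial>M)" for n
  proof -
    note d = sol_diff[OF g \<phi>[of n]]
    have "(\<integral>x. f x * (\<eta> x - \<phi> n x) \<partial>M) = (\<integral>x. f x * \<eta> x \<partial>M) - (\<integral>x. f x * \<phi> n x \<partial>M)"
      using integrable_mult_data[OF f sol_bdd_data[OF g]] integrable_mult_data[OF f sol_bdd_data[OF \<phi>]]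
      by (simp add: right_diff_distrib)
    also have "\<dots> = (\<integral>x. f x * \<eta> x \<partial>M)" using zero[OF \<psi>(1) \<phi>] by simp
    finally have eq: "(\<integral>x. f x * \<eta> x \<partial>M) = (\<integral>x. f x * (\<eta> x - \<phi> n x) \<partial>M)" by simp
    show ?thesis
      unfolding eq by (rule integral_mult_bound_AE(2)[OF f bdd_data_measurable[OF sol_bdd_data[OF d]] C(2)[OF sol_data[OF d] sol_weak_sol[OF d]]])
  qed
  moreover have "(\<lambda>n. C * Lnorm M (ereal m) (\<lambda>x. g x - \<psi> n x) * (\<integral>x. \<bar>f x\<bar> \<partial>M)) \<longlonglongrightarrow> C * 0 * (\<integral>x. \<bar>f x\<bar> \<partial>M)"
    by (intro tendsto_intros \<psi>(2))
  ultimately have "\<bar>\<integral>x. f x * \<eta> x \<partial>M\<bar> \<le> C * 0 * (\<integral>x. \<bar>f x\<bar> \<partial>M)"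
    by (intro LIMSEQ_le_const) auto
  then show "(\<integral>x. f x * \<eta> x \<partial>M) = 0" by simp
qed

lemma datum_unique:
  assumes "integrable M u" "integrable M f" "integrable M h"
    and "very_weak_laplacian s \<Omega> u f" "very_weak_laplacian s \<Omega> u h"
  shows "AE x in M. f x = h x"
proof -
  have fm: "f \<in> borel_measurable M" and hm: "h \<in> borel_measurable M" using assms by auto
  have "AE x in M. f x - h x = 0"
  proof (rule datum_zero)
    fix \<psi> \<phi> assume \<psi>: "\<psi> \<in> test_fun \<Omega>" and \<phi>: "sol \<psi> \<phi>"
    have "(\<integral>x. f x * \<phi> x \<partial>M) = (\<integral>x. u x * \<psi> x \<partial>M)" "(\<integral>x. h x * \<phi> x \<partial>M) = (\<integral>x. u x * \<psi> x \<partial>M)"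
      using assms(4,5) \<psi> \<phi> unfolding very_weak_laplacian_iff[OF fm] very_weak_laplacian_iff[OF hm] by metis+
    then show "(\<integral>x. (f x - h x) * \<phi> x \<partial>M) = 0"
      using integrable_mult_data[OF assms(2) sol_bdd_data[OF \<phi>]] integrable_mult_data[OF assms(3) sol_bdd_data[OF \<phi>]]
      by (simp add: left_diff_distrib)
  qed (use assms in simp)
  then show ?thesis by eventually_elim simp
qed

text \<open>The Green bound from \<open>L\<^sup>1\<close> to \<open>L\<^sup>1\<close> turns convergence of the data into convergence of the solutions
  in \<open>L\<^sup>1\<close>, and symmetry of the Green operator, applied in the pairing with test functions, identifies the
  limit with \<open>u\<close>. All estimates for very weak solutions pass through this approximation.\<close>

lemma very_weak_approximation:
  assumes u: "integrable M u" and f: "f \<in> Lspace M (ereal r)" and r: "1 \<le> r" and vw: "very_weak_laplacian s \<Omega> u f"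
  obtains \<psi> \<phi> where "\<And>n::nat. \<psi> n \<in> test_fun \<Omega>" "\<And>n. sol (\<psi> n) (\<phi> n)"
    "(\<lambda>n. Lnorm M (ereal r) (\<lambda>x. f x - \<psi> n x)) \<longlonglongrightarrow> 0" "AE x in M. (\<lambda>n. \<phi> n x) \<longlonglongrightarrow> u x"
proof -
  have fi: "integrable M f" by (rule Lspace_integrable[OF f r])
  have fm: "f \<in> borel_measurable M" using fi by simp
  obtain \<psi> where \<psi>: "\<And>n::nat. \<psi> n \<in> test_fun \<Omega>" "(\<lambda>n. Lnorm M (ereal r) (\<lambda>x. f x - \<psi> n x)) \<longlonglongrightarrow> 0"
    using test_fun_dense_sequence[OF open_\<Omega> bounded_\<Omega> f r] by blast
  have "\<exists>\<phi>. sol (\<psi> n) \<phi>" for n using sol_exists[OF test_fun_bdd_data[OF \<psi>(1)]] by blast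
  then obtain \<phi> where \<phi>: "\<And>n. sol (\<psi> n) (\<phi> n)" by metis
  have \<psi>L: "\<psi> n \<in> Lspace M (ereal r)" for n using r by (intro bdd_data_Lspace sol_data[OF \<phi>]) simp
  have \<psi>i: "integrable M (\<psi> n)" for n by (rule bdd_data_integrable[OF sol_data[OF \<phi>]])
  obtain A where A: "A \<ge> 0" "\<And>f. f \<in> Lspace M (ereal r) \<Longrightarrow> (\<integral>x. \<bar>f x\<bar> \<partial>M) \<le> A * Lnorm M (ereal r) f"
    using L1_le_Lnorm[OF r] by blast
  have lim1: "(\<lambda>n. \<integral>x. \<bar>f x - \<psi> n x\<bar> \<partial>M) \<longlonglongrightarrow> 0"
  proof (rule Lim_null_comparison[OF always_eventually[OF allI]])
    show "norm (\<integral>x. \<bar>f x - \<psi> n x\<bar> \<partial>M) \<le> A * Lnorm M (ereal r) (\<lambda>x. f x - \<psi> n x)" for n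
      using A(2)[OF Lspace_diff[OF f \<psi>L r], of n] by simp
    show "(\<lambda>n. A * Lnorm M (ereal r) (\<lambda>x. f x - \<psi> n x)) \<longlonglongrightarrow> 0"
      using tendsto_mult_left[OF \<psi>(2), of A] by simp
  qed
  have "green_bound 1 1" using dim s_pos by (intro green_bound_one) (auto simp: field_simps)
  then obtain C where C: "C \<ge> 0" "\<And>g \<phi>. sol g \<phi> \<Longrightarrow> Lnorm M (ereal 1) \<phi> \<le> C * Lnorm M (ereal 1) g"
    unfolding green_bound_def by blast
  have L1: "\<phi> n \<in> Lspace M (ereal 1)" for n by (intro bdd_data_Lspace sol_bdd_data[OF \<phi>]) simp
  have cauchy: "\<exists>K. \<forall>m\<ge>K. \<forall>n\<ge>K. Lnorm M (ereal 1) (\<lambda>x. \<phi> m x - \<phi> n x) < e" if e: "e > 0" for e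
  proof -
    define d where "d = e / (2 * (C + 1))"
    have d: "d > 0" "C * (2 * d) < e" using e C(1) by (auto simp: d_def field_simps)
    obtain K where K: "\<And>n. n \<ge> K \<Longrightarrow> (\<integral>x. \<bar>f x - \<psi> n x\<bar> \<partial>M) < d"
      using order_tendstoD(2)[OF lim1 d(1)] unfolding eventually_sequentially by blast
    have "Lnorm M (ereal 1) (\<lambda>x. \<phi> m x - \<phi> n x) < e" if mn: "m \<ge> K" "n \<ge> K" for m n
    proof -
      have "Lnorm M (ereal 1) (\<lambda>x. \<psi> m x - \<psi> n x) = (\<integral>x. \<bar>\<psi> m x - \<psi> n x\<bar> \<partial>M)"
        by (simp only: one_ereal_def[symmetric] Lnorm_one)
      also have "\<dots> \<le> (\<integral>x. \<bar>f x - \<psi> m x\<bar> + \<bar>f x - \<psi> n x\<bar> \<partial>M)"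
        using fi \<psi>i by (intro integral_mono) auto
      also have "\<dots> = (\<integral>x. \<bar>f x - \<psi> m x\<bar> \<partial>M) + (\<integral>x. \<bar>f x - \<psi> n x\<bar> \<partial>M)"
        using fi \<psi>i by simp
      also have "\<dots> \<le> 2 * d" using K[OF mn(1)] K[OF mn(2)] by simp
      finally have "C * Lnorm M (ereal 1) (\<lambda>x. \<psi> m x - \<psi> n x) \<le> C * (2 * d)"
        by (rule mult_left_mono[OF _ C(1)])
      then show ?thesis using d(2) C(2)[OF sol_diff[OF \<phi> \<phi>], of m n] by linarith
    qed
    then show ?thesis by blast
  qed
  obtain v k where v: "v \<in> Lspace M (ereal 1)" "strict_mono (k :: nat \<Rightarrow> nat)" "AE x in M. (\<lambda>n. \<phi> (k n) x) \<longlonglongrightarrow> v x"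
      "(\<lambda>n. Lnorm M (ereal 1) (\<lambda>x. \<phi> n x - v x)) \<longlonglongrightarrow> 0"
    using M.Lspace_complete[where f = \<phi>, OF L1 order_refl cauchy] by blast
  have vi: "integrable M v" by (rule Lspace_integrable[OF v(1) order_refl])
  have limv: "(\<lambda>n. \<integral>x. \<bar>v x - \<phi> n x\<bar> \<partial>M) \<longlonglongrightarrow> 0"
    using v(4) by (simp only: one_ereal_def[symmetric] Lnorm_one abs_minus_commute[of "v _"])
  have "AE x in M. u x - v x = 0"
  proof (rule fundamental_lemma_calculus_of_variations[OF open_\<Omega> bounded_\<Omega>])
    show "integrable M (\<lambda>x. u x - v x)" using u vi by simp
    fix \<eta> assume \<eta>: "\<eta> \<in> test_fun \<Omega>"
    note \<eta>d = test_fun_bdd_data[OF \<eta>]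
    obtain \<zeta> where \<zeta>: "sol \<eta> \<zeta>" using sol_exists[OF \<eta>d] by blast
    have sym: "(\<integral>x. \<phi> n x * \<eta> x \<partial>M) = (\<integral>x. \<psi> n x * \<zeta> x \<partial>M)" for n
      using weak_sol_symmetric[OF sol_weak_sol[OF \<phi>[of n]] sol_weak_sol[OF \<zeta>]] by (simp add: mult.commute)
    have 1: "(\<lambda>n. \<integral>x. \<phi> n x * \<eta> x \<partial>M) \<longlonglongrightarrow> (\<integral>x. v x * \<eta> x \<partial>M)"
      by (rule LIMSEQ_integral_mult[OF vi bdd_data_integrable[OF sol_bdd_data[OF \<phi>]] limv \<eta>d])
    have 2: "(\<lambda>n. \<integral>x. \<psi> n x * \<zeta> x \<partial>M) \<longlonglongrightarrow> (\<integral>x. f x * \<zeta> x \<partial>M)"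
      by (rule LIMSEQ_integral_mult[OF fi \<psi>i lim1 sol_bdd_data[OF \<zeta>]])
    have "(\<integral>x. v x * \<eta> x \<partial>M) = (\<integral>x. f x * \<zeta> x \<partial>M)"
      by (rule LIMSEQ_unique[OF 1[unfolded sym] 2])
    also have "\<dots> = (\<integral>x. u x * \<eta> x \<partial>M)"
      using vw \<eta> \<zeta> unfolding very_weak_laplacian_iff[OF fm] by metis
    finally show "(\<integral>x. (u x - v x) * \<eta> x \<partial>M) = 0"
      using integrable_mult_data[OF u \<eta>d] integrable_mult_data[OF vi \<eta>d] by (simp add: left_diff_distrib)
  qed
  with v(3) have lim: "AE x in M. (\<lambda>n. \<phi> (k n) x) \<longlonglongrightarrow> u x" by eventually_elim simp
  have "(\<lambda>n. Lnorm M (ereal r) (\<lambda>x. f x - \<psi> (k n) x)) \<longlonglongrightarrow> 0"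
    using LIMSEQ_subseq_LIMSEQ[OF \<psi>(2) v(2)] by (simp add: o_def)
  then show thesis by (rule that[of "\<lambda>n. \<psi> (k n)" "\<lambda>n. \<phi> (k n)", OF \<psi>(1) \<phi> _ lim])
qed

lemma Lnorm_tendsto:
  assumes "f \<in> Lspace M (ereal r)" "1 \<le> r" "\<And>n. \<psi> n \<in> Lspace M (ereal r)"
    and lim: "(\<lambda>n. Lnorm M (ereal r) (\<lambda>x. f x - \<psi> n x)) \<longlonglongrightarrow> 0"
  shows "(\<lambda>n. Lnorm M (ereal r) (\<psi> n)) \<longlonglongrightarrow> Lnorm M (ereal r) f"
proof -
  have "norm (Lnorm M (ereal r) (\<psi> n) - Lnorm M (ereal r) f) \<le> Lnorm M (ereal r) (\<lambda>x. f x - \<psi> n x)" for n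
    using Lnorm_triangle_diff[OF assms(1) assms(3)[of n] assms(2)]
      Lnorm_triangle_diff[OF assms(3)[of n] assms(1) assms(2)]
      Lnorm_minus_commute[of M "ereal r" f "\<psi> n"] by simp
  then have "(\<lambda>n. Lnorm M (ereal r) (\<psi> n) - Lnorm M (ereal r) f) \<longlonglongrightarrow> 0"
    by (rule Lim_null_comparison[OF always_eventually[OF allI] lim])
  then show ?thesis by (simp add: LIM_zero_iff)
qed

text \<open>Fatou's lemma along the approximating solutions of \<open>very_weak_approximation\<close>.\<close>

lemma very_weak_Lnorm_bound:
  assumes gb: "green_bound r \<gamma>" and r: "1 \<le> r" and \<gamma>: "1 \<le> \<gamma>"
  obtains C where "C \<ge> 0"
    "\<And>u f. integrable M u \<Longrightarrow> f \<in> Lspace M (ereal r) \<Longrightarrow> very_weak_laplacian s \<Omega> u f \<Longrightarrow>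
      u \<in> Lspace M (ereal \<gamma>) \<and> Lnorm M (ereal \<gamma>) u \<le> C * Lnorm M (ereal r) f"
proof -
  obtain C where C: "C \<ge> 0" "\<And>g \<phi>. sol g \<phi> \<Longrightarrow> Lnorm M (ereal \<gamma>) \<phi> \<le> C * Lnorm M (ereal r) g"
    using gb unfolding green_bound_def by blast
  have "u \<in> Lspace M (ereal \<gamma>) \<and> Lnorm M (ereal \<gamma>) u \<le> C * Lnorm M (ereal r) f"
    if u: "integrable M u" and f: "f \<in> Lspace M (ereal r)" and vw: "very_weak_laplacian s \<Omega> u f" for u f
  proof -
    obtain \<psi> \<phi> where \<psi>: "\<And>n::nat. \<psi> n \<in> test_fun \<Omega>" and \<phi>: "\<And>n. sol (\<psi> n) (\<phi> n)"
        and lim: "(\<lambda>n. Lnorm M (ereal r) (\<lambda>x. f x - \<psi> n x)) \<longlonglongrightarrow> 0" and AE: "AE x in M. (\<lambda>n. \<phi> n x) \<longlonglongrightarrow> u x"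
      using very_weak_approximation[OF u f r vw] by blast
    have \<psi>L: "\<psi> n \<in> Lspace M (ereal r)" for n using r by (intro bdd_data_Lspace sol_data[OF \<phi>]) simp
    have \<phi>L: "\<phi> n \<in> Lspace M (ereal \<gamma>)" for n using \<gamma> by (intro bdd_data_Lspace sol_bdd_data[OF \<phi>]) simp
    have um: "u \<in> borel_measurable M" using u by simp
    have "(\<lambda>n. C * Lnorm M (ereal r) (\<psi> n)) \<longlonglongrightarrow> C * Lnorm M (ereal r) f"
      by (intro tendsto_mult_left Lnorm_tendsto[OF f r \<psi>L lim])
    from Lspace_Fatou[OF \<phi>L um \<gamma> AE C(2)[OF \<phi>] this] show ?thesis by blast
  qed
  with C(1) that show thesis by blast
qed

lemma Lspace_infinity:
  assumes u: "u \<in> borel_measurable M" and K: "AE x in M. \<bar>u x\<bar> \<le> K" and K0: "K \<ge> 0"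
  shows "u \<in> Lspace M \<infinity>" "Lnorm M \<infinity> u \<le> K"
proof -
  have m: "(\<lambda>x. ereal \<bar>u x\<bar>) \<in> borel_measurable M" using u by simp
  have le: "esssup M (\<lambda>x. ereal \<bar>u x\<bar>) \<le> ereal K"
    using K by (intro esssup_I[OF m]) auto
  show "u \<in> Lspace M \<infinity>" using u le by (auto simp: Lspace_def intro: le_less_trans)
  show "Lnorm M \<infinity> u \<le> K"
    unfolding Lnorm_def using le K0 by (cases "esssup M (\<lambda>x. ereal \<bar>u x\<bar>)") auto
qed

lemma very_weak_Linfinity_bound:
  assumes r: "r > N / (2 * s)"
  obtains C where "C \<ge> 0"
    "\<And>u f. integrable M u \<Longrightarrow> f \<in> Lspace M (ereal r) \<Longrightarrow> very_weak_laplacian s \<Omega> u f \<Longrightarrow>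
      u \<in> Lspace M \<infinity> \<and> Lnorm M \<infinity> u \<le> C * Lnorm M (ereal r) f"
proof -
  have "N / (2 * s) > 1" using dim s_pos by simp
  with r have r1: "1 \<le> r" by linarith
  obtain C where C: "C \<ge> 0"
      "\<And>g \<phi>. g \<in> bdd_data \<Longrightarrow> weak_sol g \<phi> \<Longrightarrow> AE x in M. \<bar>\<phi> x\<bar> \<le> C * Lnorm M (ereal r) g"
    using Stampacchia[OF r] by blast
  have "u \<in> Lspace M \<infinity> \<and> Lnorm M \<infinity> u \<le> C * Lnorm M (ereal r) f"
    if u: "integrable M u" and f: "f \<in> Lspace M (ereal r)" and vw: "very_weak_laplacian s \<Omega> u f" for u f
  proof -
    obtain \<psi> \<phi> where \<psi>: "\<And>n::nat. \<psi> n \<in> test_fun \<Omega>" and \<phi>: "\<And>n. sol (\<psi> n) (\<phi> n)"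
        and lim: "(\<lambda>n. Lnorm M (ereal r) (\<lambda>x. f x - \<psi> n x)) \<longlonglongrightarrow> 0" and AE: "AE x in M. (\<lambda>n. \<phi> n x) \<longlonglongrightarrow> u x"
      using very_weak_approximation[OF u f r1 vw] by blast
    have \<psi>L: "\<psi> n \<in> Lspace M (ereal r)" for n using r1 by (intro bdd_data_Lspace sol_data[OF \<phi>]) simp
    have lc: "(\<lambda>n. C * Lnorm M (ereal r) (\<psi> n)) \<longlonglongrightarrow> C * Lnorm M (ereal r) f"
      by (intro tendsto_mult_left Lnorm_tendsto[OF f r1 \<psi>L lim])
    have "AE x in M. \<forall>n. \<bar>\<phi> n x\<bar> \<le> C * Lnorm M (ereal r) (\<psi> n)"
      using C(2)[OF sol_data[OF \<phi>] sol_weak_sol[OF \<phi>]] by (simp add: AE_all_countable)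
    with AE have "AE x in M. \<bar>u x\<bar> \<le> C * Lnorm M (ereal r) f"
    proof eventually_elim
      case (elim x)
      show ?case by (rule LIMSEQ_le[OF tendsto_rabs[OF elim(1)] lc]) (use elim(2) in blast)
    qed
    moreover have "u \<in> borel_measurable M" using u by simp
    moreover have "0 \<le> C * Lnorm M (ereal r) f" using C(1) Lnorm_nonneg[of M r f] by simp
    ultimately show ?thesis using Lspace_infinity by blast
  qed
  with C(1) that show thesis by blast
qed

end

section \<open>The space of very weak solutions\<close>

context bounded_open_set
begin

lemma WspaceI:
  "integrable M u \<Longrightarrow> f \<in> Lspace M (ereal r) \<Longrightarrow> very_weak_laplacian s \<Omega> u f \<Longrightarrow> u \<in> Wspace s r \<Omega>"
  unfolding Wspace_def by (auto simp: Lspace_one)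

text \<open>The datum chosen in \<open>Wlaplacian\<close> agrees almost everywhere with any other one.\<close>

lemma Wnorm_eq:
  assumes r: "1 \<le> r" and u: "integrable M u" and f: "f \<in> Lspace M (ereal r)" and vw: "very_weak_laplacian s \<Omega> u f"
  shows "Wnorm s r \<Omega> u = Lnorm M (ereal r) f"
proof -
  define h where "h = Wlaplacian s r \<Omega> u"
  have h: "h \<in> Lspace M (ereal r) \<and> very_weak_laplacian s \<Omega> u h"
    unfolding h_def Wlaplacian_def by (rule someI[of _ f]) (use f vw in simp)
  have "AE x in M. h x = f x"
    using h f vw by (intro datum_unique[OF u] Lspace_integrable[OF _ r]) auto
  moreover have "h \<in> borel_measurable M" "f \<in> borel_measurable M" using h f by (auto simp: Lspace_ereal)
  ultimately have "Lnorm M (ereal r) h = Lnorm M (ereal r) f" by (intro Lnorm_cong_AE)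
  then show ?thesis by (simp add: Wnorm_def h_def)
qed

lemma WspaceE:
  assumes "1 \<le> r" "u \<in> Wspace s r \<Omega>"
  obtains f where "integrable M u" "f \<in> Lspace M (ereal r)" "very_weak_laplacian s \<Omega> u f"
    "Wnorm s r \<Omega> u = Lnorm M (ereal r) f"
proof -
  obtain f where f: "integrable M u" "f \<in> Lspace M (ereal r)" "very_weak_laplacian s \<Omega> u f"
    using assms(2) unfolding Wspace_def Lspace_one by blast
  with Wnorm_eq[OF assms(1) f] that show thesis by blast
qed

lemma Wspace_lin:
  assumes r: "1 \<le> r" and u: "integrable M u" "f \<in> Lspace M (ereal r)" "very_weak_laplacian s \<Omega> u f"
    and v: "integrable M v" "h \<in> Lspace M (ereal r)" "very_weak_laplacian s \<Omega> v h"
  shows "integrable M (\<lambda>x. a * u x + b * v x)" "(\<lambda>x. a * f x + b * h x) \<in> Lspace M (ereal r)"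
    "very_weak_laplacian s \<Omega> (\<lambda>x. a * u x + b * v x) (\<lambda>x. a * f x + b * h x)"
proof -
  show "integrable M (\<lambda>x. a * u x + b * v x)" using u(1) v(1) by simp
  show "(\<lambda>x. a * f x + b * h x) \<in> Lspace M (ereal r)"
    by (rule Lspace_add[OF Lspace_cmult[OF u(2)] Lspace_cmult[OF v(2)] r])
  show "very_weak_laplacian s \<Omega> (\<lambda>x. a * u x + b * v x) (\<lambda>x. a * f x + b * h x)"
    by (rule very_weak_laplacian_lin[OF u(1) v(1) Lspace_integrable[OF u(2) r] Lspace_integrable[OF v(2) r] u(3) v(3)])
qed

lemma Wspace_L1_bound:
  assumes r: "1 \<le> r"
  obtains C where "C \<ge> 0"
    "\<And>u f. integrable M u \<Longrightarrow> f \<in> Lspace M (ereal r) \<Longrightarrow> very_weak_laplacian s \<Omega> u f \<Longrightarrow>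
      u \<in> Lspace M (ereal 1) \<and> Lnorm M (ereal 1) u \<le> C * Lnorm M (ereal r) f"
proof -
  have gb: "green_bound 1 1" using dim s_pos by (intro green_bound_one) (auto simp: field_simps)
  then have gb1: "green_bound r 1" by (rule green_bound_mono) (use r in auto)
  from very_weak_Lnorm_bound[OF gb1 r order_refl] that show thesis by blast
qed

lemma Wnorm_zero_iff:
  assumes r: "1 \<le> r" and uW: "u \<in> Wspace s r \<Omega>"
  shows "Wnorm s r \<Omega> u = 0 \<longleftrightarrow> (AE x in M. u x = 0)"
proof -
  obtain C where C: "C \<ge> 0"
    "\<And>u f. integrable M u \<Longrightarrow> f \<in> Lspace M (ereal r) \<Longrightarrow> very_weak_laplacian s \<Omega> u f \<Longrightarrow>
      u \<in> Lspace M (ereal 1) \<and> Lnorm M (ereal 1) u \<le> C * Lnorm M (ereal r) f"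
    using Wspace_L1_bound[OF r] by blast
  obtain f where u: "integrable M u" "f \<in> Lspace M (ereal r)" "very_weak_laplacian s \<Omega> u f" "Wnorm s r \<Omega> u = Lnorm M (ereal r) f"
    using WspaceE[OF r uW] by blast
  have uL: "u \<in> Lspace M (ereal 1)" "Lnorm M (ereal 1) u \<le> C * Lnorm M (ereal r) f" using C(2)[OF u(1-3)] by auto
  show ?thesis
  proof
    assume "Wnorm s r \<Omega> u = 0"
    then have "Lnorm M (ereal 1) u = 0" using uL(2) u(4) Lnorm_nonneg[of M 1 u] by simp
    then show "AE x in M. u x = 0" using Lnorm_eq_0_iff[OF uL(1)] by simp
  next
    assume u0: "AE x in M. u x = 0"
    have fi: "integrable M f" by (rule Lspace_integrable[OF u(2) r])
    have fm: "f \<in> borel_measurable M" using fi by simp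
    have "AE x in M. f x = 0"
    proof (rule datum_zero[OF fi])
      fix \<psi> \<phi> assume \<psi>: "\<psi> \<in> test_fun \<Omega>" and \<phi>: "sol \<psi> \<phi>"
      have "(\<integral>x. f x * \<phi> x \<partial>M) = (\<integral>x. u x * \<psi> x \<partial>M)"
        using u(3) \<psi> \<phi> unfolding very_weak_laplacian_iff[OF fm] by metis
      also have "\<dots> = 0"
      proof (rule integral_eq_zero_AE)
        show "AE x in M. u x * \<psi> x = 0" using u0 by eventually_elim simp
      qed
      finally show "(\<integral>x. f x * \<phi> x \<partial>M) = 0" .
    qed
    then show "Wnorm s r \<Omega> u = 0"
      unfolding u(4) using r by (subst Lnorm_eq_0_iff[OF u(2)]) auto
  qed
qed

lemma Wspace_cong_AE:
  assumes r: "1 \<le> r" and uW: "u \<in> Wspace s r \<Omega>" and vm: "v \<in> borel_measurable M" and eq: "AE x in M. u x = v x"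
  shows "v \<in> Wspace s r \<Omega>" "Wnorm s r \<Omega> v = Wnorm s r \<Omega> u"
proof -
  obtain f where u: "integrable M u" "f \<in> Lspace M (ereal r)" "very_weak_laplacian s \<Omega> u f" "Wnorm s r \<Omega> u = Lnorm M (ereal r) f"
    using WspaceE[OF r uW] by blast
  have vi: "integrable M v"
  proof (rule integrable_cong_AE_imp[OF u(1) vm])
    show "AE x in M. u x = v x" by (rule eq)
  qed
  have um: "u \<in> borel_measurable M" using u(1) by simp
  have "(\<integral>x. v x * \<psi> x \<partial>M) = (\<integral>x. u x * \<psi> x \<partial>M)" if "\<psi> \<in> test_fun \<Omega>" for \<psi>
  proof (rule integral_cong_AE)
    note [measurable] = um vm bdd_data_measurable[OF test_fun_bdd_data[OF that]]
    show "(\<lambda>x. v x * \<psi> x) \<in> borel_measurable M" "(\<lambda>x. u x * \<psi> x) \<in> borel_measurable M" by measurable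
    show "AE x in M. v x * \<psi> x = u x * \<psi> x" using eq by eventually_elim simp
  qed
  then have vw: "very_weak_laplacian s \<Omega> v f" using u(3) by (simp add: very_weak_laplacian_def)
  show "v \<in> Wspace s r \<Omega>" by (rule WspaceI[OF vi u(2) vw])
  show "Wnorm s r \<Omega> v = Wnorm s r \<Omega> u" unfolding Wnorm_eq[OF r vi u(2) vw] u(4) ..
qed

text \<open>The data converge in \<open>L\<^sup>r\<close> and, by the Green bound into \<open>L\<^sup>1\<close>, the functions converge in \<open>L\<^sup>1\<close>. The defining identity
  pairs each of them with bounded functions only, so it passes to the limit.\<close>

lemma Wspace_complete:
  assumes r: "1 \<le> r" and \<sigma>: "\<And>n. \<sigma> n \<in> Wspace s r \<Omega>"
    and cauchy: "\<And>\<epsilon>. \<epsilon> > 0 \<Longrightarrow> \<exists>K. \<forall>m\<ge>K. \<forall>n\<ge>K. Wnorm s r \<Omega> (\<lambda>x. \<sigma> m x - \<sigma> n x) < \<epsilon>"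
  shows "\<exists>u\<in>Wspace s r \<Omega>. (\<lambda>n. Wnorm s r \<Omega> (\<lambda>x. \<sigma> n x - u x)) \<longlonglongrightarrow> 0"
proof -
  obtain C where C: "C \<ge> 0"
    "\<And>u f. integrable M u \<Longrightarrow> f \<in> Lspace M (ereal r) \<Longrightarrow> very_weak_laplacian s \<Omega> u f \<Longrightarrow>
      u \<in> Lspace M (ereal 1) \<and> Lnorm M (ereal 1) u \<le> C * Lnorm M (ereal r) f"
    using Wspace_L1_bound[OF r] by blast
  have "\<exists>f. integrable M (\<sigma> n) \<and> f \<in> Lspace M (ereal r) \<and> very_weak_laplacian s \<Omega> (\<sigma> n) f" for n
    by (rule WspaceE[OF r \<sigma>[of n]]) blast
  then obtain f where si: "\<And>n. integrable M (\<sigma> n)" and f: "\<And>n. f n \<in> Lspace M (ereal r)"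
      and vw: "\<And>n. very_weak_laplacian s \<Omega> (\<sigma> n) (f n)" by metis
  have D: "integrable M (\<lambda>x. \<sigma> m x - \<sigma> n x)" "(\<lambda>x. f m x - f n x) \<in> Lspace M (ereal r)"
      "very_weak_laplacian s \<Omega> (\<lambda>x. \<sigma> m x - \<sigma> n x) (\<lambda>x. f m x - f n x)" for m n
    using Wspace_lin[OF r si f vw si f vw, of 1 m "-1" n] by simp_all
  have Neq: "Wnorm s r \<Omega> (\<lambda>x. \<sigma> m x - \<sigma> n x) = Lnorm M (ereal r) (\<lambda>x. f m x - f n x)" for m n
    by (rule Wnorm_eq[OF r D])
  have fc: "\<exists>K. \<forall>m\<ge>K. \<forall>n\<ge>K. Lnorm M (ereal r) (\<lambda>x. f m x - f n x) < e" if "e > 0" for e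
    using cauchy[OF that] unfolding Neq .
  obtain h k where h: "h \<in> Lspace M (ereal r)" "strict_mono (k :: nat \<Rightarrow> nat)" "AE x in M. (\<lambda>n. f (k n) x) \<longlonglongrightarrow> h x"
      "(\<lambda>n. Lnorm M (ereal r) (\<lambda>x. f n x - h x)) \<longlonglongrightarrow> 0"
    using M.Lspace_complete[where f = f, OF f r fc] by blast
  have s1: "\<sigma> n \<in> Lspace M (ereal 1)" for n using C(2)[OF si f vw] by blast
  have sc: "\<exists>K. \<forall>m\<ge>K. \<forall>n\<ge>K. Lnorm M (ereal 1) (\<lambda>x. \<sigma> m x - \<sigma> n x) < e" if e: "e > 0" for e
  proof -
    have "e / (C + 1) > 0" using e C(1) by simp
    from cauchy[OF this] obtain K where
      K: "\<And>m n. m \<ge> K \<Longrightarrow> n \<ge> K \<Longrightarrow> Wnorm s r \<Omega> (\<lambda>x. \<sigma> m x - \<sigma> n x) < e / (C + 1)"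
      by blast
    have "Lnorm M (ereal 1) (\<lambda>x. \<sigma> m x - \<sigma> n x) < e" if mn: "m \<ge> K" "n \<ge> K" for m n
    proof -
      have "Lnorm M (ereal 1) (\<lambda>x. \<sigma> m x - \<sigma> n x) \<le> C * Wnorm s r \<Omega> (\<lambda>x. \<sigma> m x - \<sigma> n x)"
        unfolding Neq using C(2)[OF D] by blast
      also have "\<dots> \<le> C * (e / (C + 1))" using K[OF mn] C(1) by (intro mult_left_mono) auto
      also have "\<dots> < e" using e C(1) by (simp add: field_simps)
      finally show ?thesis .
    qed
    then show ?thesis by blast
  qed
  obtain v k' where v: "v \<in> Lspace M (ereal 1)" "strict_mono (k' :: nat \<Rightarrow> nat)" "AE x in M. (\<lambda>n. \<sigma> (k' n) x) \<longlonglongrightarrow> v x"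
      "(\<lambda>n. Lnorm M (ereal 1) (\<lambda>x. \<sigma> n x - v x)) \<longlonglongrightarrow> 0"
    using M.Lspace_complete[where f = \<sigma>, OF s1 order_refl sc] by blast
  have vi: "integrable M v" by (rule Lspace_integrable[OF v(1) order_refl])
  have hi: "integrable M h" by (rule Lspace_integrable[OF h(1) r])
  have fi: "integrable M (f n)" for n by (rule Lspace_integrable[OF f r])
  obtain A where A: "A \<ge> 0" "\<And>f. f \<in> Lspace M (ereal r) \<Longrightarrow> (\<integral>x. \<bar>f x\<bar> \<partial>M) \<le> A * Lnorm M (ereal r) f"
    using L1_le_Lnorm[OF r] by blast
  have limf: "(\<lambda>n. \<integral>x. \<bar>h x - f n x\<bar> \<partial>M) \<longlonglongrightarrow> 0"
  proof (rule Lim_null_comparison[OF always_eventually[OF allI]])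
    show "norm (\<integral>x. \<bar>h x - f n x\<bar> \<partial>M) \<le> A * Lnorm M (ereal r) (\<lambda>x. f n x - h x)" for n
      using A(2)[OF Lspace_diff[OF f h(1) r], of n] by (simp add: abs_minus_commute)
    show "(\<lambda>n. A * Lnorm M (ereal r) (\<lambda>x. f n x - h x)) \<longlonglongrightarrow> 0"
      using tendsto_mult_left[OF h(4), of A] by simp
  qed
  have lims: "(\<lambda>n. \<integral>x. \<bar>v x - \<sigma> n x\<bar> \<partial>M) \<longlonglongrightarrow> 0"
    using v(4) by (simp only: one_ereal_def[symmetric] Lnorm_one abs_minus_commute[of "v _"])
  have hm: "h \<in> borel_measurable M" and fm: "f n \<in> borel_measurable M" for n
    using hi fi[of n] by auto
  have "(\<integral>x. v x * \<psi> x \<partial>M) = (\<integral>x. h x * \<phi> x \<partial>M)" if \<psi>: "\<psi> \<in> test_fun \<Omega>" and \<phi>: "sol \<psi> \<phi>" for \<psi> \<phi>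
  proof (rule LIMSEQ_unique)
    show "(\<lambda>n. \<integral>x. \<sigma> n x * \<psi> x \<partial>M) \<longlonglongrightarrow> (\<integral>x. v x * \<psi> x \<partial>M)"
      by (rule LIMSEQ_integral_mult[OF vi si lims sol_data[OF \<phi>]])
    have "(\<lambda>n. \<integral>x. f n x * \<phi> x \<partial>M) \<longlonglongrightarrow> (\<integral>x. h x * \<phi> x \<partial>M)"
      by (rule LIMSEQ_integral_mult[OF hi fi limf sol_bdd_data[OF \<phi>]])
    moreover have "(\<integral>x. \<sigma> n x * \<psi> x \<partial>M) = (\<integral>x. f n x * \<phi> x \<partial>M)" for n
      using vw[of n] \<psi> \<phi> unfolding very_weak_laplacian_iff[OF fm] by blast
    ultimately show "(\<lambda>n. \<integral>x. \<sigma> n x * \<psi> x \<partial>M) \<longlonglongrightarrow> (\<integral>x. h x * \<phi> x \<partial>M)" by simp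
  qed
  then have vvw: "very_weak_laplacian s \<Omega> v h" by (subst very_weak_laplacian_iff[OF hm]) blast
  have E: "integrable M (\<lambda>x. \<sigma> n x - v x)" "(\<lambda>x. f n x - h x) \<in> Lspace M (ereal r)"
      "very_weak_laplacian s \<Omega> (\<lambda>x. \<sigma> n x - v x) (\<lambda>x. f n x - h x)" for n
    using Wspace_lin[OF r si f vw vi h(1) vvw, of 1 n "-1"] by simp_all
  have "Wnorm s r \<Omega> (\<lambda>x. \<sigma> n x - v x) = Lnorm M (ereal r) (\<lambda>x. f n x - h x)" for n
    by (rule Wnorm_eq[OF r E])
  then show ?thesis
    using h(4) WspaceI[OF vi h(1) vvw] by (intro bexI[of _ v]) simp_all
qed

lemma Wspace_banach:
  assumes r: "1 \<le> r"
  shows "banach_space_ae M (Wspace s r \<Omega>) (Wnorm s r \<Omega>)"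
proof -
  have zero: "(\<lambda>x. 0) \<in> Lspace M (ereal r)" using r by (simp add: Lspace_ereal)
  have vw0: "very_weak_laplacian s \<Omega> (\<lambda>x. 0) (\<lambda>x. 0)" by (simp add: very_weak_laplacian_def)
  have add: "(\<lambda>x. u x + v x) \<in> Wspace s r \<Omega> \<and> Wnorm s r \<Omega> (\<lambda>x. u x + v x) \<le> Wnorm s r \<Omega> u + Wnorm s r \<Omega> v"
    if uW: "u \<in> Wspace s r \<Omega>" and vW: "v \<in> Wspace s r \<Omega>" for u v
  proof -
    obtain f where u: "integrable M u" "f \<in> Lspace M (ereal r)" "very_weak_laplacian s \<Omega> u f" "Wnorm s r \<Omega> u = Lnorm M (ereal r) f"
      using WspaceE[OF r uW] by blast
    obtain h where v: "integrable M v" "h \<in> Lspace M (ereal r)" "very_weak_laplacian s \<Omega> v h" "Wnorm s r \<Omega> v = Lnorm M (ereal r) h"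
      using WspaceE[OF r vW] by blast
    have L: "integrable M (\<lambda>x. u x + v x)" "(\<lambda>x. f x + h x) \<in> Lspace M (ereal r)"
        "very_weak_laplacian s \<Omega> (\<lambda>x. u x + v x) (\<lambda>x. f x + h x)"
      using Wspace_lin[OF r u(1-3) v(1-3), of 1 1] by simp_all
    show ?thesis
      unfolding Wnorm_eq[OF r L] u(4) v(4) using WspaceI[OF L] Lnorm_triangle[OF u(2) v(2) r] by blast
  qed
  have scale: "(\<lambda>x. c * u x) \<in> Wspace s r \<Omega> \<and> Wnorm s r \<Omega> (\<lambda>x. c * u x) = \<bar>c\<bar> * Wnorm s r \<Omega> u"
    if uW: "u \<in> Wspace s r \<Omega>" for u c
  proof -
    obtain f where u: "integrable M u" "f \<in> Lspace M (ereal r)" "very_weak_laplacian s \<Omega> u f" "Wnorm s r \<Omega> u = Lnorm M (ereal r) f"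
      using WspaceE[OF r uW] by blast
    have L: "integrable M (\<lambda>x. c * u x)" "(\<lambda>x. c * f x) \<in> Lspace M (ereal r)"
        "very_weak_laplacian s \<Omega> (\<lambda>x. c * u x) (\<lambda>x. c * f x)"
      using Wspace_lin[OF r u(1-3) u(1-3), of c 0] by simp_all
    have "r > 0" using r by simp
    then show ?thesis
      unfolding Wnorm_eq[OF r L] u(4) using WspaceI[OF L] Lnorm_cmult by blast
  qed
  show ?thesis
    unfolding banach_space_ae_def
  proof (intro conjI)
    show "Wspace s r \<Omega> \<subseteq> borel_measurable M"
      unfolding Wspace_def by (auto simp: Lspace_def)
    show "(\<lambda>x. 0) \<in> Wspace s r \<Omega>" by (rule WspaceI[OF _ zero vw0]) simp
    show "\<forall>u\<in>Wspace s r \<Omega>. \<forall>v\<in>Wspace s r \<Omega>. (\<lambda>x. u x + v x) \<in> Wspace s r \<Omega>" using add by blast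
    show "\<forall>c. \<forall>u\<in>Wspace s r \<Omega>. (\<lambda>x. c * u x) \<in> Wspace s r \<Omega>" using scale by blast
    show "\<forall>u\<in>Wspace s r \<Omega>. \<forall>v\<in>borel_measurable M. (AE x in M. u x = v x) \<longrightarrow>
        v \<in> Wspace s r \<Omega> \<and> Wnorm s r \<Omega> v = Wnorm s r \<Omega> u"
      using Wspace_cong_AE[OF r] by blast
    show "\<forall>u\<in>Wspace s r \<Omega>. 0 \<le> Wnorm s r \<Omega> u" by (simp add: Wnorm_def Lnorm_nonneg)
    show "\<forall>u\<in>Wspace s r \<Omega>. Wnorm s r \<Omega> u = 0 \<longleftrightarrow> (AE x in M. u x = 0)" using Wnorm_zero_iff[OF r] by blast
    show "\<forall>c. \<forall>u\<in>Wspace s r \<Omega>. Wnorm s r \<Omega> (\<lambda>x. c * u x) = \<bar>c\<bar> * Wnorm s r \<Omega> u" using scale by blast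
    show "\<forall>u\<in>Wspace s r \<Omega>. \<forall>v\<in>Wspace s r \<Omega>. Wnorm s r \<Omega> (\<lambda>x. u x + v x) \<le> Wnorm s r \<Omega> u + Wnorm s r \<Omega> v"
      using add by blast
    show "\<forall>\<sigma>::nat \<Rightarrow> 'a \<Rightarrow> real. (\<forall>n. \<sigma> n \<in> Wspace s r \<Omega>) \<and>
        (\<forall>\<epsilon>>0. \<exists>K. \<forall>m\<ge>K. \<forall>n\<ge>K. Wnorm s r \<Omega> (\<lambda>x. \<sigma> m x - \<sigma> n x) < \<epsilon>) \<longrightarrow>
        (\<exists>u\<in>Wspace s r \<Omega>. (\<lambda>n. Wnorm s r \<Omega> (\<lambda>x. \<sigma> n x - u x)) \<longlonglongrightarrow> 0)"
      by (intro allI impI, rule Wspace_complete[OF r]) simp_all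
  qed
qed

lemma sol_Wspace:
  assumes "sol g \<phi>" "1 \<le> r"
  shows "integrable M \<phi>" "g \<in> Lspace M (ereal r)" "very_weak_laplacian s \<Omega> \<phi> g"
proof -
  have "0 < r" using assms(2) by simp
  then show "g \<in> Lspace M (ereal r)" by (rule bdd_data_Lspace[OF sol_data[OF assms(1)]])
  show "integrable M \<phi>" by (rule bdd_data_integrable[OF sol_bdd_data[OF assms(1)]])
  show "very_weak_laplacian s \<Omega> \<phi> g" by (rule sol_very_weak_laplacian[OF assms(1)])
qed

lemma Tspace_subset_Wspace:
  assumes r: "1 \<le> r"
  shows "Tspace s \<Omega> \<subseteq> Wspace s r \<Omega>"
proof
  fix \<phi> assume "\<phi> \<in> Tspace s \<Omega>"
  then obtain \<psi> where \<phi>: "\<phi> \<in> X0 s \<Omega>" and \<psi>: "\<psi> \<in> test_fun \<Omega>" "fractional_laplacian s \<Omega> \<phi> \<psi>"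
    unfolding Tspace_def by blast
  obtain \<phi>' where \<phi>': "sol \<psi> \<phi>'" "AE x in M. \<phi> x = \<phi>' x" using fractional_laplacian_sol[OF \<psi>] by blast
  have W: "\<phi>' \<in> Wspace s r \<Omega>" by (rule WspaceI[OF sol_Wspace[OF \<phi>'(1) r]])
  have "AE x in M. \<phi>' x = \<phi> x" using \<phi>'(2) by eventually_elim simp
  then show "\<phi> \<in> Wspace s r \<Omega>" by (rule Wspace_cong_AE(1)[OF r W X0_measurable[OF \<phi>]])
qed

lemma sol_close:
  assumes r: "1 \<le> r" and u: "integrable M u" "f \<in> Lspace M (ereal r)" "very_weak_laplacian s \<Omega> u f" and e: "e > 0"
  obtains \<psi> \<phi> where "\<psi> \<in> test_fun \<Omega>" "sol \<psi> \<phi>" "Lnorm M (ereal r) (\<lambda>x. f x - \<psi> x) < e"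
    "integrable M (\<lambda>x. u x - \<phi> x)" "(\<lambda>x. f x - \<psi> x) \<in> Lspace M (ereal r)"
    "very_weak_laplacian s \<Omega> (\<lambda>x. u x - \<phi> x) (\<lambda>x. f x - \<psi> x)"
proof -
  obtain \<psi> where \<psi>: "\<psi> \<in> test_fun \<Omega>" "Lnorm M (ereal r) (\<lambda>x. f x - \<psi> x) < e"
    using test_fun_dense[OF open_\<Omega> bounded_\<Omega> u(2) r e] by blast
  obtain \<phi> where \<phi>: "sol \<psi> \<phi>" using sol_exists[OF test_fun_bdd_data[OF \<psi>(1)]] by blast
  show thesis
  proof (rule that[OF \<psi>(1) \<phi> \<psi>(2)])
    show "integrable M (\<lambda>x. u x - \<phi> x)" "(\<lambda>x. f x - \<psi> x) \<in> Lspace M (ereal r)"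
        "very_weak_laplacian s \<Omega> (\<lambda>x. u x - \<phi> x) (\<lambda>x. f x - \<psi> x)"
      using Wspace_lin[OF r u sol_Wspace[OF \<phi> r], of 1 "-1"] by simp_all
  qed
qed

lemma Tspace_dense:
  assumes r: "1 \<le> r"
  shows "dense_in_space (Tspace s \<Omega>) (Wspace s r \<Omega>) (Wnorm s r \<Omega>)"
  unfolding dense_in_space_def
proof (intro conjI ballI allI impI Tspace_subset_Wspace[OF r])
  fix u and e :: real assume uW: "u \<in> Wspace s r \<Omega>" and e: "0 < e"
  obtain f where u: "integrable M u" "f \<in> Lspace M (ereal r)" "very_weak_laplacian s \<Omega> u f"
    by (rule WspaceE[OF r uW])
  obtain \<psi> \<phi> where *: "\<psi> \<in> test_fun \<Omega>" "sol \<psi> \<phi>" "Lnorm M (ereal r) (\<lambda>x. f x - \<psi> x) < e"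
    "integrable M (\<lambda>x. u x - \<phi> x)" "(\<lambda>x. f x - \<psi> x) \<in> Lspace M (ereal r)"
    "very_weak_laplacian s \<Omega> (\<lambda>x. u x - \<phi> x) (\<lambda>x. f x - \<psi> x)"
    by (rule sol_close[OF r u e])
  show "\<exists>\<phi>\<in>Tspace s \<Omega>. Wnorm s r \<Omega> (\<lambda>x. u x - \<phi> x) < e"
    using sol_Tspace[OF *(1,2)] Wnorm_eq[OF r *(4-6)] *(3) by (intro bexI[of _ \<phi>]) simp_all
qed

lemma Wspace_embedding:
  assumes r: "1 \<le> r" and gb: "green_bound r \<gamma>" and \<gamma>: "1 \<le> \<gamma>"
  shows "continuous_embedding (Wspace s r \<Omega>) (Wnorm s r \<Omega>) (Lspace M (ereal \<gamma>)) (Lnorm M (ereal \<gamma>))"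
proof -
  obtain C where C: "C \<ge> 0" "\<And>u f. integrable M u \<Longrightarrow> f \<in> Lspace M (ereal r) \<Longrightarrow> very_weak_laplacian s \<Omega> u f \<Longrightarrow>
      u \<in> Lspace M (ereal \<gamma>) \<and> Lnorm M (ereal \<gamma>) u \<le> C * Lnorm M (ereal r) f"
    using very_weak_Lnorm_bound[OF gb r \<gamma>] by blast
  have "u \<in> Lspace M (ereal \<gamma>) \<and> Lnorm M (ereal \<gamma>) u \<le> C * Wnorm s r \<Omega> u" if "u \<in> Wspace s r \<Omega>" for u
    by (rule WspaceE[OF r that]) (simp add: C)
  then show ?thesis unfolding continuous_embedding_def by blast
qed

lemma Wspace_embedding_infinity:
  assumes r: "r > N / (2 * s)"
  shows "continuous_embedding (Wspace s r \<Omega>) (Wnorm s r \<Omega>) (Lspace M \<infinity>) (Lnorm M \<infinity>)"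
proof -
  have "N / (2 * s) > 1" using dim s_pos by simp
  with r have r1: "1 \<le> r" by linarith
  obtain C where C: "C \<ge> 0" "\<And>u f. integrable M u \<Longrightarrow> f \<in> Lspace M (ereal r) \<Longrightarrow> very_weak_laplacian s \<Omega> u f \<Longrightarrow>
      u \<in> Lspace M \<infinity> \<and> Lnorm M \<infinity> u \<le> C * Lnorm M (ereal r) f"
    using very_weak_Linfinity_bound[OF r] by blast
  have "u \<in> Lspace M \<infinity> \<and> Lnorm M \<infinity> u \<le> C * Wnorm s r \<Omega> u" if "u \<in> Wspace s r \<Omega>" for u
    by (rule WspaceE[OF r1 that]) (simp add: C)
  then show ?thesis unfolding continuous_embedding_def by blast
qed

text \<open>Convergence in \<open>L\<^sup>1\<close> and boundedness in \<open>L\<^sup>\<delta>\<close> give convergence in \<open>L\<^sup>\<gamma>\<close> for \<open>\<gamma> < \<delta>\<close>, by splitting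
  the values of the functions at a large height \<open>R\<close>.\<close>

lemma Cauchy_interpolation:
  assumes \<gamma>: "1 \<le> \<gamma>" "\<gamma> < \<delta>" and \<phi>: "\<And>n. \<phi> n \<in> bdd_data"
    and cauchy: "\<And>e. e > 0 \<Longrightarrow> \<exists>K. \<forall>m\<ge>K. \<forall>n\<ge>K. (\<integral>x. \<bar>\<phi> m x - \<phi> n x\<bar> \<partial>M) < e"
    and D: "\<And>n. Lnorm M (ereal \<delta>) (\<phi> n) \<le> D" and e: "e > 0"
  shows "\<exists>K. \<forall>m\<ge>K. \<forall>n\<ge>K. Lnorm M (ereal \<gamma>) (\<lambda>x. \<phi> m x - \<phi> n x) < e"
proof -
  have \<delta>: "1 \<le> \<delta>" "\<delta> > 0" using \<gamma> by auto
  have \<phi>L: "\<phi> n \<in> Lspace M (ereal p)" if "p > 0" for n p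
    by (rule bdd_data_Lspace[OF \<phi> that])
  define E where "E = (2 * D) powr \<delta>"
  have E: "E \<ge> 0" by (simp add: E_def)
  have dE: "(\<integral>x. \<bar>\<phi> m x - \<phi> n x\<bar> powr \<delta> \<partial>M) \<le> E" for m n
  proof -
    have "Lnorm M (ereal \<delta>) (\<lambda>x. \<phi> m x - \<phi> n x) \<le> Lnorm M (ereal \<delta>) (\<phi> m) + Lnorm M (ereal \<delta>) (\<phi> n)"
      using Lnorm_triangle[OF \<phi>L[OF \<delta>(2)] Lspace_cmult[OF \<phi>L[OF \<delta>(2)], of "-1"] \<delta>(1), of m n]
        Lnorm_cmult[OF \<delta>(2), of M "-1" "\<phi> n"] by simp
    also have "\<dots> \<le> 2 * D" using D[of m] D[of n] by simp
    finally have le: "Lnorm M (ereal \<delta>) (\<lambda>x. \<phi> m x - \<phi> n x) \<le> 2 * D" .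
    have "(\<integral>x. \<bar>\<phi> m x - \<phi> n x\<bar> powr \<delta> \<partial>M) = Lnorm M (ereal \<delta>) (\<lambda>x. \<phi> m x - \<phi> n x) powr \<delta>"
      by (rule Lnorm_powr[OF \<delta>(2), symmetric])
    also have "\<dots> \<le> E" unfolding E_def using \<delta>(2) by (intro powr_mono2 le Lnorm_nonneg) simp
    finally show ?thesis .
  qed
  define t where "t = (e / 2) powr \<gamma>"
  have t: "t > 0" using e by (simp add: t_def)
  have "((\<lambda>R. R powr (\<gamma> - \<delta>) * E) \<longlongrightarrow> 0 * E) at_top"
    using \<gamma> by (intro tendsto_mult tendsto_const tendsto_neg_powr filterlim_ident) auto
  then have "eventually (\<lambda>R. R powr (\<gamma> - \<delta>) * E < t / 2) at_top"
    by (rule order_tendstoD(2)) (use t in simp)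
  with eventually_gt_at_top[of "0::real"] have "eventually (\<lambda>R. R > 0 \<and> R powr (\<gamma> - \<delta>) * E < t / 2) at_top"
    by (rule eventually_conj)
  then obtain R where R: "R > 0" "R powr (\<gamma> - \<delta>) * E < t / 2"
    using eventually_happens'[OF trivial_limit_at_top_linorder] by blast
  define h where "h = t / (2 * R powr (\<gamma> - 1))"
  have h: "h > 0" "R powr (\<gamma> - 1) * h = t / 2" using t R by (auto simp: h_def)
  obtain K where K: "\<And>m n. m \<ge> K \<Longrightarrow> n \<ge> K \<Longrightarrow> (\<integral>x. \<bar>\<phi> m x - \<phi> n x\<bar> \<partial>M) < h"
    using cauchy[OF h(1)] by blast
  have "Lnorm M (ereal \<gamma>) (\<lambda>x. \<phi> m x - \<phi> n x) < e" if mn: "m \<ge> K" "n \<ge> K" for m n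
  proof -
    let ?d = "\<lambda>x. \<phi> m x - \<phi> n x"
    have dd: "?d \<in> bdd_data" using bdd_data_lin[OF \<phi> \<phi>, of 1 m "-1" n] by simp
    have i: "integrable M (\<lambda>x. \<bar>?d x\<bar> powr p)" if "p > 0" for p
      using bdd_data_Lspace[OF dd that] by (simp add: Lspace_ereal)
    have i1: "integrable M (\<lambda>x. \<bar>?d x\<bar>)" by (rule integrable_abs[OF bdd_data_integrable[OF dd]])
    have "\<gamma> > 0" using \<gamma> by simp
    have "(\<integral>x. \<bar>?d x\<bar> powr \<gamma> \<partial>M) \<le> (\<integral>x. R powr (\<gamma> - 1) * \<bar>?d x\<bar> + R powr (\<gamma> - \<delta>) * \<bar>?d x\<bar> powr \<delta> \<partial>M)"
    proof (rule integral_mono)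
      show "integrable M (\<lambda>x. \<bar>?d x\<bar> powr \<gamma>)" by (rule i[OF \<open>\<gamma> > 0\<close>])
      show "integrable M (\<lambda>x. R powr (\<gamma> - 1) * \<bar>?d x\<bar> + R powr (\<gamma> - \<delta>) * \<bar>?d x\<bar> powr \<delta>)"
        by (rule Bochner_Integration.integrable_add[OF integrable_mult_right[OF i1] integrable_mult_right[OF i[OF \<delta>(2)]]])
      show "\<bar>?d x\<bar> powr \<gamma> \<le> R powr (\<gamma> - 1) * \<bar>?d x\<bar> + R powr (\<gamma> - \<delta>) * \<bar>?d x\<bar> powr \<delta>" for x
        by (rule powr_interpolation[OF R(1) \<gamma>(1) less_imp_le[OF \<gamma>(2)]])
    qed
    also have "\<dots> = R powr (\<gamma> - 1) * (\<integral>x. \<bar>?d x\<bar> \<partial>M) + R powr (\<gamma> - \<delta>) * (\<integral>x. \<bar>?d x\<bar> powr \<delta> \<partial>M)"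
      by (simp only: Bochner_Integration.integral_add[OF integrable_mult_right[OF i1] integrable_mult_right[OF i[OF \<delta>(2)]]] integral_mult_right_zero)
    also have "\<dots> \<le> R powr (\<gamma> - 1) * h + R powr (\<gamma> - \<delta>) * E"
      using K[OF mn] by (intro add_mono mult_left_mono dE) auto
    also have "\<dots> \<le> t" using h(2) R(2) by simp
    finally have "Lnorm M (ereal \<gamma>) ?d \<le> e / 2"
      unfolding t_def using e \<open>\<gamma> > 0\<close> by (intro Lnorm_leI) auto
    then show ?thesis using e by simp
  qed
  then show ?thesis by blast
qed

text \<open>A bounded sequence in \<open>Wspace s r \<Omega>\<close> is first replaced by a sequence of solutions with
  bounded data, at distances tending to \<open>0\<close> in \<open>L\<^sup>\<gamma>\<close>. The solutions are precompact in \<open>L\<^sup>1\<close> and bounded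
  in \<open>L\<^sup>\<delta>\<close> for an exponent \<open>\<delta> > \<gamma>\<close>.\<close>

lemma Wspace_compact_embedding:
  assumes r: "1 \<le> r" and \<gamma>: "1 \<le> \<gamma>" "\<gamma> < \<delta>" and gb: "green_bound r \<delta>"
  shows "compact_embedding (Wspace s r \<Omega>) (Wnorm s r \<Omega>) (Lspace M (ereal \<gamma>)) (Lnorm M (ereal \<gamma>))"
proof -
  have gb\<gamma>: "green_bound r \<gamma>" by (rule green_bound_mono[OF gb r order_refl \<gamma>(1)]) (use \<gamma> in simp)
  obtain A where A: "A \<ge> 0" "\<And>f. f \<in> Lspace M (ereal r) \<Longrightarrow> (\<integral>x. \<bar>f x\<bar> \<partial>M) \<le> A * Lnorm M (ereal r) f"
    using L1_le_Lnorm[OF r] by blast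
  obtain C where C: "C \<ge> 0" "\<And>g \<phi>. sol g \<phi> \<Longrightarrow> Lnorm M (ereal \<delta>) \<phi> \<le> C * Lnorm M (ereal r) g"
    using gb unfolding green_bound_def by blast
  obtain C' where C': "C' \<ge> 0" "\<And>u f. integrable M u \<Longrightarrow> f \<in> Lspace M (ereal r) \<Longrightarrow> very_weak_laplacian s \<Omega> u f \<Longrightarrow>
      u \<in> Lspace M (ereal \<gamma>) \<and> Lnorm M (ereal \<gamma>) u \<le> C' * Lnorm M (ereal r) f"
    using very_weak_Lnorm_bound[OF gb\<gamma> r \<gamma>(1)] by blast
  have "\<exists>k v. strict_mono (k :: nat \<Rightarrow> nat) \<and> v \<in> Lspace M (ereal \<gamma>) \<and>
      (\<lambda>n. Lnorm M (ereal \<gamma>) (\<lambda>x. \<sigma> (k n) x - v x)) \<longlonglongrightarrow> 0"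
    if \<sigma>: "\<And>n. \<sigma> n \<in> Wspace s r \<Omega>" and B: "\<And>n. Wnorm s r \<Omega> (\<sigma> n) \<le> B" for \<sigma> :: "nat \<Rightarrow> 'a \<Rightarrow> real" and B
  proof -
    define P where "P n \<psi> \<phi> \<longleftrightarrow> sol \<psi> \<phi> \<and> Lnorm M (ereal r) \<psi> \<le> B + 1 \<and> (\<lambda>x. \<sigma> n x - \<phi> x) \<in> Lspace M (ereal \<gamma>) \<and>
        Lnorm M (ereal \<gamma>) (\<lambda>x. \<sigma> n x - \<phi> x) \<le> C' * inverse (real (Suc n))" for n \<psi> \<phi>
    have "\<exists>\<psi> \<phi>. P n \<psi> \<phi>" for n
    proof -
      obtain f where u: "integrable M (\<sigma> n)" "f \<in> Lspace M (ereal r)" "very_weak_laplacian s \<Omega> (\<sigma> n) f"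
          "Wnorm s r \<Omega> (\<sigma> n) = Lnorm M (ereal r) f"
        by (rule WspaceE[OF r \<sigma>[of n]])
      have e: "inverse (real (Suc n)) > 0" by simp
      obtain \<psi> \<phi> where *: "\<psi> \<in> test_fun \<Omega>" "sol \<psi> \<phi>" "Lnorm M (ereal r) (\<lambda>x. f x - \<psi> x) < inverse (real (Suc n))"
        "integrable M (\<lambda>x. \<sigma> n x - \<phi> x)" "(\<lambda>x. f x - \<psi> x) \<in> Lspace M (ereal r)"
        "very_weak_laplacian s \<Omega> (\<lambda>x. \<sigma> n x - \<phi> x) (\<lambda>x. f x - \<psi> x)"
        by (rule sol_close[OF r u(1-3) e])
      have "inverse (real (Suc n)) \<le> 1" by (simp add: inverse_le_1_iff)
      moreover have "Lnorm M (ereal r) \<psi> \<le> Lnorm M (ereal r) f + Lnorm M (ereal r) (\<lambda>x. f x - \<psi> x)"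
        using Lnorm_triangle_diff[OF sol_Wspace(2)[OF *(2) r] u(2) r] Lnorm_minus_commute[of M "ereal r" f \<psi>] by simp
      ultimately have 1: "Lnorm M (ereal r) \<psi> \<le> B + 1" using B[of n] u(4) *(3) by linarith
      have 2: "(\<lambda>x. \<sigma> n x - \<phi> x) \<in> Lspace M (ereal \<gamma>) \<and>
          Lnorm M (ereal \<gamma>) (\<lambda>x. \<sigma> n x - \<phi> x) \<le> C' * Lnorm M (ereal r) (\<lambda>x. f x - \<psi> x)"
        by (rule C'(2)[OF *(4-6)])
      have "C' * Lnorm M (ereal r) (\<lambda>x. f x - \<psi> x) \<le> C' * inverse (real (Suc n))"
        by (rule mult_left_mono[OF less_imp_le[OF *(3)] C'(1)])
      with 2 have "Lnorm M (ereal \<gamma>) (\<lambda>x. \<sigma> n x - \<phi> x) \<le> C' * inverse (real (Suc n))" by linarith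
      with 1 2 *(2) show ?thesis unfolding P_def by blast
    qed
    then obtain \<psi> \<phi> where P: "\<And>n. P n (\<psi> n) (\<phi> n)" by metis
    have sol: "\<And>n. sol (\<psi> n) (\<phi> n)" and \<psi>B: "\<And>n. Lnorm M (ereal r) (\<psi> n) \<le> B + 1"
        and dL: "\<And>n. (\<lambda>x. \<sigma> n x - \<phi> n x) \<in> Lspace M (ereal \<gamma>)"
        and d: "\<And>n. Lnorm M (ereal \<gamma>) (\<lambda>x. \<sigma> n x - \<phi> n x) \<le> C' * inverse (real (Suc n))"
      using P unfolding P_def by blast+
    have \<phi>L: "\<phi> n \<in> Lspace M (ereal p)" if "p > 0" for n p
      by (rule bdd_data_Lspace[OF sol_bdd_data[OF sol] that])
    have g1: "(\<integral>x. \<bar>\<psi> n x\<bar> \<partial>M) \<le> A * (B + 1)" for n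
      using A(2)[OF sol_Wspace(2)[OF sol r], of n] mult_left_mono[OF \<psi>B[of n] A(1)] by linarith
    define D where "D = C * (B + 1)"
    have \<phi>D: "Lnorm M (ereal \<delta>) (\<phi> n) \<le> D" for n
      using C(2)[OF sol, of n] mult_left_mono[OF \<psi>B[of n] C(1)] unfolding D_def by linarith
    have \<delta>: "1 < \<delta>" "0 < \<delta>" using \<gamma> by auto
    have \<phi>\<delta>: "(\<integral>x. \<bar>\<phi> n x\<bar> powr \<delta> \<partial>M) \<le> D powr \<delta>" for n
    proof -
      have "(\<integral>x. \<bar>\<phi> n x\<bar> powr \<delta> \<partial>M) = Lnorm M (ereal \<delta>) (\<phi> n) powr \<delta>" by (rule Lnorm_powr[OF \<delta>(2), symmetric])
      also have "\<dots> \<le> D powr \<delta>" using \<delta>(2) by (intro powr_mono2 \<phi>D Lnorm_nonneg) simp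
      finally show ?thesis .
    qed
    obtain k where k: "strict_mono (k :: nat \<Rightarrow> nat)"
        "\<And>e. e > 0 \<Longrightarrow> \<exists>K. \<forall>m\<ge>K. \<forall>n\<ge>K. (\<integral>x. \<bar>\<phi> (k m) x - \<phi> (k n) x\<bar> \<partial>M) < e"
      using L1_precompact[where g = \<psi> and \<phi> = \<phi>, OF sol g1 \<delta>(1) \<phi>\<delta>] by blast
    have cauchy: "\<exists>K. \<forall>m\<ge>K. \<forall>n\<ge>K. Lnorm M (ereal \<gamma>) (\<lambda>x. \<phi> (k m) x - \<phi> (k n) x) < e" if "e > 0" for e
      by (rule Cauchy_interpolation[where \<phi> = "\<lambda>n. \<phi> (k n)", OF \<gamma> sol_bdd_data[OF sol] k(2) \<phi>D that])
    have \<gamma>0: "\<gamma> > 0" using \<gamma> by simp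
    obtain v j where v: "v \<in> Lspace M (ereal \<gamma>)" "strict_mono (j :: nat \<Rightarrow> nat)"
        "AE x in M. (\<lambda>n. \<phi> (k (j n)) x) \<longlonglongrightarrow> v x"
        "(\<lambda>n. Lnorm M (ereal \<gamma>) (\<lambda>x. \<phi> (k n) x - v x)) \<longlonglongrightarrow> 0"
      using M.Lspace_complete[where f = "\<lambda>n. \<phi> (k n)", OF \<phi>L[OF \<gamma>0] \<gamma>(1) cauchy] by blast
    have "(\<lambda>n. Lnorm M (ereal \<gamma>) (\<lambda>x. \<sigma> (k n) x - v x)) \<longlonglongrightarrow> 0"
    proof (rule Lim_null_comparison[OF always_eventually[OF allI]])
      show "norm (Lnorm M (ereal \<gamma>) (\<lambda>x. \<sigma> (k n) x - v x)) \<le>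
          C' * inverse (real (Suc n)) + Lnorm M (ereal \<gamma>) (\<lambda>x. \<phi> (k n) x - v x)" for n
      proof -
        have "Lnorm M (ereal \<gamma>) (\<lambda>x. \<sigma> (k n) x - v x) \<le>
            Lnorm M (ereal \<gamma>) (\<lambda>x. \<sigma> (k n) x - \<phi> (k n) x) + Lnorm M (ereal \<gamma>) (\<lambda>x. \<phi> (k n) x - v x)"
          using Lnorm_triangle[OF dL Lspace_diff[OF \<phi>L[OF \<gamma>0] v(1) \<gamma>(1)] \<gamma>(1), of "k n" "k n"] by simp
        moreover have "C' * inverse (real (Suc (k n))) \<le> C' * inverse (real (Suc n))"
          using C'(1) seq_suble[OF k(1), of n] by (intro mult_left_mono le_imp_inverse_le) auto
        moreover have "Lnorm M (ereal \<gamma>) (\<lambda>x. \<sigma> (k n) x - v x) \<ge> 0" by (rule Lnorm_nonneg)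
        ultimately show ?thesis using d[of "k n"] unfolding real_norm_def by linarith
      qed
      have "(\<lambda>n. C' * inverse (real (Suc n)) + Lnorm M (ereal \<gamma>) (\<lambda>x. \<phi> (k n) x - v x)) \<longlonglongrightarrow> C' * 0 + 0"
        by (intro tendsto_intros LIMSEQ_inverse_real_of_nat v(4))
      then show "(\<lambda>n. C' * inverse (real (Suc n)) + Lnorm M (ereal \<gamma>) (\<lambda>x. \<phi> (k n) x - v x)) \<longlonglongrightarrow> 0" by simp
    qed
    with k(1) v(1) show ?thesis by blast
  qed
  then show ?thesis
    using Wspace_embedding[OF r gb\<gamma> \<gamma>(1)] unfolding compact_embedding_def by blast
qed

text \<open>The strict inequality for \<open>\<gamma>\<close> leaves room for a larger exponent with a Green bound, also for \<open>r = 1\<close>, where the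
  critical exponent itself is excluded.\<close>

lemma green_bound_above:
  assumes r: "1 \<le> r" and \<gamma>: "1 \<le> \<gamma>" and c: "2 * s * r < N \<and> \<gamma> < N * r / (N - 2 * s * r) \<or> N \<le> 2 * s * r"
  obtains \<delta> where "\<gamma> < \<delta>" "green_bound r \<delta>"
proof (cases "N \<le> 2 * s * r")
  case True
  then have "r \<ge> N / (2 * s)" using s_pos by (simp add: field_simps)
  then have "green_bound r (\<gamma> + 1)" using \<gamma> by (intro green_bound_supercritical) auto
  then show thesis by (rule that[rotated]) simp
next
  case False
  define X where "X = N * r / (N - 2 * s * r)"
  have X: "\<gamma> < X" using c False by (simp add: X_def)
  define \<delta> where "\<delta> = (\<gamma> + X) / 2"
  have \<delta>: "\<gamma> < \<delta>" "\<delta> < X" "1 \<le> \<delta>" using X \<gamma> by (auto simp: \<delta>_def)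
  have "green_bound r \<delta>"
  proof (cases "r = 1")
    case True
    then show ?thesis using \<delta> by (simp add: X_def green_bound_one)
  next
    case r1: False
    have "r < N / (2 * s)" using False s_pos by (simp add: field_simps)
    then show ?thesis using \<delta> r r1 by (intro green_bound_critical) (auto simp: X_def)
  qed
  with \<delta>(1) that show thesis by blast
qed

end

theorem proposition2p6:
  fixes s r N :: real and \<Omega> :: "'a::euclidean_space set"
  assumes "N = real DIM('a)"
    and "0 < s" and "s < 1" and "2 * s < N" and "1 \<le> r"
    and "smooth_bounded_domain \<Omega>"
  shows "banach_space_ae (lebesgue_on \<Omega>) (Wspace s r \<Omega>) (Wnorm s r \<Omega>) \<and>
    dense_in_space (Tspace s \<Omega>) (Wspace s r \<Omega>) (Wnorm s r \<Omega>) \<and>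
    (\<forall>\<gamma>::ereal.
       (r = 1 \<and> 1 \<le> \<gamma> \<and> \<gamma> < ereal (N / (N - 2 * s))) \<or>
       (1 < r \<and> r < N / (2 * s) \<and> 1 \<le> \<gamma> \<and> \<gamma> \<le> ereal (N * r / (N - 2 * s * r))) \<or>
       (2 * s * r = N \<and> 1 \<le> \<gamma> \<and> \<gamma> < \<infinity>) \<or>
       (2 * s * r > N \<and> \<gamma> = \<infinity>) \<longrightarrow>
       continuous_embedding (Wspace s r \<Omega>) (Wnorm s r \<Omega>)
         (Lspace (lebesgue_on \<Omega>) \<gamma>) (Lnorm (lebesgue_on \<Omega>) \<gamma>)) \<and>
    (\<forall>\<gamma>::ereal.
       (N > 2 * s * r \<and> 1 \<le> \<gamma> \<and> \<gamma> < ereal (N * r / (N - 2 * s * r))) \<or>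
       (N \<le> 2 * s * r \<and> 1 \<le> \<gamma> \<and> \<gamma> < \<infinity>) \<longrightarrow>
       compact_embedding (Wspace s r \<Omega>) (Wnorm s r \<Omega>)
         (Lspace (lebesgue_on \<Omega>) \<gamma>) (Lnorm (lebesgue_on \<Omega>) \<gamma>))"
proof -
  interpret bounded_open_set s N \<Omega>
    by (rule bounded_open_set.intro) (use assms in \<open>simp_all add: smooth_bounded_domain_def\<close>)
  note r = \<open>1 \<le> r\<close>
  have real: "\<exists>g. \<gamma> = ereal g \<and> 1 \<le> g" if "1 \<le> \<gamma>" "\<gamma> < \<infinity>" for \<gamma> :: ereal
    using that by (cases \<gamma>) auto
  have cont: "continuous_embedding (Wspace s r \<Omega>) (Wnorm s r \<Omega>) (Lspace M \<gamma>) (Lnorm M \<gamma>)"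
    if c: "(r = 1 \<and> 1 \<le> \<gamma> \<and> \<gamma> < ereal (N / (N - 2 * s))) \<or>
       (1 < r \<and> r < N / (2 * s) \<and> 1 \<le> \<gamma> \<and> \<gamma> \<le> ereal (N * r / (N - 2 * s * r))) \<or>
       (2 * s * r = N \<and> 1 \<le> \<gamma> \<and> \<gamma> < \<infinity>) \<or> (2 * s * r > N \<and> \<gamma> = \<infinity>)" for \<gamma> :: ereal
  proof (cases "2 * s * r > N \<and> \<gamma> = \<infinity>")
    case True
    then have "r > N / (2 * s)" using s_pos by (simp add: field_simps)
    with True show ?thesis using Wspace_embedding_infinity by simp
  next
    case False
    have "1 \<le> \<gamma>" using c False by blast
    moreover have "\<gamma> < \<infinity>" using c False by (cases \<gamma>) auto
    ultimately obtain g where g: "\<gamma> = ereal g" "1 \<le> g" using real by blast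
    have "green_bound r g"
    proof -
      consider "r = 1" "g < N / (N - 2 * s)" | "1 < r" "r < N / (2 * s)" "g \<le> N * r / (N - 2 * s * r)"
        | "2 * s * r = N"
        using c False unfolding g(1) ereal_less_eq less_ereal.simps by blast
      then show ?thesis
      proof cases
        case 1 then show ?thesis using green_bound_one g by simp
      next
        case 2 then show ?thesis using green_bound_critical g by simp
      next
        case 3
        then have "r \<ge> N / (2 * s)" using s_pos by (simp add: field_simps)
        then show ?thesis by (rule green_bound_supercritical[OF _ g(2)])
      qed
    qed
    then show ?thesis unfolding g(1) by (rule Wspace_embedding[OF r _ g(2)])
  qed
  have comp: "compact_embedding (Wspace s r \<Omega>) (Wnorm s r \<Omega>) (Lspace M \<gamma>) (Lnorm M \<gamma>)"
    if c: "(N > 2 * s * r \<and> 1 \<le> \<gamma> \<and> \<gamma> < ereal (N * r / (N - 2 * s * r))) \<or>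
       (N \<le> 2 * s * r \<and> 1 \<le> \<gamma> \<and> \<gamma> < \<infinity>)" for \<gamma> :: ereal
  proof -
    have "1 \<le> \<gamma>" using c by blast
    moreover have "\<gamma> < \<infinity>" using c by (cases \<gamma>) auto
    ultimately obtain g where g: "\<gamma> = ereal g" "1 \<le> g" using real by blast
    have "2 * s * r < N \<and> g < N * r / (N - 2 * s * r) \<or> N \<le> 2 * s * r"
      using c unfolding g(1) less_ereal.simps by blast
    from green_bound_above[OF r g(2) this] obtain \<delta> where "g < \<delta>" "green_bound r \<delta>" by blast
    then show ?thesis unfolding g(1) by (rule Wspace_compact_embedding[OF r g(2)])
  qed
  show ?thesis
    using Wspace_banach[OF r] Tspace_dense[OF r] cont comp by blast
qed

end
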